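(* Let $\Omega$ be the two-dimensional torus, or $\mathbb{R}^2$, or a bounded open regular subset of $\mathbb{R}^2$, and let $b\in L^2_{loc}(\Omega;\mathbb{R}^2)$ satisfy $\operatorname{div} b=0$ in the sense of distributions (and be tangent to $\partial\Omega$ in the case of a bounded domain). Assume that the condition $$(P_x)\qquad \exists\, \xi\in\mathbb{R}^2,\ \alpha>0,\ \epsilon>0\ \text{ such that } b(y)\cdot\xi\ge\alpha \text{ for almost all } y\in B(x,\epsilon)$$ holds for every $x\in\Omega$ except on a set of isolated points. Then condition (R) holds: for every $u^o\in L^\infty(\Omega)$, every solution $u\in L^\infty([0,\infty)\times\Omega)$ of the transport equation $\partial_t u+b\cdot\nabla_x u=0$ on $[0,\infty)\times\Omega$ with initial condition $u^o$ is a renormalized solution.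
   Context: The vector field $b=b(x)$ is autonomous. $B(x,\epsilon)$ is the open ball of centre $x$ and radius $\epsilon$ (contained in $\Omega$); $\xi,\alpha,\epsilon$ may depend on $x$. "Except on a set of isolated points" means that every point of the set of $x\in\Omega$ where $(P_x)$ fails is an isolated point of that set. Tangency of $b$ to $\partial\Omega$ means that the normal component of $b$ on $\partial\Omega$ vanishes (in the weak sense). Solution: for $u^o\in L^\infty(\Omega)$, a function $u\in L^\infty([0,\infty)\times\Omega)$ is a solution with initial condition $u^o$ if for all $\phi\in C_c^\infty([0,\infty)\times\Omega)$ (test functions need not vanish at $t=0$) $$\int_{[0,\infty)\times\Omega}u\,\big(\partial_t\phi+b\cdot\nabla_x\phi\big)\,dt\,dx=-\int_\Omega u^o(x)\,\phi(0,x)\,dx.$$ Renormalized solution: $u$ is a renormalized solution with initial condition $u^o$ if for every $\beta\in C^1_b(\mathbb{R})$ (differentiable functions $\mathbb{R}\to\mathbb{R}$ with bounded continuous derivative), $\beta(u)$ is a solution with initial condition $\beta(u^o)$. *)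

theory Defs
  imports "HOL-Analysis.Analysis"
begin

subsection \<open>Differentiability classes and test functions\<close>

primrec Ck_on :: "nat \<Rightarrow> 'a::euclidean_space set \<Rightarrow> ('a \<Rightarrow> real) \<Rightarrow> bool" where
  "Ck_on 0 S f \<longleftrightarrow> continuous_on S f"
| "Ck_on (Suc k) S f \<longleftrightarrow>
     (\<forall>x\<in>S. f differentiable (at x)) \<and>
     (\<forall>e\<in>Basis. Ck_on k S (\<lambda>x. frechet_derivative f (at x) e))"

definition smooth :: "('a::euclidean_space \<Rightarrow> real) \<Rightarrow> bool" where
  "smooth f \<longleftrightarrow> (\<forall>k. Ck_on k UNIV f)"

definition grad :: "(real^2 \<Rightarrow> real) \<Rightarrow> real^2 \<Rightarrow> real^2" where
  "grad f x = (\<chi> i. frechet_derivative f (at x) (axis i 1))"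

definition support_within :: "('a::euclidean_space \<Rightarrow> real) \<Rightarrow> 'a set \<Rightarrow> bool" where
  "support_within f S \<longleftrightarrow> (\<exists>K. compact K \<and> K \<subseteq> S \<and> (\<forall>x. f x \<noteq> 0 \<longrightarrow> x \<in> K))"


subsection \<open>The spatial domain\<close>

datatype domain2 = Torus | Plane | Bounded "(real^2) set"

text \<open>
  A function on the torus is represented by its lift, a function on the plane of period one in each
  coordinate. Accordingly a point of the torus is represented by any of its lifts, so
  the region of the torus is the whole plane, while integrals over the torus are taken over
  the unit cell.
\<close>

primrec region :: "domain2 \<Rightarrow> (real^2) set" where
  "region Torus = UNIV"
| "region Plane = UNIV"
| "region (Bounded \<Omega>) = \<Omega>"

primrec cell :: "domain2 \<Rightarrow> (real^2) set" where
  "cell Torus = {x. \<forall>i. 0 \<le> x $ i \<and> x $ i < 1}"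
| "cell Plane = UNIV"
| "cell (Bounded \<Omega>) = \<Omega>"

primrec function_on :: "domain2 \<Rightarrow> (real^2 \<Rightarrow> 'a) \<Rightarrow> bool" where
  "function_on Torus f \<longleftrightarrow> (\<forall>x i. f (x + axis i 1) = f x)"
| "function_on Plane f \<longleftrightarrow> True"
| "function_on (Bounded \<Omega>) f \<longleftrightarrow> True"

text \<open>
  Regularity of an open set: near each boundary point the set is a strict sublevel set of
  a \<open>C\<^sup>1\<close> function with non-vanishing gradient. This is the weakest classical regularity
  providing a continuous unit normal, so sets with smoother boundary are included.
\<close>

definition regular_open :: "(real^2) set \<Rightarrow> bool" where
  "regular_open \<Omega> \<longleftrightarrow> open \<Omega> \<and>
     (\<forall>x\<in>frontier \<Omega>. \<exists>U \<rho>. open U \<and> x \<in> U \<and> Ck_on 1 U \<rho> \<and>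
        (\<forall>y\<in>U. grad \<rho> y \<noteq> 0) \<and> \<Omega> \<inter> U = {y\<in>U. \<rho> y < 0})"

primrec valid_domain :: "domain2 \<Rightarrow> bool" where
  "valid_domain Torus \<longleftrightarrow> True"
| "valid_domain Plane \<longleftrightarrow> True"
| "valid_domain (Bounded \<Omega>) \<longleftrightarrow> bounded \<Omega> \<and> regular_open \<Omega>"

primrec compact_support_in :: "domain2 \<Rightarrow> (real^2 \<Rightarrow> real) \<Rightarrow> bool" where
  "compact_support_in Torus \<psi> \<longleftrightarrow> True"
| "compact_support_in Plane \<psi> \<longleftrightarrow> support_within \<psi> UNIV"
| "compact_support_in (Bounded \<Omega>) \<psi> \<longleftrightarrow> support_within \<psi> \<Omega>"

definition space_test :: "domain2 \<Rightarrow> (real^2 \<Rightarrow> real) \<Rightarrow> bool" where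
  "space_test D \<psi> \<longleftrightarrow> smooth \<psi> \<and> function_on D \<psi> \<and> compact_support_in D \<psi>"

primrec compact_support_in_spacetime :: "domain2 \<Rightarrow> (real \<times> (real^2) \<Rightarrow> real) \<Rightarrow> bool" where
  "compact_support_in_spacetime Torus \<phi> \<longleftrightarrow> (\<exists>T. \<forall>t x. T < \<bar>t\<bar> \<longrightarrow> \<phi> (t, x) = 0)"
| "compact_support_in_spacetime Plane \<phi> \<longleftrightarrow> support_within \<phi> UNIV"
| "compact_support_in_spacetime (Bounded \<Omega>) \<phi> \<longleftrightarrow> support_within \<phi> (UNIV \<times> \<Omega>)"

text \<open>
  Smooth compactly supported functions on \<open>[0,\<infinity>) \<times> \<Omega>\<close> are the restrictions to nonnegative
  times of smooth compactly supported functions on \<open>\<real> \<times> \<Omega>\<close>; they are represented by such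
  extensions, of which only the values at \<open>t \<ge> 0\<close> are used. They need not vanish at \<open>t = 0\<close>.
\<close>

definition spacetime_test :: "domain2 \<Rightarrow> (real \<times> (real^2) \<Rightarrow> real) \<Rightarrow> bool" where
  "spacetime_test D \<phi> \<longleftrightarrow> smooth \<phi> \<and> (\<forall>t. function_on D (\<lambda>x. \<phi> (t, x))) \<and>
     compact_support_in_spacetime D \<phi>"


subsection \<open>The vector field\<close>

definition L2_loc :: "(real^2) set \<Rightarrow> (real^2 \<Rightarrow> real^2) \<Rightarrow> bool" where
  "L2_loc S b \<longleftrightarrow> b \<in> borel_measurable (lebesgue_on S) \<and>
     (\<forall>K. compact K \<and> K \<subseteq> S \<longrightarrow> integrable (lebesgue_on K) (\<lambda>x. (norm (b x))\<^sup>2))"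

definition divergence_free :: "domain2 \<Rightarrow> (real^2 \<Rightarrow> real^2) \<Rightarrow> bool" where
  "divergence_free D b \<longleftrightarrow>
     (\<forall>\<psi>. space_test D \<psi> \<longrightarrow> (LINT x|lebesgue_on (cell D). b x \<bullet> grad \<psi> x) = 0)"

text \<open>
  By Green's formula, for a divergence free field the integral below is the pairing of the
  normal component on the boundary with the trace of \<open>\<psi>\<close>. Test functions do not vanish
  near the boundary. A locally square integrable field need not be integrable up to the
  boundary; the pairing is required to vanish whenever it is defined, which is for every
  \<open>\<psi>\<close> if the field is integrable on the domain.
\<close>

primrec tangent_to_boundary :: "domain2 \<Rightarrow> (real^2 \<Rightarrow> real^2) \<Rightarrow> bool" where
  "tangent_to_boundary Torus b \<longleftrightarrow> True"
| "tangent_to_boundary Plane b \<longleftrightarrow> True"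
| "tangent_to_boundary (Bounded \<Omega>) b \<longleftrightarrow>
     (\<forall>\<psi>. smooth \<psi> \<and> support_within \<psi> UNIV \<and>
          integrable (lebesgue_on \<Omega>) (\<lambda>x. b x \<bullet> grad \<psi> x) \<longrightarrow>
        (LINT x|lebesgue_on \<Omega>. b x \<bullet> grad \<psi> x) = 0)"

text \<open>
  On the torus balls are taken in the plane; since \<open>\<epsilon>\<close> may be decreased, this is the
  condition for balls of the torus.
\<close>

definition local_direction :: "domain2 \<Rightarrow> (real^2 \<Rightarrow> real^2) \<Rightarrow> real^2 \<Rightarrow> bool" where
  "local_direction D b x \<longleftrightarrow>
     (\<exists>\<xi> \<alpha> \<epsilon>. \<alpha> > 0 \<and> \<epsilon> > 0 \<and> ball x \<epsilon> \<subseteq> region D \<and>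
        (AE y in lebesgue_on (ball x \<epsilon>). b y \<bullet> \<xi> \<ge> \<alpha>))"


subsection \<open>Solutions and renormalized solutions\<close>

definition Linf :: "'a::euclidean_space set \<Rightarrow> ('a \<Rightarrow> real) \<Rightarrow> bool" where
  "Linf S f \<longleftrightarrow> f \<in> borel_measurable (lebesgue_on S) \<and>
     (\<exists>C. AE x in lebesgue_on S. \<bar>f x\<bar> \<le> C)"

definition Linf_space :: "domain2 \<Rightarrow> (real^2 \<Rightarrow> real) \<Rightarrow> bool" where
  "Linf_space D u0 \<longleftrightarrow> Linf (region D) u0 \<and> function_on D u0"

definition Linf_spacetime :: "domain2 \<Rightarrow> (real \<times> (real^2) \<Rightarrow> real) \<Rightarrow> bool" where
  "Linf_spacetime D u \<longleftrightarrow> Linf ({0..} \<times> region D) u \<and>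
     (\<forall>t\<ge>0. function_on D (\<lambda>x. u (t, x)))"

definition transport_solution ::
    "domain2 \<Rightarrow> (real^2 \<Rightarrow> real^2) \<Rightarrow> (real^2 \<Rightarrow> real) \<Rightarrow> (real \<times> (real^2) \<Rightarrow> real) \<Rightarrow> bool" where
  "transport_solution D b u0 u \<longleftrightarrow> Linf_spacetime D u \<and>
     (\<forall>\<phi>. spacetime_test D \<phi> \<longrightarrow>
        (LINT (t, x)|lebesgue_on ({0..} \<times> cell D).
            u (t, x) * (deriv (\<lambda>s. \<phi> (s, x)) t + b x \<bullet> grad (\<lambda>y. \<phi> (t, y)) x))
        = - (LINT x|lebesgue_on (cell D). u0 x * \<phi> (0, x)))"

definition C1b :: "(real \<Rightarrow> real) \<Rightarrow> bool" where
  "C1b \<beta> \<longleftrightarrow> (\<forall>s. \<beta> differentiable (at s)) \<and>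
     continuous_on UNIV (deriv \<beta>) \<and> bounded (range (deriv \<beta>))"

definition renormalized_solution ::
    "domain2 \<Rightarrow> (real^2 \<Rightarrow> real^2) \<Rightarrow> (real^2 \<Rightarrow> real) \<Rightarrow> (real \<times> (real^2) \<Rightarrow> real) \<Rightarrow> bool" where
  "renormalized_solution D b u0 u \<longleftrightarrow>
     (\<forall>\<beta>. C1b \<beta> \<longrightarrow> transport_solution D b (\<lambda>x. \<beta> (u0 x)) (\<lambda>z. \<beta> (u z)))"

definition condition_R :: "domain2 \<Rightarrow> (real^2 \<Rightarrow> real^2) \<Rightarrow> bool" where
  "condition_R D b \<longleftrightarrow>
     (\<forall>u0 u. Linf_space D u0 \<and> transport_solution D b u0 u \<longrightarrow> renormalized_solution D b u0 u)"

end

theory Submission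
  imports Defs "HOL-Computational_Algebra.Polynomial"
begin

text \<open>
  The key fact is that bounded solutions of \<open>div (U b) = F\<close> form an algebra: if also
  \<open>div (V b) = G\<close>, then \<open>div (U V b) = F V + G U\<close>. Near a point where \<open>(P_x)\<close> holds, rotate so that
  \<open>b\<^sub>1 > 0\<close>. The stream function \<open>H\<close>, with \<open>\<nabla>H = (-b\<^sub>2, b\<^sub>1)\<close>, is then increasing in \<open>x\<^sub>2\<close>, and
  \<open>(x\<^sub>1, x\<^sub>2) \<mapsto> (x\<^sub>1, H)\<close> turns \<open>b\<^sub>1 dx\<close> into Lebesgue measure and \<open>b \<cdot> \<nabla>\<close> into \<open>b\<^sub>1 \<partial>\<^sub>1\<close>. The equations become
  \<open>\<partial>\<^sub>1 U = F / b\<^sub>1\<close> and \<open>\<partial>\<^sub>1 V = G / b\<^sub>1\<close>, for which the product rule is elementary. An isolated exceptional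
  point does not matter, since in the plane an \<open>L\<^sup>2\<close> field does not see a point.

  Mollifying a solution \<open>u\<close> of the transport equation in time alone gives \<open>div (u\<^sub>n b) = - \<partial>\<^sub>t u\<^sub>n\<close> for every
  fixed time, with a bounded right-hand side. Hence products, and so polynomials, of solutions are
  solutions; \<open>\<beta>(u)\<close> is reached by uniform approximation of \<open>\<beta>\<close> on the bounded range of \<open>u\<close>. The torus
  reduces to the plane, because every test function on the torus is the periodization of one on the plane.
\<close>

subsection \<open>Smooth functions and test functions\<close>

text \<open>Two points shape the proof. It is applied to exact stream functions of the mollified
  field; the error is the field tested against the rotated mollification error, a product of two L2
  functions of which the second tends to 0. This is where square integrability enters away from the
  exceptional points. Second, as div b = 0, a test function \<psi> is itself a solution of div
  (\<psi> b) = b . grad \<psi>. The weak product rule for U and V therefore becomes a symmetric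
  identity for three compactly supported fluxes: the integral of F1 U2 U3 + F2 U1 U3 + F3 U1 U2 is
  0, which in stream coordinates says that the integral of an x1-derivative vanishes. Localizing by
  cutoffs adds terms U b . grad X to the right-hand sides, so these are only integrable, while the U
  remain bounded; all limits of products are arranged for one integrable and two bounded
  factors.\<close>

abbreviation fderiv :: "('a::euclidean_space \<Rightarrow> real) \<Rightarrow> 'a \<Rightarrow> 'a \<Rightarrow> real" where
  "fderiv f x \<equiv> frechet_derivative f (at x)"

lemma fderivI: "(f has_derivative f') (at x) \<Longrightarrow> fderiv f x = f'"
  by (rule frechet_derivative_at [symmetric])

text \<open>The induction on the order of differentiability is done once, for a whole class
  \<open>P\<close>. Later closure properties reduce to naming a class that is stable under partial
  derivatives.\<close>

lemma smooth_coinduct [consumes 1, case_names step]: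
  assumes "P f"
    and step: "\<And>f. P f \<Longrightarrow> (\<forall>x. f differentiable (at x)) \<and> (\<forall>e\<in>Basis. P (\<lambda>x. fderiv f x e))"
  shows "smooth f"
proof -
  have "Ck_on k UNIV f" if "P f" for k f
    using that
  proof (induction k arbitrary: f)
    case 0
    then show ?case
      using step[of f] by (auto intro: differentiable_imp_continuous_within continuous_at_imp_continuous_on)
  next
    case (Suc k)
    then show ?case using step[of f] by auto
  qed
  then show ?thesis using assms(1) by (simp add: smooth_def)
qed

lemma smooth_differentiable: "smooth f \<Longrightarrow> f differentiable (at x)"
  unfolding smooth_def by (metis Ck_on.simps(2) UNIV_I)

lemma smooth_has_derivative: "smooth f \<Longrightarrow> (f has_derivative fderiv f x) (at x)"
  using smooth_differentiable frechet_derivative_works by blast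

lemma smooth_fderiv_Basis: "smooth f \<Longrightarrow> e \<in> Basis \<Longrightarrow> smooth (\<lambda>x. fderiv f x e)"
  unfolding smooth_def using Ck_on.simps(2)[of _ UNIV f] by blast

lemma smooth_continuous: "smooth f \<Longrightarrow> continuous_on S f"
  by (meson continuous_at_imp_continuous_on differentiable_imp_continuous_within smooth_differentiable)

lemma linear_fderiv: "smooth f \<Longrightarrow> linear (fderiv f x)"
  using smooth_differentiable linear_frechet_derivative by blast

lemma smooth_const: "smooth (\<lambda>x. c)"
proof -
  have "\<exists>c. (\<lambda>x::'a. c) = (\<lambda>x. c::real)" for c by blast
  show ?thesis
  proof (rule smooth_coinduct[where P="\<lambda>h. \<exists>c. h = (\<lambda>x. c)"])
    fix h :: "'a \<Rightarrow> real" assume "\<exists>c. h = (\<lambda>x. c)"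
    then obtain c where "h = (\<lambda>x. c)" by blast
    moreover have "fderiv (\<lambda>x::'a. c) x = (\<lambda>_. 0)" for x
      by (rule fderivI) simp
    ultimately show "(\<forall>x. h differentiable (at x)) \<and> (\<forall>e\<in>Basis. \<exists>c. (\<lambda>x. fderiv h x e) = (\<lambda>x. c))"
      by auto
  qed auto
qed

text \<open>The derivative of a product contains both derivatives and both factors, so smoothness of a single
  product cannot be proved by coinduction alone; the class below is closed under all operations at once.\<close>

inductive smooth_closure :: "('a::euclidean_space \<Rightarrow> real) \<Rightarrow> bool" where
  base: "smooth f \<Longrightarrow> smooth_closure f"
| add: "smooth_closure f \<Longrightarrow> smooth_closure g \<Longrightarrow> smooth_closure (\<lambda>x. f x + g x)"
| mult: "smooth_closure f \<Longrightarrow> smooth_closure g \<Longrightarrow> smooth_closure (\<lambda>x. f x * g x)"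
| comp: "smooth h \<Longrightarrow> smooth_closure f \<Longrightarrow> smooth_closure (\<lambda>x. h (f x))" for h :: "real \<Rightarrow> real"

lemma smooth_closure_step:
  assumes "smooth_closure f"
  shows "(\<forall>x. f differentiable (at x)) \<and> (\<forall>e\<in>Basis. smooth_closure (\<lambda>x. fderiv f x e))"
  using assms
proof induction
  case (base f)
  then show ?case by (auto intro: smooth_closure.base smooth_differentiable smooth_fderiv_Basis)
next
  case (add f g)
  have d: "((\<lambda>x. f x + g x) has_derivative (\<lambda>v. fderiv f x v + fderiv g x v)) (at x)" for x
    using add.IH by (intro has_derivative_add) (auto simp: frechet_derivative_works)
  show ?case
    using add.IH d smooth_closure.add[of "\<lambda>x. fderiv f x e" "\<lambda>x. fderiv g x e" for e]
    unfolding fderivI[OF d] differentiable_def by blast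
next
  case (mult f g)
  have d: "((\<lambda>x. f x * g x) has_derivative (\<lambda>v. f x * fderiv g x v + fderiv f x v * g x)) (at x)" for x
    using mult.IH by (intro has_derivative_mult) (auto simp: frechet_derivative_works)
  have "smooth_closure (\<lambda>x. f x * fderiv g x e + fderiv f x e * g x)" if "e \<in> Basis" for e
    by (rule smooth_closure.add; rule smooth_closure.mult) (use mult that in auto)
  then show ?case
    using d unfolding fderivI[OF d] differentiable_def by blast
next
  case (comp h f)
  have d: "((\<lambda>x. h (f x)) has_derivative (\<lambda>v. fderiv f x v * fderiv h (f x) 1)) (at x)" for x
  proof -
    have "((\<lambda>x. h (f x)) has_derivative (\<lambda>v. fderiv h (f x) (fderiv f x v))) (at x)"
      by (rule has_derivative_compose[of f "fderiv f x"])
         (use comp in \<open>auto simp: frechet_derivative_works[symmetric] smooth_differentiable\<close>)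
    moreover have "(\<lambda>v. fderiv h (f x) (fderiv f x v)) = (\<lambda>v. fderiv f x v * fderiv h (f x) 1)"
      by (rule ext) (metis linear.scaleR[OF linear_fderiv[OF comp.hyps(1)]] mult.right_neutral real_scaleR_def)
    ultimately show ?thesis by (rule has_derivative_eq_rhs)
  qed
  have "smooth_closure (\<lambda>x. fderiv h (f x) 1)"
    using smooth_closure.comp[OF smooth_fderiv_Basis[OF comp.hyps(1), of 1] comp.hyps(2)] by simp
  then show ?case
    using comp smooth_closure.mult[where g="\<lambda>x. fderiv h (f x) 1"] d
    unfolding fderivI[OF d] differentiable_def by blast
qed

lemma smooth_closure_imp_smooth: "smooth_closure f \<Longrightarrow> smooth f"
  by (rule smooth_coinduct[where P=smooth_closure]) (use smooth_closure_step in auto)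

lemma smooth_add: "smooth f \<Longrightarrow> smooth g \<Longrightarrow> smooth (\<lambda>x. f x + g x)"
  by (rule smooth_closure_imp_smooth, rule smooth_closure.add) (auto intro: smooth_closure.base)

lemma smooth_mult: "smooth f \<Longrightarrow> smooth g \<Longrightarrow> smooth (\<lambda>x. f x * g x)"
  by (rule smooth_closure_imp_smooth, rule smooth_closure.mult) (auto intro: smooth_closure.base)

lemma smooth_comp: "smooth h \<Longrightarrow> smooth f \<Longrightarrow> smooth (\<lambda>x. h (f x))" for h :: "real \<Rightarrow> real"
  by (rule smooth_closure_imp_smooth, rule smooth_closure.comp) (auto intro: smooth_closure.base)

lemma smooth_minus: "smooth f \<Longrightarrow> smooth (\<lambda>x. - f x)"
  using smooth_mult[OF smooth_const[of "-1"]] by simp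

lemma smooth_diff: "smooth f \<Longrightarrow> smooth g \<Longrightarrow> smooth (\<lambda>x. f x - g x)"
  using smooth_add[OF _ smooth_minus, of f g] by simp

lemma smooth_sum: "(\<And>i. i \<in> I \<Longrightarrow> smooth (f i)) \<Longrightarrow> smooth (\<lambda>x. \<Sum>i\<in>I. f i x)"
  by (induction I rule: infinite_finite_induct) (auto intro: smooth_const smooth_add)

lemma smooth_linear: "linear f \<Longrightarrow> smooth f"
proof -
  assume "linear f"
  then have d: "(f has_derivative f) (at x)" for x
    by (simp add: linear_linear bounded_linear_imp_has_derivative)
  show ?thesis
  proof (rule smooth_coinduct[where P="\<lambda>h. h = f \<or> smooth h"])
    fix h assume "h = f \<or> smooth h"
    then show "(\<forall>x. h differentiable (at x)) \<and> (\<forall>e\<in>Basis. (\<lambda>x. fderiv h x e) = f \<or> smooth (\<lambda>x. fderiv h x e))"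
    proof
      assume "h = f"
      then show ?thesis using d by (auto simp: fderivI[OF d] differentiable_def smooth_const)
    qed (simp add: smooth_differentiable smooth_fderiv_Basis)
  qed simp
qed

lemma smooth_fderiv: assumes "smooth f" shows "smooth (\<lambda>x. fderiv f x v)"
proof -
  have "fderiv f x v = (\<Sum>e\<in>Basis. (v \<bullet> e) * fderiv f x e)" for x
    using linear_sum[OF linear_fderiv[OF assms, of x], of "\<lambda>e. (v \<bullet> e) *\<^sub>R e" Basis]
      linear.scaleR[OF linear_fderiv[OF assms, of x]]
    by (simp add: euclidean_representation)
  then show ?thesis
    using assms by (auto intro!: smooth_sum smooth_mult smooth_const smooth_fderiv_Basis)
qed

text \<open>The linear map may go between different spaces, so this covers translations,
  reflections, dilations, slices of space-time functions and functions of one coordinate. The class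
  for the coinduction is all \<open>g (L x + c)\<close> with \<open>g\<close> smooth:
  differentiating along \<open>e\<close> replaces \<open>g\<close> by its derivative along
  \<open>L e\<close>.\<close>

lemma smooth_comp_affine:
  assumes "smooth f" "linear L"
  shows "smooth (\<lambda>x. f (L x + c))"
    and "fderiv (\<lambda>x. f (L x + c)) x v = fderiv f (L x + c) (L v)"
proof -
  have d: "((\<lambda>x. f (L x + c)) has_derivative (\<lambda>v. fderiv f (L x + c) (L v))) (at x)" if "smooth f" for x f
  proof (rule has_derivative_compose[of "\<lambda>x. L x + c" L])
    show "((\<lambda>x. L x + c) has_derivative L) (at x)"
      using assms(2) by (auto intro!: derivative_eq_intros bounded_linear_imp_has_derivative simp: linear_linear)
  qed (rule smooth_has_derivative[OF that])
  show "fderiv (\<lambda>x. f (L x + c)) x v = fderiv f (L x + c) (L v)"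
    by (simp add: fderivI[OF d[OF assms(1)]])
  show "smooth (\<lambda>x. f (L x + c))"
  proof (rule smooth_coinduct[where P="\<lambda>h. \<exists>f. smooth f \<and> h = (\<lambda>x. f (L x + c))"])
    fix h assume "\<exists>f. smooth f \<and> h = (\<lambda>x. f (L x + c))"
    then obtain f where f: "smooth f" and h: "h = (\<lambda>x. f (L x + c))" by blast
    have "\<exists>g. smooth g \<and> (\<lambda>x. fderiv h x e) = (\<lambda>x. g (L x + c))" for e
      using smooth_fderiv[OF f, of "L e"] by (auto simp: h fderivI[OF d[OF f]])
    moreover have "h differentiable (at x)" for x
      using d[OF f, of x] by (auto simp: h differentiable_def)
    ultimately show "(\<forall>x. h differentiable (at x)) \<and> (\<forall>e\<in>Basis. \<exists>f. smooth f \<and> (\<lambda>x. fderiv h x e) = (\<lambda>x. f (L x + c)))"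
      by blast
  qed (use assms(1) in blast)
qed

text \<open>A partial derivative at a point sees only a neighbourhood. This makes locally finite
  sums smooth, in particular periodizations, for which no single finite sum is valid
  everywhere.\<close>

lemma smooth_local:
  assumes "\<And>x. \<exists>U g. open U \<and> x \<in> U \<and> smooth g \<and> (\<forall>y\<in>U. f y = g y)"
  shows "smooth f"
proof (rule smooth_coinduct[where P="\<lambda>f. \<forall>x. \<exists>U g. open U \<and> x \<in> U \<and> smooth g \<and> (\<forall>y\<in>U. f y = g y)"])
  fix f assume *: "\<forall>x::'a. \<exists>U g. open U \<and> x \<in> U \<and> smooth g \<and> (\<forall>y\<in>U. f y = g y)"
  have d: "(f has_derivative fderiv g y) (at y)"
    if "open U" "y \<in> U" "smooth g" "\<And>y. y \<in> U \<Longrightarrow> f y = g y" for U g y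
    using has_derivative_transform_within_open[OF smooth_has_derivative[OF that(3)] that(1,2)] that(4)
    by simp
  show "(\<forall>x. f differentiable (at x)) \<and>
      (\<forall>e\<in>Basis. \<forall>x. \<exists>U g. open U \<and> x \<in> U \<and> smooth g \<and> (\<forall>y\<in>U. fderiv f y e = g y))"
  proof (intro conjI allI ballI)
    fix x
    obtain U g where g: "open U" "x \<in> U" "smooth g" "\<And>y. y \<in> U \<Longrightarrow> f y = g y"
      using * by meson
    show "f differentiable (at x)"
      using d[OF g] by (auto simp: differentiable_def)
    fix e :: 'a
    have "\<forall>y\<in>U. fderiv f y e = fderiv g y e"
      using d[OF g(1) _ g(3,4)] fderivI by metis
    then show "\<exists>U g. open U \<and> x \<in> U \<and> smooth g \<and> (\<forall>y\<in>U. fderiv f y e = g y)"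
      using g(1,2) smooth_fderiv[OF g(3)] by blast
  qed
qed (use assms in auto)

lemma fderiv_add: "smooth f \<Longrightarrow> smooth g \<Longrightarrow> fderiv (\<lambda>x. f x + g x) x v = fderiv f x v + fderiv g x v"
  by (subst fderivI[OF has_derivative_add[OF smooth_has_derivative smooth_has_derivative]]) auto

lemma fderiv_mult: "smooth f \<Longrightarrow> smooth g \<Longrightarrow> fderiv (\<lambda>x. f x * g x) x v = f x * fderiv g x v + fderiv f x v * g x"
  by (subst fderivI[OF has_derivative_mult[OF smooth_has_derivative smooth_has_derivative]]) auto

lemma fderiv_const: "fderiv (\<lambda>x. c) x v = 0"
  by (subst fderivI[OF has_derivative_const]) auto

lemma fderiv_diff: "smooth f \<Longrightarrow> smooth g \<Longrightarrow> fderiv (\<lambda>x. f x - g x) x v = fderiv f x v - fderiv g x v"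
  by (subst fderivI[OF has_derivative_diff[OF smooth_has_derivative smooth_has_derivative]]) auto

lemma fderiv_real: "smooth f \<Longrightarrow> fderiv f x v = v * deriv f x" for f :: "real \<Rightarrow> real"
proof -
  assume f: "smooth f"
  then obtain f' where "(f has_real_derivative f') (at x)"
    using real_differentiable_def smooth_differentiable by blast
  then show ?thesis
    by (metis DERIV_imp_deriv fderivI has_field_derivative_def mult.commute)
qed

lemma smooth_has_real_derivative:
  "smooth f \<Longrightarrow> (f has_real_derivative deriv f x) (at x)" for f :: "real \<Rightarrow> real"
  using DERIV_deriv_iff_real_differentiable smooth_differentiable by blast

lemma smooth_deriv: "smooth f \<Longrightarrow> smooth (deriv f)" for f :: "real \<Rightarrow> real"
proof -
  assume f: "smooth f"
  have "(\<lambda>x. fderiv f x 1) = deriv f" using fderiv_real[OF f] by auto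
  then show ?thesis using smooth_fderiv[OF f, of 1] by simp
qed

lemma fderiv_comp:
  "smooth h \<Longrightarrow> smooth f \<Longrightarrow> fderiv (\<lambda>x. h (f x)) x v = deriv h (f x) * fderiv f x v" for h :: "real \<Rightarrow> real"
  by (subst fderivI[OF has_derivative_compose[OF smooth_has_derivative smooth_has_derivative]])
     (auto simp: fderiv_real)

lemma smooth_antiderivative:
  fixes f g :: "real \<Rightarrow> real"
  assumes "smooth g" "\<And>x. (f has_real_derivative g x) (at x)"
  shows "smooth f"
proof (rule smooth_coinduct[where P="\<lambda>h. h = f \<or> smooth h"])
  have d: "fderiv f x 1 = g x" for x
    using fderivI[OF assms(2)[of x, unfolded has_field_derivative_def]] by simp
  fix h assume "h = f \<or> smooth h"
  then show "(\<forall>x. h differentiable (at x)) \<and> (\<forall>e\<in>Basis. (\<lambda>x. fderiv h x e) = f \<or> smooth (\<lambda>x. fderiv h x e))"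
  proof
    assume "h = f"
    then show ?thesis using assms by (auto simp: d real_differentiable_def)
  qed (simp add: smooth_differentiable smooth_fderiv_Basis)
qed simp

section \<open>Flat functions and the smooth step\<close>

lemma poly_times_exp_tendsto_0: "((\<lambda>x. poly p x * exp (- x)) \<longlongrightarrow> 0) at_top" for p :: "real poly"
proof -
  have "((\<lambda>x. \<Sum>i\<le>degree p. coeff p i * (x ^ i / exp x)) \<longlongrightarrow> (\<Sum>i\<le>degree p. coeff p i * 0)) at_top"
    by (intro tendsto_intros tendsto_power_div_exp_0)
  then show ?thesis
    by (simp add: poly_altdef sum_distrib_right exp_minus divide_inverse mult.assoc)
qed

text \<open>The classical flat function \<open>exp (- 1 / x)\<close>, multiplied by a polynomial in
  \<open>1 / x\<close> so that the family is closed under differentiation: the derivative replaces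
  \<open>p\<close> by \<open>X^2 (p - p')\<close>.\<close>

definition flat_fun :: "real poly \<Rightarrow> real \<Rightarrow> real" where
  "flat_fun p x = (if x > 0 then poly p (1 / x) * exp (- (1 / x)) else 0)"

lemma flat_fun_has_derivative:
  "(flat_fun p has_real_derivative flat_fun ([:0, 0, 1:] * (p - pderiv p)) x) (at x)"
proof -
  consider "x > 0" | "x = 0" | "x < 0" by linarith
  then show ?thesis
  proof cases
    case 1
    have "((\<lambda>x. poly p (1 / x) * exp (- (1 / x))) has_real_derivative
        flat_fun ([:0, 0, 1:] * (p - pderiv p)) x) (at x)"
      using 1
      by (auto intro!: derivative_eq_intros poly_DERIV[THEN DERIV_chain2]
          simp: flat_fun_def field_simps power2_eq_square)
    then show ?thesis
      by (rule has_field_derivative_transform_within_open[where S="{0<..}"]) (use 1 in \<open>auto simp: flat_fun_def\<close>)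
  next
    case 3
    have "((\<lambda>x. 0) has_real_derivative flat_fun ([:0, 0, 1:] * (p - pderiv p)) x) (at x)"
      using 3 by (simp add: flat_fun_def)
    then show ?thesis
      by (rule has_field_derivative_transform_within_open[where S="{..<0}"]) (use 3 in \<open>auto simp: flat_fun_def\<close>)
  next
    case 2
    have "((\<lambda>x. flat_fun p x / x) \<longlongrightarrow> 0) (at_right 0)"
    proof (rule Lim_transform_eventually)
      \<comment> \<open>With y = 1 / x the difference quotient at 0 is y p(y) exp(-y), and
        \<open>pCons 0 p\<close> is the polynomial y p(y).\<close>
      show "((\<lambda>x. poly (pCons 0 p) (inverse x) * exp (- inverse x)) \<longlongrightarrow> 0) (at_right 0)"
        by (rule filterlim_compose[OF poly_times_exp_tendsto_0 filterlim_inverse_at_top_right])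
      show "\<forall>\<^sub>F x in at_right 0. poly (pCons 0 p) (inverse x) * exp (- inverse x) = flat_fun p x / x"
        by (auto simp: eventually_at_filter flat_fun_def field_simps)
    qed
    moreover have "((\<lambda>x. flat_fun p x / x) \<longlongrightarrow> 0) (at_left 0)"
      by (rule Lim_transform_eventually[OF tendsto_const]) (auto simp: eventually_at_filter flat_fun_def)
    ultimately have "((\<lambda>x. flat_fun p x / x) \<longlongrightarrow> 0) (at 0)"
      by (simp add: filterlim_split_at)
    then show ?thesis
      using 2 by (simp add: has_field_derivative_iff flat_fun_def)
  qed
qed

lemma smooth_flat_fun: "smooth (flat_fun p)"
proof (rule smooth_coinduct[where P="\<lambda>h. \<exists>p. h = flat_fun p"])
  fix h assume "\<exists>p. h = flat_fun p"
  then obtain p where h: "h = flat_fun p" by blast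
  have "(\<lambda>x. fderiv h x 1) = flat_fun ([:0, 0, 1:] * (p - pderiv p))"
    using fderivI[OF flat_fun_has_derivative[unfolded has_field_derivative_def]] h by auto
  then show "(\<forall>x. h differentiable (at x)) \<and> (\<forall>e\<in>Basis. \<exists>p. (\<lambda>x. fderiv h x e) = flat_fun p)"
    using flat_fun_has_derivative[of p] h by (auto simp: real_differentiable_def)
qed blast

text \<open>The step is a normalized primitive \<open>G\<close> of \<open>k\<close>, the product of
  \<open>exp (- 1 / s)\<close> and \<open>exp (- 1 / (1 - s))\<close> on the unit interval. The mean
  value theorem shows that \<open>G\<close> is constant on both outer half-lines and strictly larger
  at 1 than at 0, so the normalization is legitimate.\<close>

lemma smooth_step_exists:
  "\<exists>J::real \<Rightarrow> real. smooth J \<and> (\<forall>s\<le>0. J s = 0) \<and> (\<forall>s\<ge>1. J s = 1) \<and> mono J"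
proof -
  define k where "k s = flat_fun 1 s * flat_fun 1 (1 - s)" for s :: real
  have smk: "smooth k"
    unfolding k_def using smooth_comp_affine(1)[OF smooth_flat_fun[of 1], of "\<lambda>x. - x" 1]
    by (auto intro!: smooth_mult smooth_flat_fun linear_uminus)
  have k0: "k s \<ge> 0" for s by (simp add: k_def flat_fun_def)
  have kp: "k s > 0" if "0 < s" "s < 1" for s using that by (simp add: k_def flat_fun_def)
  have kz: "k s = 0" if "s \<le> 0 \<or> s \<ge> 1" for s using that by (auto simp: k_def flat_fun_def)
  have "\<exists>G. \<forall>x. -\<infinity> < ereal x \<longrightarrow> ereal x < \<infinity> \<longrightarrow> (G has_vector_derivative k x) (at x)"
    by (rule einterval_antiderivative)
       (use smooth_continuous[OF smk, of UNIV] in \<open>auto simp: continuous_on_eq_continuous_at\<close>)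
  then obtain G where G: "(G has_real_derivative k x) (at x)" for x
    by (auto simp: has_real_derivative_iff_has_vector_derivative)
  have mono: "G x \<le> G y" if "x \<le> y" for x y
    using DERIV_nonneg_imp_nondecreasing[OF that] G k0 by blast
  have "\<exists>z. z > 0 \<and> z < 1 \<and> G 1 - G 0 = (1 - 0) * k z"
    using MVT2[of 0 1 G k] G by auto
  then have lt: "G 0 < G 1" using kp by fastforce
  have c0: "G s = G 0" if "s \<le> 0" for s
  proof (cases "s = 0")
    case False
    then have "\<exists>z. z > s \<and> z < 0 \<and> G 0 - G s = (0 - s) * k z"
      using MVT2[of s 0 G k] G that by auto
    then show ?thesis using kz by force
  qed simp
  have c1: "G s = G 1" if "s \<ge> 1" for s
  proof (cases "s = 1")
    case False
    then have "\<exists>z. z > 1 \<and> z < s \<and> G s - G 1 = (s - 1) * k z"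
      using MVT2[of 1 s G k] G that by auto
    then show ?thesis using kz by force
  qed simp
  define J where "J s = (G s - G 0) / (G 1 - G 0)" for s
  have "smooth J"
  proof (rule smooth_antiderivative)
    show "smooth (\<lambda>s. (1 / (G 1 - G 0)) * k s)" by (intro smooth_mult smooth_const smk)
    show "(J has_real_derivative 1 / (G 1 - G 0) * k x) (at x)" for x
      unfolding J_def using lt by (auto intro!: derivative_eq_intros G)
  qed
  moreover have "mono J" unfolding J_def using mono lt by (auto intro!: monoI divide_right_mono)
  moreover have "J s = 0" if "s \<le> 0" for s
    unfolding J_def c0[OF that] by simp
  moreover have "J s = 1" if "s \<ge> 1" for s
    unfolding J_def c1[OF that] using lt by simp
  ultimately show ?thesis by blast
qed

definition smooth_step :: "real \<Rightarrow> real" where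
  "smooth_step = (SOME J. smooth J \<and> (\<forall>s\<le>0. J s = 0) \<and> (\<forall>s\<ge>1. J s = 1) \<and> mono J)"

lemma smooth_step:
  shows smooth_smooth_step: "smooth smooth_step"
    and smooth_step_eq_0: "s \<le> 0 \<Longrightarrow> smooth_step s = 0"
    and smooth_step_eq_1: "s \<ge> 1 \<Longrightarrow> smooth_step s = 1"
    and mono_smooth_step: "mono smooth_step"
  using someI_ex[OF smooth_step_exists] by (auto simp: smooth_step_def)

lemma smooth_step_bounds: "0 \<le> smooth_step s" "smooth_step s \<le> 1"
  using monoD[OF mono_smooth_step, of "min s 0" s] monoD[OF mono_smooth_step, of s "max s 1"]
  by (auto simp: smooth_step_eq_0 smooth_step_eq_1)

section \<open>Test functions and cutoffs\<close>

definition tests :: "'a::euclidean_space set \<Rightarrow> ('a \<Rightarrow> real) set" where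
  "tests S = {f. smooth f \<and> support_within f S}"

lemma testsD:
  assumes "f \<in> tests S"
  shows tests_smooth: "smooth f" and "support_within f S"
  using assms by (auto simp: tests_def)

lemma testsE:
  assumes "f \<in> tests S"
  obtains K where "smooth f" "compact K" "K \<subseteq> S" "\<And>x. x \<notin> K \<Longrightarrow> f x = 0"
  using assms unfolding tests_def support_within_def by blast

lemma tests_cases:
  "f \<in> tests S \<Longrightarrow> \<exists>K. smooth f \<and> compact K \<and> K \<subseteq> S \<and> (\<forall>x. x \<notin> K \<longrightarrow> f x = 0)"
  unfolding tests_def support_within_def by blast

lemma testsI: "smooth f \<Longrightarrow> compact K \<Longrightarrow> K \<subseteq> S \<Longrightarrow> (\<And>x. x \<notin> K \<Longrightarrow> f x = 0) \<Longrightarrow> f \<in> tests S"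
  unfolding tests_def support_within_def by blast

lemma tests_mono: "f \<in> tests S \<Longrightarrow> S \<subseteq> T \<Longrightarrow> f \<in> tests T"
  by (meson order_trans testsE testsI)

lemma tests_mult:
  assumes "f \<in> tests S" "smooth g"
  shows "(\<lambda>x. f x * g x) \<in> tests S" "(\<lambda>x. g x * f x) \<in> tests S"
  using assms by (auto elim!: testsE intro!: testsI smooth_mult)

lemma fderiv_eq_0_outside:
  assumes "\<And>x. x \<notin> K \<Longrightarrow> f x = 0" "closed K" "x \<notin> K"
  shows "fderiv f x v = 0"
proof -
  have "(f has_derivative (\<lambda>_. 0)) (at x)"
    by (rule has_derivative_transform_within_open[of "\<lambda>_. 0" _ _ _ "- K"])
       (use assms in \<open>auto simp: open_Compl\<close>)
  then show ?thesis by (simp add: fderivI)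
qed

lemma fderiv_eq_0_locally_const:
  assumes "open W" "\<And>x. x \<in> W \<Longrightarrow> f x = c" "x \<in> W"
  shows "fderiv f x v = 0"
proof -
  have "(f has_derivative (\<lambda>_. 0)) (at x)"
    by (rule has_derivative_transform_within_open[of "\<lambda>_. c" _ _ _ W]) (use assms in auto)
  then show ?thesis by (simp add: fderivI)
qed

lemma fderiv_tests:
  assumes "f \<in> tests S"
  shows "(\<lambda>x. fderiv f x v) \<in> tests S"
proof -
  obtain K where K: "smooth f" "compact K" "K \<subseteq> S" "\<And>x. x \<notin> K \<Longrightarrow> f x = 0"
    using tests_cases[OF assms] by blast
  show ?thesis
    by (rule testsI[OF smooth_fderiv K(2,3)])
       (use K fderiv_eq_0_outside[of K f, OF K(4) compact_imp_closed[OF K(2)]] in auto)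
qed

text \<open>The squared distance keeps the function smooth at the centre. The argument of the step
  is nonpositive up to distance r / sqrt 2, in particular on the half ball, and at least 1 from
  distance r on.\<close>

definition ball_cutoff :: "'a::euclidean_space \<Rightarrow> real \<Rightarrow> 'a \<Rightarrow> real" where
  "ball_cutoff a r x = 1 - smooth_step (2 * ((x - a) \<bullet> (x - a)) / r\<^sup>2 - 1)"

lemma smooth_inner_self: "smooth (\<lambda>x::'a::euclidean_space. (x - a) \<bullet> (x - a))"
proof -
  have "smooth (\<lambda>x::'a. \<Sum>e\<in>Basis. ((x - a) \<bullet> e) * ((x - a) \<bullet> e))"
    unfolding inner_diff_left
    by (intro smooth_sum smooth_mult smooth_diff smooth_const smooth_linear bounded_linear.linear bounded_linear_inner_left)
  then show ?thesis by (subst euclidean_inner) simp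
qed

lemma ball_cutoff:
  assumes "r > 0"
  shows smooth_ball_cutoff: "smooth (ball_cutoff a r)"
    and ball_cutoff_bounds: "0 \<le> ball_cutoff a r x" "ball_cutoff a r x \<le> 1"
    and ball_cutoff_eq_1: "dist a x \<le> r / 2 \<Longrightarrow> ball_cutoff a r x = 1"
    and ball_cutoff_eq_0: "dist a x \<ge> r \<Longrightarrow> ball_cutoff a r x = 0"
proof -
  have "smooth (\<lambda>x. 1 - smooth_step (2 / r\<^sup>2 * ((x - a) \<bullet> (x - a)) - 1))"
    by (rule smooth_diff[OF smooth_const smooth_comp[OF smooth_smooth_step
            smooth_diff[OF smooth_mult[OF smooth_const smooth_inner_self] smooth_const]]])
  moreover have "ball_cutoff a r = (\<lambda>x. 1 - smooth_step (2 / r\<^sup>2 * ((x - a) \<bullet> (x - a)) - 1))"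
    by (auto simp: ball_cutoff_def)
  ultimately show "smooth (ball_cutoff a r)" by simp
  show "0 \<le> ball_cutoff a r x" "ball_cutoff a r x \<le> 1"
    using smooth_step_bounds by (auto simp: ball_cutoff_def)
  have d: "(x - a) \<bullet> (x - a) = (dist a x)\<^sup>2"
    by (simp add: dist_norm power2_norm_eq_inner inner_diff inner_commute)
  show "ball_cutoff a r x = 1" if "dist a x \<le> r / 2"
  proof -
    have "2 * (dist a x)\<^sup>2 / r\<^sup>2 \<le> 2 * (r / 2)\<^sup>2 / r\<^sup>2"
      using that by (intro divide_right_mono mult_left_mono power_mono) auto
    also have "\<dots> \<le> 1" using assms by (simp add: power2_eq_square)
    finally have "2 * (dist a x)\<^sup>2 / r\<^sup>2 - 1 \<le> 0" by simp
    then show ?thesis unfolding ball_cutoff_def d by (simp add: smooth_step_eq_0)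
  qed
  show "ball_cutoff a r x = 0" if "dist a x \<ge> r"
  proof -
    have "r\<^sup>2 \<le> (dist a x)\<^sup>2" using that assms by (intro power_mono) auto
    then have "2 * (dist a x)\<^sup>2 / r\<^sup>2 - 1 \<ge> 1" using assms by (simp add: le_divide_eq)
    then show ?thesis unfolding ball_cutoff_def d by (simp add: smooth_step_eq_1)
  qed
qed

lemma ball_cutoff_tests: "r > 0 \<Longrightarrow> cball a r \<subseteq> S \<Longrightarrow> ball_cutoff a r \<in> tests S"
  by (rule testsI[of _ "cball a r"]) (auto simp: smooth_ball_cutoff ball_cutoff_eq_0)

text \<open>A test function supported in a finite union of balls \<open>B\<^sub>1, \<dots>, B\<^sub>n\<close> with cutoffs \<open>\<chi>\<^sub>i\<close> is split
  as \<open>\<psi> \<chi>\<^sub>n + \<psi> (1 - \<chi>\<^sub>n)\<close>; the second summand is supported in one ball less.\<close>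

lemma tests_locally_zero_imp_zero:
  fixes L :: "('a::euclidean_space \<Rightarrow> real) \<Rightarrow> real"
  assumes add: "\<And>f g. f \<in> tests S \<Longrightarrow> g \<in> tests S \<Longrightarrow> L (\<lambda>x. f x + g x) = L f + L g"
    and loc: "\<And>x. x \<in> S \<Longrightarrow> \<exists>r>0. \<forall>f\<in>tests (S \<inter> ball x r). L f = 0"
    and f: "f \<in> tests S"
  shows "L f = 0"
proof -
  obtain r where r: "\<And>x. x \<in> S \<Longrightarrow> r x > 0 \<and> (\<forall>f\<in>tests (S \<inter> ball x (r x)). L f = 0)"
    using loc by metis
  obtain K where K: "smooth f" "compact K" "K \<subseteq> S" "\<And>x. x \<notin> K \<Longrightarrow> f x = 0"
    using tests_cases[OF f] by blast
  \<comment> \<open>A quarter of the radius: the cutoff of radius \<open>r x / 2\<close> equals 1 on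
    the quarter ball, and its support, the closed half ball, still lies inside
    \<open>ball x (r x)\<close>.\<close>
  have "K \<subseteq> (\<Union>x\<in>S. ball x (r x / 4))" using K(3) r by (force)
  then obtain C where C: "C \<subseteq> S" "finite C" "K \<subseteq> (\<Union>x\<in>C. ball x (r x / 4))"
    using K(2) by (metis (no_types, lifting) compactE_image open_ball)
  have *: "L g = 0" if "finite C" "C \<subseteq> S" "smooth g" "\<And>x. x \<notin> K \<Longrightarrow> g x = 0"
    "\<And>x. g x \<noteq> 0 \<Longrightarrow> x \<in> (\<Union>x\<in>C. ball x (r x / 4))" for C g
    using that
  proof (induction C arbitrary: g rule: finite_induct)
    case empty
    then have "g = (\<lambda>x. 0)" by auto
    \<comment> \<open>Additivity at the zero function reads L 0 = L 0 + L 0.\<close>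
    then show ?case using add[of "\<lambda>x. 0" "\<lambda>x. 0"] by (auto simp: testsI[of _ "{}"] smooth_const)
  next
    case (insert a C)
    let ?X = "ball_cutoff a (r a / 2)"
    have ra: "r a > 0" and a: "a \<in> S" using insert.prems r by auto
    have 1: "(\<lambda>x. g x * ?X x) \<in> tests (S \<inter> ball a (r a))"
    proof (rule testsI[where K="K \<inter> cball a (r a / 2)"])
      show "compact (K \<inter> cball a (r a / 2))" using K(2) by (intro compact_Int) auto
      show "K \<inter> cball a (r a / 2) \<subseteq> S \<inter> ball a (r a)" using K(3) ra by auto
    qed (use insert.prems ra in \<open>auto intro!: smooth_mult smooth_ball_cutoff ball_cutoff_eq_0\<close>)
    then have 2: "(\<lambda>x. g x * ?X x) \<in> tests S" by (rule tests_mono) auto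
    have sm: "smooth (\<lambda>x. g x * (1 - ?X x))"
      using insert.prems ra by (intro smooth_mult smooth_diff smooth_const smooth_ball_cutoff) auto
    then have 3: "(\<lambda>x. g x * (1 - ?X x)) \<in> tests S"
      by (rule testsI[OF _ K(2,3)]) (use insert.prems in auto)
    have 4: "L (\<lambda>x. g x * (1 - ?X x)) = 0"
    proof (rule insert.IH[OF _ sm])
      fix x assume "g x * (1 - ?X x) \<noteq> 0"
      moreover from this have "dist a x > r a / 4"
        using ball_cutoff_eq_1[of "r a / 2" a x] ra by force
      ultimately show "x \<in> (\<Union>x\<in>C. ball x (r x / 4))" using insert.prems(4)[of x] by force
    qed (use insert.prems in auto)
    have "L (\<lambda>x. g x * ?X x + g x * (1 - ?X x)) = 0"
      using add[OF 2 3] 4 r[OF a] 1 by simp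
    then show ?case by (simp add: algebra_simps)
  qed
  show ?thesis by (rule *[of C]) (use C K in force)+
qed

lemma smooth_borel_measurable: "smooth f \<Longrightarrow> f \<in> borel_measurable borel"
  by (intro borel_measurable_continuous_onI smooth_continuous)

lemma tests_bounded:
  assumes "f \<in> tests S"
  obtains C where "C > 0" "\<And>x. \<bar>f x\<bar> \<le> C"
proof -
  obtain K where K: "smooth f" "compact K" "K \<subseteq> S" "\<And>x. x \<notin> K \<Longrightarrow> f x = 0"
    using tests_cases[OF assms] by blast
  have "bounded (f ` K)" using K by (intro compact_imp_bounded compact_continuous_image smooth_continuous)
  then obtain C where C: "C > 0" "\<And>x. x \<in> K \<Longrightarrow> \<bar>f x\<bar> \<le> C" by (auto simp: bounded_pos)
  then have "\<bar>f x\<bar> \<le> C" for x using K(4)[of x] by (cases "x \<in> K") auto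
  then show ?thesis using C that by blast
qed

lemma tests_fderiv_bounded:
  assumes "f \<in> tests S"
  obtains C where "C > 0" "\<And>x v. \<bar>fderiv f x v\<bar> \<le> C * norm v"
proof -
  have "\<exists>C>0. \<forall>x. \<bar>fderiv f x e\<bar> \<le> C" for e
    using tests_bounded[OF fderiv_tests[OF assms, of e]] by metis
  then obtain C where C: "\<And>e. C e > 0 \<and> (\<forall>x. \<bar>fderiv f x e\<bar> \<le> C e)" by metis
  have lin: "linear (fderiv f x)" for x using assms by (intro linear_fderiv) (rule testsD)
  have "\<bar>fderiv f x v\<bar> \<le> (\<Sum>e\<in>Basis. C e) * norm v" for x v
  proof -
    have "fderiv f x v = (\<Sum>e\<in>Basis. (v \<bullet> e) * fderiv f x e)"
      using linear_sum[OF lin[of x], of "\<lambda>e. (v \<bullet> e) *\<^sub>R e" Basis] linear.scaleR[OF lin[of x]]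
      by (simp add: euclidean_representation)
    also have "\<bar>\<dots>\<bar> \<le> (\<Sum>e\<in>Basis. norm v * C e)"
      using C by (intro order_trans[OF sum_abs] sum_mono) (auto simp: abs_mult intro!: mult_mono Basis_le_norm)
    finally show ?thesis by (simp add: sum_distrib_left mult.commute)
  qed
  moreover have "(\<Sum>e\<in>Basis. C e) > 0" using C by (intro sum_pos) auto
  ultimately show ?thesis using that by blast
qed

subsection \<open>Convolution and mollification\<close>

lemma integrable_bounded_mult:
  fixes f g :: "'a \<Rightarrow> real"
  assumes "integrable M f" "g \<in> borel_measurable M" "\<And>x. x \<in> space M \<Longrightarrow> \<bar>g x\<bar> \<le> C"
  shows "integrable M (\<lambda>x. g x * f x)"
proof (rule Bochner_Integration.integrable_bound[where f="\<lambda>x. C * f x"])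
  show "AE x in M. norm (g x * f x) \<le> norm (C * f x)"
    using assms(3) by (intro AE_I2) (auto simp: abs_mult intro!: mult_right_mono intro: order_trans[OF _ abs_ge_self])
qed (use assms in auto)

lemma lborel_distr_reflect: "distr lborel borel (\<lambda>y. x - y) = lborel" for x :: "'a::euclidean_space"
  by (subst (2) lborel_affine[of "-1" x]) (auto simp: density_1)

lemma lborel_distr_translate: "distr lborel borel (\<lambda>y. y + x) = lborel" for x :: "'a::euclidean_space"
proof -
  have "(\<lambda>y. y + x) = (+) x" by (auto simp: add.commute)
  then show ?thesis by (simp only: lborel_distr_plus)
qed

lemma integral_reflect_lborel:
  fixes f :: "'a::euclidean_space \<Rightarrow> real"
  assumes "f \<in> borel_measurable borel"
  shows "(LINT y|lborel. f (x - y)) = (LINT y|lborel. f y)"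
  by (subst (2) lborel_distr_reflect[of x, symmetric], subst integral_distr) (use assms in auto)

lemma integrable_reflect_lborel:
  fixes f :: "'a::euclidean_space \<Rightarrow> real"
  assumes "integrable lborel f"
  shows "integrable lborel (\<lambda>y. f (x - y))"
  by (rule integrable_distr[of "\<lambda>y. x - y" lborel borel]) (use assms in \<open>auto simp: lborel_distr_reflect\<close>)

lemma integral_translate_lborel:
  fixes f :: "'a::euclidean_space \<Rightarrow> real"
  assumes "f \<in> borel_measurable borel"
  shows "(LINT y|lborel. f (y + x)) = (LINT y|lborel. f y)"
  by (subst (2) lborel_distr_translate[of x, symmetric], subst integral_distr) (use assms in auto)

lemma integrable_translate_lborel:
  fixes f :: "'a::euclidean_space \<Rightarrow> real"
  assumes "integrable lborel f"
  shows "integrable lborel (\<lambda>y. f (y + x))"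
  by (rule integrable_distr[of "\<lambda>y. y + x" lborel borel]) (use assms in \<open>auto simp: lborel_distr_translate\<close>)

text \<open>Pointwise convergence is available only at points of \<open>U\<close>, where openness
  gives it, so dominated convergence handles the positive part of
  \<open>indicator U x - indicator U (x + h n)\<close>. Both indicators have the same integral,
  hence the L1 distance is twice the integral of that positive part.\<close>

lemma L1_translation_tendsto_indicator_open:
  fixes h :: "nat \<Rightarrow> 'a::euclidean_space"
  assumes U: "open U" "emeasure lborel U < \<infinity>" and h: "h \<longlonglongrightarrow> 0"
  shows "(\<lambda>n. LINT x|lborel. \<bar>indicator U (x + h n) - indicator U x :: real\<bar>) \<longlonglongrightarrow> 0"
proof -
  let ?u = "indicator U :: 'a \<Rightarrow> real"
  have [measurable]: "U \<in> sets borel" using U by auto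
  have iU: "integrable lborel ?u" using U by auto
  have iT: "integrable lborel (\<lambda>x. ?u (x + h n))" for n by (rule integrable_translate_lborel[OF iU])
  have lim: "(\<lambda>n. LINT x|lborel. max 0 (?u x - ?u (x + h n))) \<longlonglongrightarrow> (LINT x|(lborel::'a measure). 0)"
  proof (rule integral_dominated_convergence[where w="?u"])
    show "AE x in lborel. (\<lambda>n. max 0 (?u x - ?u (x + h n))) \<longlonglongrightarrow> 0"
    proof (rule AE_I2)
      fix x
      show "(\<lambda>n. max 0 (?u x - ?u (x + h n))) \<longlonglongrightarrow> 0"
      proof (cases "x \<in> U")
        case True
        have "(\<lambda>n. x + h n) \<longlonglongrightarrow> x" using tendsto_add[OF tendsto_const h, of x] by simp
        then have "\<forall>\<^sub>F n in sequentially. x + h n \<in> U" using U True topological_tendstoD by blast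
        then show ?thesis
          by (intro tendsto_eventually) (auto elim!: eventually_mono simp: True)
      qed (auto simp: indicator_def intro!: tendsto_eventually)
    qed
  qed (use iU in \<open>auto simp: indicator_def\<close>)
  have "(LINT x|lborel. \<bar>?u (x + h n) - ?u x\<bar>) = 2 * (LINT x|lborel. max 0 (?u x - ?u (x + h n)))" for n
  proof -
    have "(LINT x|lborel. \<bar>?u (x + h n) - ?u x\<bar>)
        = (LINT x|lborel. 2 * max 0 (?u x - ?u (x + h n)) - (?u x - ?u (x + h n)))"
      by (rule Bochner_Integration.integral_cong) (auto simp: indicator_def)
    also have "\<dots> = 2 * (LINT x|lborel. max 0 (?u x - ?u (x + h n))) - ((LINT x|lborel. ?u x) - (LINT x|lborel. ?u (x + h n)))"
      using iU iT[of n] by (subst Bochner_Integration.integral_diff) auto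
    finally show ?thesis using integral_translate_lborel[of ?u "h n"] by simp
  qed
  then show ?thesis using tendsto_mult[OF tendsto_const lim, of 2] by simp
qed

text \<open>The property is closed under L1 limits, because translations are L1 isometries
  (\<open>approx\<close>). It passes from open sets to Borel sets by outer regularity, and then to
  integrable functions through simple ones.\<close>

lemma L1_translation_tendsto:
  fixes f :: "'a::euclidean_space \<Rightarrow> real"
  assumes "integrable lborel f" "h \<longlonglongrightarrow> 0"
  shows "(\<lambda>n. LINT x|lborel. \<bar>f (x + h n) - f x\<bar>) \<longlonglongrightarrow> 0"
proof -
  have approx: "(\<lambda>n. LINT x|lborel. \<bar>f (x + h n) - f x\<bar>) \<longlonglongrightarrow> 0"
    if f: "integrable lborel f"
      and ex: "\<And>e. e > 0 \<Longrightarrow> \<exists>g. integrable lborel g \<and> (LINT x|lborel. \<bar>g x - f x\<bar>) < e \<and>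
          (\<lambda>n. LINT x|lborel. \<bar>g (x + h n) - g x\<bar>) \<longlonglongrightarrow> 0" for f :: "'a \<Rightarrow> real"
  proof (rule LIMSEQ_I)
    fix e :: real assume "e > 0"
    then obtain g where g: "integrable lborel g" "(LINT x|lborel. \<bar>g x - f x\<bar>) < e / 4"
        "(\<lambda>n. LINT x|lborel. \<bar>g (x + h n) - g x\<bar>) \<longlonglongrightarrow> 0"
      using ex[of "e / 4"] by auto
    obtain N where N: "\<And>n. n \<ge> N \<Longrightarrow> (LINT x|lborel. \<bar>g (x + h n) - g x\<bar>) < e / 4"
      using LIMSEQ_D[OF g(3), of "e/4"] \<open>e > 0\<close> by force
    have "norm ((LINT x|lborel. \<bar>f (x + h n) - f x\<bar>) - 0) < e" if "n \<ge> N" for n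
    proof -
      note [simp] = integrable_translate_lborel[OF f, of "h n"] integrable_translate_lborel[OF g(1), of "h n"] f g(1)
      have "(LINT x|lborel. \<bar>f (x + h n) - f x\<bar>) \<le>
          (LINT x|lborel. \<bar>g (x + h n) - f (x + h n)\<bar> + \<bar>g (x + h n) - g x\<bar> + \<bar>g x - f x\<bar>)"
        by (rule integral_mono) auto
      also have "\<dots> = (LINT x|lborel. \<bar>g (x + h n) - f (x + h n)\<bar>) + (LINT x|lborel. \<bar>g (x + h n) - g x\<bar>) + (LINT x|lborel. \<bar>g x - f x\<bar>)"
        by simp
      also have "(LINT x|lborel. \<bar>g (x + h n) - f (x + h n)\<bar>) = (LINT x|lborel. \<bar>g x - f x\<bar>)"
        by (rule integral_translate_lborel)
            (use borel_measurable_integrable[OF f] borel_measurable_integrable[OF g(1)] in measurable)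
      finally have "(LINT x|lborel. \<bar>f (x + h n) - f x\<bar>) < e"
        using g(2) N[OF that] \<open>e > 0\<close> by linarith
      then show ?thesis by simp
    qed
    then show "\<exists>N. \<forall>n\<ge>N. norm ((LINT x|lborel. \<bar>f (x + h n) - f x\<bar>) - 0) < e" by blast
  qed
  show ?thesis
    using assms(1)
  proof (induction rule: integrable_induct)
    case (base A c)
    have [measurable]: "A \<in> sets borel" using base by simp
    have iA: "integrable lborel (indicator A :: 'a \<Rightarrow> real)" using base by auto
    have 1: "(\<lambda>n. LINT x|lborel. \<bar>indicator A (x + h n) - indicator A x :: real\<bar>) \<longlonglongrightarrow> 0"
    proof (rule approx[OF iA])
      fix e :: real assume "e > 0"
      then obtain U where U: "open U" "A \<subseteq> U" "emeasure lborel (U - A) < e"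
        using outer_regular_lborel[of A e] by auto
      have "emeasure lborel U \<le> emeasure lborel A + emeasure lborel (U - A)"
        using emeasure_subadditive[of A lborel "U - A"] U by (simp add: Un_absorb1)
      then have fin: "emeasure lborel U < \<infinity>"
        using U base by (metis ennreal_add_less_top ennreal_less_top infinity_ennreal_def order_le_less_trans order_less_trans)
      have "(LINT x|lborel. \<bar>indicator U x - indicator A x :: real\<bar>) = (LINT x|lborel. indicator (U - A) x)"
        by (rule Bochner_Integration.integral_cong) (use U in \<open>auto simp: indicator_def\<close>)
      also have "\<dots> = measure lborel (U - A)" by simp
      also have "\<dots> < e"
        using U(3) emeasure_eq_ennreal_measure[of lborel "U - A"]
        by (metis ennreal_less_iff measure_nonneg top.not_eq_extremum order_less_imp_not_less ennreal_less_top)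
      finally show "\<exists>g. integrable lborel g \<and> (LINT x|lborel. \<bar>g x - indicator A x\<bar>) < e \<and>
          (\<lambda>n. LINT x|lborel. \<bar>g (x + h n) - g x\<bar>) \<longlonglongrightarrow> 0"
        using U fin L1_translation_tendsto_indicator_open[OF U(1) fin assms(2)]
        by (intro exI[of _ "indicator U"]) auto
    qed
    have "\<bar>indicator A (x + h n) *\<^sub>R c - indicator A x *\<^sub>R c\<bar> = \<bar>c\<bar> * \<bar>indicator A (x + h n) - indicator A x\<bar>" for x n
      by (auto simp: indicator_def)
    then show ?case using tendsto_mult[OF tendsto_const 1, of "\<bar>c\<bar>"] by simp
  next
    case (add f g)
    have "(\<lambda>n. (LINT x|lborel. \<bar>f (x + h n) - f x\<bar>) + (LINT x|lborel. \<bar>g (x + h n) - g x\<bar>)) \<longlonglongrightarrow> 0 + 0"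
      by (intro tendsto_add add)
    moreover have "(LINT x|lborel. \<bar>f (x + h n) + g (x + h n) - (f x + g x)\<bar>)
        \<le> (LINT x|lborel. \<bar>f (x + h n) - f x\<bar>) + (LINT x|lborel. \<bar>g (x + h n) - g x\<bar>)" for n
    proof -
      note [simp] = integrable_translate_lborel[OF add(1), of "h n"] integrable_translate_lborel[OF add(2), of "h n"] add(1,2)
      have "(LINT x|lborel. \<bar>f (x + h n) + g (x + h n) - (f x + g x)\<bar>)
        \<le> (LINT x|lborel. \<bar>f (x + h n) - f x\<bar> + \<bar>g (x + h n) - g x\<bar>)"
        by (rule integral_mono) auto
      then show ?thesis by simp
    qed
    ultimately show ?case
      by (rule_tac Lim_null_comparison[OF always_eventually]) (simp_all)
  next
    case (lim f s)
    show ?case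
    proof (rule approx[OF lim(4)])
      fix e :: real assume "e > 0"
      have "(\<lambda>i. LINT x|lborel. \<bar>s i x - f x\<bar>) \<longlonglongrightarrow> (LINT x|(lborel::'a measure). 0)"
      proof (rule integral_dominated_convergence[where w="\<lambda>x. 3 * \<bar>f x\<bar>"])
        show "AE x in lborel. (\<lambda>i. \<bar>s i x - f x\<bar>) \<longlonglongrightarrow> 0"
          using lim(2) by (intro AE_I2 tendsto_rabs_zero LIM_zero) auto
        show "AE x in lborel. norm \<bar>s i x - f x\<bar> \<le> 3 * \<bar>f x\<bar>" for i
        proof (rule AE_I2)
          fix x
          have "norm (s i x) \<le> 2 * norm (f x)" using lim(3)[of x i] by simp
          then show "norm \<bar>s i x - f x\<bar> \<le> 3 * \<bar>f x\<bar>" by simp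
        qed
      qed (use lim(1,4) in auto)
      then have "(\<lambda>i. LINT x|lborel. \<bar>s i x - f x\<bar>) \<longlonglongrightarrow> 0" by simp
      then have "\<forall>\<^sub>F i in sequentially. (LINT x|lborel. \<bar>s i x - f x\<bar>) < e"
        using \<open>e > 0\<close> by (rule order_tendstoD)
      then obtain i where "(LINT x|lborel. \<bar>s i x - f x\<bar>) < e"
        by (meson eventually_sequentially order_refl)
      then show "\<exists>g. integrable lborel g \<and> (LINT x|lborel. \<bar>g x - f x\<bar>) < e \<and>
          (\<lambda>n. LINT x|lborel. \<bar>g (x + h n) - g x\<bar>) \<longlonglongrightarrow> 0"
        using lim(1)[of i] lim(5)[of i] by (intro exI[of _ "s i"]) auto
    qed
  qed
qed

lemma L1_translation_small:
  fixes f :: "'a::euclidean_space \<Rightarrow> real"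
  assumes "integrable lborel f" "e > 0"
  obtains d where "d > 0" "\<And>h. norm h < d \<Longrightarrow> (LINT x|lborel. \<bar>f (x + h) - f x\<bar>) < e"
proof -
  have "\<exists>d>0. \<forall>h. norm h < d \<longrightarrow> (LINT x|lborel. \<bar>f (x + h) - f x\<bar>) < e"
  proof (rule ccontr)
    assume neg: "\<not> ?thesis"
    have "\<exists>h. norm h < 1 / Suc n \<and> \<not> (LINT x|lborel. \<bar>f (x + h) - f x\<bar>) < e" for n
      using neg by (metis divide_pos_pos of_nat_0_less_iff zero_less_Suc zero_less_one)
    then obtain h where h: "\<And>n. norm (h n) < 1 / Suc n" "\<And>n. \<not> (LINT x|lborel. \<bar>f (x + h n) - f x\<bar>) < e"
      by metis
    have "h \<longlonglongrightarrow> 0"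
      by (rule LIMSEQ_norm_0) (use h(1) in auto)
    from order_tendstoD(2)[OF L1_translation_tendsto[OF assms(1) this] assms(2)]
    show False using h(2) by (auto simp: eventually_sequentially)
  qed
  then show ?thesis using that by blast
qed

section \<open>Integrals with a moving kernel, and convolution\<close>

definition shift_integral :: "('a::euclidean_space \<Rightarrow> real) \<Rightarrow> ('b::euclidean_space \<Rightarrow> 'a) \<Rightarrow> ('b \<Rightarrow> real) \<Rightarrow> 'a \<Rightarrow> real" where
  "shift_integral k L f x = (LINT y|lborel. k (x + L y) * f y)"

lemma integrable_shift_integrand:
  assumes "k \<in> tests UNIV" "integrable lborel f" "L \<in> borel_measurable borel"
  shows "integrable lborel (\<lambda>y. k (x + L y) * f y)"
proof -
  obtain C where "\<And>x. \<bar>k x\<bar> \<le> C" using tests_bounded[OF assms(1)] by metis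
  moreover have "k \<in> borel_measurable borel" using assms(1) by (intro smooth_borel_measurable) (rule testsD)
  ultimately show ?thesis
    using assms(3) by (intro integrable_bounded_mult[OF assms(2), of _ C]) auto
qed

text \<open>Compact support makes the second derivatives bounded, so Taylor's estimate holds with
  one constant for all base points. Differentiation under the integral then needs no limit
  theorem.\<close>

lemma tests_second_order_bound:
  assumes "k \<in> tests S"
  obtains C where "C > 0" "\<And>z v. \<bar>k (z + v) - k z - fderiv k z v\<bar> \<le> C * norm v * norm v"
proof -
  have sm: "smooth k" using assms by (rule testsD)
  have "\<exists>C>0. \<forall>w z. \<bar>fderiv k w e - fderiv k z e\<bar> \<le> C * norm (w - z)" for e
  proof -
    note t = fderiv_tests[OF assms, of e]
    obtain C where C: "C > 0" "\<And>x v. \<bar>fderiv (\<lambda>x. fderiv k x e) x v\<bar> \<le> C * norm v"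
      using tests_fderiv_bounded[OF t] by metis
    have "norm (fderiv k w e - fderiv k z e) \<le> C * norm (w - z)" for w z
      by (rule differentiable_bound[of UNIV _ "fderiv (\<lambda>x. fderiv k x e)"])
         (use C t in \<open>auto intro!: smooth_has_derivative onorm_bound dest: testsD\<close>)
    then show ?thesis using C(1) by auto
  qed
  then obtain C where C: "\<And>e. C e > 0 \<and> (\<forall>w z. \<bar>fderiv k w e - fderiv k z e\<bar> \<le> C e * norm (w - z))" by metis
  have rep: "fderiv k x v = (\<Sum>e\<in>Basis. (v \<bullet> e) * fderiv k x e)" for x v
    using linear_sum[OF linear_fderiv[OF sm, of x], of "\<lambda>e. (v \<bullet> e) *\<^sub>R e" Basis] linear.scaleR[OF linear_fderiv[OF sm, of x]]
    by (simp add: euclidean_representation)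
  have lip: "\<bar>fderiv k w v - fderiv k z v\<bar> \<le> (\<Sum>e\<in>Basis. C e) * norm (w - z) * norm v" for w z v
  proof -
    have "fderiv k w v - fderiv k z v = (\<Sum>e\<in>Basis. (v \<bullet> e) * (fderiv k w e - fderiv k z e))"
      by (simp add: rep[of w v] rep[of z v] sum_subtractf right_diff_distrib)
    also have "\<bar>\<dots>\<bar> \<le> (\<Sum>e\<in>Basis. norm v * (C e * norm (w - z)))"
      using C by (intro order_trans[OF sum_abs] sum_mono) (auto simp: abs_mult intro!: mult_mono Basis_le_norm)
    finally show ?thesis by (simp add: sum_distrib_left sum_distrib_right mult_ac)
  qed
  have "\<bar>k (z + v) - k z - fderiv k z v\<bar> \<le> (\<Sum>e\<in>Basis. C e) * norm v * norm v" for z v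
  proof -
    \<comment> \<open>Mean value inequality for \<open>w \<mapsto> k w - fderiv k z w\<close> on the
      ball of radius |v|, where the derivative is bounded by the Lipschitz constant of
      \<open>fderiv k\<close> times |v|.\<close>
    have "norm ((k (z + v) - fderiv k z (z + v)) - (k z - fderiv k z z)) \<le> ((\<Sum>e\<in>Basis. C e) * norm v) * norm ((z + v) - z)"
    proof (rule differentiable_bound[of "cball z (norm v)" _ "\<lambda>w v. fderiv k w v - fderiv k z v"])
      fix w assume w: "w \<in> cball z (norm v)"
      show "((\<lambda>w. k w - fderiv k z w) has_derivative (\<lambda>v. fderiv k w v - fderiv k z v)) (at w within cball z (norm v))"
        by (rule has_derivative_at_withinI[OF
            has_derivative_diff[OF smooth_has_derivative[OF sm] bounded_linear_imp_has_derivative]])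
           (use linear_fderiv[OF sm, of z] in \<open>simp add: linear_linear\<close>)
      have S: "(\<Sum>e\<in>(Basis::'a set). C e) \<ge> 0" using C by (intro sum_nonneg) (meson less_imp_le)
      show "onorm (\<lambda>v. fderiv k w v - fderiv k z v) \<le> (\<Sum>e\<in>Basis. C e) * norm v"
      proof (rule onorm_bound)
        fix u
        have "norm (w - z) \<le> norm v" using w by (simp add: dist_norm norm_minus_commute)
        then show "norm (fderiv k w u - fderiv k z u) \<le> (\<Sum>e\<in>Basis. C e) * norm v * norm u"
          using S by (intro order_trans[OF lip[of w u z, unfolded real_norm_def[symmetric]]] mult_right_mono mult_left_mono) auto
      qed (use S in auto)
    qed (auto simp: dist_norm)
    then show ?thesis using linear_add[OF linear_fderiv[OF sm, of z], of z v] by simp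
  qed
  moreover have "(\<Sum>e\<in>(Basis::'a set). C e) > 0" using C by (intro sum_pos) auto
  ultimately show ?thesis using that by blast
qed

text \<open>The remainder is at most C |v|^2 times the L1 norm of \<open>f\<close>. Two
  constructions share this result: \<open>L = uminus\<close> gives convolutions, while
  \<open>L s = s *\<^sub>R e\<close> with the indicator of an interval gives primitives along
  \<open>e\<close>.\<close>

lemma shift_integral_has_derivative:
  assumes k: "k \<in> tests UNIV" and f: "integrable lborel f" and L: "L \<in> borel_measurable borel"
  shows "(shift_integral k L f has_derivative (\<lambda>v. shift_integral (\<lambda>z. fderiv k z v) L f x)) (at x)"
proof -
  have sm: "smooth k" using k by (rule testsD)
  note i1 = integrable_shift_integrand[OF k f L] and i2 = integrable_shift_integrand[OF fderiv_tests[OF k] f L]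
  obtain C where C: "C > 0" "\<And>z v. \<bar>k (z + v) - k z - fderiv k z v\<bar> \<le> C * norm v * norm v"
    using tests_second_order_bound[OF k] by metis
  have lin: "linear (\<lambda>v. shift_integral (\<lambda>z. fderiv k z v) L f x)"
    unfolding shift_integral_def
    using i2[of x] by (intro linearI)
      (auto simp: linear_add[OF linear_fderiv[OF sm]] linear.scaleR[OF linear_fderiv[OF sm]] distrib_right mult.assoc)
  define B where "B = (LINT y|lborel. \<bar>f y\<bar>)"
  have B: "B \<ge> 0" unfolding B_def by simp
  have bd: "norm (shift_integral k L f (x + v) - shift_integral k L f x - shift_integral (\<lambda>z. fderiv k z v) L f x) \<le> (C * B) * norm v * norm v" for v
  proof -
    have "shift_integral k L f (x + v) - shift_integral k L f x - shift_integral (\<lambda>z. fderiv k z v) L f x =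
        (LINT y|lborel. (k (x + L y + v) - k (x + L y) - fderiv k (x + L y) v) * f y)"
      unfolding shift_integral_def using i1[of "x + v"] i1[of x] i2[of x v] by (simp add: algebra_simps)
    also have "norm \<dots> \<le> (LINT y|lborel. C * norm v * norm v * \<bar>f y\<bar>)"
    proof (rule Bochner_Integration.integral_norm_bound_integral)
      show "integrable lborel (\<lambda>y. (k (x + L y + v) - k (x + L y) - fderiv k (x + L y) v) * f y)"
        using i1[of "x + v"] i1[of x] i2[of x v] by (simp add: algebra_simps)
      show "norm ((k (x + L y + v) - k (x + L y) - fderiv k (x + L y) v) * f y) \<le> C * norm v * norm v * \<bar>f y\<bar>" for y
        using C(2)[of "x + L y" v] by (auto simp: abs_mult intro!: mult_right_mono)
    qed (use f in auto)
    finally show ?thesis by (simp add: B_def mult_ac)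
  qed
  show ?thesis
    unfolding has_derivative_at
  proof
    show "bounded_linear (\<lambda>v. shift_integral (\<lambda>z. fderiv k z v) L f x)" using lin by (simp add: linear_linear)
    show "(\<lambda>h. norm (shift_integral k L f (x + h) - shift_integral k L f x - shift_integral (\<lambda>z. fderiv k z h) L f x) / norm h) \<midarrow>0\<rightarrow> 0"
    proof (rule tendsto_sandwich[of "\<lambda>_. 0" _ _ "\<lambda>h. C * B * norm h"])
      show "((\<lambda>h::'a. C * B * norm h) \<longlongrightarrow> 0) (at 0)"
        by (auto intro!: tendsto_eq_intros)
      have "norm (shift_integral k L f (x + h) - shift_integral k L f x - shift_integral (\<lambda>z. fderiv k z h) L f x) / norm h \<le> C * B * norm h" for h
        using bd[of h] C B by (cases "h = 0") (auto simp: divide_le_eq)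
      then show "\<forall>\<^sub>F h in at 0. norm (shift_integral k L f (x + h) - shift_integral k L f x - shift_integral (\<lambda>z. fderiv k z h) L f x) / norm h \<le> C * B * norm h"
        by simp
    qed auto
  qed
qed

lemma fderiv_shift_integral:
  "k \<in> tests UNIV \<Longrightarrow> integrable lborel f \<Longrightarrow> L \<in> borel_measurable borel \<Longrightarrow>
    fderiv (shift_integral k L f) x v = shift_integral (\<lambda>z. fderiv k z v) L f x"
  by (simp add: fderivI[OF shift_integral_has_derivative])

lemma smooth_shift_integral:
  assumes "k \<in> tests UNIV" "integrable lborel f" "L \<in> borel_measurable borel"
  shows "smooth (shift_integral k L f)"
proof (rule smooth_coinduct[where P="\<lambda>h. \<exists>k\<in>tests UNIV. h = shift_integral k L f"])
  fix h assume "\<exists>k\<in>tests UNIV. h = shift_integral k L f"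
  then obtain k where k: "k \<in> tests UNIV" and h: "h = shift_integral k L f" by blast
  have "(\<lambda>x. fderiv h x e) = shift_integral (\<lambda>z. fderiv k z e) L f" for e
    by (auto simp: h fderiv_shift_integral[OF k assms(2,3)])
  then show "(\<forall>x. h differentiable (at x)) \<and> (\<forall>e\<in>Basis. \<exists>k\<in>tests UNIV. (\<lambda>x. fderiv h x e) = shift_integral k L f)"
    using shift_integral_has_derivative[OF k assms(2,3)] fderiv_tests[OF k] h by (auto simp: differentiable_def)
qed (use assms in auto)

definition conv :: "('a::euclidean_space \<Rightarrow> real) \<Rightarrow> ('a \<Rightarrow> real) \<Rightarrow> 'a \<Rightarrow> real" where
  "conv k f x = (LINT y|lborel. k (x - y) * f y)"

lemma conv_eq_shift_integral: "conv k f = shift_integral k uminus f"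
  by (auto simp: conv_def shift_integral_def)

lemma integrable_conv_integrand:
  assumes "k \<in> tests UNIV" "integrable lborel f"
  shows "integrable lborel (\<lambda>y. k (x - y) * f y)"
  using integrable_shift_integrand[OF assms, of uminus x] by simp

lemma fderiv_conv:
  "k \<in> tests UNIV \<Longrightarrow> integrable lborel f \<Longrightarrow> fderiv (conv k f) x v = conv (\<lambda>z. fderiv k z v) f x"
  by (simp add: conv_eq_shift_integral fderiv_shift_integral)

lemma smooth_conv:
  assumes "k \<in> tests UNIV" "integrable lborel f"
  shows "smooth (conv k f)"
  unfolding conv_eq_shift_integral by (rule smooth_shift_integral[OF assms]) simp

lemma conv_vanish:
  assumes "\<And>x. norm x \<ge> d \<Longrightarrow> k x = 0" "\<And>y. dist x y < d \<Longrightarrow> f y = 0"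
  shows "conv k f x = 0"
proof -
  have "k (x - y) * f y = 0" for y
    using assms(1)[of "x - y"] assms(2)[of y] by (cases "dist x y < d") (auto simp: dist_norm)
  then have "(\<lambda>y. k (x - y) * f y) = (\<lambda>y. 0)" by (rule ext)
  then show ?thesis unfolding conv_def by simp
qed

lemma conv_tests:
  fixes k :: "'a::euclidean_space \<Rightarrow> real"
  assumes "k \<in> tests UNIV" "integrable lborel f" "\<And>x. norm x \<ge> d \<Longrightarrow> k x = 0"
    "compact K" "\<And>x. x \<notin> K \<Longrightarrow> f x = 0" "\<And>x y. x \<in> K \<Longrightarrow> dist x y \<le> d \<Longrightarrow> y \<in> S"
  shows "conv k f \<in> tests S"
proof (rule testsI[where K="(\<Union>x\<in>K. \<Union>y\<in>cball 0 d. {x + y})"])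
  show "compact (\<Union>x\<in>K. \<Union>y\<in>cball 0 d. {x + y})"
    by (rule compact_sums'[OF assms(4) compact_cball])
  show "(\<Union>x\<in>K. \<Union>y\<in>cball 0 d. {x + y}) \<subseteq> S"
    using assms(6) by (auto simp: dist_norm)
  show "conv k f x = 0" if "x \<notin> (\<Union>x\<in>K. \<Union>y\<in>cball 0 d. {x + y})" for x
  proof (rule conv_vanish[OF assms(3)])
    fix y assume "dist x y < d"
    have "x \<in> (\<Union>x\<in>K. \<Union>y\<in>cball 0 d. {x + y})" if "y \<in> K"
      using that \<open>dist x y < d\<close>
      by (rule_tac UN_I[of y], simp, rule_tac UN_I[of "x - y"]) (auto simp: dist_norm norm_minus_commute)
    then have "y \<notin> K" using that by blast
    then show "f y = 0" by (rule assms(5))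
  qed
qed (rule smooth_conv[OF assms(1,2)])

section \<open>Approximate identities\<close>

definition approx_identity :: "(nat \<Rightarrow> 'a::euclidean_space \<Rightarrow> real) \<Rightarrow> bool" where
  "approx_identity k \<longleftrightarrow> (\<forall>n. k n \<in> tests UNIV \<and> (\<forall>x. 0 \<le> k n x) \<and> (LINT x|lborel. k n x) = 1 \<and>
     (\<forall>x. norm x \<ge> 1 / Suc n \<longrightarrow> k n x = 0))"

lemma approx_identityD:
  assumes "approx_identity k"
  shows approx_identity_tests: "k n \<in> tests UNIV" and approx_identity_nonneg: "0 \<le> k n x"
    and approx_identity_integral: "(LINT x|lborel. k n x) = 1"
    and approx_identity_support: "norm x \<ge> 1 / Suc n \<Longrightarrow> k n x = 0"
  using assms unfolding approx_identity_def by blast+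

lemma tests_integrable:
  assumes "f \<in> tests S"
  shows "integrable lborel f"
proof -
  obtain K where K: "smooth f" "compact K" "K \<subseteq> S" "\<And>x. x \<notin> K \<Longrightarrow> f x = 0"
    using tests_cases[OF assms] by blast
  obtain C where "C > 0" "\<And>x. \<bar>f x\<bar> \<le> C" using tests_bounded[OF assms] by metis
  moreover have "integrable lborel (indicator K :: 'a \<Rightarrow> real)"
    using emeasure_compact_finite[OF K(2)] K(2) by (auto simp: borel_compact)
  ultimately have "integrable lborel (\<lambda>x. f x * indicator K x)"
    using smooth_borel_measurable[OF K(1)] by (intro integrable_bounded_mult[of _ _ _ C]) auto
  moreover have "f x * indicator K x = f x" for x using K(4) by (cases "x \<in> K") auto
  ultimately show ?thesis by simp
qed

definition mollifier :: "'a::euclidean_space \<Rightarrow> real \<Rightarrow> 'a \<Rightarrow> real" where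
  "mollifier a r x = ball_cutoff a r x / (LINT y|lborel. ball_cutoff a r y)"

lemma mollifier:
  assumes "r > 0"
  shows mollifier_tests: "mollifier a r \<in> tests (cball a r)"
    and mollifier_nonneg: "0 \<le> mollifier a r x"
    and mollifier_integral: "(LINT x|lborel. mollifier a r x) = 1"
    and mollifier_support: "dist a x \<ge> r \<Longrightarrow> mollifier a r x = 0"
proof -
  let ?I = "LINT y|lborel. ball_cutoff a r y"
  have t: "ball_cutoff a r \<in> tests (cball a r)" by (rule ball_cutoff_tests[OF assms]) simp
  have "0 < measure lborel (ball a (r / 2))"
    using assms by (simp add: content_ball_pos)
  also have "\<dots> = (LINT x|lborel. indicator (ball a (r / 2)) x)" by simp
  also have "\<dots> \<le> ?I"
  proof (rule integral_mono)
    show "integrable lborel (ball_cutoff a r)" by (rule tests_integrable[OF t])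
    show "indicator (ball a (r / 2)) x \<le> ball_cutoff a r x" for x
      using ball_cutoff_eq_1[OF assms, of a x] ball_cutoff_bounds[OF assms, of a x]
      by (auto simp: indicator_def)
  qed (auto intro!: emeasure_bounded_finite)
  finally have I: "?I > 0" .
  have "(\<lambda>x. ball_cutoff a r x * (1 / ?I)) \<in> tests (cball a r)"
    by (rule tests_mult(1)[OF t smooth_const])
  then show "mollifier a r \<in> tests (cball a r)" by (simp add: mollifier_def[abs_def])
  show "0 \<le> mollifier a r x" using I ball_cutoff_bounds[OF assms, of a x] by (simp add: mollifier_def)
  show "(LINT x|lborel. mollifier a r x) = 1" using I by (simp add: mollifier_def)
  show "mollifier a r x = 0" if "dist a x \<ge> r" using ball_cutoff_eq_0[OF assms that] by (simp add: mollifier_def)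
qed

text \<open>Kernels need not be centred or even: only the distance of their support from the origin
  counts. The kernel in time used later is one-sided.\<close>

lemma approx_identity_mollifier:
  assumes "\<And>n. r n > 0" "\<And>n. norm (a n) + r n \<le> 1 / Suc n"
  shows "approx_identity (\<lambda>n. mollifier (a n) (r n))"
proof -
  have "mollifier (a n) (r n) x = 0" if "1 / real (Suc n) \<le> norm x" for n x
  proof (rule mollifier_support[OF assms(1)])
    have "norm x \<le> norm (a n) + dist (a n) x" unfolding dist_norm by (metis add.commute norm_minus_commute norm_triangle_sub)
    then show "r n \<le> dist (a n) x" using assms(2)[of n] that by linarith
  qed
  then show ?thesis
    unfolding approx_identity_def using assms
    by (auto simp: mollifier_nonneg mollifier_integral intro: tests_mono[OF mollifier_tests])
qed

lemma conv_commute: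
  assumes [measurable]: "k \<in> borel_measurable borel" "f \<in> borel_measurable borel"
  shows "conv k f x = (LINT y|lborel. k y * f (x - y))"
proof -
  have "(LINT y|lborel. k y * f (x - y)) = (LINT y|lborel. (\<lambda>y. k y * f (x - y)) (x - y))"
    by (rule integral_reflect_lborel[symmetric]) measurable
  then show ?thesis by (simp add: conv_def)
qed

text \<open>The difference \<open>conv k f - f\<close> is the average, with weight
  \<open>k h\<close>, of the differences between \<open>f\<close> and its translate by
  \<open>h\<close>. Tonelli's theorem bounds its L1 norm by the worst translate that has positive
  weight.\<close>

lemma conv_L1_bound:
  fixes k f :: "'a::euclidean_space \<Rightarrow> real"
  assumes k: "k \<in> tests UNIV" "\<And>x. 0 \<le> k x" "(LINT x|lborel. k x) = 1" and f: "integrable lborel f"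
    and e: "\<And>h. k h \<noteq> 0 \<Longrightarrow> (LINT x|lborel. \<bar>f (x - h) - f x\<bar>) \<le> e"
  shows "integrable lborel (conv k f)" "(LINT x|lborel. \<bar>conv k f x - f x\<bar>) \<le> e"
proof -
  have [measurable]: "k \<in> borel_measurable borel" using k(1) by (intro smooth_borel_measurable) (rule testsD)
  have [measurable]: "f \<in> borel_measurable borel" using f by simp
  have [measurable]: "conv k f \<in> borel_measurable borel"
    by (intro smooth_borel_measurable smooth_conv k f)
  have ik: "integrable lborel k" by (rule tests_integrable[OF k(1)])
  have ih: "integrable lborel (\<lambda>x. f (x - h))" for h
    using integrable_translate_lborel[OF f, of "- h"] by simp
  have nn: "(\<integral>\<^sup>+x. ennreal \<bar>conv k f x - f x\<bar> \<partial>lborel) \<le> ennreal e"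
  proof -
    have "ennreal \<bar>conv k f x - f x\<bar> \<le> (\<integral>\<^sup>+y. ennreal (k y * \<bar>f (x - y) - f x\<bar>) \<partial>lborel)" for x
    proof -
      have i1: "integrable lborel (\<lambda>y. k y * f (x - y))"
        using integrable_reflect_lborel[OF integrable_conv_integrand[OF k(1) f, of x], of x] by simp
      have i2: "integrable lborel (\<lambda>y. k y * f x)" using ik by simp
      have eq: "conv k f x - f x = (LINT y|lborel. k y * (f (x - y) - f x))"
        using i1 i2 ik k(3) by (simp add: conv_commute right_diff_distrib)
      have "ennreal \<bar>conv k f x - f x\<bar> \<le> ennreal (LINT y|lborel. \<bar>k y * (f (x - y) - f x)\<bar>)"
        unfolding eq by (intro ennreal_leI integral_abs_bound)
      also have "\<dots> = (\<integral>\<^sup>+y. ennreal \<bar>k y * (f (x - y) - f x)\<bar> \<partial>lborel)"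
        using i1 i2 by (intro nn_integral_eq_integral[symmetric]) (auto simp: right_diff_distrib)
      finally show ?thesis using k(2) by (simp add: abs_mult)
    qed
    then have "(\<integral>\<^sup>+x. ennreal \<bar>conv k f x - f x\<bar> \<partial>lborel)
        \<le> (\<integral>\<^sup>+x. \<integral>\<^sup>+y. ennreal (k y * \<bar>f (x - y) - f x\<bar>) \<partial>lborel \<partial>lborel)"
      by (intro nn_integral_mono) simp
    also have "\<dots> = (\<integral>\<^sup>+y. \<integral>\<^sup>+x. ennreal (k y * \<bar>f (x - y) - f x\<bar>) \<partial>lborel \<partial>lborel)"
      by (rule lborel_pair.Fubini') measurable
    also have "\<dots> = (\<integral>\<^sup>+y. ennreal (k y) * (\<integral>\<^sup>+x. ennreal \<bar>f (x - y) - f x\<bar> \<partial>lborel) \<partial>lborel)"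
      using k(2) by (simp add: ennreal_mult nn_integral_cmult)
    also have "\<dots> \<le> (\<integral>\<^sup>+y. ennreal (k y) * ennreal e \<partial>lborel)"
    proof (rule nn_integral_mono)
      fix y :: 'a
      have "(\<integral>\<^sup>+x. ennreal \<bar>f (x - y) - f x\<bar> \<partial>lborel) = ennreal (LINT x|lborel. \<bar>f (x - y) - f x\<bar>)"
        using ih[of y] f by (intro nn_integral_eq_integral) auto
      then show "ennreal (k y) * (\<integral>\<^sup>+x. ennreal \<bar>f (x - y) - f x\<bar> \<partial>lborel) \<le> ennreal (k y) * ennreal e"
        using e[of y] by (cases "k y = 0") (auto intro!: mult_left_mono ennreal_leI)
    qed
    also have "\<dots> = (\<integral>\<^sup>+y. ennreal (k y) \<partial>lborel) * ennreal e"
      by (rule nn_integral_multc) simp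
    also have "(\<integral>\<^sup>+y. ennreal (k y) \<partial>lborel) = 1"
      using nn_integral_eq_integral[OF ik] k by simp
    finally show ?thesis by simp
  qed
  have "integrable lborel (\<lambda>x. conv k f x - f x)"
  proof (rule integrableI_bounded)
    show "(\<integral>\<^sup>+x. ennreal (norm (conv k f x - f x)) \<partial>lborel) < \<infinity>"
      using nn by (simp add: order_le_less_trans[OF _ ennreal_less_top])
  qed simp
  from Bochner_Integration.integrable_add[OF this f]
  show 1: "integrable lborel (conv k f)" by simp
  have "k \<noteq> (\<lambda>x. 0)" using k(3) by auto
  then obtain h where "k h \<noteq> 0" by auto
  moreover have "0 \<le> (LINT x|lborel. \<bar>f (x - h) - f x\<bar>)" by simp
  ultimately have "e \<ge> 0" using e[of h] by linarith
  moreover have "(\<integral>\<^sup>+x. ennreal \<bar>conv k f x - f x\<bar> \<partial>lborel) = ennreal (LINT x|lborel. \<bar>conv k f x - f x\<bar>)"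
    using 1 f by (intro nn_integral_eq_integral) auto
  ultimately show "(LINT x|lborel. \<bar>conv k f x - f x\<bar>) \<le> e" using nn by (simp add: ennreal_le_iff)
qed

lemma integrable_conv:
  assumes "approx_identity k" "integrable lborel f"
  shows "integrable lborel (conv (k n) f)"
proof (rule conv_L1_bound(1)[OF approx_identity_tests[OF assms(1)] approx_identity_nonneg[OF assms(1)]
      approx_identity_integral[OF assms(1)] assms(2)])
  fix h :: 'a
  have "(LINT x|lborel. \<bar>f (x - h) - f x\<bar>) \<le> (LINT x|lborel. \<bar>f (x - h)\<bar> + \<bar>f x\<bar>)"
    using integrable_translate_lborel[OF assms(2), of "- h"] assms(2)
    by (intro integral_mono) auto
  also have "\<dots> = (LINT x|lborel. \<bar>f (x - h)\<bar>) + (LINT x|lborel. \<bar>f x\<bar>)"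
    using integrable_translate_lborel[OF assms(2), of "- h"] assms(2) by simp
  also have "\<dots> = (LINT x|lborel. \<bar>f x\<bar>) + (LINT x|lborel. \<bar>f x\<bar>)"
    using integral_translate_lborel[of "\<lambda>x. \<bar>f x\<bar>" "- h"] assms(2) by simp
  finally show "(LINT x|lborel. \<bar>f (x - h) - f x\<bar>) \<le> (LINT x|lborel. \<bar>f x\<bar>) + (LINT x|lborel. \<bar>f x\<bar>)" .
qed

lemma conv_tendsto_L1:
  assumes k: "approx_identity k" and f: "integrable lborel f"
  shows "(\<lambda>n. LINT x|lborel. \<bar>conv (k n) f x - f x\<bar>) \<longlonglongrightarrow> 0"
proof (rule LIMSEQ_I)
  fix e :: real assume "e > 0"
  then obtain d where d: "d > 0" "\<And>h. norm h < d \<Longrightarrow> (LINT x|lborel. \<bar>f (x + h) - f x\<bar>) < e / 2"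
    using L1_translation_small[OF f, of "e / 2"] by auto
  obtain N where N: "1 / Suc N < d" using d(1) reals_Archimedean by (auto simp: inverse_eq_divide)
  have "norm ((LINT x|lborel. \<bar>conv (k n) f x - f x\<bar>) - 0) < e" if "n \<ge> N" for n
  proof -
    have "(LINT x|lborel. \<bar>conv (k n) f x - f x\<bar>) \<le> e / 2"
    proof (rule conv_L1_bound(2)[OF approx_identity_tests[OF k] approx_identity_nonneg[OF k] approx_identity_integral[OF k] f])
      fix h assume "k n h \<noteq> 0"
      then have "norm h < 1 / Suc n" using approx_identity_support[OF k] by (meson not_le)
      also have "\<dots> \<le> 1 / Suc N" using that by (simp add: frac_le)
      finally show "(LINT x|lborel. \<bar>f (x - h) - f x\<bar>) \<le> e / 2"
        using d(2)[of "- h"] N by simp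
    qed
    moreover have "0 \<le> (LINT x|lborel. \<bar>conv (k n) f x - f x\<bar>)" by simp
    ultimately show ?thesis using \<open>e > 0\<close> unfolding real_norm_def by linarith
  qed
  then show "\<exists>N. \<forall>n\<ge>N. norm ((LINT x|lborel. \<bar>conv (k n) f x - f x\<bar>) - 0) < e" by blast
qed

lemma conv_abs_le:
  assumes k: "approx_identity k" and f: "integrable lborel f" and "\<And>x. \<bar>f x\<bar> \<le> C"
  shows "\<bar>conv (k n) f x\<bar> \<le> C"
proof -
  have ik: "integrable lborel (k n)" by (rule tests_integrable[OF approx_identity_tests[OF k]])
  have "\<bar>conv (k n) f x\<bar> \<le> (LINT y|lborel. k n (x - y) * C)"
    unfolding conv_def real_norm_def[symmetric]
  proof (rule Bochner_Integration.integral_norm_bound_integral)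
    show "integrable lborel (\<lambda>y. k n (x - y) * C)" using integrable_reflect_lborel[OF ik, of x] by simp
    show "norm (k n (x - y) * f y) \<le> k n (x - y) * C" for y
      using approx_identity_nonneg[OF k] assms(3) by (auto simp: abs_mult intro!: mult_left_mono)
  qed (rule integrable_conv_integrand[OF approx_identity_tests[OF k] f])
  also have "\<dots> = C"
    using integral_reflect_lborel[of "k n" x] approx_identity_integral[OF k] ik by simp
  finally show ?thesis .
qed

lemma conv_diff:
  assumes "k \<in> tests UNIV" "integrable lborel f" "integrable lborel g"
  shows "conv k (\<lambda>x. f x - g x) x = conv k f x - conv k g x"
  unfolding conv_def using integrable_conv_integrand[OF assms(1,2), of x] integrable_conv_integrand[OF assms(1,3), of x]
  by (simp add: right_diff_distrib)

text \<open>Jensen's inequality for the square, obtained by expanding the nonnegative variance of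
  \<open>f\<close> under the probability density \<open>k n (x - y)\<close>.\<close>

lemma conv_power2_le:
  assumes k: "approx_identity k" and f: "integrable lborel f" "integrable lborel (\<lambda>x. (f x)\<^sup>2)"
  shows "(conv (k n) f x)\<^sup>2 \<le> conv (k n) (\<lambda>x. (f x)\<^sup>2) x"
proof -
  define m where "m = conv (k n) f x"
  note t = approx_identity_tests[OF k, of n]
  have ik: "integrable lborel (\<lambda>y. k n (x - y))" by (intro integrable_reflect_lborel tests_integrable[OF t])
  have 1: "(LINT y|lborel. k n (x - y)) = 1"
    using integral_reflect_lborel[of "k n" x] approx_identity_integral[OF k] tests_integrable[OF t] by simp
  have "0 \<le> (LINT y|lborel. k n (x - y) * (f y - m)\<^sup>2)"
    using approx_identity_nonneg[OF k] by (intro Bochner_Integration.integral_nonneg) auto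
  also have "\<dots> = (LINT y|lborel. k n (x - y) * (f y)\<^sup>2 - 2 * m * (k n (x - y) * f y) + m\<^sup>2 * k n (x - y))"
    by (rule Bochner_Integration.integral_cong) (auto simp: power2_eq_square algebra_simps)
  also have "\<dots> = conv (k n) (\<lambda>x. (f x)\<^sup>2) x - 2 * m * m + m\<^sup>2"
    using integrable_conv_integrand[OF t f(1), of x] integrable_conv_integrand[OF t f(2), of x] ik 1
    by (simp add: m_def conv_def)
  finally show ?thesis by (simp add: m_def power2_eq_square)
qed

lemma conv_integral:
  assumes k: "approx_identity k" and f: "integrable lborel f"
  shows "(LINT x|lborel. conv (k n) f x) = (LINT x|lborel. f x)"
proof -
  note t = approx_identity_tests[OF k, of n]
  have [measurable]: "k n \<in> borel_measurable borel" using t by (intro smooth_borel_measurable) (rule testsD)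
  have [measurable]: "f \<in> borel_measurable borel" using f by simp
  have ik: "integrable lborel (k n)" by (rule tests_integrable[OF t])
  have tr: "(LINT x|lborel. k n (x - y)) = 1" for y
    using integral_translate_lborel[of "k n" "- y"] approx_identity_integral[OF k, of n] by simp
  have itr: "integrable lborel (\<lambda>x. k n (x - y))" for y
    using integrable_translate_lborel[OF ik, of "- y"] by simp
  have i: "integrable (lborel \<Otimes>\<^sub>M lborel) (\<lambda>(x, y). k n (y - x) * f x)"
  proof (rule lborel_pair.Fubini_integrable)
    show "integrable lborel (\<lambda>x. LINT y|lborel. norm (case (x, y) of (x, y) \<Rightarrow> k n (y - x) * f x))"
      using f approx_identity_nonneg[OF k] by (simp add: abs_mult tr)
    show "AE x in lborel. integrable lborel (\<lambda>y. case (x, y) of (x, y) \<Rightarrow> k n (y - x) * f x)"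
      using itr by simp
  qed measurable
  have "(LINT x|lborel. conv (k n) f x) = (LINT x|lborel. LINT y|lborel. k n (x - y) * f y)"
    by (simp add: conv_def)
  also have "\<dots> = (LINT y|lborel. LINT x|lborel. k n (x - y) * f y)"
    using lborel_pair.Fubini_integral[of "\<lambda>x y. k n (y - x) * f x"] i by simp
  also have "\<dots> = (LINT x|lborel. f x)" by (simp add: tr)
  finally show ?thesis .
qed

text \<open>Mollification contracts the L2 norm (\<open>sq\<close>), so \<open>f\<close> may be
  truncated. For the bounded truncation, L2 convergence follows from the L1 convergence already
  known.\<close>

lemma conv_tendsto_L2:
  assumes k: "approx_identity k" and f: "integrable lborel f" "integrable lborel (\<lambda>x. (f x)\<^sup>2)"
  shows "integrable lborel (\<lambda>x. (conv (k n) f x - f x)\<^sup>2)"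
    and "(\<lambda>n. LINT x|lborel. (conv (k n) f x - f x)\<^sup>2) \<longlonglongrightarrow> 0"
proof -
  have [measurable]: "f \<in> borel_measurable borel" using f by simp
  have sq: "integrable lborel (\<lambda>x. (conv (k n) g x)\<^sup>2)" "(LINT x|lborel. (conv (k n) g x)\<^sup>2) \<le> (LINT x|lborel. (g x)\<^sup>2)"
    if g: "integrable lborel g" "integrable lborel (\<lambda>x. (g x)\<^sup>2)" for g and n
  proof -
    have [measurable]: "conv (k n) g \<in> borel_measurable borel"
      by (intro smooth_borel_measurable smooth_conv approx_identity_tests k g)
    note i = integrable_conv[OF k g(2), of n]
    show 1: "integrable lborel (\<lambda>x. (conv (k n) g x)\<^sup>2)"
      by (rule Bochner_Integration.integrable_bound[OF i])
         (use conv_power2_le[OF k g, of n] in \<open>auto intro!: AE_I2 order_trans[OF _ abs_ge_self]\<close>)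
    show "(LINT x|lborel. (conv (k n) g x)\<^sup>2) \<le> (LINT x|lborel. (g x)\<^sup>2)"
      using integral_mono[OF 1 i conv_power2_le[OF k g]] conv_integral[OF k g(2), of n] by simp
  qed
  have [measurable]: "conv (k n) f \<in> borel_measurable borel" for n
    by (intro smooth_borel_measurable smooth_conv approx_identity_tests k f)
  have diff2: "integrable lborel (\<lambda>x. (g x - h x)\<^sup>2)"
    if [measurable]: "g \<in> borel_measurable borel" "h \<in> borel_measurable borel"
      and i: "integrable lborel (\<lambda>x. (g x)\<^sup>2)" "integrable lborel (\<lambda>x. (h x)\<^sup>2)" for g h :: "'a \<Rightarrow> real"
  proof (rule Bochner_Integration.integrable_bound[where f="\<lambda>x. 2 * (g x)\<^sup>2 + 2 * (h x)\<^sup>2"])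
    have "(a - b)\<^sup>2 \<le> 2 * a\<^sup>2 + 2 * b\<^sup>2" for a b :: real
      using zero_le_power2[of "a + b"] by (simp add: power2_eq_square algebra_simps)
    then show "AE x in lborel. norm ((g x - h x)\<^sup>2) \<le> norm (2 * (g x)\<^sup>2 + 2 * (h x)\<^sup>2)"
      by (intro AE_I2) simp
  qed (use i in auto)
  show main: "integrable lborel (\<lambda>x. (conv (k n) f x - f x)\<^sup>2)" for n
    by (rule diff2) (use sq(1)[OF f] f in auto)
  show "(\<lambda>n. LINT x|lborel. (conv (k n) f x - f x)\<^sup>2) \<longlonglongrightarrow> 0"
  proof (rule LIMSEQ_I)
    fix e :: real assume "e > 0"
    define g where "g m x = (if \<bar>f x\<bar> \<le> real m then f x else 0)" for m :: nat and x
    have [measurable]: "g m \<in> borel_measurable borel" for m unfolding g_def by measurable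
    have g_le: "\<bar>g m x\<bar> \<le> \<bar>f x\<bar>" "\<bar>g m x\<bar> \<le> real m" for m x by (auto simp: g_def)
    have ig: "integrable lborel (g m)" for m
      by (rule Bochner_Integration.integrable_bound[OF f(1)]) (use g_le in auto)
    have ig2: "integrable lborel (\<lambda>x. (g m x)\<^sup>2)" for m
      by (rule Bochner_Integration.integrable_bound[OF f(2)]) (use g_le in \<open>auto simp: abs_le_square_iff\<close>)
    have ifg: "integrable lborel (\<lambda>x. (f x - g m x)\<^sup>2)" for m
      by (rule diff2) (use f ig2 in auto)
    have "(\<lambda>m. LINT x|lborel. (f x - g m x)\<^sup>2) \<longlonglongrightarrow> (LINT x|(lborel::'a measure). 0)"
    proof (rule integral_dominated_convergence[where w="\<lambda>x. (f x)\<^sup>2"])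
      show "AE x in lborel. (\<lambda>m. (f x - g m x)\<^sup>2) \<longlonglongrightarrow> 0"
      proof (rule AE_I2)
        fix x
        obtain M :: nat where "\<bar>f x\<bar> \<le> real M" using real_arch_simple by blast
        then have "\<forall>\<^sub>F m in sequentially. (f x - g m x)\<^sup>2 = 0"
          by (auto simp: g_def eventually_sequentially intro!: exI[of _ M])
        then show "(\<lambda>m. (f x - g m x)\<^sup>2) \<longlonglongrightarrow> 0" by (rule tendsto_eventually)
      qed
      show "AE x in lborel. norm ((f x - g m x)\<^sup>2) \<le> (f x)\<^sup>2" for m by (auto simp: g_def)
    qed (use f in auto)
    then have "\<forall>\<^sub>F m in sequentially. (LINT x|lborel. (f x - g m x)\<^sup>2) < e / 12"
      using \<open>e > 0\<close> by (intro order_tendstoD) auto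
    then obtain m where m: "(LINT x|lborel. (f x - g m x)\<^sup>2) < e / 12"
      by (meson eventually_sequentially order_refl)
    have "\<forall>\<^sub>F n in sequentially. (LINT x|lborel. \<bar>conv (k n) (g m) x - g m x\<bar>) < e / (12 * (real m + 1))"
      using \<open>e > 0\<close> by (intro order_tendstoD[OF conv_tendsto_L1[OF k ig]]) auto
    then obtain N where N: "\<And>n. n \<ge> N \<Longrightarrow> (LINT x|lborel. \<bar>conv (k n) (g m) x - g m x\<bar>) < e / (12 * (real m + 1))"
      by (auto simp: eventually_sequentially)
    have "(LINT x|lborel. (conv (k n) f x - f x)\<^sup>2) < e" if "n \<ge> N" for n
    proof -
      let ?d = "\<lambda>x. f x - g m x"
      have id: "integrable lborel ?d" using f ig by auto
      have [measurable]: "conv (k n) (g m) \<in> borel_measurable borel" "conv (k n) ?d \<in> borel_measurable borel"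
        by (intro smooth_borel_measurable smooth_conv approx_identity_tests k ig id)+
      have iL: "integrable lborel (\<lambda>x. \<bar>conv (k n) (g m) x - g m x\<bar>)"
        using integrable_conv[OF k ig] ig by auto
      \<comment> \<open>With d = f - g m the error is conv d + (conv (g m) - g m) - d. The two outer
        terms are controlled by the L2 norm of d; the middle one is at most 2 m, so its square is at
        most 2 m times its modulus. The thresholds e / 12 and e / (12 (m + 1)) turn the three
        contributions into at most e / 4, less than e / 2, and at most e / 4.\<close>
      have "(conv (k n) f x - f x)\<^sup>2 \<le> 3 * (conv (k n) ?d x)\<^sup>2 + 3 * (2 * real m * \<bar>conv (k n) (g m) x - g m x\<bar>) + 3 * (?d x)\<^sup>2" for x
      proof -
        define p q r where "p = conv (k n) ?d x" and "q = conv (k n) (g m) x - g m x" and "r = ?d x"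
        have "conv (k n) f x - f x = p + q - r"
          unfolding p_def q_def r_def using conv_diff[OF approx_identity_tests[OF k] f(1) ig] by simp
        moreover have "(p + q - r)\<^sup>2 \<le> 3 * p\<^sup>2 + 3 * q\<^sup>2 + 3 * r\<^sup>2"
          using zero_le_power2[of "p - q"] zero_le_power2[of "p + r"] zero_le_power2[of "q + r"]
          by (simp add: power2_eq_square algebra_simps)
        moreover have "q\<^sup>2 \<le> 2 * real m * \<bar>q\<bar>"
        proof -
          have "\<bar>q\<bar> \<le> 2 * real m"
            unfolding q_def using conv_abs_le[OF k ig, of m "real m" n x] g_le(2)[of m] g_le(2)[of m x] by fastforce
          then have "\<bar>q\<bar> * \<bar>q\<bar> \<le> 2 * real m * \<bar>q\<bar>" by (rule mult_right_mono) simp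
          then show ?thesis by (simp add: power2_eq_square)
        qed
        ultimately show ?thesis unfolding p_def[symmetric] q_def[symmetric] r_def[symmetric] by simp
      qed
      then have "(LINT x|lborel. (conv (k n) f x - f x)\<^sup>2) \<le>
        (LINT x|lborel. 3 * (conv (k n) ?d x)\<^sup>2 + 3 * (2 * real m * \<bar>conv (k n) (g m) x - g m x\<bar>) + 3 * (?d x)\<^sup>2)"
        using main sq(1)[OF id ifg] iL ifg by (intro integral_mono) auto
      also have "\<dots> = 3 * (LINT x|lborel. (conv (k n) ?d x)\<^sup>2) + 6 * real m * (LINT x|lborel. \<bar>conv (k n) (g m) x - g m x\<bar>)
          + 3 * (LINT x|lborel. (?d x)\<^sup>2)"
        using sq(1)[OF id ifg] iL ifg by simp
      also have "\<dots> \<le> 3 * (e / 12) + 6 * real m * (e / (12 * (real m + 1))) + 3 * (e / 12)"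
        using sq(2)[OF id ifg, of n] m N[OF that] by (intro add_mono mult_left_mono) auto
      also have "\<dots> < e"
      proof -
        have "6 * real m * (e / (12 * (real m + 1))) = (e / 2) * (real m / (real m + 1))" by (simp add: field_simps)
        also have "\<dots> < (e / 2) * 1" using \<open>e > 0\<close> by (intro mult_strict_left_mono) auto
        finally show ?thesis by simp
      qed
      finally show ?thesis .
    qed
    then show "\<exists>N. \<forall>n\<ge>N. norm ((LINT x|lborel. (conv (k n) f x - f x)\<^sup>2) - 0) < e" by auto
  qed
qed

text \<open>L1 convergence alone does not survive multiplication by an unbounded weight, but the
  uniform bound \<open>C\<close> helps: where |G| exceeds \<open>m\<close> the bound is used, and
  the integral of |G| there is small; elsewhere the weight is at most \<open>m\<close>.\<close>

lemma L1_weighted_tendsto: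
  fixes E :: "nat \<Rightarrow> 'a \<Rightarrow> real"
  assumes E: "\<And>n. integrable M (E n)" "(\<lambda>n. LINT x|M. \<bar>E n x\<bar>) \<longlonglongrightarrow> 0"
    and C: "\<And>n x. \<bar>E n x\<bar> \<le> C" and G: "integrable M G"
  shows "(\<lambda>n. LINT x|M. \<bar>G x\<bar> * \<bar>E n x\<bar>) \<longlonglongrightarrow> 0"
proof (rule LIMSEQ_I)
  fix e :: real assume "e > 0"
  have [measurable]: "G \<in> borel_measurable M" "\<And>n. E n \<in> borel_measurable M" using G E by auto
  have C0: "C \<ge> 0" using C[of 0 undefined] by simp
  define g where "g m x = (if \<bar>G x\<bar> \<le> real m then 0 else \<bar>G x\<bar>)" for m :: nat and x
  have [measurable]: "g m \<in> borel_measurable M" for m unfolding g_def by measurable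
  have ig: "integrable M (g m)" for m
    by (rule Bochner_Integration.integrable_bound[OF G]) (auto simp: g_def)
  have "(\<lambda>m. LINT x|M. g m x) \<longlonglongrightarrow> (LINT x|M. 0)"
  proof (rule integral_dominated_convergence[where w="\<lambda>x. \<bar>G x\<bar>"])
    show "AE x in M. (\<lambda>m. g m x) \<longlonglongrightarrow> 0"
    proof (rule AE_I2)
      fix x
      obtain N :: nat where "\<bar>G x\<bar> \<le> real N" using real_arch_simple by blast
      then have "\<forall>\<^sub>F m in sequentially. g m x = 0"
        by (auto simp: g_def eventually_sequentially intro!: exI[of _ N])
      then show "(\<lambda>m. g m x) \<longlonglongrightarrow> 0" by (rule tendsto_eventually)
    qed
    show "AE x in M. norm (g m x) \<le> \<bar>G x\<bar>" for m by (auto simp: g_def)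
  qed (use G in auto)
  then have "\<forall>\<^sub>F m in sequentially. (LINT x|M. g m x) < e / (2 * (C + 1))"
    using \<open>e > 0\<close> C0 by (intro order_tendstoD(2)) auto
  then obtain m where m: "(LINT x|M. g m x) < e / (2 * (C + 1))"
    by (meson eventually_sequentially order_refl)
  have "\<forall>\<^sub>F n in sequentially. (LINT x|M. \<bar>E n x\<bar>) < e / (2 * (real m + 1))"
    using \<open>e > 0\<close> by (intro order_tendstoD(2)[OF E(2)]) auto
  then obtain N where N: "\<And>n. n \<ge> N \<Longrightarrow> (LINT x|M. \<bar>E n x\<bar>) < e / (2 * (real m + 1))"
    by (auto simp: eventually_sequentially)
  have "(LINT x|M. \<bar>G x\<bar> * \<bar>E n x\<bar>) < e" if "n \<ge> N" for n
  proof -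
    have le: "\<bar>G x\<bar> * \<bar>E n x\<bar> \<le> (real m + 1) * \<bar>E n x\<bar> + (C + 1) * g m x" for x
    proof (cases "\<bar>G x\<bar> \<le> real m")
      case True
      then have "\<bar>G x\<bar> * \<bar>E n x\<bar> \<le> (real m + 1) * \<bar>E n x\<bar>" by (intro mult_right_mono) auto
      then show ?thesis using True by (simp add: g_def)
    next
      case False
      have "\<bar>G x\<bar> * \<bar>E n x\<bar> \<le> (C + 1) * \<bar>G x\<bar>"
        using C[of n x] by (subst mult.commute, intro mult_right_mono) auto
      moreover have "0 \<le> (real m + 1) * \<bar>E n x\<bar>" by simp
      moreover have "g m x = \<bar>G x\<bar>" using False by (simp add: g_def)
      ultimately show ?thesis by (simp only: add_increasing)
    qed
    have "(LINT x|M. \<bar>G x\<bar> * \<bar>E n x\<bar>) \<le> (LINT x|M. (real m + 1) * \<bar>E n x\<bar> + (C + 1) * g m x)"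
    proof (rule integral_mono[OF _ _ le])
      show "integrable M (\<lambda>x. \<bar>G x\<bar> * \<bar>E n x\<bar>)"
        by (rule Bochner_Integration.integrable_bound[where f="\<lambda>x. C * \<bar>G x\<bar>"])
           (use G C C0 in \<open>auto simp: abs_mult mult.commute[of C] intro!: mult_left_mono\<close>)
    qed (use E ig in auto)
    also have "\<dots> = (real m + 1) * (LINT x|M. \<bar>E n x\<bar>) + (C + 1) * (LINT x|M. g m x)"
      using E ig by simp
    also have "\<dots> < (real m + 1) * (e / (2 * (real m + 1))) + (C + 1) * (e / (2 * (C + 1)))"
      using N[OF that] m C0 by (intro add_strict_mono mult_strict_left_mono) auto
    also have "\<dots> = e"
    proof -
      have half: "a * (e / (2 * a)) = e / 2" if "a > 0" for a using that by simp
      have "(real m + 1) * (e / (2 * (real m + 1))) = e / 2" by (rule half) simp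
      moreover have "(C + 1) * (e / (2 * (C + 1))) = e / 2" by (rule half) (use C0 in simp)
      ultimately show ?thesis by (simp only:)
    qed
    finally show ?thesis .
  qed
  then show "\<exists>N. \<forall>n\<ge>N. norm ((LINT x|M. \<bar>G x\<bar> * \<bar>E n x\<bar>) - 0) < e"
    by (intro exI[of _ N]) (auto simp: abs_of_nonneg)
qed

text \<open>Young's inequality |g a| \<le> d g^2 + a^2 / (4 d) takes the place of Cauchy-Schwarz and
  yields integrability of the product at the same time. The choice d = e / (2 B), where B exceeds
  the integral of g^2, splits \<open>e\<close> evenly.\<close>

lemma L2_product_tendsto:
  fixes a :: "nat \<Rightarrow> 'a \<Rightarrow> real"
  assumes g: "g \<in> borel_measurable M" "integrable M (\<lambda>x. (g x)\<^sup>2)"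
    and a: "\<And>n. a n \<in> borel_measurable M" "\<And>n. integrable M (\<lambda>x. (a n x)\<^sup>2)"
    and lim: "(\<lambda>n. LINT x|M. (a n x)\<^sup>2) \<longlonglongrightarrow> 0"
  shows "\<And>n. integrable M (\<lambda>x. g x * a n x)" "(\<lambda>n. LINT x|M. \<bar>g x * a n x\<bar>) \<longlonglongrightarrow> 0"
proof -
  have le: "\<bar>g x * a n x\<bar> \<le> d * (g x)\<^sup>2 + (a n x)\<^sup>2 / (4 * d)" if "d > 0" for d x n
  proof -
    have "0 \<le> (2 * d * \<bar>g x\<bar> - \<bar>a n x\<bar>)\<^sup>2" by simp
    also have "\<dots> = 4 * d * (d * (g x)\<^sup>2 + (a n x)\<^sup>2 / (4 * d) - \<bar>g x * a n x\<bar>)"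
      using that by (simp add: power2_eq_square abs_mult field_simps)
    finally show ?thesis using that by (simp add: zero_le_mult_iff)
  qed
  show i: "integrable M (\<lambda>x. g x * a n x)" for n
    by (rule Bochner_Integration.integrable_bound[where f="\<lambda>x. 1 * (g x)\<^sup>2 + (a n x)\<^sup>2 / (4 * 1)"])
       (use g a le[of 1] in \<open>auto intro!: AE_I2 order_trans[OF _ abs_ge_self]\<close>)
  show "(\<lambda>n. LINT x|M. \<bar>g x * a n x\<bar>) \<longlonglongrightarrow> 0"
  proof (rule LIMSEQ_I)
    fix e :: real assume "e > 0"
    define B where "B = (LINT x|M. (g x)\<^sup>2) + 1"
    have B: "B > 0" unfolding B_def by (smt (verit) Bochner_Integration.integral_nonneg zero_le_power2)
    define d where "d = e / (2 * B)"
    have d: "d > 0" using B \<open>e > 0\<close> by (simp add: d_def)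
    have "\<forall>\<^sub>F n in sequentially. (LINT x|M. (a n x)\<^sup>2) < 2 * d * e"
      using \<open>e > 0\<close> d by (intro order_tendstoD(2)[OF lim]) auto
    then obtain N where N: "\<And>n. n \<ge> N \<Longrightarrow> (LINT x|M. (a n x)\<^sup>2) < 2 * d * e"
      by (auto simp: eventually_sequentially)
    have "(LINT x|M. \<bar>g x * a n x\<bar>) < e" if "n \<ge> N" for n
    proof -
      have "(LINT x|M. \<bar>g x * a n x\<bar>) \<le> (LINT x|M. d * (g x)\<^sup>2 + (a n x)\<^sup>2 / (4 * d))"
        by (rule integral_mono[OF _ _ le[OF d]]) (use i g a in auto)
      also have "\<dots> = d * (LINT x|M. (g x)\<^sup>2) + (LINT x|M. (a n x)\<^sup>2) / (4 * d)"
        using g a by simp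
      also have "\<dots> < d * B + (2 * d * e) / (4 * d)"
        using N[OF that] d by (intro add_strict_mono mult_strict_left_mono divide_strict_right_mono) (auto simp: B_def)
      also have "\<dots> = e" using d B by (simp add: d_def)
      finally show ?thesis .
    qed
    then show "\<exists>N. \<forall>n\<ge>N. norm ((LINT x|M. \<bar>g x * a n x\<bar>) - 0) < e"
      by (intro exI[of _ N]) (auto simp: abs_of_nonneg)
  qed
qed

subsection \<open>The stream function of a field with positive first component\<close>

text \<open>A primitive transports its own density to Lebesgue measure, even if \<open>c\<close>
  vanishes on large sets: stretches where \<open>G\<close> is constant carry no mass. It suffices to
  compare the masses of half-lines, and the mass of \<open>c\<close> to the right of x is
  \<open>m - (G x - a)\<close>.\<close>

lemma distr_density_primitive:
  fixes c :: "real \<Rightarrow> real" and a :: real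
  assumes c: "integrable lborel c" "\<And>x. 0 \<le> c x"
  defines "G \<equiv> \<lambda>x. a + (LINT s|lborel. (if s \<le> x then c s else 0))"
  defines "m \<equiv> (LINT s|lborel. c s)"
  shows "distr (density lborel (\<lambda>x. ennreal (c x))) borel G = density lborel (indicator {a<..<a + m})"
proof (rule measure_eqI_lessThan)
  have [measurable]: "c \<in> borel_measurable borel" using c by simp
  have ic: "integrable lborel (\<lambda>s. if s \<le> x then c s else 0)" for x
    by (rule Bochner_Integration.integrable_bound[OF c(1)]) auto
  have ic': "integrable lborel (\<lambda>s. if x < s then c s else 0)" for x
    by (rule Bochner_Integration.integrable_bound[OF c(1)]) auto
  have mono: "G x \<le> G y" if "x \<le> y" for x y
    unfolding G_def using that c by (intro add_left_mono integral_mono ic) auto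
  then have "mono G" by (rule monoI)
  then have [measurable]: "G \<in> borel_measurable borel" by (rule borel_measurable_mono)
  have m0: "m \<ge> 0" unfolding m_def using c by simp
  have tail: "(LINT s|lborel. (if x < s then c s else 0)) = m - (G x - a)" for x
  proof -
    have "m = (LINT s|lborel. (if s \<le> x then c s else 0) + (if x < s then c s else 0))"
      unfolding m_def by (rule Bochner_Integration.integral_cong) auto
    then show ?thesis using ic ic' by (simp add: G_def)
  qed
  have em: "emeasure (density lborel (\<lambda>x. ennreal (c x))) {x<..} = ennreal (m - (G x - a))" for x
  proof -
    have "emeasure (density lborel (\<lambda>x. ennreal (c x))) {x<..} = (\<integral>\<^sup>+s. ennreal (if x < s then c s else 0) \<partial>lborel)"
      by (simp add: emeasure_density) (auto intro!: nn_integral_cong simp: indicator_def)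
    also have "\<dots> = ennreal (m - (G x - a))"
      using c(2) ic'[of x] by (subst nn_integral_eq_integral) (auto simp: tail)
    finally show ?thesis .
  qed
  have em_UNIV: "emeasure (density lborel (\<lambda>x. ennreal (c x))) UNIV = ennreal m"
    using nn_integral_eq_integral[OF c(1)] c(2) by (simp add: emeasure_density m_def)
  have bound: "a \<le> G x" "G x \<le> a + m" for x
  proof -
    show "a \<le> G x" unfolding G_def using c(2) by (simp add: Bochner_Integration.integral_nonneg)
    have "0 \<le> (LINT s|lborel. (if x < s then c s else 0))" using c(2) by (intro Bochner_Integration.integral_nonneg) auto
    then show "G x \<le> a + m" by (simp add: tail)
  qed
  have lim: "(\<lambda>n. G (y n)) \<longlonglongrightarrow> a + (LINT s|lborel. f s)"
    if "f \<in> borel_measurable borel" "AE s in lborel. (\<lambda>n. if s \<le> y n then c s else 0) \<longlonglongrightarrow> f s" for f y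
    unfolding G_def
    by (intro tendsto_add tendsto_const integral_dominated_convergence[where w=c])
       (use c that in auto)
  have cont: "continuous_on UNIV G"
    unfolding continuous_on_sequentially o_def
  proof (intro allI ballI impI, elim conjE)
    fix y x assume y: "y \<longlonglongrightarrow> (x::real)"
    have "AE s in lborel. s \<noteq> x" by (rule AE_lborel_singleton)
    then have "AE s in lborel. (\<lambda>n. if s \<le> y n then c s else 0) \<longlonglongrightarrow> (if s \<le> x then c s else 0)"
    proof eventually_elim
      case (elim s)
      then consider "s < x" | "s > x" by linarith
      then show ?case
      proof cases
        case 1
        then have "\<forall>\<^sub>F n in sequentially. s < y n" using y by (simp add: order_tendstoD)
        then have "\<forall>\<^sub>F n in sequentially. (if s \<le> y n then c s else 0) = (if s \<le> x then c s else 0)"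
          by eventually_elim (use 1 in auto)
        then show ?thesis by (rule tendsto_eventually)
      next
        case 2
        then have "\<forall>\<^sub>F n in sequentially. y n < s" using y by (simp add: order_tendstoD)
        then have "\<forall>\<^sub>F n in sequentially. (if s \<le> y n then c s else 0) = (if s \<le> x then c s else 0)"
          by eventually_elim (use 2 in auto)
        then show ?thesis by (rule tendsto_eventually)
      qed
    qed
    from lim[OF _ this] show "(\<lambda>n. G (y n)) \<longlonglongrightarrow> G x" by (simp add: G_def)
  qed
  have lim_bot: "(\<lambda>n. G (- real n)) \<longlonglongrightarrow> a"
  proof -
    have "(\<lambda>n. if s \<le> - real n then c s else 0) \<longlonglongrightarrow> 0" for s
    proof -
      obtain N :: nat where "- s < real N" using reals_Archimedean2 by blast
      then have "\<forall>\<^sub>F n in sequentially. (if s \<le> - real n then c s else 0) = 0"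
        by (auto simp: eventually_sequentially intro!: exI[of _ N])
      then show ?thesis by (rule tendsto_eventually)
    qed
    then show ?thesis using lim[of "\<lambda>s. 0" "\<lambda>n. - real n"] by simp
  qed
  have lim_top: "(\<lambda>n. G (real n)) \<longlonglongrightarrow> a + m"
  proof -
    have "(\<lambda>n. if s \<le> real n then c s else 0) \<longlonglongrightarrow> c s" for s
    proof -
      obtain N :: nat where "s < real N" using reals_Archimedean2 by blast
      then have "\<forall>\<^sub>F n in sequentially. (if s \<le> real n then c s else 0) = c s"
        by (auto simp: eventually_sequentially intro!: exI[of _ N])
      then show ?thesis by (rule tendsto_eventually)
    qed
    then show ?thesis using lim[of c real] by (simp add: m_def)
  qed
  fix t :: real
  let ?M = "distr (density lborel (\<lambda>x. ennreal (c x))) borel G"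
  have L: "emeasure ?M {t<..} = emeasure (density lborel (\<lambda>x. ennreal (c x))) {x. t < G x}"
    by (subst emeasure_distr) (auto simp: vimage_def)
  have Rt: "emeasure (density lborel (indicator {a<..<a + m})) {t<..} = emeasure lborel ({a<..<a + m} \<inter> {t<..})"
    by (simp add: emeasure_density flip: indicator_inter_arith)
  show "emeasure ?M {t<..} < \<infinity>"
  proof -
    have "emeasure ?M {t<..} \<le> emeasure (density lborel (\<lambda>x. ennreal (c x))) UNIV"
      unfolding L by (rule emeasure_mono) auto
    then show ?thesis by (simp add: em_UNIV order_le_less_trans[OF _ ennreal_less_top])
  qed
  consider "\<forall>x. t < G x" | "\<forall>x. G x \<le> t" | x0 x1 where "G x0 \<le> t" "t < G x1"
    by (meson not_le)
  then show "emeasure ?M {t<..} = emeasure (density lborel (indicator {a<..<a + m})) {t<..}"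
  proof cases
    case 1
    then have "t \<le> a" by (intro LIMSEQ_le_const[OF lim_bot]) (auto intro: less_imp_le)
    then have "{a<..<a + m} \<inter> {t<..} = {a<..<a + m}" by auto
    moreover have "{x. t < G x} = UNIV" using 1 by auto
    ultimately show ?thesis using m0 by (simp add: L Rt em_UNIV)
  next
    case 2
    then have "a + m \<le> t" by (intro LIMSEQ_le_const2[OF lim_top]) auto
    then have "{a<..<a + m} \<inter> {t<..} = {}" by auto
    moreover have "{x. t < G x} = {}" using 2 by (auto simp: not_less)
    ultimately show ?thesis by (simp only: L Rt emeasure_empty)
  next
    case (3 x0 x1)
    \<comment> \<open>As \<open>G\<close> may be constant on intervals, the level \<open>t\<close>
      is represented by its last point: to the right of \<open>Sup S\<close> the value exceeds
      \<open>t\<close>, up to it the value is at most \<open>t\<close>.\<close>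
    define S where "S = {x. G x \<le> t}"
    have "closed S" unfolding S_def
      using continuous_on_closed_Collect_le[OF cont continuous_on_const[of UNIV t]] by simp
    have bdd: "bdd_above S" and ne: "S \<noteq> {}"
      using 3 mono unfolding S_def by (auto intro!: bdd_aboveI[of _ x1]) (meson not_le order_le_less_trans order_less_imp_le)
    define z where "z = Sup S"
    have z: "z \<in> S" unfolding z_def by (rule closed_contains_Sup[OF ne bdd \<open>closed S\<close>])
    have "x0 \<le> x1" using 3 mono by (meson linorder_not_le order_le_less_trans order_less_imp_le)
    then obtain z' where "G z' = t"
      using IVT'[of G x0 t x1] 3 cont continuous_on_subset by (metis order_less_imp_le subset_UNIV)
    then have "z' \<le> z" unfolding z_def by (intro cSup_upper bdd) (auto simp: S_def)
    then have Gz: "G z = t" using mono[of z' z] z \<open>G z' = t\<close> by (simp add: S_def)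
    have "x > z \<Longrightarrow> t < G x" for x
      using cSup_upper[of x S, OF _ bdd] unfolding z_def S_def by (metis linorder_not_le mem_Collect_eq)
    then have "{x. t < G x} = {z<..}"
      using mono Gz by (auto simp: not_le[symmetric])
    moreover have "{a<..<a + m} \<inter> {t<..} = {t<..<a + m}" using bound[of z] Gz by auto
    ultimately show ?thesis using bound[of z] by (simp add: L Rt em Gz algebra_simps)
  qed
qed (auto)

section \<open>Primitives along a direction and the mollified stream function\<close>

lemma AE_lborel_fst:
  assumes "AE y in (lborel::'a::euclidean_space measure). P y"
  shows "AE x in (lborel::('a \<times> 'b::euclidean_space) measure). P (fst x)"
proof -
  obtain N where N: "{y \<in> space lborel. \<not> P y} \<subseteq> N" "N \<in> sets lborel" "emeasure lborel N = 0"
    using assms by (rule AE_E) 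
  have "N \<times> UNIV \<in> null_sets (lborel \<Otimes>\<^sub>M (lborel::'b measure))"
    using N by (auto simp: null_sets_def lborel.emeasure_pair_measure_Times)
  then show ?thesis
    using N(1) unfolding lborel_prod by (intro AE_I'[of "N \<times> UNIV"]) auto
qed

text \<open>Primitives of test functions along a unit vector \<open>e\<close>, written as shift integrals so that they are
  smooth everywhere; they are primitives only on the strip \<open>\<bar>x \<bullet> e\<bar> \<le> T\<close>.\<close>

definition primitive_along :: "real \<Rightarrow> 'a::euclidean_space \<Rightarrow> ('a \<Rightarrow> real) \<Rightarrow> 'a \<Rightarrow> real" where
  "primitive_along T e f = shift_integral f (\<lambda>s. s *\<^sub>R e) (indicator {- (2 * T)..0})"

lemma integrable_indicator_Icc: "integrable lborel (indicator {a..b::real} :: real \<Rightarrow> real)"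
  using emeasure_bounded_finite[of "{a..b}"] by (simp add: integrable_indicator_iff less_top)

lemma smooth_primitive_along: "f \<in> tests UNIV \<Longrightarrow> smooth (primitive_along T e f)"
  unfolding primitive_along_def by (rule smooth_shift_integral) (auto simp: integrable_indicator_Icc)

lemma fderiv_primitive_along:
  "f \<in> tests UNIV \<Longrightarrow> fderiv (primitive_along T e f) x v = primitive_along T e (\<lambda>z. fderiv f z v) x"
  unfolding primitive_along_def by (rule fderiv_shift_integral) (auto simp: integrable_indicator_Icc)

lemma primitive_along_eq:
  assumes f: "\<And>z. \<bar>z \<bullet> e\<bar> \<ge> T \<Longrightarrow> f z = 0" "f \<in> borel_measurable borel" and "e \<bullet> e = 1" "\<bar>x \<bullet> e\<bar> \<le> T"
  shows "primitive_along T e f x = (LINT s|lborel. (if s \<le> x \<bullet> e then f (x + (s - x \<bullet> e) *\<^sub>R e) else 0))"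
proof -
  have [measurable]: "f \<in> borel_measurable borel" by fact
  have "primitive_along T e f x = (LINT s|lborel. f (x + (s + - (x \<bullet> e)) *\<^sub>R e) * indicator {- (2 * T)..0} (s + - (x \<bullet> e)))"
    unfolding primitive_along_def shift_integral_def by (rule integral_translate_lborel[symmetric]) measurable
  also have "\<dots> = (LINT s|lborel. (if s \<le> x \<bullet> e then f (x + (s - x \<bullet> e) *\<^sub>R e) else 0))"
  proof (rule Bochner_Integration.integral_cong[OF refl])
    fix s
    have "(x + (s - x \<bullet> e) *\<^sub>R e) \<bullet> e = s" using assms(3) by (simp add: inner_add_left)
    then have "f (x + (s - x \<bullet> e) *\<^sub>R e) = 0" if "s < - T" using f(1)[of "x + (s - x \<bullet> e) *\<^sub>R e"] that by simp
    then show "f (x + (s + - (x \<bullet> e)) *\<^sub>R e) * indicator {- (2 * T)..0} (s + - (x \<bullet> e)) =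
        (if s \<le> x \<bullet> e then f (x + (s - x \<bullet> e) *\<^sub>R e) else 0)"
      using assms(4) by (auto simp: indicator_def)
  qed
  finally show ?thesis .
qed

text \<open>The integral runs over a segment of length 2 T ending at x. Since |x . e| \<le> T, its
  starting point has coordinate at most -T, where \<open>f\<close> vanishes, so only the end point
  contributes.\<close>

lemma primitive_along_fderiv:
  assumes f: "\<And>z. \<bar>z \<bullet> e\<bar> \<ge> T \<Longrightarrow> f z = 0" "f \<in> tests UNIV" and "e \<bullet> e = 1" "\<bar>x \<bullet> e\<bar> \<le> T" "T \<ge> 0"
  shows "primitive_along T e (\<lambda>z. fderiv f z e) x = f x"
proof -
  have sm: "smooth f" using f(2) by (rule testsD)
  have lin: "linear (\<lambda>s::real. s *\<^sub>R e)" by (simp add: linear_iff scaleR_add_left)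
  have g: "smooth (\<lambda>s. f (s *\<^sub>R e + x))" "fderiv (\<lambda>s. f (s *\<^sub>R e + x)) s 1 = fderiv f (s *\<^sub>R e + x) (1 *\<^sub>R e)" for s
    using smooth_comp_affine[OF sm lin] by blast+
  have d: "deriv (\<lambda>s. f (s *\<^sub>R e + x)) s = fderiv f (x + s *\<^sub>R e) e" for s
    using g(2)[of s] fderiv_real[OF g(1), of s 1] by (simp add: add.commute)
  have "(LINT s|lborel. deriv (\<lambda>s. f (s *\<^sub>R e + x)) s * indicator {- (2 * T)..0} s) = f (0 *\<^sub>R e + x) - f ((- (2 * T)) *\<^sub>R e + x)"
    using assms(5) smooth_continuous[OF smooth_deriv[OF g(1)], of UNIV]
    by (intro integral_FTC_Icc_real smooth_has_real_derivative[OF g(1)])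
       (auto simp: continuous_on_eq_continuous_at)
  moreover have "f ((- (2 * T)) *\<^sub>R e + x) = 0"
    using assms(3,4,5) by (intro f(1)) (auto simp: inner_add_left inner_diff_left)
  ultimately show ?thesis by (simp add: primitive_along_def shift_integral_def d)
qed

text \<open>The local picture after a linear change of coordinates, with the field extended by zero
  so that it can be mollified on the whole plane. The divergence is tested only inside the box
  because the extension may create divergence on its boundary. Positivity of \<open>c1\<close> is
  demanded at every point of the box, which a change on a null set achieves.\<close>

locale flux_box =
  fixes R :: real and c1 c2 :: "real \<times> real \<Rightarrow> real"
  assumes R: "R > 0"
    and c1: "integrable lborel c1" "integrable lborel (\<lambda>x. (c1 x)\<^sup>2)"
    and c2: "integrable lborel c2" "integrable lborel (\<lambda>x. (c2 x)\<^sup>2)"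
    and c1_pos: "\<And>x. x \<in> {-R<..<R} \<times> {-R<..<R} \<Longrightarrow> c1 x > 0"
    and c_zero: "\<And>x. x \<notin> {-R<..<R} \<times> {-R<..<R} \<Longrightarrow> c1 x = 0" "\<And>x. x \<notin> {-R<..<R} \<times> {-R<..<R} \<Longrightarrow> c2 x = 0"
    and divergence: "\<And>\<psi>. \<psi> \<in> tests ({-R<..<R} \<times> {-R<..<R}) \<Longrightarrow>
      (LINT x|lborel. c1 x * fderiv \<psi> x (1, 0) + c2 x * fderiv \<psi> x (0, 1)) = 0"
begin

abbreviation "Q \<equiv> {-R<..<R} \<times> {-R<..<R}"

abbreviation "moll n \<equiv> mollifier (0::real \<times> real) (1 / Suc n)"

definition "c1n n = conv (moll n) c1"
definition "c2n n = conv (moll n) c2"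

lemma moll: "approx_identity moll"
  by (rule approx_identity_mollifier) auto

lemma c_measurable [measurable]: "c1 \<in> borel_measurable borel" "c2 \<in> borel_measurable borel"
  using c1 c2 by auto

lemma c1_nonneg: "0 \<le> c1 x"
  using c1_pos[of x] c_zero(1)[of x] by fastforce

lemma moll_tests: "moll n \<in> tests UNIV"
  by (rule approx_identity_tests[OF moll])

lemma cn_tests: "c1n n \<in> tests UNIV" "c2n n \<in> tests UNIV"
proof -
  have K: "compact (cbox (-R,-R) (R,R))" by (rule compact_cbox)
  have out: "x \<notin> Q" if "x \<notin> cbox (-R,-R) (R,R)" for x
    using that by (auto simp: cbox_def Basis_prod_def)
  show "c1n n \<in> tests UNIV" unfolding c1n_def
    by (rule conv_tests[OF moll_tests c1(1) approx_identity_support[OF moll] K]) (use out c_zero in auto)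
  show "c2n n \<in> tests UNIV" unfolding c2n_def
    by (rule conv_tests[OF moll_tests c2(1) approx_identity_support[OF moll] K]) (use out c_zero in auto)
qed

lemma cn_zero:
  assumes "\<bar>fst x\<bar> \<ge> R + 1 \<or> \<bar>snd x\<bar> \<ge> R + 1"
  shows "c1n n x = 0" "c2n n x = 0"
proof -
  have *: "y \<notin> Q" if "dist x y < 1 / Suc n" for y
  proof -
    have "dist x y < 1" using that by (rule order_less_le_trans) simp
    then have "\<bar>fst x - fst y\<bar> < 1" "\<bar>snd x - snd y\<bar> < 1"
      using dist_fst_le[of x y] dist_snd_le[of x y] by (auto simp: dist_real_def)
    then show ?thesis using assms by auto
  qed
  show "c1n n x = 0" unfolding c1n_def
    by (rule conv_vanish[OF approx_identity_support[OF moll]]) (use * c_zero in auto)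
  show "c2n n x = 0" unfolding c2n_def
    by (rule conv_vanish[OF approx_identity_support[OF moll]]) (use * c_zero in auto)
qed

text \<open>The mollifier reflected about z, \<open>y \<mapsto> moll n (z - y)\<close>, is an
  admissible test function as soon as its support stays in the box; hence the margin 1 / (n +
  1).\<close>

lemma divergence_cn:
  assumes "\<bar>fst z\<bar> < R - 1 / Suc n" "\<bar>snd z\<bar> < R - 1 / Suc n"
  shows "fderiv (c1n n) z (1, 0) + fderiv (c2n n) z (0, 1) = 0"
proof -
  define \<psi> where "\<psi> y = moll n (- y + z)" for y
  have lin: "linear (uminus :: real \<times> real \<Rightarrow> _)" by (rule linear_uminus)
  have sm: "smooth (moll n)" by (rule testsD(1)[OF moll_tests])
  have "\<psi> \<in> tests Q"
  proof (rule testsI[where K="cball z (1 / Suc n)"])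
    show "smooth \<psi>" unfolding \<psi>_def by (rule smooth_comp_affine(1)[OF sm lin])
    show "cball z (1 / Suc n) \<subseteq> Q"
    proof
      fix y assume "y \<in> cball z (1 / Suc n)"
      then have "\<bar>fst z - fst y\<bar> \<le> 1 / Suc n" "\<bar>snd z - snd y\<bar> \<le> 1 / Suc n"
        using dist_fst_le[of z y] dist_snd_le[of z y] by (auto simp: dist_real_def)
      then show "y \<in> Q" using assms by (auto simp: mem_Times_iff)
    qed
    show "\<psi> x = 0" if "x \<notin> cball z (1 / Suc n)" for x
      unfolding \<psi>_def using that
      by (intro approx_identity_support[OF moll]) (auto simp: dist_norm add.commute)
  qed simp
  from divergence[OF this]
  have 0: "(LINT x|lborel. c1 x * fderiv \<psi> x (1, 0) + c2 x * fderiv \<psi> x (0, 1)) = 0" .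
  have d: "fderiv \<psi> y v = - fderiv (moll n) (z - y) v" for y v
    unfolding \<psi>_def smooth_comp_affine(2)[OF sm lin]
    using linear_neg[OF linear_fderiv[OF sm]] by (simp add: add.commute)
  have "fderiv (c1n n) z (1, 0) + fderiv (c2n n) z (0, 1) =
     (LINT y|lborel. fderiv (moll n) (z - y) (1, 0) * c1 y) + (LINT y|lborel. fderiv (moll n) (z - y) (0, 1) * c2 y)"
    unfolding c1n_def c2n_def fderiv_conv[OF moll_tests c1(1)] fderiv_conv[OF moll_tests c2(1)] by (simp add: conv_def)
  also have "\<dots> = - (LINT x|lborel. c1 x * fderiv \<psi> x (1, 0) + c2 x * fderiv \<psi> x (0, 1))"
    using integrable_conv_integrand[OF fderiv_tests[OF moll_tests] c1(1)] integrable_conv_integrand[OF fderiv_tests[OF moll_tests] c2(1)]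
    by (simp add: d mult.commute)
  finally show ?thesis by (simp only: 0) 
qed

abbreviation "P1 f \<equiv> primitive_along (R + 2) (1::real, 0::real) f"
abbreviation "P2 f \<equiv> primitive_along (R + 2) (0::real, 1::real) f"

text \<open>Integral of the rotated mollified field along an L-shaped path: horizontally at height
  \<open>r\<close> up to \<open>fst x\<close>, then vertically to \<open>snd x\<close>. The vertical
  leg starts at a height inside the box, so that it stays where the mollified field is divergence
  free. The width \<open>R + 2\<close> of the primitives exceeds \<open>R + 1\<close>, beyond which
  the mollified components vanish.\<close>

definition "Hn n r x = P2 (c1n n) x - P2 (c1n n) (fst x, r) - P1 (c2n n) (fst x, r)"

lemma Hn:
  shows smooth_Hn: "smooth (Hn n r)"
    and fderiv_Hn: "fderiv (Hn n r) x v =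
      P2 (\<lambda>z. fderiv (c1n n) z v) x - P2 (\<lambda>z. fderiv (c1n n) z (fst v, 0)) (fst x, r)
        - P1 (\<lambda>z. fderiv (c2n n) z (fst v, 0)) (fst x, r)"
proof -
  have lin: "linear (\<lambda>x::real \<times> real. (fst x, 0::real))" by (auto simp: linear_iff)
  note s = smooth_primitive_along[OF cn_tests(1), of "R + 2" "(0, 1)" n]
    smooth_primitive_along[OF cn_tests(1), of "R + 2" "(0, 1)" n, THEN smooth_comp_affine(1), OF lin, of "(0, r)"]
    smooth_primitive_along[OF cn_tests(2), of "R + 2" "(1, 0)" n, THEN smooth_comp_affine(1), OF lin, of "(0, r)"]
  have eq: "Hn n r = (\<lambda>x. P2 (c1n n) x - P2 (c1n n) ((fst x, 0) + (0, r)) - P1 (c2n n) ((fst x, 0) + (0, r)))"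
    by (auto simp: Hn_def)
  show "smooth (Hn n r)" unfolding eq by (rule smooth_diff[OF smooth_diff[OF s(1,2)] s(3)])
  show "fderiv (Hn n r) x v =
      P2 (\<lambda>z. fderiv (c1n n) z v) x - P2 (\<lambda>z. fderiv (c1n n) z (fst v, 0)) (fst x, r)
        - P1 (\<lambda>z. fderiv (c2n n) z (fst v, 0)) (fst x, r)"
    unfolding eq fderiv_diff[OF smooth_diff[OF s(1,2)] s(3)] fderiv_diff[OF s(1,2)]
      smooth_comp_affine(2)[OF smooth_primitive_along[OF cn_tests(1)] lin]
      smooth_comp_affine(2)[OF smooth_primitive_along[OF cn_tests(2)] lin]
      fderiv_primitive_along[OF cn_tests(1)] fderiv_primitive_along[OF cn_tests(2)]
    by simp
qed

text \<open>The vertical derivative is immediate. For the horizontal one, \<open>d t\<close>, the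
  primitive of the x1-derivative of \<open>c1n\<close> plus \<open>c2n\<close> at height
  \<open>t\<close>, is constant by \<open>divergence_cn\<close>; comparing the heights
  \<open>snd x\<close> and \<open>r\<close> cancels every term except
  \<open>- c2n n x\<close>.\<close>

lemma gradient_Hn:
  assumes x: "\<bar>fst x\<bar> < R - 1 / Suc n" "\<bar>snd x\<bar> < R - 1 / Suc n" and r: "\<bar>r\<bar> < R - 1 / Suc n"
  shows "fderiv (Hn n r) x (1, 0) = - c2n n x" "fderiv (Hn n r) x (0, 1) = c1n n x"
proof -
  have R': "R - 1 / Suc n < R + 2" using R by (simp add: field_simps)
  have z1: "c1n n z = 0" if "\<bar>z \<bullet> (0, 1)\<bar> \<ge> R + 2" for z using that by (intro cn_zero) (auto simp: inner_prod_def)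
  have z2: "c2n n z = 0" if "\<bar>z \<bullet> (1, 0)\<bar> \<ge> R + 2" for z using that by (intro cn_zero) (auto simp: inner_prod_def)
  have p1: "P2 (\<lambda>z. fderiv (c1n n) z (0, 1)) x = c1n n x"
    using x R R' by (intro primitive_along_fderiv z1 cn_tests) (auto simp: inner_prod_def)
  have p2: "P1 (\<lambda>z. fderiv (c2n n) z (1, 0)) (fst x, r) = c2n n (fst x, r)"
    using x R R' by (intro primitive_along_fderiv z2 cn_tests) (auto simp: inner_prod_def)
  have lin0: "P2 (\<lambda>z. fderiv (c1n n) z (0, 0)) y = 0" "P1 (\<lambda>z. fderiv (c2n n) z (0, 0)) y = 0" for y
    using linear_0[OF linear_fderiv[OF testsD(1)[OF cn_tests(1)]]] linear_0[OF linear_fderiv[OF testsD(1)[OF cn_tests(2)]]]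
    by (simp_all add: primitive_along_def shift_integral_def zero_prod_def[symmetric])
  show "fderiv (Hn n r) x (0, 1) = c1n n x"
    unfolding fderiv_Hn by (simp add: p1 lin0)
  define d where "d t = P2 (\<lambda>z. fderiv (c1n n) z (1, 0)) (fst x, t) + c2n n (fst x, t)" for t
  have lin: "linear (\<lambda>t::real. (0::real, t))" by (auto simp: linear_iff)
  have t1: "(\<lambda>z. fderiv (c1n n) z (1, 0)) \<in> tests UNIV" by (rule fderiv_tests[OF cn_tests(1)])
  have dd: "(d has_real_derivative 0) (at t)" if "\<bar>t\<bar> < R - 1 / Suc n" for t
  proof -
    have sm: "smooth (\<lambda>t. P2 (\<lambda>z. fderiv (c1n n) z (1, 0)) ((0, t) + (fst x, 0)))"
      "smooth (\<lambda>t. c2n n ((0, t) + (fst x, 0)))"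
      by (rule smooth_comp_affine(1)[OF smooth_primitive_along[OF t1] lin])
         (rule smooth_comp_affine(1)[OF testsD(1)[OF cn_tests(2)] lin])
    have eq: "d = (\<lambda>t. P2 (\<lambda>z. fderiv (c1n n) z (1, 0)) ((0, t) + (fst x, 0)) + c2n n ((0, t) + (fst x, 0)))"
      by (auto simp: d_def)
    have zz: "fderiv (c1n n) z (1, 0) = 0" if "\<bar>z \<bullet> (0, 1)\<bar> \<ge> R + 2" for z
      by (rule fderiv_eq_0_outside[where K="{z. \<bar>z \<bullet> (0, 1)\<bar> \<le> R + 1}"])
         (use that in \<open>auto intro!: cn_zero closed_Collect_le continuous_intros simp: inner_prod_def\<close>)
    have "fderiv d t 1 = fderiv (P2 (\<lambda>z. fderiv (c1n n) z (1, 0))) ((0, t) + (fst x, 0)) (0, 1) + fderiv (c2n n) ((0, t) + (fst x, 0)) (0, 1)"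
      unfolding eq fderiv_add[OF sm] smooth_comp_affine(2)[OF smooth_primitive_along[OF t1] lin]
        smooth_comp_affine(2)[OF testsD(1)[OF cn_tests(2)] lin] ..
    also have "fderiv (P2 (\<lambda>z. fderiv (c1n n) z (1, 0))) ((0, t) + (fst x, 0)) (0, 1) = fderiv (c1n n) (fst x, t) (1, 0)"
      unfolding fderiv_primitive_along[OF t1] using that R R'
      by (subst primitive_along_fderiv[OF zz t1]) (auto simp: inner_prod_def)
    also have "fderiv (c1n n) (fst x, t) (1, 0) + fderiv (c2n n) ((0, t) + (fst x, 0)) (0, 1) = 0"
      using divergence_cn[of "(fst x, t)" n] that x by simp
    finally have "deriv d t = 0"
      using fderiv_real[of d t 1] smooth_add[OF sm] eq by simp
    then show ?thesis using smooth_has_real_derivative[of d t] smooth_add[OF sm] eq by simp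
  qed
  have "d (snd x) = d r"
  proof -
    have "\<exists>c. \<forall>t\<in>{-(R - 1 / Suc n)<..<R - 1 / Suc n}. d t = c"
      by (rule has_field_derivative_zero_constant) (auto intro!: has_field_derivative_at_within dd simp: abs_less_iff)
    then show ?thesis using x r by (auto simp: abs_less_iff)
  qed
  then show "fderiv (Hn n r) x (1, 0) = - c2n n x"
    unfolding fderiv_Hn by (simp add: p2 d_def)
qed

end

section \<open>Tensor products and auxiliary integrals\<close>

lemma borel_measurable_fst_borel [measurable]:
  "fst \<in> (borel :: ('a::second_countable_topology \<times> 'b::second_countable_topology) measure) \<rightarrow>\<^sub>M borel"
  by (simp flip: borel_prod)

lemma borel_measurable_snd_borel [measurable]:
  "snd \<in> (borel :: ('a::second_countable_topology \<times> 'b::second_countable_topology) measure) \<rightarrow>\<^sub>M borel"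
  by (simp flip: borel_prod)

lemma integral_if_diff:
  fixes f g :: "'a \<Rightarrow> real"
  assumes "integrable M (\<lambda>s. if P s then f s else 0)" "integrable M (\<lambda>s. if P s then g s else 0)"
  shows "(LINT s|M. (if P s then f s else 0)) - (LINT s|M. (if P s then g s else 0)) = (LINT s|M. (if P s then f s - g s else 0))"
proof -
  have "(\<lambda>s. if P s then f s - g s else 0) = (\<lambda>s. (if P s then f s else 0) - (if P s then g s else 0))" by auto
  then show ?thesis using Bochner_Integration.integral_diff[OF assms] by simp
qed

lemma tests_tensor:
  fixes k l :: "real \<Rightarrow> real"
  assumes k: "k \<in> tests UNIV" and l: "l \<in> tests UNIV"
  shows "(\<lambda>z. k (fst z) * l (snd z)) \<in> tests UNIV"
    and "fderiv (\<lambda>z. k (fst z) * l (snd z)) z (1, 0) = deriv k (fst z) * l (snd z)"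
proof -
  obtain K where K: "smooth k" "compact K" "\<And>x. x \<notin> K \<Longrightarrow> k x = 0" using tests_cases[OF k] by blast
  obtain L where L: "smooth l" "compact L" "\<And>x. x \<notin> L \<Longrightarrow> l x = 0" using tests_cases[OF l] by blast
  have lin: "linear (fst :: real \<times> real \<Rightarrow> real)" "linear (snd :: real \<times> real \<Rightarrow> real)" by (auto simp: linear_iff)
  have sm: "smooth (\<lambda>z::real \<times> real. k (fst z))" "smooth (\<lambda>z::real \<times> real. l (snd z))"
    using smooth_comp_affine(1)[OF K(1) lin(1), of 0] smooth_comp_affine(1)[OF L(1) lin(2), of 0] by auto
  have d: "fderiv (\<lambda>z. k (fst z)) z v = fderiv k (fst z) (fst v)" "fderiv (\<lambda>z. l (snd z)) z v = fderiv l (snd z) (snd v)"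
    for v :: "real \<times> real"
    using smooth_comp_affine(2)[OF K(1) lin(1), of 0] smooth_comp_affine(2)[OF L(1) lin(2), of 0] by auto
  show "(\<lambda>z. k (fst z) * l (snd z)) \<in> tests UNIV"
    by (rule testsI[OF smooth_mult[OF sm], of "K \<times> L"])
       (use K(2) L(2) K(3) L(3) in \<open>force simp: compact_Times mem_Times_iff\<close>)+
  show "fderiv (\<lambda>z. k (fst z) * l (snd z)) z (1, 0) = deriv k (fst z) * l (snd z)"
    unfolding fderiv_mult[OF sm] d by (simp add: fderiv_real K L)
qed

lemma deriv_tests:
  fixes k :: "real \<Rightarrow> real"
  assumes "k \<in> tests S"
  shows "deriv k \<in> tests S"
proof -
  have "(\<lambda>x. fderiv k x 1) = deriv k" using fderiv_real[OF testsD(1)[OF assms]] by auto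
  then show ?thesis using fderiv_tests[OF assms, of 1] by simp
qed

lemma integral_tensor:
  fixes k l :: "real \<Rightarrow> real"
  assumes "integrable lborel k" "integrable lborel l"
  shows "(LINT z|lborel. k (fst z) * l (snd z)) = (LINT y|lborel. k y) * (LINT y|lborel. l y)"
proof -
  have [measurable]: "k \<in> borel_measurable borel" "l \<in> borel_measurable borel" using assms by auto
  have i: "integrable (lborel \<Otimes>\<^sub>M lborel) (\<lambda>z. k (fst z) * l (snd z))"
    by (rule lborel_pair.Fubini_integrable) (use assms in \<open>auto simp: abs_mult\<close>)
  have "(LINT z|lborel. k (fst z) * l (snd z)) = (LINT x|lborel. LINT y|lborel. k x * l y)"
    using lborel_pair.integral_fst'[OF i] by (simp add: lborel_prod)
  then show ?thesis by simp
qed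

lemma approx_identity_tensor:
  fixes k :: "nat \<Rightarrow> real \<Rightarrow> real"
  assumes "\<And>n. k n \<in> tests UNIV" "\<And>n x. 0 \<le> k n x" "\<And>n. (LINT x|lborel. k n x) = 1"
    "\<And>n x. \<bar>x\<bar> \<ge> 1 / (2 * Suc n) \<Longrightarrow> k n x = 0"
  shows "approx_identity (\<lambda>n z. k n (fst z) * k n (snd z))"
  unfolding approx_identity_def
proof (intro allI conjI impI)
  fix n and z :: "real \<times> real"
  show "(\<lambda>z. k n (fst z) * k n (snd z)) \<in> tests UNIV" by (rule tests_tensor) fact+
  show "(LINT z|lborel. k n (fst z) * k n (snd z)) = 1"
    using assms(3)[of n] tests_integrable[OF assms(1)[of n]] by (simp add: integral_tensor)
  assume "1 / real (Suc n) \<le> norm z"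
  moreover have "norm z \<le> \<bar>fst z\<bar> + \<bar>snd z\<bar>"
    using norm_Pair_le[of "fst z" "snd z"] by simp
  moreover have "1 / real (Suc n) = 1 / (2 * Suc n) + 1 / (2 * Suc n)" by (simp add: field_simps)
  ultimately have "1 / (2 * Suc n) + 1 / (2 * Suc n) \<le> \<bar>fst z\<bar> + \<bar>snd z\<bar>" by simp
  then have "\<bar>fst z\<bar> \<ge> 1 / (2 * Suc n) \<or> \<bar>snd z\<bar> \<ge> 1 / (2 * Suc n)"
    by (metis add_strict_mono not_le)
  then show "k n (fst z) * k n (snd z) = 0" using assms(4) by auto
qed (use assms in auto)

text \<open>Fubini with the derivative variable innermost: each horizontal line contributes 0.
  Vanishing for large first coordinate suffices; in the second variable only integrability is asked,
  as the stream coordinate need not be bounded.\<close>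

lemma integral_fderiv_eq_0:
  fixes P :: "real \<times> real \<Rightarrow> real"
  assumes P: "smooth P" and zero: "\<And>z. \<bar>fst z\<bar> \<ge> T \<Longrightarrow> P z = 0"
    and int: "integrable lborel (\<lambda>z. fderiv P z (1, 0))"
  shows "(LINT z|lborel. fderiv P z (1, 0)) = 0"
proof -
  have lin: "linear (\<lambda>y::real. (y, 0::real))" by (auto simp: linear_iff)
  have inner: "(LINT y|lborel. fderiv P (y, h) (1, 0)) = 0" for h
  proof -
    have sm: "smooth (\<lambda>y. P ((y, 0) + (0, h)))" by (rule smooth_comp_affine(1)[OF P lin])
    have d: "deriv (\<lambda>y. P ((y, 0) + (0, h))) y = fderiv P (y, h) (1, 0)" for y
      using fderiv_real[OF sm, of y 1] smooth_comp_affine(2)[OF P lin, of "(0, h)" y 1] by simp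
    define M where "M = max T 0 + 1"
    have out: "fderiv P (y, h) (1, 0) = 0" if "\<bar>y\<bar> > max T 0" for y
      by (rule fderiv_eq_0_outside[where K="{z. \<bar>fst z\<bar> \<le> max T 0}"])
         (use that in \<open>auto intro!: zero closed_Collect_le continuous_intros\<close>)
    have "(LINT y|lborel. deriv (\<lambda>y. P ((y, 0) + (0, h))) y * indicator {- M..M} y) = P ((M, 0) + (0, h)) - P ((- M, 0) + (0, h))"
      using smooth_continuous[OF smooth_deriv[OF sm], of UNIV]
      by (intro integral_FTC_Icc_real smooth_has_real_derivative[OF sm])
         (auto simp: continuous_on_eq_continuous_at M_def)
    also have "\<dots> = 0" using zero[of "(M, h)"] zero[of "(- M, h)"] by (simp add: M_def)
    also have "(LINT y|lborel. deriv (\<lambda>y. P ((y, 0) + (0, h))) y * indicator {- M..M} y) = (LINT y|lborel. fderiv P (y, h) (1, 0))"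
      unfolding d
    proof (rule Bochner_Integration.integral_cong[OF refl])
      show "fderiv P (y, h) (1, 0) * indicator {- M..M} y = fderiv P (y, h) (1, 0)" for y
        using out[of y] by (cases "\<bar>y\<bar> > max T 0") (auto simp: indicator_def M_def)
    qed
    finally show ?thesis .
  qed
  have i: "integrable (lborel \<Otimes>\<^sub>M lborel) (case_prod (\<lambda>y h. fderiv P (y, h) (1, 0)))"
    using int by (simp add: lborel_prod case_prod_unfold)
  have "(LINT z|lborel. fderiv P z (1, 0)) = (LINT h|lborel. LINT y|lborel. fderiv P (y, h) (1, 0))"
    using lborel_pair.integral_snd[OF i] by (simp add: lborel_prod case_prod_unfold)
  then show ?thesis by (simp add: inner)
qed

section \<open>The limiting stream function\<close>

context flux_box
begin

text \<open>\<open>H r\<close> is the stream function that vanishes at \<open>(-R, r)\<close>. For almost every \<open>y\<close> it increases from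
  \<open>lo r y\<close> to \<open>hi r y\<close> on \<open>{y} \<times> (-R, R)\<close>, and \<open>X r\<close> is its inverse in the second variable, obtained as the
  length of a sublevel set.\<close>

definition "S2 x = (LINT s|lborel. (if s \<le> snd x then c1 (fst x, s) else 0))"
definition "S1 r y = (LINT s|lborel. (if s \<le> y then c2 (s, r) else 0))"
definition "lo r y = - S2 (y, r) - S1 r y"
definition "H r x = lo r (fst x) + S2 x"
definition "hi r y = lo r y + (LINT s|lborel. c1 (y, s))"
definition "X r z = - R + (LINT s|lborel. (if \<bar>s\<bar> < R \<and> H r (fst z, s) \<le> snd z then 1 else 0::real))"

lemma H_measurable [measurable]:
  "S2 \<in> borel_measurable borel" "lo r \<in> borel_measurable borel" "H r \<in> borel_measurable borel"
  "hi r \<in> borel_measurable borel" "X r \<in> borel_measurable borel"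
proof -
  show [measurable]: "S2 \<in> borel_measurable borel" unfolding S2_def by measurable
  have [measurable]: "S1 r \<in> borel_measurable borel" unfolding S1_def by measurable
  show [measurable]: "lo r \<in> borel_measurable borel" unfolding lo_def by measurable
  show "hi r \<in> borel_measurable borel" unfolding hi_def by measurable
  show [measurable]: "H r \<in> borel_measurable borel" unfolding H_def by measurable
  show "X r \<in> borel_measurable borel" unfolding X_def by measurable
qed

lemma AE_c1_slice: "AE y in lborel. integrable lborel (\<lambda>s. c1 (y, s))"
proof -
  have "integrable (lborel \<Otimes>\<^sub>M lborel) (\<lambda>(y, s). c1 (y, s))" using c1(1) by (simp add: lborel_prod)
  from lborel_pair.AE_integrable_fst[OF this] show ?thesis by simp
qed

text \<open>L1 convergence in the plane yields, along a subsequence, L1 convergence on almost every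
  line. For \<open>c1\<close> almost every vertical line is enough. For \<open>c2\<close> the single
  line at height \<open>r\<close> is used, so \<open>r\<close> is picked after the subsequence,
  among the heights at which convergence holds.\<close>

lemma good_height:
  obtains r \<sigma> where "\<bar>r\<bar> < R" "strict_mono \<sigma>" "integrable lborel (\<lambda>s. c2 (s, r))"
    "AE x in lborel. x \<in> Q \<longrightarrow> (\<lambda>n. Hn (\<sigma> n) r x) \<longlonglongrightarrow> H r x"
proof -
  have d1: "integrable lborel (\<lambda>x. c1n n x - c1 x)" "(\<lambda>n. LINT x|lborel. \<bar>c1n n x - c1 x\<bar>) \<longlonglongrightarrow> 0" for n
    unfolding c1n_def using integrable_conv[OF moll c1(1)] c1(1) conv_tendsto_L1[OF moll c1(1)] by auto
  have d2: "integrable lborel (\<lambda>x. c2n n x - c2 x)" "(\<lambda>n. LINT x|lborel. \<bar>c2n n x - c2 x\<bar>) \<longlonglongrightarrow> 0" for n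
    unfolding c2n_def using integrable_conv[OF moll c2(1)] c2(1) conv_tendsto_L1[OF moll c2(1)] by auto
  define g1 where "g1 n y = (LINT s|lborel. \<bar>c1n n (y, s) - c1 (y, s)\<bar>)" for n y
  define g2 where "g2 n r = (LINT s|lborel. \<bar>c2n n (s, r) - c2 (s, r)\<bar>)" for n r
  have p1: "integrable (lborel \<Otimes>\<^sub>M lborel) (\<lambda>(y, s). \<bar>c1n n (y, s) - c1 (y, s)\<bar>)" for n
    using integrable_abs[OF d1(1)[of n]] by (simp add: lborel_prod case_prod_unfold)
  have p2: "integrable (lborel \<Otimes>\<^sub>M lborel) (\<lambda>(y, s). \<bar>c2n n (y, s) - c2 (y, s)\<bar>)" for n
    using integrable_abs[OF d2(1)[of n]] by (simp add: lborel_prod case_prod_unfold)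
  have i1: "integrable lborel (g1 n)" for n
    unfolding g1_def using lborel_pair.integrable_fst[OF p1] by simp
  have i2: "integrable lborel (g2 n)" for n
    unfolding g2_def using lborel_pair.integrable_snd[OF p2] by simp
  have e1: "(LINT y|lborel. norm (g1 n y)) = (LINT x|lborel. \<bar>c1n n x - c1 x\<bar>)" for n
    using lborel_pair.integral_fst[OF p1] by (simp add: g1_def lborel_prod case_prod_unfold)
  have e2: "(LINT y|lborel. norm (g2 n y)) = (LINT x|lborel. \<bar>c2n n x - c2 x\<bar>)" for n
    using lborel_pair.integral_snd[OF p2] by (simp add: g2_def lborel_prod case_prod_unfold)
  have l1: "(\<lambda>n. LINT y|lborel. norm (g1 n y)) \<longlonglongrightarrow> 0" unfolding e1 by (rule d1(2))
  obtain s1 :: "nat \<Rightarrow> nat" where s1: "strict_mono s1" "AE y in lborel. (\<lambda>n. g1 (s1 n) y) \<longlonglongrightarrow> 0"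
    using tendsto_L1_AE_subseq[OF i1 l1] by auto
  have l2: "(\<lambda>n. LINT y|lborel. norm (g2 (s1 n) y)) \<longlonglongrightarrow> 0"
    unfolding e2 using LIMSEQ_subseq_LIMSEQ[OF d2(2) s1(1)] by (simp add: o_def)
  obtain s2 :: "nat \<Rightarrow> nat" where s2: "strict_mono s2" "AE y in lborel. (\<lambda>n. g2 (s1 (s2 n)) y) \<longlonglongrightarrow> 0"
    using tendsto_L1_AE_subseq[OF i2 l2] by auto
  have ic2: "AE r in lborel. integrable lborel (\<lambda>s. c2 (s, r))"
    using lborel_pair.AE_integrable_snd[of "\<lambda>y s. c2 (y, s)"] c2(1) by (simp add: lborel_prod case_prod_unfold)
  have id2: "AE r in lborel. \<forall>n. integrable lborel (\<lambda>s. \<bar>c2n n (s, r) - c2 (s, r)\<bar>)"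
    unfolding AE_all_countable using lborel_pair.AE_integrable_snd[OF p2] by simp
  have id1: "AE y in lborel. \<forall>n. integrable lborel (\<lambda>s. \<bar>c1n n (y, s) - c1 (y, s)\<bar>)"
    unfolding AE_all_countable using lborel_pair.AE_integrable_fst[OF p1] by simp
  \<comment> \<open>Almost every height qualifies and the interval has positive length, so some
    height inside it does.\<close>
  have "\<exists>r. r \<in> {-R<..<R} \<and> (\<lambda>n. g2 (s1 (s2 n)) r) \<longlonglongrightarrow> 0 \<and> integrable lborel (\<lambda>s. c2 (s, r)) \<and>
      (\<forall>n. integrable lborel (\<lambda>s. \<bar>c2n n (s, r) - c2 (s, r)\<bar>))"
  proof (rule ccontr)
    assume neg: "\<not> ?thesis"
    have "AE r in lborel. r \<notin> {-R<..<R}"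
      using s2(2) ic2 id2 by eventually_elim (use neg in blast)
    then have "emeasure lborel {-R<..<R} = 0"
      by (subst (asm) AE_iff_measurable[of "{-R<..<R}"]) auto
    then show False using R by simp
  qed
  then obtain r where r0: "r \<in> {-R<..<R}" and r: "(\<lambda>n. g2 (s1 (s2 n)) r) \<longlonglongrightarrow> 0" "integrable lborel (\<lambda>s. c2 (s, r))"
      "\<forall>n. integrable lborel (\<lambda>s. \<bar>c2n n (s, r) - c2 (s, r)\<bar>)" by blast
  have r: "\<bar>r\<bar> < R" "(\<lambda>n. g2 (s1 (s2 n)) r) \<longlonglongrightarrow> 0" "integrable lborel (\<lambda>s. c2 (s, r))"
      "\<And>n. integrable lborel (\<lambda>s. \<bar>c2n n (s, r) - c2 (s, r)\<bar>)" using r0 r by (auto simp: abs_less_iff)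
  define \<sigma> where "\<sigma> = s1 \<circ> s2"
  have "AE y in lborel. \<forall>t. \<bar>y\<bar> < R \<and> \<bar>t\<bar> < R \<longrightarrow> (\<lambda>n. Hn (\<sigma> n) r (y, t)) \<longlonglongrightarrow> H r (y, t)"
    using s1(2) AE_c1_slice id1
  proof eventually_elim
    case (elim y)
    have meas: "c1n n \<in> borel_measurable borel" "c2n n \<in> borel_measurable borel" for n
      by (rule smooth_borel_measurable[OF testsD(1)[OF cn_tests(1)]]
          smooth_borel_measurable[OF testsD(1)[OF cn_tests(2)]])+
    note [measurable] = meas
    \<comment> \<open>The error of a truncated line integral is at most the error \<open>g1\<close>
      on the whole line, whatever the end point \<open>t\<close>. Convergence therefore holds for
      all \<open>t\<close> on a good vertical line.\<close>
    have P2: "(\<lambda>n. P2 (c1n (\<sigma> n)) (y, t)) \<longlonglongrightarrow> S2 (y, t)" if "\<bar>t\<bar> < R" for t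
    proof (rule LIM_zero_cancel, rule Lim_null_comparison)
      have P2_eq: "P2 (c1n n) (y, t) = (LINT s|lborel. (if s \<le> t then c1n n (y, s) else 0))" for n
        using that R by (subst primitive_along_eq) (auto intro!: cn_zero meas simp: inner_prod_def cong: if_cong)
      have ii: "integrable lborel (\<lambda>s. if s \<le> t then c1 (y, s) else 0)"
        by (rule Bochner_Integration.integrable_bound[OF elim(2)]) auto
      have jj: "integrable lborel (\<lambda>s. c1n n (y, s) - c1 (y, s))" for n
        by (subst integrable_abs_iff[symmetric]) (use elim(3) in auto)
      have "integrable lborel (\<lambda>s. c1n n (y, s))" for n
        using Bochner_Integration.integrable_add[OF jj[of n] elim(2)] by simp
      then have kk: "integrable lborel (\<lambda>s. if s \<le> t then c1n n (y, s) else 0)" for n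
        by (rule Bochner_Integration.integrable_bound) auto
      have "norm (P2 (c1n n) (y, t) - S2 (y, t)) \<le> g1 n y" for n
      proof -
        have "P2 (c1n n) (y, t) - S2 (y, t) = (LINT s|lborel. (if s \<le> t then c1n n (y, s) - c1 (y, s) else 0))"
          unfolding P2_eq S2_def fst_conv snd_conv by (rule integral_if_diff[OF kk ii])
        also have "norm \<dots> \<le> g1 n y" unfolding g1_def
          by (rule Bochner_Integration.integral_norm_bound_integral)
             (use elim(3) in \<open>auto intro: Bochner_Integration.integrable_bound[OF jj[of n]]\<close>)
        finally show ?thesis .
      qed
      then show "\<forall>\<^sub>F n in sequentially. norm (P2 (c1n (\<sigma> n)) (y, t) - S2 (y, t)) \<le> g1 (\<sigma> n) y" by simp
      show "(\<lambda>n. g1 (\<sigma> n) y) \<longlonglongrightarrow> 0"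
        using LIMSEQ_subseq_LIMSEQ[OF elim(1) s2(1)] by (simp add: \<sigma>_def o_def)
    qed
    have P1: "(\<lambda>n. P1 (c2n (\<sigma> n)) (y, r)) \<longlonglongrightarrow> S1 r y" if "\<bar>y\<bar> < R"
    proof (rule LIM_zero_cancel, rule Lim_null_comparison)
      have P1_eq: "P1 (c2n n) (y, r) = (LINT s|lborel. (if s \<le> y then c2n n (s, r) else 0))" for n
        using that R by (subst primitive_along_eq) (auto intro!: cn_zero meas simp: inner_prod_def cong: if_cong)
      have ii: "integrable lborel (\<lambda>s. if s \<le> y then c2 (s, r) else 0)"
        by (rule Bochner_Integration.integrable_bound[OF r(3)]) auto
      have jj: "integrable lborel (\<lambda>s. c2n n (s, r) - c2 (s, r))" for n
        by (subst integrable_abs_iff[symmetric]) (use r(4) in auto)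
      have "integrable lborel (\<lambda>s. c2n n (s, r))" for n
        using Bochner_Integration.integrable_add[OF jj[of n] r(3)] by simp
      then have kk: "integrable lborel (\<lambda>s. if s \<le> y then c2n n (s, r) else 0)" for n
        by (rule Bochner_Integration.integrable_bound) auto
      have "norm (P1 (c2n n) (y, r) - S1 r y) \<le> g2 n r" for n
      proof -
        have "P1 (c2n n) (y, r) - S1 r y = (LINT s|lborel. (if s \<le> y then c2n n (s, r) - c2 (s, r) else 0))"
          unfolding P1_eq S1_def by (rule integral_if_diff[OF kk ii])
        also have "norm \<dots> \<le> g2 n r" unfolding g2_def
          by (rule Bochner_Integration.integral_norm_bound_integral)
             (use r(4) in \<open>auto intro: Bochner_Integration.integrable_bound[OF jj[of n]]\<close>)
        finally show ?thesis .
      qed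
      then show "\<forall>\<^sub>F n in sequentially. norm (P1 (c2n (\<sigma> n)) (y, r) - S1 r y) \<le> g2 (\<sigma> n) r" by simp
      show "(\<lambda>n. g2 (\<sigma> n) r) \<longlonglongrightarrow> 0" using r(2) by (simp add: \<sigma>_def o_def)
    qed
    show ?case
      unfolding Hn_def H_def lo_def using P2 P1 r(1)
      by (auto intro!: tendsto_eq_intros)
  qed
  then have "AE x in lborel. \<forall>t. \<bar>fst x\<bar> < R \<and> \<bar>t\<bar> < R \<longrightarrow> (\<lambda>n. Hn (\<sigma> n) r (fst x, t)) \<longlonglongrightarrow> H r (fst x, t)"
    by (rule AE_lborel_fst)
  then have "AE x in lborel. x \<in> Q \<longrightarrow> (\<lambda>n. Hn (\<sigma> n) r x) \<longlonglongrightarrow> H r x"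
    by eventually_elim (auto simp: mem_Times_iff abs_less_iff)
  moreover have "strict_mono \<sigma>" unfolding \<sigma>_def by (rule strict_mono_o[OF s1(1) s2(1)])
  ultimately show ?thesis using that[of r \<sigma>] r by blast
qed

lemma S2_Pair: "S2 (y, t) = (LINT s|lborel. (if s \<le> t then c1 (y, s) else 0))"
  by (simp add: S2_def cong: if_cong)

text \<open>Testing with \<open>k(y - x\<^sub>1) l(h - H\<^sub>n(x))\<close>: as \<open>b\<close> is orthogonal to \<open>\<nabla>H\<close>, the derivative falls on \<open>k\<close> only
  in the limit.\<close>

lemma streamline_identity:
  assumes r: "\<bar>r\<bar> < R" and \<sigma>: "strict_mono \<sigma>"
    and H: "AE x in lborel. x \<in> Q \<longrightarrow> (\<lambda>n. Hn (\<sigma> n) r x) \<longlonglongrightarrow> H r x"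
    and K: "compact K" "K \<subseteq> Q"
    and U: "U \<in> borel_measurable borel" "\<And>x. \<bar>U x\<bar> \<le> C" "\<And>x. x \<notin> K \<Longrightarrow> U x = 0"
    and F: "integrable lborel F" "\<And>x. x \<notin> K \<Longrightarrow> F x = 0"
    and eq: "\<And>\<psi>. smooth \<psi> \<Longrightarrow>
      (LINT x|lborel. U x * (c1 x * fderiv \<psi> x (1, 0) + c2 x * fderiv \<psi> x (0, 1))) = - (LINT x|lborel. F x * \<psi> x)"
    and k: "k \<in> tests UNIV" and l: "l \<in> tests UNIV"
  shows "(LINT x|lborel. U x * c1 x * (deriv k (y - fst x) * l (h - H r x)))
    = (LINT x|lborel. F x * (k (y - fst x) * l (h - H r x)))"
proof -
  have [measurable]: "U \<in> borel_measurable borel" "F \<in> borel_measurable borel" using U F by auto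
  have sm: "smooth k" "smooth l" using k l by (auto dest: testsD)
  have [measurable]: "k \<in> borel_measurable borel" "l \<in> borel_measurable borel" "deriv k \<in> borel_measurable borel" "deriv l \<in> borel_measurable borel"
    by (intro smooth_borel_measurable sm smooth_deriv)+
  have cont: "isCont l a" "isCont (deriv l) a" for a
    using smooth_continuous[OF sm(2), of UNIV] smooth_continuous[OF smooth_deriv[OF sm(2)], of UNIV]
    by (auto simp: continuous_on_eq_continuous_at)
  obtain Ck where Ck: "Ck > 0" "\<And>x. \<bar>k x\<bar> \<le> Ck" using tests_bounded[OF k] by metis
  obtain Cl where Cl: "Cl > 0" "\<And>x. \<bar>l x\<bar> \<le> Cl" using tests_bounded[OF l] by metis
  obtain Dk where Dk: "Dk > 0" "\<And>x. \<bar>deriv k x\<bar> \<le> Dk" using tests_bounded[OF deriv_tests[OF k]] by metis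
  obtain Dl where Dl: "Dl > 0" "\<And>x. \<bar>deriv l x\<bar> \<le> Dl" using tests_bounded[OF deriv_tests[OF l]] by metis
  have C: "C \<ge> 0" using U(2)[of undefined] by simp
  have "open Q" by (intro open_Times) auto
  then obtain e where e: "e > 0" "(\<Union>x\<in>K. cball x e) \<subseteq> Q"
    using compact_subset_open_imp_cball_epsilon_subset[OF K(1) _ K(2)] by metis
  have Ke: "\<bar>fst x\<bar> < R - e" "\<bar>snd x\<bar> < R - e" if "x \<in> K" for x
  proof -
    have "cball x e \<subseteq> Q" using that e by blast
    moreover have "{(fst x + e, snd x), (fst x - e, snd x), (fst x, snd x + e), (fst x, snd x - e)} \<subseteq> cball x e"
      using e by (cases x) (auto simp: dist_Pair_Pair dist_real_def)
    ultimately have "{(fst x + e, snd x), (fst x - e, snd x), (fst x, snd x + e), (fst x, snd x - e)} \<subseteq> Q"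
      by blast
    then show "\<bar>fst x\<bar> < R - e" "\<bar>snd x\<bar> < R - e" by auto
  qed
  \<comment> \<open>Both summits of the L-shaped path must keep the margin required by
    \<open>gradient_Hn\<close>: \<open>e\<close> takes care of the points of \<open>K\<close>, and
    \<open>R - \<bar>r\<bar>\<close> of the height \<open>r\<close>.\<close>
  define d where "d = min e (R - \<bar>r\<bar>)"
  have "d > 0" using e r by (simp add: d_def)
  then obtain N where N: "1 / real (Suc N) < d" by (metis inverse_eq_divide reals_Archimedean)
  have small: "1 / real (Suc (\<sigma> n)) < d" if "n \<ge> N" for n
  proof -
    have "1 / real (Suc (\<sigma> n)) \<le> 1 / real (Suc N)"
      using that seq_suble[OF \<sigma>, of n] by (intro divide_left_mono) auto
    then show ?thesis using N by linarith
  qed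
  have cm [measurable]: "c1n n \<in> borel_measurable borel" "c2n n \<in> borel_measurable borel" for n
    by (rule smooth_borel_measurable[OF testsD(1)[OF cn_tests(1)]]
        smooth_borel_measurable[OF testsD(1)[OF cn_tests(2)]])+
  have Hm [measurable]: "Hn n r \<in> borel_measurable borel" for n
    by (intro smooth_borel_measurable smooth_Hn)
  define A where "A n x = U x * c1 x * (deriv k (y - fst x) * l (h - Hn n r x))" for n x
  \<comment> \<open>The chain rule error: the field applied to grad \<open>Hn\<close> is c2 c1n - c1
    c2n, which equals c2 (c1n - c1) - c1 (c2n - c2). Every term is a product of two L2 functions,
    one of which tends to 0.\<close>
  define B where "B n x = U x * (k (y - fst x) * deriv l (h - Hn n r x)) * (c2 x * (c1n n x - c1 x) - c1 x * (c2n n x - c2 x))" for n x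
  define D where "D n x = F x * (k (y - fst x) * l (h - Hn n r x))" for n x
  have iA: "integrable lborel (A n)" for n
    unfolding A_def
    by (rule Bochner_Integration.integrable_bound[where f="\<lambda>x. C * c1 x * (Dk * Cl)"])
       (use c1(1) U(2) Dk Cl C in \<open>auto simp: abs_mult intro!: AE_I2 mult_mono mult_nonneg_nonneg\<close>)
  have d1: "integrable lborel (\<lambda>x. (c1n n x - c1 x)\<^sup>2)" "(\<lambda>n. LINT x|lborel. (c1n n x - c1 x)\<^sup>2) \<longlonglongrightarrow> 0" for n
    unfolding c1n_def by (rule conv_tendsto_L2[OF moll c1])+
  have d2: "integrable lborel (\<lambda>x. (c2n n x - c2 x)\<^sup>2)" "(\<lambda>n. LINT x|lborel. (c2n n x - c2 x)\<^sup>2) \<longlonglongrightarrow> 0" for n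
    unfolding c2n_def by (rule conv_tendsto_L2[OF moll c2])+
  have m: "c2 \<in> borel_measurable lborel" "\<And>n. (\<lambda>x. c1n n x - c1 x) \<in> borel_measurable lborel"
    "c1 \<in> borel_measurable lborel" "\<And>n. (\<lambda>x. c2n n x - c2 x) \<in> borel_measurable lborel" by simp_all
  note p1 = L2_product_tendsto[OF m(1) c2(2) m(2) d1] and p2 = L2_product_tendsto[OF m(3) c1(2) m(4) d2]
  have B_le: "\<bar>B n x\<bar> \<le> C * (Ck * Dl) * (\<bar>c2 x * (c1n n x - c1 x)\<bar> + \<bar>c1 x * (c2n n x - c2 x)\<bar>)" for n x
  proof -
    have "\<bar>U x\<bar> * (\<bar>k (y - fst x)\<bar> * \<bar>deriv l (h - Hn n r x)\<bar>) * \<bar>c2 x * (c1n n x - c1 x) - c1 x * (c2n n x - c2 x)\<bar>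
        \<le> C * (Ck * Dl) * (\<bar>c2 x * (c1n n x - c1 x)\<bar> + \<bar>c1 x * (c2n n x - c2 x)\<bar>)"
      by (intro mult_mono U(2) Ck(2) Dl(2) abs_triangle_ineq4)
         (use C Ck(1) Dl(1) in \<open>auto intro!: mult_nonneg_nonneg\<close>)
    then show ?thesis by (simp add: B_def abs_mult)
  qed
  have iBb: "integrable lborel (\<lambda>x. C * (Ck * Dl) * (\<bar>c2 x * (c1n n x - c1 x)\<bar> + \<bar>c1 x * (c2n n x - c2 x)\<bar>))" for n
    using p1(1) p2(1) by auto
  have iB: "integrable lborel (B n)" for n
  proof (rule Bochner_Integration.integrable_bound[OF iBb[of n]])
    show "B n \<in> borel_measurable lborel" unfolding B_def by measurable
    show "AE x in lborel. norm (B n x) \<le> norm (C * (Ck * Dl) * (\<bar>c2 x * (c1n n x - c1 x)\<bar> + \<bar>c1 x * (c2n n x - c2 x)\<bar>))"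
      unfolding real_norm_def by (rule AE_I2) (rule order_trans[OF B_le abs_ge_self])
  qed
  have identity: "(LINT x|lborel. A n x) + (LINT x|lborel. B n x) = (LINT x|lborel. D n x)" if n: "1 / real (Suc n) < d" for n
  proof -
    define \<psi> where "\<psi> x = k (y - fst x) * l (h - Hn n r x)" for x
    have lin: "linear (\<lambda>x::real \<times> real. - fst x)" by (auto simp: linear_iff)
    have s1: "smooth (\<lambda>x::real \<times> real. k (- fst x + y))" by (rule smooth_comp_affine(1)[OF sm(1) lin])
    have s0: "smooth (\<lambda>x. h - Hn n r x)" by (rule smooth_diff[OF smooth_const smooth_Hn])
    have s2: "smooth (\<lambda>x. l (h - Hn n r x))" by (rule smooth_comp[OF sm(2) s0])
    have \<psi>: "\<psi> = (\<lambda>x. k (- fst x + y) * l (h - Hn n r x))" by (auto simp: \<psi>_def)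
    have s\<psi>: "smooth \<psi>" unfolding \<psi> by (rule smooth_mult[OF s1 s2])
    have f\<psi>: "fderiv \<psi> x v = k (y - fst x) * (deriv l (h - Hn n r x) * - fderiv (Hn n r) x v)
        - fst v * deriv k (y - fst x) * l (h - Hn n r x)" for x v
      unfolding \<psi> fderiv_mult[OF s1 s2] fderiv_comp[OF sm(2) s0] fderiv_diff[OF smooth_const smooth_Hn] fderiv_const
        smooth_comp_affine(2)[OF sm(1) lin] fderiv_real[OF sm(1)]
      by simp
    have "U x * (c1 x * fderiv \<psi> x (1, 0) + c2 x * fderiv \<psi> x (0, 1)) = - A n x - B n x" for x
    proof (cases "x \<in> K")
      case True
      have "fderiv (Hn n r) x (1, 0) = - c2n n x" "fderiv (Hn n r) x (0, 1) = c1n n x"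
        using Ke[OF True] n by (intro gradient_Hn; simp add: d_def)+
      then show ?thesis by (simp add: f\<psi> A_def B_def algebra_simps)
    qed (simp add: U A_def B_def)
    then have "(LINT x|lborel. U x * (c1 x * fderiv \<psi> x (1, 0) + c2 x * fderiv \<psi> x (0, 1)))
        = - (LINT x|lborel. A n x) - (LINT x|lborel. B n x)"
      using iA[of n] iB[of n] by simp
    with eq[OF s\<psi>] show ?thesis by (simp add: D_def \<psi>_def)
  qed
  have limA: "(\<lambda>n. LINT x|lborel. A (\<sigma> n) x) \<longlonglongrightarrow> (LINT x|lborel. U x * c1 x * (deriv k (y - fst x) * l (h - H r x)))"
  proof (rule integral_dominated_convergence[where w="\<lambda>x. C * c1 x * (Dk * Cl)"])
    show "AE x in lborel. (\<lambda>n. A (\<sigma> n) x) \<longlonglongrightarrow> U x * c1 x * (deriv k (y - fst x) * l (h - H r x))"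
      using H
    proof eventually_elim
      case (elim x)
      show ?case
      proof (cases "x \<in> K")
        case True
        then have "(\<lambda>n. Hn (\<sigma> n) r x) \<longlonglongrightarrow> H r x" using elim K by blast
        then show ?thesis unfolding A_def
          by (intro tendsto_intros isCont_tendsto_compose[OF cont(1)])
      qed (simp add: A_def U)
    qed
    show "AE x in lborel. norm (A (\<sigma> n) x) \<le> C * c1 x * (Dk * Cl)" for n
      unfolding A_def using U(2) Dk Cl C c1_nonneg
      by (auto simp: abs_mult intro!: AE_I2 mult_mono mult_nonneg_nonneg)
  qed (use c1(1) in \<open>auto simp: A_def\<close>)
  have limD: "(\<lambda>n. LINT x|lborel. D (\<sigma> n) x) \<longlonglongrightarrow> (LINT x|lborel. F x * (k (y - fst x) * l (h - H r x)))"
  proof (rule integral_dominated_convergence[where w="\<lambda>x. \<bar>F x\<bar> * (Ck * Cl)"])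
    show "AE x in lborel. (\<lambda>n. D (\<sigma> n) x) \<longlonglongrightarrow> F x * (k (y - fst x) * l (h - H r x))"
      using H
    proof eventually_elim
      case (elim x)
      show ?case
      proof (cases "x \<in> K")
        case True
        then have "(\<lambda>n. Hn (\<sigma> n) r x) \<longlonglongrightarrow> H r x" using elim K by blast
        then show ?thesis unfolding D_def
          by (intro tendsto_intros isCont_tendsto_compose[OF cont(1)])
      qed (simp add: D_def F)
    qed
    show "AE x in lborel. norm (D (\<sigma> n) x) \<le> \<bar>F x\<bar> * (Ck * Cl)" for n
      unfolding D_def using Ck Cl by (auto simp: abs_mult intro!: AE_I2 mult_mono mult_nonneg_nonneg)
  qed (use F(1) in \<open>auto simp: D_def\<close>)
  have limB: "(\<lambda>n. LINT x|lborel. B (\<sigma> n) x) \<longlonglongrightarrow> 0"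
  proof (rule Lim_null_comparison)
    have "norm (LINT x|lborel. B n x) \<le> C * (Ck * Dl) * ((LINT x|lborel. \<bar>c2 x * (c1n n x - c1 x)\<bar>) + (LINT x|lborel. \<bar>c1 x * (c2n n x - c2 x)\<bar>))" for n
    proof -
      have "norm (LINT x|lborel. B n x) \<le> (LINT x|lborel. C * (Ck * Dl) * (\<bar>c2 x * (c1n n x - c1 x)\<bar> + \<bar>c1 x * (c2n n x - c2 x)\<bar>))"
        by (rule Bochner_Integration.integral_norm_bound_integral[OF iB iBb]) (use B_le in auto)
      then show ?thesis using p1(1) p2(1) by simp
    qed
    then show "\<forall>\<^sub>F n in sequentially. norm (LINT x|lborel. B (\<sigma> n) x) \<le>
      C * (Ck * Dl) * ((LINT x|lborel. \<bar>c2 x * (c1n (\<sigma> n) x - c1 x)\<bar>) + (LINT x|lborel. \<bar>c1 x * (c2n (\<sigma> n) x - c2 x)\<bar>))"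
      by simp
    have "(\<lambda>n. C * (Ck * Dl) * ((LINT x|lborel. \<bar>c2 x * (c1n n x - c1 x)\<bar>) + (LINT x|lborel. \<bar>c1 x * (c2n n x - c2 x)\<bar>))) \<longlonglongrightarrow> C * (Ck * Dl) * (0 + 0)"
      by (intro tendsto_mult tendsto_add tendsto_const p1(2) p2(2))
    from LIMSEQ_subseq_LIMSEQ[OF this \<sigma>]
    show "(\<lambda>n. C * (Ck * Dl) * ((LINT x|lborel. \<bar>c2 x * (c1n (\<sigma> n) x - c1 x)\<bar>) + (LINT x|lborel. \<bar>c1 x * (c2n (\<sigma> n) x - c2 x)\<bar>))) \<longlonglongrightarrow> 0"
      by (simp add: o_def)
  qed
  have "(\<lambda>n. (LINT x|lborel. A (\<sigma> n) x) + (LINT x|lborel. B (\<sigma> n) x)) \<longlonglongrightarrow> (LINT x|lborel. F x * (k (y - fst x) * l (h - H r x)))"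
    by (rule Lim_transform_eventually[OF limD])
       (use identity small in \<open>auto simp: eventually_sequentially intro!: exI[of _ N]\<close>)
  moreover have "(\<lambda>n. (LINT x|lborel. A (\<sigma> n) x) + (LINT x|lborel. B (\<sigma> n) x)) \<longlonglongrightarrow>
      (LINT x|lborel. U x * c1 x * (deriv k (y - fst x) * l (h - H r x))) + 0"
    by (rule tendsto_add[OF limA limB])
  ultimately show ?thesis using LIMSEQ_unique by fastforce
qed

section \<open>Change of variables to stream coordinates\<close>

definition "Phi r x = (fst x, H r x)"
text \<open>The density of the image of the measure c1 dx under \<open>Phi r\<close>. Accordingly
  \<open>pull r V\<close> is \<open>V\<close> composed with the inverse of \<open>Phi r\<close>,
  extended by zero outside the image.\<close>

definition "strip r z = (if lo r (fst z) < snd z \<and> snd z < hi r (fst z) then 1 else 0::real)"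
definition "pull r V z = V (fst z, X r z) * strip r z"

lemma Phi_measurable [measurable]:
  "Phi r \<in> borel \<rightarrow>\<^sub>M borel" "strip r \<in> borel_measurable borel"
  unfolding Phi_def strip_def by measurable

text \<open>\<open>Phi r\<close> preserves the first coordinate, so Tonelli reduces the claim to
  almost every vertical line, where \<open>H\<close> is a primitive of \<open>c1\<close> and
  \<open>distr_density_primitive\<close> applies.\<close>

lemma distr_Phi:
  "distr (density lborel (\<lambda>x. ennreal (c1 x))) borel (Phi r) = density lborel (\<lambda>z. ennreal (strip r z))"
proof (rule measure_eqI)
  fix A assume "A \<in> sets (distr (density lborel (\<lambda>x. ennreal (c1 x))) borel (Phi r))"
  then have [measurable]: "A \<in> sets borel" by simp
  have "emeasure (distr (density lborel (\<lambda>x. ennreal (c1 x))) borel (Phi r)) A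
      = (\<integral>\<^sup>+x. ennreal (c1 x) * indicator A (Phi r x) \<partial>lborel)"
    by (subst emeasure_distr, simp, simp, subst emeasure_density) (auto simp: indicator_vimage[symmetric] vimage_def indicator_def intro!: nn_integral_cong)
  also have "\<dots> = (\<integral>\<^sup>+y. \<integral>\<^sup>+s. ennreal (c1 (y, s)) * indicator A (y, H r (y, s)) \<partial>lborel \<partial>lborel)"
    unfolding lborel_prod[symmetric] by (subst lborel.nn_integral_fst[symmetric]) (auto simp: lborel_prod Phi_def)
  also have "\<dots> = (\<integral>\<^sup>+y. \<integral>\<^sup>+g. ennreal (strip r (y, g)) * indicator A (y, g) \<partial>lborel \<partial>lborel)"
  proof (rule nn_integral_cong_AE)
    show "AE y in lborel. (\<integral>\<^sup>+s. ennreal (c1 (y, s)) * indicator A (y, H r (y, s)) \<partial>lborel)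
        = (\<integral>\<^sup>+g. ennreal (strip r (y, g)) * indicator A (y, g) \<partial>lborel)"
      using AE_c1_slice
    proof eventually_elim
      case (elim y)
      have G: "(\<lambda>s. H r (y, s)) = (\<lambda>x. lo r y + (LINT s|lborel. (if s \<le> x then c1 (y, s) else 0)))"
        by (auto simp: H_def S2_Pair)
      have "(\<integral>\<^sup>+s. ennreal (c1 (y, s)) * indicator A (y, H r (y, s)) \<partial>lborel)
          = (\<integral>\<^sup>+s. indicator A (y, H r (y, s)) \<partial>density lborel (\<lambda>s. ennreal (c1 (y, s))))"
        by (subst nn_integral_density) auto
      also have "\<dots> = (\<integral>\<^sup>+g. indicator A (y, g) \<partial>distr (density lborel (\<lambda>s. ennreal (c1 (y, s)))) borel (\<lambda>s. H r (y, s)))"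
        by (subst nn_integral_distr) auto
      also have "\<dots> = (\<integral>\<^sup>+g. indicator A (y, g) \<partial>density lborel (indicator {lo r y<..<lo r y + (LINT s|lborel. c1 (y, s))}))"
        unfolding G by (subst distr_density_primitive[OF elim]) (auto simp: c1_nonneg)
      also have "\<dots> = (\<integral>\<^sup>+g. indicator {lo r y<..<lo r y + (LINT s|lborel. c1 (y, s))} g * indicator A (y, g) \<partial>lborel)"
        by (subst nn_integral_density) auto
      finally show ?case
        by (simp add: strip_def hi_def) (auto simp: indicator_def intro!: nn_integral_cong)
    qed
  qed
  also have "\<dots> = (\<integral>\<^sup>+z. ennreal (strip r z) * indicator A z \<partial>lborel)"
    unfolding lborel_prod[symmetric] by (subst lborel.nn_integral_fst[symmetric]) (auto simp: lborel_prod)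
  also have "\<dots> = emeasure (density lborel (\<lambda>z. ennreal (strip r z))) A"
    by (subst emeasure_density) auto
  finally show "emeasure (distr (density lborel (\<lambda>x. ennreal (c1 x))) borel (Phi r)) A
      = emeasure (density lborel (\<lambda>z. ennreal (strip r z))) A" .
qed simp

text \<open>Strict positivity of \<open>c1\<close> makes \<open>H\<close> strictly increasing on
  almost every vertical line. Within the box the sublevel set at height H(y,t) is then the interval
  from -R to t, whose length t + R is what \<open>X\<close> measures.\<close>

lemma X_Phi: "AE x in lborel. x \<in> Q \<longrightarrow> X r (Phi r x) = snd x"
proof -
  have "AE y in lborel. \<forall>t. (y, t) \<in> Q \<longrightarrow> X r (Phi r (y, t)) = t"
    using AE_c1_slice
  proof eventually_elim
    case (elim y)
    show ?case
    proof (intro allI impI)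
      fix t assume t: "(y, t) \<in> Q"
      have ii: "integrable lborel (\<lambda>s. if s \<le> a then c1 (y, s) else 0)" for a
        by (rule Bochner_Integration.integrable_bound[OF elim]) auto
      have mono: "H r (y, a) \<le> H r (y, b)" if "a \<le> b" for a b
        unfolding H_def S2_Pair fst_conv using that c1_nonneg by (auto intro!: integral_mono ii)
      have strict: "H r (y, t) < H r (y, s)" if s: "t < s" "s < R" for s
      proof -
        have diff: "S2 (y, s) - S2 (y, t) = (LINT u|lborel. (if t < u \<and> u \<le> s then c1 (y, u) else 0))"
        proof -
          have "S2 (y, s) - S2 (y, t) = (LINT u|lborel. (if u \<le> s then c1 (y, u) else 0) - (if u \<le> t then c1 (y, u) else 0))"
            unfolding S2_Pair by (rule Bochner_Integration.integral_diff[OF ii ii, symmetric])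
          also have "\<dots> = (LINT u|lborel. (if t < u \<and> u \<le> s then c1 (y, u) else 0))"
            by (rule Bochner_Integration.integral_cong) (use s in auto)
          finally show ?thesis .
        qed
        have i: "integrable lborel (\<lambda>u. if t < u \<and> u \<le> s then c1 (y, u) else 0)"
          by (rule Bochner_Integration.integrable_bound[OF elim]) auto
        have "(LINT u|lborel. (if t < u \<and> u \<le> s then c1 (y, u) else 0)) \<noteq> 0"
        proof
          assume "(LINT u|lborel. (if t < u \<and> u \<le> s then c1 (y, u) else 0)) = 0"
          then have "AE u in lborel. (if t < u \<and> u \<le> s then c1 (y, u) else 0) = 0"
            using i by (subst (asm) integral_nonneg_eq_0_iff_AE) (auto simp: c1_nonneg)
          then have "AE u in lborel. u \<notin> {t<..<s}"
          proof eventually_elim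
            case (elim u)
            show ?case
            proof
              assume u: "u \<in> {t<..<s}"
              then have "c1 (y, u) > 0" using s t by (intro c1_pos) auto
              then show False using elim u by simp
            qed
          qed
          then have "emeasure lborel {t<..<s} = 0"
            by (subst (asm) AE_iff_measurable[of "{t<..<s}"]) auto
          then show False using s by simp
        qed
        moreover have "0 \<le> (LINT u|lborel. (if t < u \<and> u \<le> s then c1 (y, u) else 0))"
          by (rule Bochner_Integration.integral_nonneg) (auto simp: c1_nonneg)
        ultimately have "S2 (y, t) < S2 (y, s)" using diff by linarith
        then show ?thesis by (simp add: H_def)
      qed
      have "(LINT s|lborel. (if \<bar>s\<bar> < R \<and> H r (y, s) \<le> H r (y, t) then 1 else 0::real)) = (LINT s|lborel. indicator {-R<..t} s)"
      proof (rule Bochner_Integration.integral_cong[OF refl])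
        fix s
        show "(if \<bar>s\<bar> < R \<and> H r (y, s) \<le> H r (y, t) then 1 else 0::real) = indicator {-R<..t} s"
        proof (cases "s \<le> t")
          case True
          then show ?thesis using mono[OF True] t by (auto simp: indicator_def)
        next
          case False
          then show ?thesis using strict[of s] t by (cases "s < R") (auto simp: indicator_def)
        qed
      qed
      also have "\<dots> = t + R" using t by simp
      finally show "X r (Phi r (y, t)) = t" by (simp add: X_def Phi_def)
    qed
  qed
  then have "AE x in lborel. \<forall>t. (fst x, t) \<in> Q \<longrightarrow> X r (Phi r (fst x, t)) = t"
    by (rule AE_lborel_fst)
  then show ?thesis by eventually_elim (metis prod.collapse snd_conv)
qed

text \<open>Image measure formula for \<open>distr_Phi\<close>. The identity
  \<open>X r (Phi r x) = snd x\<close> is known only almost everywhere in the box, which suffices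
  because the factor \<open>c1\<close> vanishes outside.\<close>

lemma pull_integral:
  assumes [measurable]: "V \<in> borel_measurable borel" "w \<in> borel_measurable borel"
    and i: "integrable lborel (\<lambda>x. V x * c1 x * w (Phi r x))"
  shows "integrable lborel (\<lambda>z. pull r V z * w z)"
    and "(LINT z|lborel. pull r V z * w z) = (LINT x|lborel. V x * c1 x * w (Phi r x))"
proof -
  define q where "q z = V (fst z, X r z) * w z" for z
  have [measurable]: "q \<in> borel_measurable borel" unfolding q_def by measurable
  have ae: "AE x in lborel. c1 x * q (Phi r x) = V x * c1 x * w (Phi r x)"
    using X_Phi[of r]
  proof eventually_elim
    case (elim x)
    then show ?case using c_zero(1)[of x] by (cases "x \<in> Q") (auto simp: q_def Phi_def)
  qed
  have "integrable lborel (\<lambda>x. c1 x * q (Phi r x))"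
    using i by (rule integrable_cong_AE_imp) (use ae in auto)
  then have "integrable (density lborel (\<lambda>x. ennreal (c1 x))) (\<lambda>x. q (Phi r x))"
    by (subst integrable_density) (auto simp: c1_nonneg)
  then have "integrable (distr (density lborel (\<lambda>x. ennreal (c1 x))) borel (Phi r)) q"
    by (subst integrable_distr_eq) auto
  then have "integrable lborel (\<lambda>z. strip r z * q z)"
    unfolding distr_Phi by (subst (asm) integrable_density) (auto simp: strip_def)
  then show "integrable lborel (\<lambda>z. pull r V z * w z)" by (simp add: pull_def q_def mult_ac)
  have "(LINT z|lborel. pull r V z * w z) = (LINT z|lborel. strip r z * q z)" by (simp add: pull_def q_def mult_ac)
  also have "\<dots> = (LINT z|density lborel (\<lambda>z. ennreal (strip r z)). q z)"
    by (subst integral_density) (auto simp: strip_def)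
  also have "\<dots> = (LINT x|lborel. c1 x * q (Phi r x))"
    unfolding distr_Phi[symmetric] by (subst integral_distr, simp, simp, subst integral_density) (auto simp: c1_nonneg)
  also have "\<dots> = (LINT x|lborel. V x * c1 x * w (Phi r x))"
    by (rule integral_cong_AE) (use ae in auto)
  finally show "(LINT z|lborel. pull r V z * w z) = (LINT x|lborel. V x * c1 x * w (Phi r x))" .
qed

end

subsection \<open>The product rule in stream coordinates\<close>

text \<open>Telescoping changes one factor at a time. Changing the integrable factor costs C^2 times
  its L1 error; changing a bounded one leaves the weight \<open>g\<close>, and
  \<open>L1_weighted_tendsto\<close> applies.\<close>

lemma L1_triple_product_tendsto:
  fixes G E E' :: "nat \<Rightarrow> 'a \<Rightarrow> real"
  assumes G: "\<And>n. integrable M (G n)" "integrable M g" "(\<lambda>n. LINT x|M. \<bar>G n x - g x\<bar>) \<longlonglongrightarrow> 0"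
    and E: "\<And>n. integrable M (E n)" "integrable M e" "(\<lambda>n. LINT x|M. \<bar>E n x - e x\<bar>) \<longlonglongrightarrow> 0"
      "\<And>n x. \<bar>E n x\<bar> \<le> C" "\<And>x. \<bar>e x\<bar> \<le> C"
    and E': "\<And>n. integrable M (E' n)" "integrable M e'" "(\<lambda>n. LINT x|M. \<bar>E' n x - e' x\<bar>) \<longlonglongrightarrow> 0"
      "\<And>n x. \<bar>E' n x\<bar> \<le> C" "\<And>x. \<bar>e' x\<bar> \<le> C"
  shows "integrable M (\<lambda>x. G n x * E n x * E' n x)" "integrable M (\<lambda>x. g x * e x * e' x)"
    and "(\<lambda>n. LINT x|M. G n x * E n x * E' n x) \<longlonglongrightarrow> (LINT x|M. g x * e x * e' x)"
proof -
  have [measurable]: "G n \<in> borel_measurable M" "E n \<in> borel_measurable M" "E' n \<in> borel_measurable M"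
    "g \<in> borel_measurable M" "e \<in> borel_measurable M" "e' \<in> borel_measurable M" for n
    using G E E' by auto
  have C: "C \<ge> 0" using E(5)[of undefined] by simp
  have int: "integrable M (\<lambda>x. p x * q x * q' x)"
    if "integrable M p" "q \<in> borel_measurable M" "q' \<in> borel_measurable M" "\<And>x. \<bar>q x\<bar> \<le> C" "\<And>x. \<bar>q' x\<bar> \<le> C"
    for p q q' :: "'a \<Rightarrow> real"
  proof -
    have "integrable M (\<lambda>x. q x * p x)" by (rule integrable_bounded_mult[OF that(1,2,4)])
    then have "integrable M (\<lambda>x. q' x * (q x * p x))" by (rule integrable_bounded_mult[OF _ that(3,5)])
    then show ?thesis by (simp add: mult_ac)
  qed
  show i1: "integrable M (\<lambda>x. G n x * E n x * E' n x)" for n by (rule int) (use G E E' in auto)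
  show i2: "integrable M (\<lambda>x. g x * e x * e' x)" by (rule int) (use G E E' in auto)
  have bd: "\<bar>E n x - e x\<bar> \<le> 2 * C" "\<bar>E' n x - e' x\<bar> \<le> 2 * C" for n x
    using E(4)[of n x] E(5)[of x] E'(4)[of n x] E'(5)[of x] by linarith+
  have w: "(\<lambda>n. LINT x|M. \<bar>g x\<bar> * \<bar>E n x - e x\<bar>) \<longlonglongrightarrow> 0"
    by (rule L1_weighted_tendsto[where C="2 * C"])
       (use G E bd in auto)
  have w': "(\<lambda>n. LINT x|M. \<bar>g x\<bar> * \<bar>E' n x - e' x\<bar>) \<longlonglongrightarrow> 0"
    by (rule L1_weighted_tendsto[where C="2 * C"])
       (use G E' bd in auto)
  have iw: "integrable M (\<lambda>x. \<bar>g x\<bar> * \<bar>E n x - e x\<bar>)" "integrable M (\<lambda>x. \<bar>g x\<bar> * \<bar>E' n x - e' x\<bar>)" for n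
  proof -
    show "integrable M (\<lambda>x. \<bar>g x\<bar> * \<bar>E n x - e x\<bar>)" "integrable M (\<lambda>x. \<bar>g x\<bar> * \<bar>E' n x - e' x\<bar>)"
      using integrable_bounded_mult[OF integrable_abs[OF G(2)], of "\<lambda>x. \<bar>E n x - e x\<bar>" "2 * C"] bd
        integrable_bounded_mult[OF integrable_abs[OF G(2)], of "\<lambda>x. \<bar>E' n x - e' x\<bar>" "2 * C"]
      by (simp_all add: mult.commute)
  qed
  show "(\<lambda>n. LINT x|M. G n x * E n x * E' n x) \<longlonglongrightarrow> (LINT x|M. g x * e x * e' x)"
  proof (rule LIM_zero_cancel, rule Lim_null_comparison)
    have le: "\<bar>G n x * E n x * E' n x - g x * e x * e' x\<bar> \<le>
        C * C * \<bar>G n x - g x\<bar> + C * (\<bar>g x\<bar> * \<bar>E n x - e x\<bar>) + C * (\<bar>g x\<bar> * \<bar>E' n x - e' x\<bar>)" for n x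
    proof -
      have eq: "G n x * E n x * E' n x - g x * e x * e' x =
          E n x * E' n x * (G n x - g x) + E' n x * (g x * (E n x - e x)) + e x * (g x * (E' n x - e' x))"
        by algebra
      have "\<bar>G n x * E n x * E' n x - g x * e x * e' x\<bar> \<le> \<bar>E n x * E' n x * (G n x - g x)\<bar> + \<bar>E' n x * (g x * (E n x - e x))\<bar> + \<bar>e x * (g x * (E' n x - e' x))\<bar>"
        unfolding eq by (rule order_trans[OF abs_triangle_ineq add_right_mono[OF abs_triangle_ineq]])
      also have "\<dots> \<le> C * C * \<bar>G n x - g x\<bar> + C * (\<bar>g x\<bar> * \<bar>E n x - e x\<bar>) + C * (\<bar>g x\<bar> * \<bar>E' n x - e' x\<bar>)"
      proof (intro add_mono)
        have "\<bar>E n x\<bar> * \<bar>E' n x\<bar> \<le> C * C" by (rule mult_mono[OF E(4) E'(4) C]) simp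
        then show "\<bar>E n x * E' n x * (G n x - g x)\<bar> \<le> C * C * \<bar>G n x - g x\<bar>"
          unfolding abs_mult by (rule mult_right_mono) simp
        show "\<bar>E' n x * (g x * (E n x - e x))\<bar> \<le> C * (\<bar>g x\<bar> * \<bar>E n x - e x\<bar>)"
          unfolding abs_mult by (rule mult_right_mono[OF E'(4)]) simp
        show "\<bar>e x * (g x * (E' n x - e' x))\<bar> \<le> C * (\<bar>g x\<bar> * \<bar>E' n x - e' x\<bar>)"
          unfolding abs_mult by (rule mult_right_mono[OF E(5)]) simp
      qed
      finally show ?thesis .
    qed
    have "norm ((LINT x|M. G n x * E n x * E' n x) - (LINT x|M. g x * e x * e' x)) \<le>
        C * C * (LINT x|M. \<bar>G n x - g x\<bar>) + C * (LINT x|M. \<bar>g x\<bar> * \<bar>E n x - e x\<bar>) + C * (LINT x|M. \<bar>g x\<bar> * \<bar>E' n x - e' x\<bar>)" for n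
    proof -
      have eq: "(LINT x|M. G n x * E n x * E' n x) - (LINT x|M. g x * e x * e' x)
          = (LINT x|M. G n x * E n x * E' n x - g x * e x * e' x)"
        by (rule Bochner_Integration.integral_diff[symmetric]) (rule i1 i2)+
      have "norm ((LINT x|M. G n x * E n x * E' n x) - (LINT x|M. g x * e x * e' x)) \<le> (LINT x|M. C * C * \<bar>G n x - g x\<bar> + C * (\<bar>g x\<bar> * \<bar>E n x - e x\<bar>) + C * (\<bar>g x\<bar> * \<bar>E' n x - e' x\<bar>))"
        unfolding eq
      proof (rule order_trans[OF integral_norm_bound integral_mono])
        show "integrable M (\<lambda>x. norm (G n x * E n x * E' n x - g x * e x * e' x))"
          by (rule integrable_norm[OF Bochner_Integration.integrable_diff[OF i1 i2]])
        show "integrable M (\<lambda>x. C * C * \<bar>G n x - g x\<bar> + C * (\<bar>g x\<bar> * \<bar>E n x - e x\<bar>) + C * (\<bar>g x\<bar> * \<bar>E' n x - e' x\<bar>))"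
          by (rule Bochner_Integration.integrable_add[OF Bochner_Integration.integrable_add[OF
                integrable_mult_right integrable_mult_right[OF iw(1)]] integrable_mult_right[OF iw(2)]])
             (use G in simp)
      qed (unfold real_norm_def, rule le)
      also have "\<dots> = C * C * (LINT x|M. \<bar>G n x - g x\<bar>) + C * (LINT x|M. \<bar>g x\<bar> * \<bar>E n x - e x\<bar>) + C * (LINT x|M. \<bar>g x\<bar> * \<bar>E' n x - e' x\<bar>)"
      proof -
        have iG: "integrable M (\<lambda>x. \<bar>G n x - g x\<bar>)" using G by simp
        note i = integrable_mult_right[OF iG, of "C * C"] integrable_mult_right[OF iw(1)[of n], of C]
          integrable_mult_right[OF iw(2)[of n], of C]
        show ?thesis
          unfolding Bochner_Integration.integral_add[OF Bochner_Integration.integrable_add[OF i(1,2)] i(3)]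
            Bochner_Integration.integral_add[OF i(1,2)] by simp
      qed
      finally show ?thesis .
    qed
    then show "\<forall>\<^sub>F n in sequentially. norm ((LINT x|M. G n x * E n x * E' n x) - (LINT x|M. g x * e x * e' x)) \<le>
        C * C * (LINT x|M. \<bar>G n x - g x\<bar>) + C * (LINT x|M. \<bar>g x\<bar> * \<bar>E n x - e x\<bar>) + C * (LINT x|M. \<bar>g x\<bar> * \<bar>E' n x - e' x\<bar>)"
      by simp
    have "(\<lambda>n. C * C * (LINT x|M. \<bar>G n x - g x\<bar>) + C * (LINT x|M. \<bar>g x\<bar> * \<bar>E n x - e x\<bar>) + C * (LINT x|M. \<bar>g x\<bar> * \<bar>E' n x - e' x\<bar>))
        \<longlonglongrightarrow> C * C * 0 + C * 0 + C * 0"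
      by (intro tendsto_add tendsto_mult tendsto_const G w w')
    then show "(\<lambda>n. C * C * (LINT x|M. \<bar>G n x - g x\<bar>) + C * (LINT x|M. \<bar>g x\<bar> * \<bar>E n x - e x\<bar>) + C * (LINT x|M. \<bar>g x\<bar> * \<bar>E' n x - e' x\<bar>)) \<longlonglongrightarrow> 0"
      by simp
  qed
qed

context flux_box
begin

definition flux_pair :: "(real \<times> real) set \<Rightarrow> (real \<times> real \<Rightarrow> real) \<Rightarrow> (real \<times> real \<Rightarrow> real) \<Rightarrow> bool" where
  "flux_pair K U F \<longleftrightarrow> U \<in> borel_measurable borel \<and> (\<exists>C. \<forall>x. \<bar>U x\<bar> \<le> C) \<and> (\<forall>x. x \<notin> K \<longrightarrow> U x = 0) \<and>
     integrable lborel F \<and> (\<forall>x. x \<notin> K \<longrightarrow> F x = 0) \<and>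
     (\<forall>\<psi>. smooth \<psi> \<longrightarrow> (LINT x|lborel. U x * (c1 x * fderiv \<psi> x (1, 0) + c2 x * fderiv \<psi> x (0, 1))) = - (LINT x|lborel. F x * \<psi> x))"

text \<open>In stream coordinates the equation reads that the x1-derivative of
  \<open>pull r U\<close> is \<open>f\<close>. The density F / c1 is legitimate as c1 > 0 on
  \<open>K\<close>, and it is integrated against c1 dx. The last claim is
  \<open>streamline_identity\<close> with the convolution kernel as test function.\<close>

lemma pull_flux_pair:
  fixes r :: real
  assumes UF: "flux_pair K U F" and K: "compact K" "K \<subseteq> Q"
  defines "f \<equiv> pull r (\<lambda>x. F x / c1 x)"
  shows "integrable lborel (pull r U)" "integrable lborel f" "\<exists>C. \<forall>z. \<bar>pull r U z\<bar> \<le> C"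
    "\<bar>fst z\<bar> \<ge> R \<Longrightarrow> pull r U z = 0"
    "\<bar>r\<bar> < R \<Longrightarrow> strict_mono \<sigma> \<Longrightarrow> AE x in lborel. x \<in> Q \<longrightarrow> (\<lambda>n. Hn (\<sigma> n) r x) \<longlonglongrightarrow> H r x \<Longrightarrow> k \<in> tests UNIV \<Longrightarrow>
      fderiv (conv (\<lambda>z. k (fst z) * k (snd z)) (pull r U)) z (1, 0) = conv (\<lambda>z. k (fst z) * k (snd z)) f z"
proof -
  obtain C where C: "\<forall>x. \<bar>U x\<bar> \<le> C" using UF unfolding flux_pair_def by blast
  have U: "U \<in> borel_measurable borel" "\<And>x. \<bar>U x\<bar> \<le> C" "\<And>x. x \<notin> K \<Longrightarrow> U x = 0"
    and F: "integrable lborel F" "\<And>x. x \<notin> K \<Longrightarrow> F x = 0"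
    and eq: "\<And>\<psi>. smooth \<psi> \<Longrightarrow>
      (LINT x|lborel. U x * (c1 x * fderiv \<psi> x (1, 0) + c2 x * fderiv \<psi> x (0, 1))) = - (LINT x|lborel. F x * \<psi> x)"
    using UF C unfolding flux_pair_def by blast+
  have [measurable]: "U \<in> borel_measurable borel" "F \<in> borel_measurable borel" using U F by auto
  have Fc: "F x / c1 x * c1 x = F x" for x
  proof (cases "x \<in> K")
    case True
    then have "c1 x > 0" using K by (intro c1_pos) auto
    then show ?thesis by simp
  qed (simp add: F)
  have iU: "integrable lborel (\<lambda>x. U x * c1 x)" by (rule integrable_bounded_mult[OF c1(1) _ U(2)]) simp
  show iu: "integrable lborel (pull r U)"
    using pull_integral(1)[of U "\<lambda>_. 1" r] iU by simp
  show if': "integrable lborel f"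
    unfolding f_def using pull_integral(1)[of "\<lambda>x. F x / c1 x" "\<lambda>_. 1" r] F(1) unfolding Fc by simp
  have "0 \<le> C" using U(2)[of undefined] by simp
  then have "\<bar>pull r U z\<bar> \<le> C" for z
    using U(2)[of "(fst z, X r z)"] by (auto simp: pull_def strip_def)
  then show "\<exists>C. \<forall>z. \<bar>pull r U z\<bar> \<le> C" by blast
  show "pull r U z = 0" if "\<bar>fst z\<bar> \<ge> R"
  proof -
    have "(fst z, X r z) \<notin> Q" using that by auto
    then have "(fst z, X r z) \<notin> K" using K by blast
    then show ?thesis by (simp add: pull_def U)
  qed
  assume r: "\<bar>r\<bar> < R" "strict_mono \<sigma>" "AE x in lborel. x \<in> Q \<longrightarrow> (\<lambda>n. Hn (\<sigma> n) r x) \<longlonglongrightarrow> H r x"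
    and k: "k \<in> tests UNIV"
  have sm: "smooth k" using k by (rule testsD)
  have [measurable]: "k \<in> borel_measurable borel" "deriv k \<in> borel_measurable borel"
    by (intro smooth_borel_measurable sm smooth_deriv)+
  obtain Ck where Ck: "Ck > 0" "\<And>x. \<bar>k x\<bar> \<le> Ck" using tests_bounded[OF k] by metis
  obtain Dk where Dk: "Dk > 0" "\<And>x. \<bar>deriv k x\<bar> \<le> Dk" using tests_bounded[OF deriv_tests[OF k]] by metis
  have b1: "\<bar>deriv k a * k b\<bar> \<le> Dk * Ck" for a b unfolding abs_mult by (intro mult_mono Ck Dk) (use Dk(1) in auto)
  have b2: "\<bar>k a * k b\<bar> \<le> Ck * Ck" for a b unfolding abs_mult by (intro mult_mono Ck) (use Ck(1) in auto)
  have "fderiv (conv (\<lambda>z. k (fst z) * k (snd z)) (pull r U)) z (1, 0)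
      = (LINT z'|lborel. pull r U z' * (deriv k (fst z - fst z') * k (snd z - snd z')))"
    unfolding fderiv_conv[OF tests_tensor(1)[OF k k] iu] tests_tensor(2)[OF k k] by (simp add: conv_def mult.commute)
  also have "\<dots> = (LINT x|lborel. U x * c1 x * (deriv k (fst z - fst x) * k (snd z - H r x)))"
  proof (subst pull_integral(2))
    show "integrable lborel (\<lambda>x. U x * c1 x * (deriv k (fst z - fst (Phi r x)) * k (snd z - snd (Phi r x))))"
      using integrable_bounded_mult[OF iU, of "\<lambda>x. deriv k (fst z - fst (Phi r x)) * k (snd z - snd (Phi r x))" "Dk * Ck"] b1
      by (simp add: mult.commute)
  qed (auto simp: Phi_def)
  also have "\<dots> = (LINT x|lborel. F x * (k (fst z - fst x) * k (snd z - H r x)))"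
    by (rule streamline_identity[OF r K U F eq k k])
  also have "\<dots> = (LINT x|lborel. F x / c1 x * c1 x * (k (fst z - fst (Phi r x)) * k (snd z - snd (Phi r x))))"
    unfolding Fc by (simp add: Phi_def)
  also have "\<dots> = (LINT z'|lborel. f z' * (k (fst z - fst z') * k (snd z - snd z')))"
    unfolding f_def
  proof (subst pull_integral(2))
    show "integrable lborel (\<lambda>x. F x / c1 x * c1 x * (k (fst z - fst (Phi r x)) * k (snd z - snd (Phi r x))))"
      using integrable_bounded_mult[OF F(1), of "\<lambda>x. k (fst z - fst (Phi r x)) * k (snd z - snd (Phi r x))" "Ck * Ck"] b2
      unfolding Fc by (simp add: mult.commute)
  qed auto
  also have "\<dots> = conv (\<lambda>z. k (fst z) * k (snd z)) f z" by (simp add: conv_def mult.commute)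
  finally show "fderiv (conv (\<lambda>z. k (fst z) * k (snd z)) (pull r U)) z (1, 0) = conv (\<lambda>z. k (fst z) * k (snd z)) f z" .
qed

text \<open>In the coordinates \<open>(x\<^sub>1, H)\<close> the equations become \<open>\<partial>\<^sub>1 u\<^sub>i = f\<^sub>i\<close>, which mollification preserves;
  the product rule is then classical.\<close>

theorem flux_triple_product:
  assumes K: "compact K" "K \<subseteq> Q"
    and p: "flux_pair K U1 F1" "flux_pair K U2 F2" "flux_pair K U3 F3"
  shows "(LINT x|lborel. F1 x * U2 x * U3 x + F2 x * U1 x * U3 x + F3 x * U1 x * U2 x) = 0"
proof -
  obtain r \<sigma> where r: "\<bar>r\<bar> < R" "strict_mono \<sigma>" "AE x in lborel. x \<in> Q \<longrightarrow> (\<lambda>n. Hn (\<sigma> n) r x) \<longlonglongrightarrow> H r x"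
    by (rule good_height)
  \<comment> \<open>Half the width in each variable keeps the tensor product inside the ball of
    radius 1 / (n + 1).\<close>
  define k where "k n = mollifier (0::real) (1 / (2 * Suc n))" for n
  have k: "k n \<in> tests UNIV" for n unfolding k_def by (rule tests_mono[OF mollifier_tests]) auto
  define \<kappa> where "\<kappa> = (\<lambda>n z. k n (fst z) * k n (snd z))"
  have \<kappa>: "approx_identity \<kappa>"
    unfolding \<kappa>_def
    by (rule approx_identity_tensor[OF k]) (auto simp: k_def mollifier_nonneg mollifier_integral mollifier_support)
  note \<kappa>t = approx_identity_tests[OF \<kappa>]
  define u where "u = pull r"
  define f where "f F = pull r (\<lambda>x. F x / c1 x)" for F
  define E where "E n V = conv (\<kappa> n) (u V)" for n V
  define G where "G n F = conv (\<kappa> n) (f F)" for n F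
  have Umeas [measurable]: "U1 \<in> borel_measurable borel" "U2 \<in> borel_measurable borel" "U3 \<in> borel_measurable borel"
    "F1 \<in> borel_measurable borel" "F2 \<in> borel_measurable borel" "F3 \<in> borel_measurable borel"
    using p unfolding flux_pair_def by auto
  have facts: "integrable lborel (u U)" "integrable lborel (f F)" "\<exists>C. \<forall>z. \<bar>u U z\<bar> \<le> C"
    "smooth (E n U)" "integrable lborel (E n U)" "integrable lborel (G n F)"
    "(\<lambda>n. LINT z|lborel. \<bar>E n U z - u U z\<bar>) \<longlonglongrightarrow> 0" "(\<lambda>n. LINT z|lborel. \<bar>G n F z - f F z\<bar>) \<longlonglongrightarrow> 0"
    "fderiv (E n U) z (1, 0) = G n F z" "\<bar>fst z\<bar> \<ge> R + 1 \<Longrightarrow> E n U z = 0"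
    if "flux_pair K U F" for U F n z
  proof -
    note q = pull_flux_pair[OF that K, where r=r]
    show iu: "integrable lborel (u U)" and if': "integrable lborel (f F)" and "\<exists>C. \<forall>z. \<bar>u U z\<bar> \<le> C"
      unfolding u_def f_def by (rule q)+
    show "smooth (E n U)" unfolding E_def by (rule smooth_conv[OF \<kappa>t iu])
    show "integrable lborel (E n U)" unfolding E_def by (rule integrable_conv[OF \<kappa> iu])
    show "integrable lborel (G n F)" unfolding G_def by (rule integrable_conv[OF \<kappa> if'])
    show "(\<lambda>n. LINT z|lborel. \<bar>E n U z - u U z\<bar>) \<longlonglongrightarrow> 0" unfolding E_def by (rule conv_tendsto_L1[OF \<kappa> iu])
    show "(\<lambda>n. LINT z|lborel. \<bar>G n F z - f F z\<bar>) \<longlonglongrightarrow> 0" unfolding G_def by (rule conv_tendsto_L1[OF \<kappa> if'])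
    show "fderiv (E n U) z (1, 0) = G n F z"
      unfolding E_def G_def u_def f_def \<kappa>_def by (rule q(5)[OF r k])
    show "E n U z = 0" if z: "\<bar>fst z\<bar> \<ge> R + 1"
      unfolding E_def
    proof (rule conv_vanish[OF approx_identity_support[OF \<kappa>]])
      fix y assume y: "dist z y < 1 / real (Suc n)"
      have "1 / real (Suc n) \<le> 1" by simp
      then have "\<bar>fst z - fst y\<bar> < 1" using dist_fst_le[of z y] y unfolding dist_real_def by linarith
      then show "u U y = 0" unfolding u_def using z by (intro q(4)) linarith
    qed
  qed
  obtain C1 C2 C3 where C': "\<And>z. \<bar>u U1 z\<bar> \<le> C1" "\<And>z. \<bar>u U2 z\<bar> \<le> C2" "\<And>z. \<bar>u U3 z\<bar> \<le> C3"
    using facts(3)[OF p(1)] facts(3)[OF p(2)] facts(3)[OF p(3)] by metis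
  define C where "C = max C1 (max C2 C3)"
  have C: "\<bar>u U1 z\<bar> \<le> C" "\<bar>u U2 z\<bar> \<le> C" "\<bar>u U3 z\<bar> \<le> C" for z
    using C'(1)[of z] C'(2)[of z] C'(3)[of z] by (auto simp: C_def)
  have EC: "\<bar>E n U1 z\<bar> \<le> C" "\<bar>E n U2 z\<bar> \<le> C" "\<bar>E n U3 z\<bar> \<le> C" for n z
    unfolding E_def by (rule conv_abs_le[OF \<kappa> facts(1)[OF p(1)] C(1)] conv_abs_le[OF \<kappa> facts(1)[OF p(2)] C(2)]
        conv_abs_le[OF \<kappa> facts(1)[OF p(3)] C(3)])+
  note t1 = L1_triple_product_tendsto[OF facts(6)[OF p(1)] facts(2)[OF p(1)] facts(8)[OF p(1)]
      facts(5)[OF p(2)] facts(1)[OF p(2)] facts(7)[OF p(2)] EC(2) C(2)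
      facts(5)[OF p(3)] facts(1)[OF p(3)] facts(7)[OF p(3)] EC(3) C(3)]
  note t2 = L1_triple_product_tendsto[OF facts(6)[OF p(2)] facts(2)[OF p(2)] facts(8)[OF p(2)]
      facts(5)[OF p(1)] facts(1)[OF p(1)] facts(7)[OF p(1)] EC(1) C(1)
      facts(5)[OF p(3)] facts(1)[OF p(3)] facts(7)[OF p(3)] EC(3) C(3)]
  note t3 = L1_triple_product_tendsto[OF facts(6)[OF p(3)] facts(2)[OF p(3)] facts(8)[OF p(3)]
      facts(5)[OF p(1)] facts(1)[OF p(1)] facts(7)[OF p(1)] EC(1) C(1)
      facts(5)[OF p(2)] facts(1)[OF p(2)] facts(7)[OF p(2)] EC(2) C(2)]
  \<comment> \<open>For the mollified functions the product rule is classical: the sum of the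
    integrands is the x1-derivative of a product that vanishes for large first coordinate.\<close>
  have zero: "(LINT z|lborel. G n F1 z * E n U2 z * E n U3 z) + (LINT z|lborel. G n F2 z * E n U1 z * E n U3 z)
      + (LINT z|lborel. G n F3 z * E n U1 z * E n U2 z) = 0" for n
  proof -
    define P where "P z = E n U1 z * (E n U2 z * E n U3 z)" for z
    have s: "smooth (E n U1)" "smooth (E n U2)" "smooth (E n U3)" using facts(4) p by auto
    have s23: "smooth (\<lambda>z. E n U2 z * E n U3 z)" by (rule smooth_mult[OF s(2,3)])
    have sP: "smooth P" unfolding P_def by (rule smooth_mult[OF s(1) s23])
    have dP: "fderiv P z (1, 0) = G n F1 z * E n U2 z * E n U3 z + G n F2 z * E n U1 z * E n U3 z + G n F3 z * E n U1 z * E n U2 z" for z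
      unfolding P_def fderiv_mult[OF s(1) s23] fderiv_mult[OF s(2,3)] facts(9)[OF p(1)] facts(9)[OF p(2)] facts(9)[OF p(3)]
      by (simp add: algebra_simps)
    have "(LINT z|lborel. fderiv P z (1, 0)) = 0"
    proof (rule integral_fderiv_eq_0[OF sP])
      show "P z = 0" if "\<bar>fst z\<bar> \<ge> R + 1" for z using facts(10)[OF p(1) that] by (simp add: P_def)
      show "integrable lborel (\<lambda>z. fderiv P z (1, 0))" unfolding dP using t1(1) t2(1) t3(1) by auto
    qed
    then show ?thesis unfolding dP using t1(1)[of n] t2(1)[of n] t3(1)[of n] by simp
  qed
  have "(\<lambda>n. (LINT z|lborel. G n F1 z * E n U2 z * E n U3 z) + (LINT z|lborel. G n F2 z * E n U1 z * E n U3 z)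
      + (LINT z|lborel. G n F3 z * E n U1 z * E n U2 z))
     \<longlonglongrightarrow> (LINT z|lborel. f F1 z * u U2 z * u U3 z) + (LINT z|lborel. f F2 z * u U1 z * u U3 z) + (LINT z|lborel. f F3 z * u U1 z * u U2 z)"
    by (intro tendsto_add t1(3) t2(3) t3(3))
  then have lim0: "(LINT z|lborel. f F1 z * u U2 z * u U3 z) + (LINT z|lborel. f F2 z * u U1 z * u U3 z) + (LINT z|lborel. f F3 z * u U1 z * u U2 z) = 0"
    unfolding zero by (simp add: LIMSEQ_const_iff)
  \<comment> \<open>Return to the original coordinates: a product of pulled back functions is the
    pull-back of the product, since \<open>strip\<close> takes only the values 0 and 1; the factor
    \<open>c1\<close> then cancels the division on \<open>K\<close>.\<close>
  have pulled: "integrable lborel (\<lambda>x. F x * U x * U' x)" "(LINT z|lborel. f F z * u U z * u U' z) = (LINT x|lborel. F x * U x * U' x)"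
    if FV: "flux_pair K V F" and UG: "flux_pair K U G" and UG': "flux_pair K U' G'" for F V U G U' G'
  proof -
    have [measurable]: "U \<in> borel_measurable borel" "U' \<in> borel_measurable borel" "F \<in> borel_measurable borel"
      and iF: "integrable lborel F" and F0: "\<And>x. x \<notin> K \<Longrightarrow> F x = 0"
      using FV UG UG' unfolding flux_pair_def by auto
    obtain A B where AB: "\<And>x. \<bar>U x\<bar> \<le> A" "\<And>x. \<bar>U' x\<bar> \<le> B" using UG UG' unfolding flux_pair_def by metis
    have Fc: "F x / c1 x * U x * U' x * c1 x = F x * U x * U' x" for x
    proof (cases "x \<in> K")
      case True
      then have "c1 x > 0" using K by (intro c1_pos) auto
      then show ?thesis by simp
    qed (simp add: F0)
    have "integrable lborel (\<lambda>x. U' x * (U x * F x))"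
      by (intro integrable_bounded_mult[OF _ _ AB(2)] integrable_bounded_mult[OF iF _ AB(1)]) auto
    then show i: "integrable lborel (\<lambda>x. F x * U x * U' x)" by (simp add: mult_ac)
    have "f F z * u U z * u U' z = pull r (\<lambda>x. F x / c1 x * U x * U' x) z * 1" for z
      by (simp add: f_def u_def pull_def strip_def)
    then have "(LINT z|lborel. f F z * u U z * u U' z) = (LINT z|lborel. pull r (\<lambda>x. F x / c1 x * U x * U' x) z * 1)" by simp
    also have "\<dots> = (LINT x|lborel. F x / c1 x * U x * U' x * c1 x * 1)"
      by (rule pull_integral(2)) (measurable, use i in \<open>simp only: Fc mult_1_right\<close>)
    finally show "(LINT z|lborel. f F z * u U z * u U' z) = (LINT x|lborel. F x * U x * U' x)" by (simp only: Fc mult_1_right)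
  qed
  show ?thesis
    using lim0 pulled(1)[OF p(1) p(2) p(3)] pulled(1)[OF p(2) p(1) p(3)] pulled(1)[OF p(3) p(1) p(2)]
    unfolding pulled(2)[OF p(1) p(2) p(3)] pulled(2)[OF p(2) p(1) p(3)] pulled(2)[OF p(3) p(1) p(2)] by simp
qed

end

subsection \<open>The product rule for divergences\<close>

lemma UNIV_2_cases:
  fixes i j :: 2
  assumes "i \<noteq> j"
  shows "UNIV = {i, j}" and "(\<forall>k. Q k) \<longleftrightarrow> Q i \<and> Q j"
proof -
  have k: "k = i \<or> k = j" for k
    using exhaust_2[of i] exhaust_2[of j] exhaust_2[of k] assms by auto
  then show "UNIV = {i, j}" by blast
  show "(\<forall>k. Q k) \<longleftrightarrow> Q i \<and> Q j" using k by metis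
qed

lemma linear_borel_measurable:
  fixes T :: "'a::euclidean_space \<Rightarrow> 'b::euclidean_space"
  shows "linear T \<Longrightarrow> T \<in> borel \<rightarrow>\<^sub>M borel"
  by (intro borel_measurable_continuous_onI linear_continuous_on) (simp add: linear_linear)

text \<open>The Lebesgue measures of \<open>real \<times> real\<close> and \<open>real ^ 2\<close>
  are identified by comparing boxes. The order of the two coordinates is left free, since the
  nonzero component of the direction may be either of them.\<close>

lemma distr_plane_coordinates:
  fixes i j :: 2
  assumes "i \<noteq> j"
  shows "distr lborel borel (\<lambda>p. (\<chi> k. if k = i then fst p else snd p) :: real ^ 2) = lborel"
proof (rule lborel_eqI[symmetric])
  let ?P = "\<lambda>p::real \<times> real. (\<chi> k. if k = i then fst p else snd p) :: real ^ 2"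
  have [measurable]: "?P \<in> borel \<rightarrow>\<^sub>M borel"
    by (rule linear_borel_measurable) (auto simp: linear_iff vec_eq_iff)
  fix l u :: "real ^ 2" assume le: "\<And>b. b \<in> Basis \<Longrightarrow> l \<bullet> b \<le> u \<bullet> b"
  have le': "l $ k \<le> u $ k" for k using le[of "axis k 1"] by (simp add: inner_axis)
  have "?P -` box l u = box (l $ i, l $ j) (u $ i, u $ j)"
    using assms by (auto simp: mem_box_cart UNIV_2_cases(2)[OF assms] mem_box Basis_prod_def)
  then have "emeasure (distr lborel borel ?P) (box l u) = emeasure lborel (box (l $ i, l $ j) (u $ i, u $ j))"
    by (simp add: emeasure_distr)
  also have "\<dots> = ennreal ((u $ i - l $ i) * (u $ j - l $ j))"
    using le' by (subst emeasure_lborel_box) (auto simp: Basis_prod_def)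
  also have "(u $ i - l $ i) * (u $ j - l $ j) = (\<Prod>k\<in>UNIV. u $ k - l $ k)"
    using assms by (subst UNIV_2_cases(1)[OF assms]) simp
  also have "\<dots> = (\<Prod>b\<in>Basis. (u - l) \<bullet> b)"
  proof -
    have inj: "inj_on (\<lambda>k. axis k (1::real) :: real ^ 2) UNIV" by (auto simp: inj_on_def axis_eq_axis)
    have "Basis = (\<lambda>k. axis k (1::real) :: real ^ 2) ` UNIV" by (auto simp: Basis_vec_def)
    then show ?thesis using prod.reindex[OF inj, of "\<lambda>b. (u - l) \<bullet> b"] by (simp add: inner_axis)
  qed
  finally show "emeasure (distr lborel borel ?P) (box l u) = (\<Prod>b\<in>Basis. (u - l) \<bullet> b)" .
qed simp

text \<open>Linear coordinates whose first component is \<open>z \<bullet> \<xi>\<close>; \<open>c\<close> is the inverse of the Jacobian determinant.\<close>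

lemma direction_coordinates:
  fixes \<xi> :: "real ^ 2"
  assumes "\<xi> \<noteq> 0"
  obtains S :: "real ^ 2 \<Rightarrow> real \<times> real" and T c where "linear S" "linear T" "\<And>p. S (T p) = p" "\<And>z. T (S z) = z"
    "\<And>z. fst (S z) = z \<bullet> \<xi>" "c > (0::real)" "distr lborel borel T = density lborel (\<lambda>_. ennreal c)"
proof -
  obtain i where i: "\<xi> $ i \<noteq> 0" using assms by (metis vec_eq_iff zero_index)
  obtain j where ij: "i \<noteq> j" using exhaust_2 by (metis one_neq_zero)
  define P where "P p = ((\<chi> k. if k = i then fst p else snd p) :: real ^ 2)" for p :: "real \<times> real"
  \<comment> \<open>The inverse of (z_i, z_j) \<mapsto> (z . \<xi>, z_j), with i chosen so that
    \<xi>_i is nonzero: a shear followed by a dilation of the first coordinate, whose image of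
    Lebesgue measure has density |\<xi>_i|.\<close>
  define A where "A p = ((fst p - \<xi> $ j * snd p) / \<xi> $ i, snd p)" for p
  define T where "T = P \<circ> A"
  define S where "S z = (z \<bullet> \<xi>, z $ j)" for z
  have inner: "z \<bullet> \<xi> = z $ i * \<xi> $ i + z $ j * \<xi> $ j" for z
    unfolding inner_vec_def using ij by (subst UNIV_2_cases(1)[OF ij]) simp
  have lA: "linear A" unfolding A_def by (auto simp: linear_iff algebra_simps add_divide_distrib diff_divide_distrib)
  have lP: "linear P" unfolding P_def by (auto simp: linear_iff vec_eq_iff)
  have [measurable]: "P \<in> borel \<rightarrow>\<^sub>M borel" "A \<in> borel \<rightarrow>\<^sub>M borel" by (intro linear_borel_measurable lP lA)+
  have dA: "distr lborel borel A = density lborel (\<lambda>_. ennreal \<bar>\<xi> $ i\<bar>)"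
  proof (rule measure_eqI)
    fix B assume "B \<in> sets (distr lborel borel A)"
    then have [measurable]: "B \<in> sets borel" by simp
    have "emeasure (distr lborel borel A) B = (\<integral>\<^sup>+x. indicator B x \<partial>distr lborel borel A)"
      by (rule nn_integral_indicator[symmetric]) simp
    also have "\<dots> = (\<integral>\<^sup>+p. indicator B (A p) \<partial>lborel)"
      by (rule nn_integral_distr) measurable
    also have "\<dots> = (\<integral>\<^sup>+q. \<integral>\<^sup>+p. indicator B ((p - \<xi> $ j * q) / \<xi> $ i, q) \<partial>lborel \<partial>lborel)"
      unfolding lborel_prod[symmetric] by (subst lborel_pair.nn_integral_snd[symmetric]) (auto simp: lborel_prod A_def)
    also have "\<dots> = (\<integral>\<^sup>+q. \<bar>\<xi> $ i\<bar> * (\<integral>\<^sup>+a. indicator B (a, q) \<partial>lborel) \<partial>lborel)"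
    proof (rule nn_integral_cong)
      fix q
      have "(\<integral>\<^sup>+p. indicator B ((p - \<xi> $ j * q) / \<xi> $ i, q) \<partial>lborel)
          = ennreal \<bar>\<xi> $ i\<bar> * (\<integral>\<^sup>+a. indicator B ((\<xi> $ j * q + \<xi> $ i * a - \<xi> $ j * q) / \<xi> $ i, q) \<partial>lborel)"
        by (rule nn_integral_real_affine[OF _ i]) measurable
      then show "(\<integral>\<^sup>+p. indicator B ((p - \<xi> $ j * q) / \<xi> $ i, q) \<partial>lborel) = \<bar>\<xi> $ i\<bar> * (\<integral>\<^sup>+a. indicator B (a, q) \<partial>lborel)"
        using i by simp
    qed
    also have "\<dots> = \<bar>\<xi> $ i\<bar> * (\<integral>\<^sup>+q. \<integral>\<^sup>+a. indicator B (a, q) \<partial>lborel \<partial>lborel)"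
      by (rule nn_integral_cmult) measurable
    also have "(\<integral>\<^sup>+q. \<integral>\<^sup>+a. indicator B (a, q) \<partial>lborel \<partial>lborel) = (\<integral>\<^sup>+p. indicator B p \<partial>lborel)"
      unfolding lborel_prod[symmetric] by (subst lborel_pair.nn_integral_snd[symmetric]) (auto simp: lborel_prod)
    finally show "emeasure (distr lborel borel A) B = emeasure (density lborel (\<lambda>_. ennreal \<bar>\<xi> $ i\<bar>)) B"
      by (simp add: emeasure_density nn_integral_cmult)
  qed simp
  have "distr lborel borel T = distr (distr lborel borel A) borel P"
    unfolding T_def by (subst distr_distr) auto
  also have "\<dots> = density (distr lborel borel P) (\<lambda>_. ennreal \<bar>\<xi> $ i\<bar>)"
    unfolding dA by (subst density_distr) auto
  also have "distr lborel borel P = lborel"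
    using distr_plane_coordinates[OF ij] by (simp add: P_def[abs_def])
  finally have dT: "distr lborel borel T = density lborel (\<lambda>_. ennreal \<bar>\<xi> $ i\<bar>)" .
  have TS: "T (S z) = z" for z
    using i ij by (auto simp: T_def P_def A_def S_def inner vec_eq_iff UNIV_2_cases(2)[OF ij])
  have ST: "S (T p) = p" for p
    using i ij by (simp add: T_def P_def A_def S_def inner prod_eq_iff)
  have "linear S" unfolding S_def by (auto simp: linear_iff inner_add_left)
  moreover have "linear T" unfolding T_def by (rule linear_compose[OF lA lP])
  ultimately show ?thesis
    using that[of S T "\<bar>\<xi> $ i\<bar>"] TS ST dT i by (simp add: S_def)
qed

text \<open>The distributional form of div (U b) = F: \<open>fderiv \<psi> x (b x)\<close> is b .
  grad \<psi>, and the minus sign comes from integration by parts.\<close>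

definition weak_div :: "'a::euclidean_space set \<Rightarrow> ('a \<Rightarrow> 'a) \<Rightarrow> ('a \<Rightarrow> real) \<Rightarrow> ('a \<Rightarrow> real) \<Rightarrow> bool" where
  "weak_div \<Omega> b U F \<longleftrightarrow> (\<forall>\<psi>\<in>tests \<Omega>. (LINT x|lborel. U x * fderiv \<psi> x (b x)) = - (LINT x|lborel. F x * \<psi> x))"

text \<open>The bound holds at every point and measurability is Borel. Working with fixed
  representatives removes almost-everywhere qualifications and makes all time slices
  measurable.\<close>

definition bounded_borel :: "('a::euclidean_space \<Rightarrow> real) \<Rightarrow> bool" where
  "bounded_borel U \<longleftrightarrow> U \<in> borel_measurable borel \<and> (\<exists>C. \<forall>x. \<bar>U x\<bar> \<le> C)"

lemma bounded_borelD:
  assumes "bounded_borel U"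
  shows "U \<in> borel_measurable borel" "\<exists>C. \<forall>x. \<bar>U x\<bar> \<le> C"
  using assms by (auto simp: bounded_borel_def)

lemma bounded_borel_const: "bounded_borel (\<lambda>x. c)"
  unfolding bounded_borel_def by auto

lemma bounded_borel_mult:
  assumes "bounded_borel U" "bounded_borel V"
  shows "bounded_borel (\<lambda>x. U x * V x)"
proof -
  obtain A B where "\<And>x. \<bar>U x\<bar> \<le> A" "\<And>x. \<bar>V x\<bar> \<le> B" using assms unfolding bounded_borel_def by metis
  then have "\<bar>U x * V x\<bar> \<le> A * B" for x
    unfolding abs_mult by (meson abs_ge_zero mult_mono order_trans)
  then show ?thesis using assms by (auto simp: bounded_borel_def)
qed

lemma bounded_borel_add:
  assumes "bounded_borel U" "bounded_borel V"
  shows "bounded_borel (\<lambda>x. U x + V x)"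
proof -
  obtain A B where "\<And>x. \<bar>U x\<bar> \<le> A" "\<And>x. \<bar>V x\<bar> \<le> B" using assms unfolding bounded_borel_def by metis
  then have "\<bar>U x + V x\<bar> \<le> A + B" for x
    by (meson abs_triangle_ineq add_mono order_trans)
  then show ?thesis using assms by (auto simp: bounded_borel_def)
qed

lemma bounded_borel_tests: "\<psi> \<in> tests S \<Longrightarrow> bounded_borel \<psi>"
  unfolding bounded_borel_def by (metis smooth_borel_measurable tests_bounded testsD(1))

lemma integrable_bounded_borel_mult:
  assumes "bounded_borel U" "integrable lborel f"
  shows "integrable lborel (\<lambda>x. U x * f x)"
  using assms unfolding bounded_borel_def by (auto intro: integrable_bounded_mult)

section \<open>Locally square integrable, divergence-free fields\<close>

locale local_L2_field =
  fixes \<Omega> :: "(real ^ 2) set" and b :: "real ^ 2 \<Rightarrow> real ^ 2"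
  assumes open_domain: "open \<Omega>"
    and b_measurable [measurable]: "b \<in> borel_measurable borel"
    and b_L2: "\<And>K. compact K \<Longrightarrow> K \<subseteq> \<Omega> \<Longrightarrow> integrable lborel (\<lambda>x. indicator K x * (norm (b x))\<^sup>2)"
begin

lemma fderiv_b_measurable:
  assumes "smooth \<psi>"
  shows "(\<lambda>x. fderiv \<psi> x (b x)) \<in> borel_measurable borel"
proof -
  have "fderiv \<psi> x (b x) = (\<Sum>e\<in>Basis. (b x \<bullet> e) * fderiv \<psi> x e)" for x
    using linear_sum[OF linear_fderiv[OF assms, of x], of "\<lambda>e. (b x \<bullet> e) *\<^sub>R e" Basis] linear.scaleR[OF linear_fderiv[OF assms, of x]]
    by (simp add: euclidean_representation)
  moreover have "(\<lambda>x. fderiv \<psi> x e) \<in> borel_measurable borel" for e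
    by (intro smooth_borel_measurable smooth_fderiv assms)
  ultimately show ?thesis by simp
qed

lemma b_L1: "compact K \<Longrightarrow> K \<subseteq> \<Omega> \<Longrightarrow> integrable lborel (\<lambda>x. indicator K x * norm (b x))"
proof -
  assume K: "compact K" "K \<subseteq> \<Omega>"
  have [measurable]: "K \<in> sets borel" using K by (simp add: borel_compact)
  show ?thesis
  proof (rule Bochner_Integration.integrable_bound[where f="\<lambda>x. indicator K x + indicator K x * (norm (b x))\<^sup>2"])
    show "integrable lborel (\<lambda>x. indicator K x + indicator K x * (norm (b x))\<^sup>2)"
      using b_L2[OF K] emeasure_compact_finite[OF K(1)] by auto
    have "s \<le> 1 + s\<^sup>2" for s :: real
      using zero_le_power2[of "s - 1 / 2"] by (simp add: power2_eq_square algebra_simps)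
    then show "AE x in lborel. norm (indicator K x * norm (b x)) \<le> norm (indicator K x + indicator K x * (norm (b x))\<^sup>2)"
      by (intro AE_I2) (auto simp: indicator_def)
  qed measurable
qed

lemma integrable_fderiv_b:
  assumes "\<psi> \<in> tests \<Omega>"
  shows "integrable lborel (\<lambda>x. fderiv \<psi> x (b x))"
proof -
  obtain K where K: "smooth \<psi>" "compact K" "K \<subseteq> \<Omega>" "\<And>x. x \<notin> K \<Longrightarrow> \<psi> x = 0" using tests_cases[OF assms] by blast
  obtain C where C: "C > 0" "\<And>x v. \<bar>fderiv \<psi> x v\<bar> \<le> C * norm v" using tests_fderiv_bounded[OF assms] by metis
  have le: "\<bar>fderiv \<psi> x (b x)\<bar> \<le> C * (indicator K x * norm (b x))" for x
    using C(2)[of x "b x"] fderiv_eq_0_outside[OF K(4) compact_imp_closed[OF K(2)], where x=x and v="b x"]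
    by (cases "x \<in> K") auto
  show ?thesis
    by (rule Bochner_Integration.integrable_bound[OF integrable_mult_right[OF b_L1[OF K(2,3)], of C]])
       (use fderiv_b_measurable[OF K(1)] le in \<open>auto intro: order_trans[OF _ abs_ge_self]\<close>)
qed

end

locale l2_field = local_L2_field +
  assumes b_div: "weak_div \<Omega> b (\<lambda>x. 1) (\<lambda>x. 0)"
begin

definition good :: "real ^ 2 \<Rightarrow> bool" where
  "good x \<longleftrightarrow> (\<exists>\<xi> \<alpha> \<epsilon>. \<alpha> > 0 \<and> \<epsilon> > 0 \<and> ball x \<epsilon> \<subseteq> \<Omega> \<and> (AE y in lborel. y \<in> ball x \<epsilon> \<longrightarrow> b y \<bullet> \<xi> \<ge> \<alpha>))"

text \<open>The defect of div (W b) = Z tested with \<psi>. As a functional additive in \<psi> it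
  fits \<open>tests_locally_zero_imp_zero\<close>, so the equation may be checked locally.\<close>

definition pairing :: "(real ^ 2 \<Rightarrow> real) \<Rightarrow> (real ^ 2 \<Rightarrow> real) \<Rightarrow> (real ^ 2 \<Rightarrow> real) \<Rightarrow> real" where
  "pairing W Z \<psi> = (LINT x|lborel. W x * fderiv \<psi> x (b x) + Z x * \<psi> x)"

lemma pairing_integrable:
  assumes "bounded_borel W" "bounded_borel Z" "\<psi> \<in> tests \<Omega>"
  shows "integrable lborel (\<lambda>x. W x * fderiv \<psi> x (b x))" "integrable lborel (\<lambda>x. Z x * \<psi> x)"
  using integrable_bounded_borel_mult[OF assms(1) integrable_fderiv_b[OF assms(3)]]
    integrable_bounded_borel_mult[OF assms(2) tests_integrable[OF assms(3)]] by auto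

lemma weak_div_iff_pairing:
  assumes "bounded_borel W" "bounded_borel Z"
  shows "weak_div \<Omega> b W Z \<longleftrightarrow> (\<forall>\<psi>\<in>tests \<Omega>. pairing W Z \<psi> = 0)"
  unfolding weak_div_def pairing_def
  by (intro ball_cong refl) (simp add: pairing_integrable[OF assms] add_eq_0_iff2)

lemma pairing_add:
  assumes "bounded_borel W" "bounded_borel Z" "\<psi> \<in> tests \<Omega>" "\<phi> \<in> tests \<Omega>"
  shows "pairing W Z (\<lambda>x. \<psi> x + \<phi> x) = pairing W Z \<psi> + pairing W Z \<phi>"
proof -
  have s: "smooth \<psi>" "smooth \<phi>" using assms by (auto dest: testsD)
  have "pairing W Z (\<lambda>x. \<psi> x + \<phi> x) = (LINT x|lborel. (W x * fderiv \<psi> x (b x) + Z x * \<psi> x) + (W x * fderiv \<phi> x (b x) + Z x * \<phi> x))"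
    unfolding pairing_def fderiv_add[OF s] by (rule Bochner_Integration.integral_cong) (auto simp: algebra_simps)
  also have "\<dots> = pairing W Z \<psi> + pairing W Z \<phi>"
    unfolding pairing_def
    using Bochner_Integration.integrable_add[OF pairing_integrable[OF assms(1,2,3)]]
      Bochner_Integration.integrable_add[OF pairing_integrable[OF assms(1,2,4)]]
    by (rule Bochner_Integration.integral_add)
  finally show ?thesis .
qed

end

lemma ball_cutoff_scale: "r > 0 \<Longrightarrow> ball_cutoff a r x = ball_cutoff 0 1 ((1 / r) *\<^sub>R x + (- (1 / r)) *\<^sub>R a)"
proof -
  have "(1 / r) *\<^sub>R x + (- (1 / r)) *\<^sub>R a - 0 = (1 / r) *\<^sub>R (x - a)" by (simp add: scaleR_diff_right)
  then show ?thesis unfolding ball_cutoff_def by (simp only:) (simp add: power2_eq_square)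
qed

text \<open>All cutoffs are dilated translates of the one for the unit ball. Independence of
  \<open>A\<close> from the centre and the radius is what the removal of points rests on.\<close>

lemma ball_cutoff_fderiv_bound:
  obtains A where "A > 0" "\<And>(a::'a::euclidean_space) r x v. r > 0 \<Longrightarrow> \<bar>fderiv (ball_cutoff a r) x v\<bar> \<le> A / r * norm v"
proof -
  have t: "ball_cutoff (0::'a) 1 \<in> tests UNIV" by (rule ball_cutoff_tests) auto
  obtain A where A: "A > 0" "\<And>x v. \<bar>fderiv (ball_cutoff (0::'a) 1) x v\<bar> \<le> A * norm v"
    using tests_fderiv_bounded[OF t] by metis
  have "\<bar>fderiv (ball_cutoff a r) x v\<bar> \<le> A / r * norm v" if r: "r > 0" for a x v :: 'a and r
  proof -
    have lin: "linear (\<lambda>x::'a. (1 / r) *\<^sub>R x)" by (simp add: linear_iff scaleR_add_right)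
    have eq: "ball_cutoff a r = (\<lambda>x. ball_cutoff 0 1 ((1 / r) *\<^sub>R x + (- (1 / r)) *\<^sub>R a))"
      using ball_cutoff_scale[OF r] by blast
    show ?thesis
      unfolding eq smooth_comp_affine(2)[OF testsD(1)[OF t] lin]
      using A(2)[of "(1 / r) *\<^sub>R x + (- (1 / r)) *\<^sub>R a" "(1 / r) *\<^sub>R v"] r by simp
  qed
  then show ?thesis using that A(1) by blast
qed

section \<open>Product rule: good points, removable points, gluing\<close>

context l2_field
begin

text \<open>With a cutoff X equal to 1 near x0, X U has divergence X F + U b . grad X, and likewise
  for V. As div b = 0, the test function satisfies div (\<psi> b) = b . grad \<psi>. The three-flux
  identity for X U, X V and \<psi> is the weak product rule, because X is 1 wherever \<psi>
  lives.\<close>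

lemma local_product:
  assumes good: "good x0" and bb: "bounded_borel U" "bounded_borel F" "bounded_borel V" "bounded_borel G"
    and UF: "weak_div \<Omega> b U F" and VG: "weak_div \<Omega> b V G"
  shows "\<exists>r>0. \<forall>\<psi>\<in>tests (\<Omega> \<inter> ball x0 r). pairing (\<lambda>x. U x * V x) (\<lambda>x. F x * V x + G x * U x) \<psi> = 0"
proof -
  obtain \<xi> \<alpha> \<epsilon> where \<alpha>: "\<alpha> > 0" and \<epsilon>: "\<epsilon> > 0" and sub: "ball x0 \<epsilon> \<subseteq> \<Omega>"
    and ae: "AE y in lborel. y \<in> ball x0 \<epsilon> \<longrightarrow> b y \<bullet> \<xi> \<ge> \<alpha>"
    using good unfolding good_def by blast
  \<comment> \<open>Otherwise 0 \<ge> \<alpha> > 0 almost everywhere on a ball, which has positive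
    measure.\<close>
  have "\<xi> \<noteq> 0"
  proof
    assume "\<xi> = 0"
    have "AE y in lborel. y \<notin> ball x0 \<epsilon>" using ae by eventually_elim (use \<alpha> \<open>\<xi> = 0\<close> in auto)
    then have "emeasure lborel (ball x0 \<epsilon>) = 0"
      by (subst (asm) AE_iff_measurable[of "ball x0 \<epsilon>"]) auto
    then have "measure lborel (ball x0 \<epsilon>) = 0" by (simp add: measure_def)
    then show False using content_ball_pos[OF \<epsilon>, of x0] by simp
  qed
  then obtain S :: "real ^ 2 \<Rightarrow> real \<times> real" and T c where ST: "linear S" "linear T" "\<And>p. S (T p) = p" "\<And>z. T (S z) = z"
    "\<And>z. fst (S z) = z \<bullet> \<xi>" and c: "c > (0::real)" and dT: "distr lborel borel T = density lborel (\<lambda>_. ennreal c)"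
    using direction_coordinates by metis
  obtain A where A: "A > 0" "\<And>v. norm (S v) \<le> A * norm v" using linear_bounded_pos[OF ST(1)] by metis
  obtain B where B: "B > 0" "\<And>p. norm (T p) \<le> B * norm p" using linear_bounded_pos[OF ST(2)] by metis
  define \<tau> where "\<tau> p = T p + x0" for p
  define \<sigma> where "\<sigma> z = S z + - S x0" for z
  have \<sigma>\<tau>: "\<sigma> (\<tau> p) = p" for p by (simp add: \<sigma>_def \<tau>_def linear_add[OF ST(1)] ST(3))
  have \<tau>\<sigma>: "\<tau> (\<sigma> z) = z" for z by (simp add: \<sigma>_def \<tau>_def linear_diff[OF ST(2)] ST(4))
  have \<sigma>_diff: "\<sigma> z = S (z - x0)" for z by (simp add: \<sigma>_def linear_diff[OF ST(1)])
  have [measurable]: "T \<in> borel \<rightarrow>\<^sub>M borel" "S \<in> borel \<rightarrow>\<^sub>M borel" by (intro linear_borel_measurable ST)+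
  have [measurable]: "\<tau> \<in> borel \<rightarrow>\<^sub>M borel" "\<sigma> \<in> borel \<rightarrow>\<^sub>M borel" unfolding \<tau>_def \<sigma>_def by measurable
  have cont: "continuous_on X \<tau>" "continuous_on Y \<sigma>" for X Y
    unfolding \<tau>_def \<sigma>_def using ST(1,2)
    by (intro continuous_on_add continuous_on_const linear_continuous_on; simp add: linear_linear)+
  have d\<tau>: "distr lborel borel \<tau> = density lborel (\<lambda>_. ennreal c)"
  proof -
    have "distr lborel borel \<tau> = distr (distr lborel borel T) borel (\<lambda>z. z + x0)"
      by (subst distr_distr) (auto simp: \<tau>_def[abs_def] o_def)
    also have "\<dots> = density (distr lborel borel (\<lambda>z. z + x0)) (\<lambda>_. ennreal c)"
      unfolding dT by (subst density_distr) auto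
    finally show ?thesis by (simp add: lborel_distr_translate)
  qed
  have tr: "integrable lborel (\<lambda>p. f (\<tau> p))" "(LINT p|lborel. f (\<tau> p)) = c * (LINT z|lborel. f z)"
    if f: "integrable lborel f" for f :: "real ^ 2 \<Rightarrow> real"
  proof -
    have [measurable]: "f \<in> borel_measurable borel" using f by simp
    have "integrable (distr lborel borel \<tau>) f"
      unfolding d\<tau> using f c by (subst integrable_density) auto
    then show "integrable lborel (\<lambda>p. f (\<tau> p))" by (subst (asm) integrable_distr_eq) auto
    have "(LINT p|lborel. f (\<tau> p)) = (LINT z|distr lborel borel \<tau>. f z)" by (subst integral_distr) auto
    also have "\<dots> = c * (LINT z|lborel. f z)" unfolding d\<tau> using c by (subst integral_density) auto
    finally show "(LINT p|lborel. f (\<tau> p)) = c * (LINT z|lborel. f z)" .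
  qed
  \<comment> \<open>A point of the box has norm at most 2 R, so its image lies within B (2 R) =
    \<epsilon> / 2 of x0. Conversely the ball of radius 2 r, which carries the cutoff, is sent into
    the ball of radius R / 2, inside the box.\<close>
  define R where "R = \<epsilon> / (4 * B)"
  define r where "r = R / (4 * A)"
  have R: "R > 0" and r: "r > 0" using \<epsilon> B(1) A(1) by (auto simp: R_def r_def)
  let ?Q = "{-R<..<R} \<times> {-R<..<R} :: (real \<times> real) set"
  have [measurable]: "?Q \<in> sets borel" by (intro borel_open open_Times) auto
  have \<tau>Q: "\<tau> p \<in> cball x0 (\<epsilon> / 2)" if "p \<in> ?Q" for p
  proof -
    have "norm p \<le> \<bar>fst p\<bar> + \<bar>snd p\<bar>" using norm_Pair_le[of "fst p" "snd p"] by simp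
    also have "\<dots> \<le> 2 * R" using that by auto
    finally have "norm (T p) \<le> B * (2 * R)" using B by (meson mult_left_mono less_imp_le order_trans)
    also have "\<dots> = \<epsilon> / 2" using B by (simp add: R_def)
    finally show ?thesis by (simp add: \<tau>_def dist_norm)
  qed
  have c_sub: "cball x0 (\<epsilon> / 2) \<subseteq> \<Omega>" using sub \<epsilon> by (auto intro!: subsetD[OF sub])
  \<comment> \<open>The value 1 is taken only on a null set of the box. It makes \<open>c1\<close>
    positive at every point there, as \<open>flux_box\<close> demands.\<close>
  define c1 where "c1 p = (if p \<in> ?Q then (if b (\<tau> p) \<bullet> \<xi> > 0 then b (\<tau> p) \<bullet> \<xi> else 1) else 0)" for p
  define c2 where "c2 p = (if p \<in> ?Q then snd (S (b (\<tau> p))) else 0)" for p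
  have [measurable]: "c1 \<in> borel_measurable borel" "c2 \<in> borel_measurable borel" unfolding c1_def c2_def by measurable
  have ae_c: "AE p in lborel. p \<in> ?Q \<longrightarrow> S (b (\<tau> p)) = (c1 p, c2 p)"
  proof -
    have "AE z in distr lborel borel \<tau>. z \<in> ball x0 \<epsilon> \<longrightarrow> b z \<bullet> \<xi> \<ge> \<alpha>"
      unfolding d\<tau> using ae by (subst AE_density) (auto elim!: eventually_mono)
    then have "AE p in lborel. \<tau> p \<in> ball x0 \<epsilon> \<longrightarrow> b (\<tau> p) \<bullet> \<xi> \<ge> \<alpha>" by (rule AE_distrD[rotated]) measurable
    then show ?thesis
    proof eventually_elim
      case (elim p)
      show ?case
      proof
        assume p: "p \<in> ?Q"
        then have "b (\<tau> p) \<bullet> \<xi> \<ge> \<alpha>" using elim \<tau>Q[OF p] \<epsilon> by auto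
        then show "S (b (\<tau> p)) = (c1 p, c2 p)" using \<alpha> p by (simp add: c1_def c2_def prod_eq_iff ST(5))
      qed
    qed
  qed
  have iQ: "integrable lborel (indicator ?Q :: _ \<Rightarrow> real)"
    using emeasure_bounded_finite[of ?Q] by (simp add: bounded_Times less_top)
  have ib: "integrable lborel (\<lambda>p. indicator (cball x0 (\<epsilon> / 2)) (\<tau> p) * (norm (b (\<tau> p)))\<^sup>2)"
    by (rule tr(1)[OF b_L2[OF compact_cball c_sub]])
  have sq1: "integrable lborel (\<lambda>p. (c1 p)\<^sup>2)"
  proof (rule Bochner_Integration.integrable_bound[where f="\<lambda>p. indicator ?Q p + (norm \<xi>)\<^sup>2 * (indicator (cball x0 (\<epsilon> / 2)) (\<tau> p) * (norm (b (\<tau> p)))\<^sup>2)"])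
    have le: "(c1 p)\<^sup>2 \<le> indicator ?Q p + (norm \<xi>)\<^sup>2 * (indicator (cball x0 (\<epsilon> / 2)) (\<tau> p) * (norm (b (\<tau> p)))\<^sup>2)" for p
    proof (cases "p \<in> ?Q")
      case True
      have "(b (\<tau> p) \<bullet> \<xi>)\<^sup>2 \<le> (norm (b (\<tau> p)) * norm \<xi>)\<^sup>2"
        using Cauchy_Schwarz_ineq2[of "b (\<tau> p)" \<xi>] by (simp add: abs_le_square_iff[symmetric])
      then have "(b (\<tau> p) \<bullet> \<xi>)\<^sup>2 \<le> (norm \<xi>)\<^sup>2 * (norm (b (\<tau> p)))\<^sup>2" by (simp add: power_mult_distrib mult.commute)
      then show ?thesis using True \<tau>Q[OF True] by (simp add: c1_def)
    qed (auto simp: c1_def)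
    then show "AE p in lborel. norm ((c1 p)\<^sup>2) \<le> norm (indicator ?Q p + (norm \<xi>)\<^sup>2 * (indicator (cball x0 (\<epsilon> / 2)) (\<tau> p) * (norm (b (\<tau> p)))\<^sup>2))"
      by (intro AE_I2) (simp add: order_trans[OF _ abs_ge_self])
  qed (use iQ ib in auto)
  have sq2: "integrable lborel (\<lambda>p. (c2 p)\<^sup>2)"
  proof (rule Bochner_Integration.integrable_bound[where f="\<lambda>p. A\<^sup>2 * (indicator (cball x0 (\<epsilon> / 2)) (\<tau> p) * (norm (b (\<tau> p)))\<^sup>2)"])
    have le: "(c2 p)\<^sup>2 \<le> A\<^sup>2 * (indicator (cball x0 (\<epsilon> / 2)) (\<tau> p) * (norm (b (\<tau> p)))\<^sup>2)" for p
    proof (cases "p \<in> ?Q")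
      case True
      have "norm (snd (S (b (\<tau> p)))) \<le> A * norm (b (\<tau> p))" 
        using norm_snd_le[of "snd (S (b (\<tau> p)))" "fst (S (b (\<tau> p)))"] A(2)[of "b (\<tau> p)"] by simp
      then have "(snd (S (b (\<tau> p))))\<^sup>2 \<le> (A * norm (b (\<tau> p)))\<^sup>2" using A(1) by (simp add: abs_le_square_iff[symmetric])
      then show ?thesis using True \<tau>Q[OF True] by (simp add: c2_def power_mult_distrib)
    qed (auto simp: c2_def)
    then show "AE p in lborel. norm ((c2 p)\<^sup>2) \<le> norm (A\<^sup>2 * (indicator (cball x0 (\<epsilon> / 2)) (\<tau> p) * (norm (b (\<tau> p)))\<^sup>2))"
      by (intro AE_I2) (simp add: order_trans[OF _ abs_ge_self])
  qed (use ib in auto)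
  have L1: "integrable lborel g"
    if "g \<in> borel_measurable borel" "integrable lborel (\<lambda>p. (g p)\<^sup>2)" "\<And>p. p \<notin> ?Q \<Longrightarrow> g p = 0" for g :: "real \<times> real \<Rightarrow> real"
  proof (rule Bochner_Integration.integrable_bound[where f="\<lambda>p. indicator ?Q p + (g p)\<^sup>2"])
    have "\<bar>s\<bar> \<le> 1 + s\<^sup>2" for s :: real
      using zero_le_power2[of "\<bar>s\<bar> - 1 / 2"] by (simp add: power2_eq_square algebra_simps)
    then show "AE p in lborel. norm (g p) \<le> norm (indicator ?Q p + (g p)\<^sup>2)"
      using that(3) by (intro AE_I2) (auto simp: indicator_def)
  qed (use that iQ in auto)
  have lin': "fderiv \<psi> p (x, y) = x * fderiv \<psi> p (1, 0) + y * fderiv \<psi> p (0, 1)" if "smooth \<psi>" for \<psi> :: "real \<times> real \<Rightarrow> real" and p x y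
  proof -
    have "fderiv \<psi> p (x *\<^sub>R (1, 0) + y *\<^sub>R (0, 1)) = x * fderiv \<psi> p (1, 0) + y * fderiv \<psi> p (0, 1)"
      unfolding linear_add[OF linear_fderiv[OF that]] linear.scaleR[OF linear_fderiv[OF that]] by simp
    then show ?thesis by simp
  qed
  have comp: "smooth (\<lambda>z. \<psi> (\<sigma> z))" "fderiv (\<lambda>z. \<psi> (\<sigma> z)) z v = fderiv \<psi> (\<sigma> z) (S v)" if "smooth \<psi>" for \<psi> z v
    unfolding \<sigma>_def by (rule smooth_comp_affine[OF that ST(1)])+
  interpret flux_box R c1 c2
  proof
    show "integrable lborel c1" by (rule L1[OF _ sq1]) (auto simp: c1_def)
    show "integrable lborel c2" by (rule L1[OF _ sq2]) (auto simp: c2_def)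
    show "c1 p > 0" if "p \<in> ?Q" for p using that by (auto simp: c1_def)
    show "c1 p = 0" "c2 p = 0" if "p \<notin> ?Q" for p using that by (auto simp: c1_def c2_def)
    fix \<psi> assume \<psi>: "\<psi> \<in> tests ?Q"
    obtain K where K: "smooth \<psi>" "compact K" "K \<subseteq> ?Q" "\<And>x. x \<notin> K \<Longrightarrow> \<psi> x = 0" using tests_cases[OF \<psi>] by blast
    have t: "(\<lambda>z. \<psi> (\<sigma> z)) \<in> tests \<Omega>"
    proof (rule testsI[where K="\<tau> ` K"])
      show "compact (\<tau> ` K)" by (rule compact_continuous_image[OF cont(1) K(2)])
      show "\<tau> ` K \<subseteq> \<Omega>" using \<tau>Q K(3) c_sub by blast
      show "\<psi> (\<sigma> z) = 0" if "z \<notin> \<tau> ` K" for z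
        using that K(4)[of "\<sigma> z"] \<tau>\<sigma>[of z] by (metis imageI)
    qed (rule comp(1)[OF K(1)])
    have "(LINT p|lborel. c1 p * fderiv \<psi> p (1, 0) + c2 p * fderiv \<psi> p (0, 1)) = (LINT p|lborel. fderiv (\<lambda>z. \<psi> (\<sigma> z)) (\<tau> p) (b (\<tau> p)))"
    proof (rule integral_cong_AE)
      show "(\<lambda>p. fderiv (\<lambda>z. \<psi> (\<sigma> z)) (\<tau> p) (b (\<tau> p))) \<in> borel_measurable lborel"
        using tr(1)[OF integrable_fderiv_b[OF t]] by simp
      have [measurable]: "(\<lambda>p. fderiv \<psi> p v) \<in> borel_measurable borel" for v
        by (intro smooth_borel_measurable smooth_fderiv K)
      show "(\<lambda>p. c1 p * fderiv \<psi> p (1, 0) + c2 p * fderiv \<psi> p (0, 1)) \<in> borel_measurable lborel" by measurable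
      show "AE p in lborel. c1 p * fderiv \<psi> p (1, 0) + c2 p * fderiv \<psi> p (0, 1) = fderiv (\<lambda>z. \<psi> (\<sigma> z)) (\<tau> p) (b (\<tau> p))"
        using ae_c
      proof eventually_elim
        case (elim p)
        show ?case
        proof (cases "p \<in> ?Q")
          case True
          then show ?thesis using elim by (simp add: comp(2)[OF K(1)] \<sigma>\<tau> lin'[OF K(1), of p "c1 p" "c2 p"])
        next
          case False
          then have "p \<notin> K" using K(3) by blast
          then show ?thesis using fderiv_eq_0_outside[OF K(4) compact_imp_closed[OF K(2)]]
            by (simp add: comp(2)[OF K(1)] \<sigma>\<tau>)
        qed
      qed
    qed
    also have "\<dots> = 0" unfolding tr(2)[OF integrable_fderiv_b[OF t]]
      using b_div t unfolding weak_div_def by simp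
    finally show "(LINT p|lborel. c1 p * fderiv \<psi> p (1, 0) + c2 p * fderiv \<psi> p (0, 1)) = 0" .
  qed (use R sq1 sq2 in auto)
  define K0 where "K0 = cball x0 (2 * r)"
  define K where "K = \<sigma> ` K0"
  have K0: "compact K0" "closed K0" by (auto simp: K0_def)
  have K: "compact K" unfolding K_def by (rule compact_continuous_image[OF cont(2) K0(1)])
  have KQ: "K \<subseteq> ?Q"
  proof
    fix p assume "p \<in> K"
    then obtain z where z: "z \<in> K0" "p = \<sigma> z" by (auto simp: K_def)
    have "norm p \<le> A * norm (z - x0)" unfolding z \<sigma>_diff by (rule A)
    also have "\<dots> \<le> A * (2 * r)" using z(1) A(1) by (intro mult_left_mono) (auto simp: K0_def dist_norm norm_minus_commute)
    also have "\<dots> < R" using A(1) R by (simp add: r_def)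
    finally have "\<bar>fst p\<bar> < R" "\<bar>snd p\<bar> < R"
      using norm_fst_le[of "fst p" "snd p"] norm_snd_le[of "snd p" "fst p"] by auto
    then show "p \<in> ?Q" by (auto simp: mem_Times_iff abs_less_iff)
  qed
  have K0\<Omega>: "K0 \<subseteq> \<Omega>"
  proof
    fix z assume "z \<in> K0"
    then have "\<sigma> z \<in> ?Q" using KQ by (auto simp: K_def)
    then show "z \<in> \<Omega>" using \<tau>Q[of "\<sigma> z"] c_sub by (auto simp: \<tau>\<sigma>)
  qed
  \<comment> \<open>The rule div (X U b) = X F + U b . grad X, carried to the box. For smooth \<psi>
    on the box the function X times \<psi> composed with \<sigma> is a test function in \<Omega>;
    the Jacobian constant \<open>c\<close> appears on both sides.\<close>
  have pair: "flux_pair K (\<lambda>p. X (\<tau> p) * U (\<tau> p)) (\<lambda>p. X (\<tau> p) * F (\<tau> p) + U (\<tau> p) * fderiv X (\<tau> p) (b (\<tau> p)))"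
    if bU: "bounded_borel U" and bF: "bounded_borel F" and wd: "weak_div \<Omega> b U F"
      and X: "smooth X" "\<And>z. z \<notin> K0 \<Longrightarrow> X z = 0" for U F X
  proof -
    have Xt: "X \<in> tests \<Omega>" by (rule testsI[OF X(1) K0(1) K0\<Omega> X(2)])
    have X0: "fderiv X z v = 0" if "z \<notin> K0" for z v by (rule fderiv_eq_0_outside[OF X(2) K0(2) that])
    have out: "\<tau> p \<notin> K0" if "p \<notin> K" for p using that \<sigma>\<tau>[of p] by (metis K_def imageI)
    have XU: "bounded_borel (\<lambda>z. X z * U z)" by (rule bounded_borel_mult[OF bounded_borel_tests[OF Xt] bU])
    have [measurable]: "U \<in> borel_measurable borel" "F \<in> borel_measurable borel" "X \<in> borel_measurable borel"
      using bU bF X(1) by (auto intro: bounded_borelD smooth_borel_measurable)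
    have iF: "integrable lborel (\<lambda>z. X z * F z + U z * fderiv X z (b z))"
      using integrable_bounded_borel_mult[OF bF tests_integrable[OF Xt]] integrable_bounded_borel_mult[OF bU integrable_fderiv_b[OF Xt]]
      by (simp add: mult.commute)
    show ?thesis
      unfolding flux_pair_def
    proof (intro conjI allI impI)
      show "(\<lambda>p. X (\<tau> p) * U (\<tau> p)) \<in> borel_measurable borel" by measurable
      show "\<exists>C. \<forall>p. \<bar>X (\<tau> p) * U (\<tau> p)\<bar> \<le> C" using XU unfolding bounded_borel_def by blast
      show "X (\<tau> p) * U (\<tau> p) = 0" if "p \<notin> K" for p using X(2)[OF out[OF that]] by simp
      show "integrable lborel (\<lambda>p. X (\<tau> p) * F (\<tau> p) + U (\<tau> p) * fderiv X (\<tau> p) (b (\<tau> p)))" by (rule tr(1)[OF iF])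
      show "X (\<tau> p) * F (\<tau> p) + U (\<tau> p) * fderiv X (\<tau> p) (b (\<tau> p)) = 0" if "p \<notin> K" for p
        using X(2)[OF out[OF that]] X0[OF out[OF that]] by simp
      fix \<psi> :: "real \<times> real \<Rightarrow> real" assume \<psi>: "smooth \<psi>"
      let ?\<psi> = "\<lambda>z. \<psi> (\<sigma> z)"
      have Zt: "(\<lambda>z. X z * ?\<psi> z) \<in> tests \<Omega>" by (rule tests_mult(1)[OF Xt comp(1)[OF \<psi>]])
      have dZ: "fderiv (\<lambda>z. X z * ?\<psi> z) z v = X z * fderiv ?\<psi> z v + fderiv X z v * ?\<psi> z" for z v
        by (rule fderiv_mult[OF X(1) comp(1)[OF \<psi>]])
      have "bounded (?\<psi> ` K0)"
        by (intro compact_imp_bounded compact_continuous_image smooth_continuous comp \<psi> K0)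
      then obtain C where C: "C > 0" "\<And>z. z \<in> K0 \<Longrightarrow> \<bar>?\<psi> z\<bar> \<le> C" by (auto simp: bounded_pos)
      have [measurable]: "K0 \<in> sets borel" "?\<psi> \<in> borel_measurable borel"
        using K0 smooth_borel_measurable[OF comp(1)[OF \<psi>]] by auto
      have b\<psi>: "bounded_borel (\<lambda>z. indicator K0 z * ?\<psi> z)"
        unfolding bounded_borel_def using C by (intro conjI exI[of _ C]) (auto simp: indicator_def)
      have "(\<lambda>z. fderiv X z (b z) * ?\<psi> z) = (\<lambda>z. (indicator K0 z * ?\<psi> z) * fderiv X z (b z))"
      proof
        fix z
        show "fderiv X z (b z) * ?\<psi> z = (indicator K0 z * ?\<psi> z) * fderiv X z (b z)"
          using X0[of z "b z"] by (cases "z \<in> K0") auto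
      qed
      then have i2: "integrable lborel (\<lambda>z. fderiv X z (b z) * ?\<psi> z)"
        using integrable_bounded_borel_mult[OF b\<psi> integrable_fderiv_b[OF Xt]] by (simp only:)
      have i1: "integrable lborel (\<lambda>z. X z * fderiv ?\<psi> z (b z))"
        using Bochner_Integration.integrable_diff[OF integrable_fderiv_b[OF Zt] i2] unfolding dZ by simp
      have i1U: "integrable lborel (\<lambda>z. U z * (X z * fderiv ?\<psi> z (b z)))" and i2U: "integrable lborel (\<lambda>z. U z * (fderiv X z (b z) * ?\<psi> z))"
        and i3: "integrable lborel (\<lambda>z. F z * (X z * ?\<psi> z))"
        by (rule integrable_bounded_borel_mult[OF bU i1] integrable_bounded_borel_mult[OF bU i2]
            integrable_bounded_borel_mult[OF bF tests_integrable[OF Zt]])+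
      have "(LINT p|lborel. X (\<tau> p) * U (\<tau> p) * (c1 p * fderiv \<psi> p (1, 0) + c2 p * fderiv \<psi> p (0, 1)))
          = (LINT p|lborel. U (\<tau> p) * (X (\<tau> p) * fderiv ?\<psi> (\<tau> p) (b (\<tau> p))))"
      proof (rule integral_cong_AE)
        show "(\<lambda>p. U (\<tau> p) * (X (\<tau> p) * fderiv ?\<psi> (\<tau> p) (b (\<tau> p)))) \<in> borel_measurable lborel"
          using tr(1)[OF i1U] by simp
        have [measurable]: "(\<lambda>p. fderiv \<psi> p v) \<in> borel_measurable borel" for v
          by (intro smooth_borel_measurable smooth_fderiv \<psi>)
        show "(\<lambda>p. X (\<tau> p) * U (\<tau> p) * (c1 p * fderiv \<psi> p (1, 0) + c2 p * fderiv \<psi> p (0, 1))) \<in> borel_measurable lborel" by measurable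
        show "AE p in lborel. X (\<tau> p) * U (\<tau> p) * (c1 p * fderiv \<psi> p (1, 0) + c2 p * fderiv \<psi> p (0, 1)) = U (\<tau> p) * (X (\<tau> p) * fderiv ?\<psi> (\<tau> p) (b (\<tau> p)))"
          using ae_c
        proof eventually_elim
          case (elim p)
          show ?case
          proof (cases "p \<in> ?Q")
            case True
            then show ?thesis using elim by (simp add: comp(2)[OF \<psi>] \<sigma>\<tau> lin'[OF \<psi>, of p "c1 p" "c2 p"])
          next
            case False
            then have "\<tau> p \<notin> K0" using out KQ by blast
            then show ?thesis using X(2) by simp
          qed
        qed
      qed
      also have "\<dots> = c * (LINT z|lborel. U z * (X z * fderiv ?\<psi> z (b z)))" by (rule tr(2)[OF i1U])
      also have "(LINT z|lborel. U z * (X z * fderiv ?\<psi> z (b z))) = (LINT z|lborel. U z * fderiv (\<lambda>z. X z * ?\<psi> z) z (b z)) - (LINT z|lborel. U z * (fderiv X z (b z) * ?\<psi> z))"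
        unfolding dZ distrib_left Bochner_Integration.integral_add[OF i1U i2U] by simp
      also have "(LINT z|lborel. U z * fderiv (\<lambda>z. X z * ?\<psi> z) z (b z)) = - (LINT z|lborel. F z * (X z * ?\<psi> z))"
        using wd Zt unfolding weak_div_def by blast
      also have "c * (- (LINT z|lborel. F z * (X z * ?\<psi> z)) - (LINT z|lborel. U z * (fderiv X z (b z) * ?\<psi> z)))
          = - (c * (LINT z|lborel. F z * (X z * ?\<psi> z) + U z * (fderiv X z (b z) * ?\<psi> z)))"
        unfolding Bochner_Integration.integral_add[OF i3 i2U] by (simp add: algebra_simps)
      also have "c * (LINT z|lborel. F z * (X z * ?\<psi> z) + U z * (fderiv X z (b z) * ?\<psi> z))
          = (LINT p|lborel. F (\<tau> p) * (X (\<tau> p) * ?\<psi> (\<tau> p)) + U (\<tau> p) * (fderiv X (\<tau> p) (b (\<tau> p)) * ?\<psi> (\<tau> p)))"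
        by (rule tr(2)[OF Bochner_Integration.integrable_add[OF i3 i2U], symmetric])
      also have "\<dots> = (LINT p|lborel. (X (\<tau> p) * F (\<tau> p) + U (\<tau> p) * fderiv X (\<tau> p) (b (\<tau> p))) * \<psi> p)"
        unfolding \<sigma>\<tau> by (rule Bochner_Integration.integral_cong[OF refl]) (simp add: algebra_simps)
      finally show "(LINT p|lborel. X (\<tau> p) * U (\<tau> p) * (c1 p * fderiv \<psi> p (1, 0) + c2 p * fderiv \<psi> p (0, 1)))
        = - (LINT p|lborel. (X (\<tau> p) * F (\<tau> p) + U (\<tau> p) * fderiv X (\<tau> p) (b (\<tau> p))) * \<psi> p)" .
    qed
  qed
  show ?thesis
  proof (intro exI[of _ r] conjI ballI)
    fix \<psi> assume \<psi>: "\<psi> \<in> tests (\<Omega> \<inter> ball x0 r)"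
    obtain L where L: "smooth \<psi>" "compact L" "L \<subseteq> \<Omega> \<inter> ball x0 r" "\<And>z. z \<notin> L \<Longrightarrow> \<psi> z = 0" using tests_cases[OF \<psi>] by blast
    have \<psi>t: "\<psi> \<in> tests \<Omega>" by (rule tests_mono[OF \<psi>]) auto
    let ?X = "ball_cutoff x0 (2 * r)"
    have r2: "2 * r > 0" using r by simp
    have X: "smooth ?X" by (rule smooth_ball_cutoff[OF r2])
    have X0: "?X z = 0" if "z \<notin> K0" for z
      by (rule ball_cutoff_eq_0[OF r2]) (use that in \<open>auto simp: K0_def\<close>)
    have \<psi>0: "\<psi> z = 0" if "z \<notin> K0" for z using that L(3) r by (intro L(4)) (auto simp: K0_def)
    note p1 = pair[OF bb(1,2) UF X X0] and p2 = pair[OF bb(3,4) VG X X0]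
    \<comment> \<open>This is \<open>pair\<close> for the constant solution U = 1, F = 0, with
      \<psi> in the role of the cutoff.\<close>
    have p3: "flux_pair K (\<lambda>p. \<psi> (\<tau> p)) (\<lambda>p. fderiv \<psi> (\<tau> p) (b (\<tau> p)))"
      using pair[OF bounded_borel_const bounded_borel_const b_div L(1) \<psi>0] by simp
    define h where "h z = (U z * V z) * fderiv \<psi> z (b z) + (F z * V z + G z * U z) * \<psi> z" for z
    \<comment> \<open>On \<open>ball x0 r\<close> the cutoff is 1 with zero derivative; off this
      ball \<psi> and its derivative vanish. Either way all traces of the cutoff disappear.\<close>
    have hh: "(?X z * F z + U z * fderiv ?X z (b z)) * (?X z * V z) * \<psi> z + (?X z * G z + V z * fderiv ?X z (b z)) * (?X z * U z) * \<psi> z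
        + fderiv \<psi> z (b z) * (?X z * U z) * (?X z * V z) = h z" for z
    proof (cases "z \<in> ball x0 r")
      case True
      have 1: "?X z = 1" if "z \<in> ball x0 r" for z using ball_cutoff_eq_1[OF r2, of x0 z] that by simp
      have 0: "fderiv ?X z (b z) = 0" by (rule fderiv_eq_0_locally_const[OF open_ball 1 True])
      show ?thesis unfolding h_def 0 1[OF True] by (simp add: algebra_simps)
    next
      case False
      then have "z \<notin> L" using L(3) by blast
      then show ?thesis using L(4) fderiv_eq_0_outside[OF L(4) compact_imp_closed[OF L(2)]] by (simp add: h_def)
    qed
    have ih: "integrable lborel h" unfolding h_def
      using pairing_integrable[OF bounded_borel_mult[OF bb(1,3)] bounded_borel_add[OF bounded_borel_mult[OF bb(2,3)] bounded_borel_mult[OF bb(4,1)]] \<psi>t]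
      by simp
    have "c * (LINT z|lborel. h z) = (LINT p|lborel. h (\<tau> p))" by (rule tr(2)[OF ih, symmetric])
    also have "\<dots> = 0" using flux_triple_product[OF K KQ p1 p2 p3] unfolding hh .
    finally show "pairing (\<lambda>x. U x * V x) (\<lambda>x. F x * V x + G x * U x) \<psi> = 0"
      using c by (simp add: pairing_def h_def)
  qed (rule r)
qed

text \<open>In the plane \<open>\<parallel>\<nabla>\<chi>(\<cdot>/\<delta>)\<parallel>\<^sub>2\<close> does not depend on \<open>\<delta>\<close>, while \<open>b\<close> has small \<open>L\<^sup>2\<close> norm on small balls: a point
  is removable.\<close>

lemma small_ball_average:
  assumes r: "r > 0" and sub: "cball x0 r \<subseteq> \<Omega>"
  shows "(\<lambda>n. LINT x|lborel. indicator (cball x0 (r / Suc n)) x * norm (b x) / (r / Suc n)) \<longlonglongrightarrow> 0"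
proof (rule LIMSEQ_I)
  fix e :: real assume e: "e > 0"
  define \<delta> where "\<delta> n = r / real (Suc n)" for n
  have \<delta>: "\<delta> n > 0" "\<delta> n \<le> r" for n using r by (auto simp: \<delta>_def divide_le_eq)
  have sub': "cball x0 (\<delta> n) \<subseteq> \<Omega>" for n using sub subset_cball[OF \<delta>(2)] by blast
  note i2 = b_L2[OF compact_cball sub'] and i1 = b_L1[OF compact_cball sub']
  define t where "t n = (LINT x|lborel. indicator (cball x0 (\<delta> n)) x * (norm (b x))\<^sup>2)" for n
  have "t \<longlonglongrightarrow> (LINT x|(lborel :: (real ^ 2) measure). 0)"
    unfolding t_def
  proof (rule integral_dominated_convergence[where w="\<lambda>x. indicator (cball x0 r) x * (norm (b x))\<^sup>2"])
    show "integrable lborel (\<lambda>x. indicator (cball x0 r) x * (norm (b x))\<^sup>2)" by (rule b_L2[OF compact_cball sub])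
    show "AE x in lborel. norm (indicator (cball x0 (\<delta> n)) x * (norm (b x))\<^sup>2) \<le> indicator (cball x0 r) x * (norm (b x))\<^sup>2" for n
      using \<delta>(2)[of n] by (intro AE_I2) (auto simp: indicator_def)
    have "AE x in lborel. x \<noteq> x0" by (rule AE_lborel_singleton)
    then show "AE x in lborel. (\<lambda>n. indicator (cball x0 (\<delta> n)) x * (norm (b x))\<^sup>2) \<longlonglongrightarrow> 0"
    proof eventually_elim
      case (elim x)
      have "\<delta> \<longlonglongrightarrow> 0" unfolding \<delta>_def by (rule LIMSEQ_Suc[OF lim_const_over_n])
      then have "\<forall>\<^sub>F n in sequentially. \<delta> n < dist x0 x" using elim by (intro order_tendstoD) auto
      then have "\<forall>\<^sub>F n in sequentially. indicator (cball x0 (\<delta> n)) x * (norm (b x))\<^sup>2 = 0"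
        by eventually_elim auto
      then show ?case by (rule tendsto_eventually)
    qed
  qed (use borel_measurable_integrable[OF i2] in auto)
  then have t0: "t \<longlonglongrightarrow> 0" by simp
  define v where "v = unit_ball_vol (2::real)"
  have v: "v \<ge> 0" by (simp add: v_def)
  \<comment> \<open>In s / d \<le> M s^2 + 1 / (4 M d^2) the last term, integrated over a disc of
    area v d^2, gives v / (4 M) independently of the radius. \<open>M\<close> makes this at most e /
    2; afterwards \<open>n\<close> is taken so large that M times the L2 mass on the disc is below e
    / 2.\<close>
  define M where "M = v / e + 1"
  have M: "M > 0" using v e by (simp add: M_def add_nonneg_pos)
  have "\<forall>\<^sub>F n in sequentially. t n < e / (2 * M)" using e M by (intro order_tendstoD(2)[OF t0]) auto
  then obtain N where N: "\<And>n. n \<ge> N \<Longrightarrow> t n < e / (2 * M)" by (auto simp: eventually_sequentially)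
  have bound: "(LINT x|lborel. indicator (cball x0 (\<delta> n)) x * norm (b x) / \<delta> n) < e" if "n \<ge> N" for n
  proof -
    have "s / d \<le> M * s\<^sup>2 + 1 / (4 * M * d\<^sup>2)" if "d > 0" for s d :: real
    proof -
      have "0 \<le> (2 * M * s - 1 / d)\<^sup>2 / (4 * M)" using M by simp
      also have "\<dots> = M * s\<^sup>2 + 1 / (4 * M * d\<^sup>2) - s / d"
        using M that by (simp add: power2_eq_square field_simps)
      finally show ?thesis by simp
    qed
    then have le: "indicator (cball x0 (\<delta> n)) x * norm (b x) / \<delta> n \<le>
        M * (indicator (cball x0 (\<delta> n)) x * (norm (b x))\<^sup>2) + 1 / (4 * M * (\<delta> n)\<^sup>2) * indicator (cball x0 (\<delta> n)) x" for x
      using \<delta>(1)[of n] by (auto simp: indicator_def)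
    have iI: "integrable lborel (indicator (cball x0 (\<delta> n)) :: real ^ 2 \<Rightarrow> real)"
      using emeasure_bounded_finite[of "cball x0 (\<delta> n)"] by (simp add: less_top)
    have "(LINT x|lborel. indicator (cball x0 (\<delta> n)) x * norm (b x) / \<delta> n) \<le>
        (LINT x|lborel. M * (indicator (cball x0 (\<delta> n)) x * (norm (b x))\<^sup>2) + 1 / (4 * M * (\<delta> n)\<^sup>2) * indicator (cball x0 (\<delta> n)) x)"
      by (rule integral_mono[OF _ _ le]) (use i1[of n] i2[of n] iI in simp_all)
    also have "\<dots> = M * t n + 1 / (4 * M * (\<delta> n)\<^sup>2) * measure lborel (cball x0 (\<delta> n))"
      using i2[of n] iI by (simp add: t_def)
    also have "measure lborel (cball x0 (\<delta> n)) = v * (\<delta> n)\<^sup>2"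
      using content_cball[of "\<delta> n" x0] \<delta>(1)[of n] by (simp add: v_def)
    also have "M * t n + 1 / (4 * M * (\<delta> n)\<^sup>2) * (v * (\<delta> n)\<^sup>2) = M * t n + v / (4 * M)"
      using \<delta>(1)[of n] by simp
    also have "\<dots> < M * (e / (2 * M)) + e / 2"
    proof (rule add_less_le_mono)
      show "M * t n < M * (e / (2 * M))" using N[OF that] M by (intro mult_strict_left_mono)
      have "v \<le> e * M" using e by (simp add: M_def field_simps)
      also have "\<dots> \<le> 2 * e * M" using e M by simp
      finally show "v / (4 * M) \<le> e / 2" using M by (simp add: field_simps)
    qed
    also have "\<dots> = e" using M by simp
    finally show ?thesis .
  qed
  have "0 \<le> (LINT x|lborel. indicator (cball x0 (\<delta> n)) x * norm (b x) / \<delta> n)" for n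
    using \<delta>(1)[of n] by (intro Bochner_Integration.integral_nonneg) simp
  then have "norm ((LINT x|lborel. indicator (cball x0 (\<delta> n)) x * norm (b x) / \<delta> n) - 0) < e" if "n \<ge> N" for n
    unfolding real_norm_def diff_zero using bound[OF that] by (simp only: abs_of_nonneg)
  then show "\<exists>N. \<forall>n\<ge>N. norm ((LINT x|lborel. indicator (cball x0 (r / Suc n)) x * norm (b x) / (r / Suc n)) - 0) < e"
    unfolding \<delta>_def by blast
qed

text \<open>Split \<psi> into \<psi> X_n and \<psi> (1 - X_n), with cutoffs X_n shrinking to x0. The
  second part vanishes near x0 and pairs to 0. For the first, the terms containing X_n
  undifferentiated (\<open>p\<close>) vanish by dominated convergence, and the term containing grad
  X_n (\<open>q\<close>) is bounded by the mean in \<open>small_ball_average\<close>.\<close>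

lemma removable_point:
  assumes r: "r > 0" and sub: "cball x0 r \<subseteq> \<Omega>" and bb: "bounded_borel W" "bounded_borel Z"
    and zero: "\<And>\<psi>. \<psi> \<in> tests (ball x0 r - {x0}) \<Longrightarrow> pairing W Z \<psi> = 0"
    and \<psi>: "\<psi> \<in> tests (ball x0 r)"
  shows "pairing W Z \<psi> = 0"
proof -
  obtain K where K: "smooth \<psi>" "compact K" "K \<subseteq> ball x0 r" "\<And>x. x \<notin> K \<Longrightarrow> \<psi> x = 0" using tests_cases[OF \<psi>] by blast
  have \<psi>t: "\<psi> \<in> tests \<Omega>" by (rule tests_mono[OF \<psi>]) (use sub in force)
  obtain A where A: "A > 0" "\<And>(a::real ^ 2) r x v. r > 0 \<Longrightarrow> \<bar>fderiv (ball_cutoff a r) x v\<bar> \<le> A / r * norm v"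
    using ball_cutoff_fderiv_bound by metis
  obtain CW where CW: "\<And>x. \<bar>W x\<bar> \<le> CW" using bounded_borelD(2)[OF bb(1)] by blast
  obtain CZ where CZ: "\<And>x. \<bar>Z x\<bar> \<le> CZ" using bounded_borelD(2)[OF bb(2)] by blast
  obtain C where C: "C > 0" "\<And>x. \<bar>\<psi> x\<bar> \<le> C" using tests_bounded[OF \<psi>] by metis
  have CW0: "CW \<ge> 0" using CW[of undefined] by simp
  have [measurable]: "W \<in> borel_measurable borel" "Z \<in> borel_measurable borel" "\<psi> \<in> borel_measurable borel"
    using bounded_borelD(1)[OF bb(1)] bounded_borelD(1)[OF bb(2)] smooth_borel_measurable[OF K(1)] by auto
  define \<delta> where "\<delta> n = r / real (Suc n)" for n
  have \<delta>: "\<delta> n > 0" "\<delta> n \<le> r" for n using r by (auto simp: \<delta>_def divide_le_eq)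
  define X where "X n = ball_cutoff x0 (\<delta> n)" for n
  have X: "smooth (X n)" for n unfolding X_def by (rule smooth_ball_cutoff[OF \<delta>(1)])
  have Xb: "0 \<le> X n x" "X n x \<le> 1" for n x unfolding X_def by (rule ball_cutoff_bounds[OF \<delta>(1)])+
  have X0: "X n x = 0" if "x \<notin> cball x0 (\<delta> n)" for n x
    unfolding X_def by (rule ball_cutoff_eq_0[OF \<delta>(1)]) (use that in auto)
  have dX: "\<bar>fderiv (X n) x (b x)\<bar> \<le> A * (indicator (cball x0 (\<delta> n)) x * norm (b x) / \<delta> n)" for n x
    using A(2)[OF \<delta>(1), of x0 n x "b x"] fderiv_eq_0_outside[OF X0[of _ n] closed_cball, where x=x and v="b x"]
    by (cases "x \<in> cball x0 (\<delta> n)") (auto simp: X_def)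
  have [measurable]: "X n \<in> borel_measurable borel" for n by (rule smooth_borel_measurable[OF X])
  define p where "p x = W x * fderiv \<psi> x (b x) + Z x * \<psi> x" for x
  define q where "q n x = W x * \<psi> x * fderiv (X n) x (b x)" for n x
  have ip: "integrable lborel p" unfolding p_def
    by (intro Bochner_Integration.integrable_add pairing_integrable[OF bb \<psi>t])
  have t1: "(\<lambda>x. \<psi> x * X n x) \<in> tests \<Omega>" for n by (rule tests_mult(1)[OF \<psi>t X])
  have ipX: "integrable lborel (\<lambda>x. X n x * p x)" for n
    by (rule integrable_bounded_mult[OF ip, where C=1]) (use Xb in auto)
  have split: "W x * fderiv (\<lambda>x. \<psi> x * X n x) x (b x) + Z x * (\<psi> x * X n x) = X n x * p x + q n x" for n x
    unfolding fderiv_mult[OF K(1) X] p_def q_def by (simp add: algebra_simps)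
  have "integrable lborel (\<lambda>x. W x * fderiv (\<lambda>x. \<psi> x * X n x) x (b x) + Z x * (\<psi> x * X n x))" for n
    by (intro Bochner_Integration.integrable_add pairing_integrable[OF bb t1])
  then have ipq: "integrable lborel (\<lambda>x. X n x * p x + q n x)" for n unfolding split .
  have iq: "integrable lborel (q n)" for n
    using Bochner_Integration.integrable_diff[OF ipq[of n] ipX[of n]] by simp
  have eq: "pairing W Z \<psi> = (LINT x|lborel. X n x * p x) + (LINT x|lborel. q n x)" for n
  proof -
    have sm: "smooth (\<lambda>x. 1 - X n x)" by (rule smooth_diff[OF smooth_const X])
    have t2: "(\<lambda>x. \<psi> x * (1 - X n x)) \<in> tests (ball x0 r - {x0})"
    proof (rule testsI[OF smooth_mult[OF K(1) sm], where K="K - ball x0 (\<delta> n / 2)"])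
      show "compact (K - ball x0 (\<delta> n / 2))" using K(2) by (rule compact_diff) simp
      show "K - ball x0 (\<delta> n / 2) \<subseteq> ball x0 r - {x0}" using K(3) \<delta>(1)[of n] by auto
      show "\<psi> x * (1 - X n x) = 0" if "x \<notin> K - ball x0 (\<delta> n / 2)" for x
        using that K(4)[of x] ball_cutoff_eq_1[OF \<delta>(1), of x0 x n] by (auto simp: X_def)
    qed
    have "(\<lambda>x. \<psi> x * (1 - X n x)) \<in> tests \<Omega>" by (rule tests_mono[OF t2]) (use sub in force)
    from pairing_add[OF bb t1[of n] this]
    have "pairing W Z \<psi> = pairing W Z (\<lambda>x. \<psi> x * X n x)" using zero[OF t2] by (simp add: algebra_simps)
    also have "\<dots> = (LINT x|lborel. X n x * p x) + (LINT x|lborel. q n x)"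
      unfolding pairing_def split by (rule Bochner_Integration.integral_add[OF ipX iq])
    finally show ?thesis .
  qed
  have lim1: "(\<lambda>n. LINT x|lborel. X n x * p x) \<longlonglongrightarrow> (LINT x|(lborel :: (real ^ 2) measure). 0)"
  proof (rule integral_dominated_convergence[where w="\<lambda>x. \<bar>p x\<bar>"])
    show "AE x in lborel. norm (X n x * p x) \<le> \<bar>p x\<bar>" for n
      using Xb by (intro AE_I2) (simp add: abs_mult mult_left_le_one_le)
    have "AE x in lborel. x \<noteq> x0" by (rule AE_lborel_singleton)
    then show "AE x in lborel. (\<lambda>n. X n x * p x) \<longlonglongrightarrow> 0"
    proof eventually_elim
      case (elim x)
      have "\<delta> \<longlonglongrightarrow> 0" unfolding \<delta>_def by (rule LIMSEQ_Suc[OF lim_const_over_n])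
      then have "\<forall>\<^sub>F n in sequentially. \<delta> n < dist x0 x" using elim by (intro order_tendstoD) auto
      then have "\<forall>\<^sub>F n in sequentially. X n x * p x = 0" by eventually_elim (simp add: X0)
      then show ?case by (rule tendsto_eventually)
    qed
  qed (use ip ipX in auto)
  have lim2: "(\<lambda>n. LINT x|lborel. q n x) \<longlonglongrightarrow> 0"
  proof (rule Lim_null_comparison)
    have "norm (LINT x|lborel. q n x) \<le> CW * C * A * (LINT x|lborel. indicator (cball x0 (\<delta> n)) x * norm (b x) / \<delta> n)" for n
    proof -
      have sub': "cball x0 (\<delta> n) \<subseteq> \<Omega>" using sub subset_cball[OF \<delta>(2)] by blast
      have ii: "integrable lborel (\<lambda>x. CW * C * A * (indicator (cball x0 (\<delta> n)) x * norm (b x) / \<delta> n))"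
        using b_L1[OF compact_cball sub'] by simp
      have "\<bar>q n x\<bar> \<le> CW * C * A * (indicator (cball x0 (\<delta> n)) x * norm (b x) / \<delta> n)" for x
      proof -
        have "\<bar>W x\<bar> * \<bar>\<psi> x\<bar> \<le> CW * C" by (rule mult_mono[OF CW C(2) CW0]) simp
        then have "\<bar>W x\<bar> * \<bar>\<psi> x\<bar> * \<bar>fderiv (X n) x (b x)\<bar> \<le> CW * C * (A * (indicator (cball x0 (\<delta> n)) x * norm (b x) / \<delta> n))"
          by (rule mult_mono[OF _ dX]) (use CW0 C(1) in auto)
        then show ?thesis by (simp add: q_def abs_mult mult.assoc)
      qed
      then have "norm (LINT x|lborel. q n x) \<le> (LINT x|lborel. CW * C * A * (indicator (cball x0 (\<delta> n)) x * norm (b x) / \<delta> n))"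
        by (intro Bochner_Integration.integral_norm_bound_integral[OF iq ii]) simp
      then show ?thesis by simp
    qed
    then show "\<forall>\<^sub>F n in sequentially. norm (LINT x|lborel. q n x) \<le> CW * C * A * (LINT x|lborel. indicator (cball x0 (\<delta> n)) x * norm (b x) / \<delta> n)" by simp
    show "(\<lambda>n. CW * C * A * (LINT x|lborel. indicator (cball x0 (\<delta> n)) x * norm (b x) / \<delta> n)) \<longlonglongrightarrow> 0"
      using tendsto_mult_right_zero[OF small_ball_average[OF r sub]] unfolding \<delta>_def by blast
  qed
  have "(\<lambda>n. pairing W Z \<psi>) \<longlonglongrightarrow> 0 + 0"
    unfolding eq[of "n" for n, abs_def] using tendsto_add[OF lim1 lim2] eq by simp
  then show ?thesis by (simp add: LIMSEQ_const_iff)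
qed

text \<open>Each point of \<Omega> has a ball on whose test functions the pairing vanishes: by
  \<open>local_product\<close> at good points, by \<open>removable_point\<close> at exceptional
  ones. The partition argument then joins these balls.\<close>

theorem weak_div_product:
  assumes iso: "discrete {x \<in> \<Omega>. \<not> good x}"
    and bb: "bounded_borel U" "bounded_borel F" "bounded_borel V" "bounded_borel G"
    and UF: "weak_div \<Omega> b U F" and VG: "weak_div \<Omega> b V G"
  shows "weak_div \<Omega> b (\<lambda>x. U x * V x) (\<lambda>x. F x * V x + G x * U x)"
proof -
  let ?W = "\<lambda>x. U x * V x" and ?Z = "\<lambda>x. F x * V x + G x * U x"
  have WZ: "bounded_borel ?W" "bounded_borel ?Z"
    by (intro bounded_borel_mult bounded_borel_add bb)+
  have add: "pairing ?W ?Z (\<lambda>x. f x + g x) = pairing ?W ?Z f + pairing ?W ?Z g"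
    if "f \<in> tests S" "g \<in> tests S" "S \<subseteq> \<Omega>" for f g S
    using that by (intro pairing_add WZ) (auto intro: tests_mono)
  have loc: "\<exists>r>0. \<forall>f\<in>tests (\<Omega> \<inter> ball x r). pairing ?W ?Z f = 0" if x: "x \<in> \<Omega>" for x
  proof (cases "good x")
    case True
    then show ?thesis by (rule local_product[OF _ bb UF VG])
  next
    case False
    then have "x isolated_in {x \<in> \<Omega>. \<not> good x}" using iso x by (auto simp: discrete_def)
    then obtain T where T: "open T" "T \<inter> {x \<in> \<Omega>. \<not> good x} = {x}" unfolding isolated_in_def by blast
    then have "open (T \<inter> \<Omega>)" "x \<in> T \<inter> \<Omega>" using open_domain x by auto
    then obtain r where r: "r > 0" "cball x r \<subseteq> T \<inter> \<Omega>" by (meson open_contains_cball)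
    \<comment> \<open>\<open>T\<close> meets the exceptional set only at \<open>x\<close>, so all
      other points of the ball are good and the locality principle applies on the punctured
      ball.\<close>
    have zero: "pairing ?W ?Z \<psi> = 0" if "\<psi> \<in> tests (ball x r - {x})" for \<psi>
    proof (rule tests_locally_zero_imp_zero[where L="pairing ?W ?Z" and S="ball x r - {x}"])
      have sub: "ball x r - {x} \<subseteq> \<Omega>" using r by force
      show "pairing ?W ?Z (\<lambda>x. f x + g x) = pairing ?W ?Z f + pairing ?W ?Z g"
        if "f \<in> tests (ball x r - {x})" "g \<in> tests (ball x r - {x})" for f g
        using add[OF that sub] .
      show "\<exists>ra>0. \<forall>f\<in>tests ((ball x r - {x}) \<inter> ball y ra). pairing ?W ?Z f = 0" if y: "y \<in> ball x r - {x}" for y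
      proof -
        have "y \<in> T \<inter> \<Omega>" using y r by (auto simp: subset_iff)
        then have "good y" using T y by blast
        from local_product[OF this bb UF VG] obtain ra where "ra > 0" "\<forall>\<psi>\<in>tests (\<Omega> \<inter> ball y ra). pairing ?W ?Z \<psi> = 0" by blast
        moreover have "(ball x r - {x}) \<inter> ball y ra \<subseteq> \<Omega> \<inter> ball y ra" using sub by blast
        ultimately show ?thesis using tests_mono by blast
      qed
    qed fact
    have "pairing ?W ?Z f = 0" if "f \<in> tests (\<Omega> \<inter> ball x r)" for f
    proof (rule removable_point[OF r(1) _ WZ zero])
      show "cball x r \<subseteq> \<Omega>" using r by blast
      show "f \<in> tests (ball x r)" using that by (rule tests_mono) auto
    qed
    then show ?thesis using r(1) by blast
  qed
  have "pairing ?W ?Z \<psi> = 0" if "\<psi> \<in> tests \<Omega>" for \<psi>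
    by (rule tests_locally_zero_imp_zero[where L="pairing ?W ?Z", OF _ loc that]) (auto intro: add)
  then show ?thesis by (simp add: weak_div_iff_pairing[OF WZ])
qed

end

subsection \<open>Transport equation and mollification in time\<close>

lemma integrable_tensor:
  fixes f :: "'a::euclidean_space \<Rightarrow> real" and g :: "'b::euclidean_space \<Rightarrow> real"
  assumes "integrable lborel f" "integrable lborel g"
  shows "integrable lborel (\<lambda>z. f (fst z) * g (snd z))"
proof -
  have [measurable]: "f \<in> borel_measurable borel" "g \<in> borel_measurable borel" using assms by auto
  have "integrable (lborel \<Otimes>\<^sub>M lborel) (\<lambda>z. f (fst z) * g (snd z))"
    by (rule lborel_pair.Fubini_integrable) (use assms in \<open>auto simp: abs_mult\<close>)
  then show ?thesis by (simp add: lborel_prod)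
qed

lemma lborel_Fubini:
  fixes f :: "'a::euclidean_space \<times> 'b::euclidean_space \<Rightarrow> real"
  assumes "integrable lborel f"
  shows "(LINT z|lborel. f z) = (LINT x|lborel. LINT y|lborel. f (x, y))"
    and "(LINT z|lborel. f z) = (LINT y|lborel. LINT x|lborel. f (x, y))"
    and "integrable lborel (\<lambda>x. LINT y|lborel. f (x, y))"
    and "integrable lborel (\<lambda>y. LINT x|lborel. f (x, y))"
proof -
  have i: "integrable (lborel \<Otimes>\<^sub>M lborel) (case_prod (\<lambda>x y. f (x, y)))" using assms by (simp add: lborel_prod case_prod_unfold)
  show "(LINT z|lborel. f z) = (LINT x|lborel. LINT y|lborel. f (x, y))"
    using lborel_pair.integral_fst[OF i] by (simp add: lborel_prod case_prod_unfold)
  show "(LINT z|lborel. f z) = (LINT y|lborel. LINT x|lborel. f (x, y))"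
    using lborel_pair.integral_snd[OF i] by (simp add: lborel_prod case_prod_unfold)
  show "integrable lborel (\<lambda>x. LINT y|lborel. f (x, y))" using lborel_pair.integrable_fst[OF i] by simp
  show "integrable lborel (\<lambda>y. LINT x|lborel. f (x, y))" using lborel_pair.integrable_snd[OF i] by simp
qed

text \<open>The mollifier is supported in \<open>[-1/(n+1), 0]\<close>, so that mollified solutions depend on later times only and
  satisfy an equation up to time \<open>0\<close>.\<close>

definition time_kernel :: "nat \<Rightarrow> real \<Rightarrow> real" where
  "time_kernel n s = real (Suc n) * deriv smooth_step (- real (Suc n) * s)"

lemma time_kernel:
  shows time_kernel_tests: "time_kernel n \<in> tests UNIV"
    and time_kernel_support: "s \<ge> 0 \<or> s \<le> - (1 / Suc n) \<Longrightarrow> time_kernel n s = 0"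
    and approx_identity_time_kernel: "approx_identity time_kernel"
proof -
  note sm = smooth_deriv[OF smooth_smooth_step]
  have d: "(smooth_step has_real_derivative deriv smooth_step s) (at s)" for s
    by (rule smooth_has_real_derivative[OF smooth_smooth_step])
  have nonneg: "deriv smooth_step s \<ge> 0" for s
    by (rule mono_on_imp_deriv_nonneg[of UNIV smooth_step]) (use mono_smooth_step d in \<open>auto simp: mono_def intro!: mono_onI\<close>)
  have lt: "deriv smooth_step s = 0" if "s < 0 \<or> s > 1" for s
  proof -
    have "fderiv smooth_step s 1 = 0"
    proof (cases "s < 0")
      case True
      then show ?thesis by (intro fderiv_eq_0_locally_const[of "{..<0}" _ 0]) (auto simp: smooth_step_eq_0)
    next
      case False
      then show ?thesis using that by (intro fderiv_eq_0_locally_const[of "{1<..}" _ 1]) (auto simp: smooth_step_eq_1)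
    qed
    then show ?thesis by (simp add: fderiv_real[OF smooth_smooth_step])
  qed
  \<comment> \<open>The end points are extrema of the step, so its derivative vanishes there too.
    The kernel is thereby exactly 0 at time 0, not only at positive times.\<close>
  have "deriv smooth_step 0 = 0"
  proof (rule DERIV_local_min[OF d])
    show "(0::real) < 1" by simp
  qed (simp add: smooth_step_eq_0 smooth_step_bounds)
  moreover have "deriv smooth_step 1 = 0"
  proof (rule DERIV_local_max[OF d])
    show "(0::real) < 1" by simp
  qed (simp add: smooth_step_eq_1 smooth_step_bounds)
  ultimately have out: "deriv smooth_step s = 0" if "s \<le> 0 \<or> s \<ge> 1" for s
    using lt[of s] that by (cases "s = 0 \<or> s = 1") auto
  show supp: "time_kernel n s = 0" if "s \<ge> 0 \<or> s \<le> - (1 / Suc n)" for n s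
  proof -
    have "- real (Suc n) * s \<le> 0 \<or> - real (Suc n) * s \<ge> 1"
    proof (cases "s \<ge> 0")
      case False
      then have "real (Suc n) * s \<le> real (Suc n) * - (1 / Suc n)" using that by (intro mult_left_mono) auto
      moreover have "real (Suc n) * - (1 / Suc n) = - 1" by simp
      moreover have "- real (Suc n) * s = - (real (Suc n) * s)" by (rule minus_mult_left[symmetric])
      ultimately show ?thesis by linarith
    next
      case True
      then have "real (Suc n) * s \<ge> 0" by (intro mult_nonneg_nonneg) auto
      moreover have "- real (Suc n) * s = - (real (Suc n) * s)" by (rule minus_mult_left[symmetric])
      ultimately show ?thesis by linarith
    qed
    then show ?thesis unfolding time_kernel_def by (simp only: out mult_zero_right)
  qed
  have lin: "linear (\<lambda>s::real. - real (Suc n) * s)" for n by (rule linearI) (simp_all add: algebra_simps)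
  have smk: "smooth (time_kernel n)" for n
    unfolding time_kernel_def[abs_def]
    using smooth_mult[OF smooth_const[of "real (Suc n)"] smooth_comp_affine(1)[OF sm lin[of n], of 0]]
    by (simp only: add_0_right)
  show t: "time_kernel n \<in> tests UNIV" for n
    by (rule testsI[OF smk, of "{- (1 / Suc n)..0}"]) (auto intro!: supp)
  have "(LINT s|lborel. time_kernel n s) = 1" for n
  proof -
    let ?F = "\<lambda>s. - smooth_step (- real (Suc n) * s)"
    have dF: "(?F has_real_derivative time_kernel n s) (at s)" for s
      unfolding time_kernel_def by (auto intro!: derivative_eq_intros DERIV_chain2[OF d] simp: algebra_simps)
    have "(LINT s|lborel. time_kernel n s * indicator {- 1..0} s) = ?F 0 - ?F (- 1)"
      using smooth_continuous[OF smk, of UNIV n]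
      by (intro integral_FTC_Icc_real dF) (auto simp: continuous_on_eq_continuous_at)
    moreover have "time_kernel n s * indicator {- 1..0} s = time_kernel n s" for s
    proof (cases "s \<in> {- 1..0}")
      case False
      have "1 / real (Suc n) \<le> 1" by simp
      moreover have "s < - 1 \<or> s > 0" using False by auto
      ultimately have "s \<ge> 0 \<or> s \<le> - (1 / real (Suc n))" by linarith
      then show ?thesis using supp[of s n] by simp
    qed simp
    ultimately show ?thesis by (simp add: smooth_step_eq_0 smooth_step_eq_1)
  qed
  then show "approx_identity time_kernel"
    unfolding approx_identity_def
  proof (intro allI conjI impI)
    show "0 \<le> time_kernel n s" for n s unfolding time_kernel_def by (intro mult_nonneg_nonneg nonneg) simp
    show "time_kernel n s = 0" if "1 / real (Suc n) \<le> norm s" for n s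
      using that by (intro supp) (auto simp: abs_if split: if_splits)
  qed (use t in auto)
qed

lemma tests_spacetime:
  fixes \<phi> :: "real \<times> 'a::euclidean_space \<Rightarrow> real"
  assumes "\<phi> \<in> tests (UNIV \<times> \<Omega>)"
  obtains T K where "T > 0" "compact K" "K \<subseteq> \<Omega>" "\<And>t x. \<bar>t\<bar> > T \<Longrightarrow> \<phi> (t, x) = 0" "\<And>t x. x \<notin> K \<Longrightarrow> \<phi> (t, x) = 0"
proof -
  obtain L where L: "compact L" "L \<subseteq> UNIV \<times> \<Omega>" "\<And>z. z \<notin> L \<Longrightarrow> \<phi> z = 0" using tests_cases[OF assms] by blast
  have "compact (fst ` L)" "compact (snd ` L)"
    by (intro compact_continuous_image L continuous_intros)+
  from compact_imp_bounded[OF this(1)]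
  obtain T where "T > 0" "\<forall>t\<in>fst ` L. norm t \<le> T" unfolding bounded_pos by blast
  with L that[of T "snd ` L"] \<open>compact (snd ` L)\<close> show ?thesis by (force simp: subset_iff)
qed

lemma tests_slice:
  fixes \<phi> :: "real \<times> 'a::euclidean_space \<Rightarrow> real"
  assumes "\<phi> \<in> tests (UNIV \<times> \<Omega>)"
  shows "(\<lambda>x. \<phi> (t, x)) \<in> tests \<Omega>" "fderiv (\<lambda>x. \<phi> (t, x)) x v = fderiv \<phi> (t, x) (0, v)"
    and "smooth (\<lambda>t. \<phi> (t, x))" "deriv (\<lambda>t. \<phi> (t, x)) t = fderiv \<phi> (t, x) (1, 0)"
proof -
  have sm: "smooth \<phi>" using assms by (rule testsD)
  have l1: "linear (\<lambda>x::'a. (0::real, x))" and l2: "linear (\<lambda>t::real. (t, 0::'a))" by (auto simp: linear_iff)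
  obtain T K where K: "compact K" "K \<subseteq> \<Omega>" "\<And>t x. x \<notin> K \<Longrightarrow> \<phi> (t, x) = 0" using tests_spacetime[OF assms] by metis
  have s1: "smooth (\<lambda>x. \<phi> (t, x))" using smooth_comp_affine(1)[OF sm l1, of "(t, 0)"] by simp
  show "(\<lambda>x. \<phi> (t, x)) \<in> tests \<Omega>" by (rule testsI[OF s1 K(1,2)]) (rule K(3))
  show "fderiv (\<lambda>x. \<phi> (t, x)) x v = fderiv \<phi> (t, x) (0, v)"
    using smooth_comp_affine(2)[OF sm l1, of "(t, 0)" x v] by simp
  show s2: "smooth (\<lambda>t. \<phi> (t, x))" using smooth_comp_affine(1)[OF sm l2, of "(0, x)"] by simp
  show "deriv (\<lambda>t. \<phi> (t, x)) t = fderiv \<phi> (t, x) (1, 0)"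
    using smooth_comp_affine(2)[OF sm l2, of "(0, x)" t 1] fderiv_real[OF s2, of t 1] by simp
qed

lemma tests_time_times_space:
  fixes \<psi> :: "'a::euclidean_space \<Rightarrow> real"
  assumes \<theta>: "\<theta> \<in> tests (UNIV :: real set)" and \<psi>: "\<psi> \<in> tests \<Omega>"
  shows "(\<lambda>z. \<theta> (fst z) * \<psi> (snd z)) \<in> tests (UNIV \<times> \<Omega>)"
    and "fderiv (\<lambda>z. \<theta> (fst z) * \<psi> (snd z)) z (1, v) = deriv \<theta> (fst z) * \<psi> (snd z) + \<theta> (fst z) * fderiv \<psi> (snd z) v"
proof -
  obtain K where K: "smooth \<theta>" "compact K" "\<And>x. x \<notin> K \<Longrightarrow> \<theta> x = 0" using tests_cases[OF \<theta>] by blast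
  obtain L where L: "smooth \<psi>" "compact L" "L \<subseteq> \<Omega>" "\<And>x. x \<notin> L \<Longrightarrow> \<psi> x = 0" using tests_cases[OF \<psi>] by blast
  have lin: "linear (fst :: real \<times> 'a \<Rightarrow> real)" "linear (snd :: real \<times> 'a \<Rightarrow> 'a)" by (auto simp: linear_iff)
  have sm: "smooth (\<lambda>z::real \<times> 'a. \<theta> (fst z))" "smooth (\<lambda>z::real \<times> 'a. \<psi> (snd z))"
    using smooth_comp_affine(1)[OF K(1) lin(1), of 0] smooth_comp_affine(1)[OF L(1) lin(2), of 0] by auto
  have d: "fderiv (\<lambda>z. \<theta> (fst z)) z w = fderiv \<theta> (fst z) (fst w)" "fderiv (\<lambda>z. \<psi> (snd z)) z w = fderiv \<psi> (snd z) (snd w)"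
    for w :: "real \<times> 'a"
    using smooth_comp_affine(2)[OF K(1) lin(1), of 0] smooth_comp_affine(2)[OF L(1) lin(2), of 0] by auto
  show "(\<lambda>z. \<theta> (fst z) * \<psi> (snd z)) \<in> tests (UNIV \<times> \<Omega>)"
  proof (rule testsI[OF smooth_mult[OF sm], of "K \<times> L"])
    show "compact (K \<times> L)" by (rule compact_Times[OF K(2) L(2)])
    show "\<theta> (fst z) * \<psi> (snd z) = 0" if "z \<notin> K \<times> L" for z
      using that K(3)[of "fst z"] L(4)[of "snd z"] by (auto simp: mem_Times_iff)
  qed (use L(3) in auto)
  show "fderiv (\<lambda>z. \<theta> (fst z) * \<psi> (snd z)) z (1, v) = deriv \<theta> (fst z) * \<psi> (snd z) + \<theta> (fst z) * fderiv \<psi> (snd z) v"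
    unfolding fderiv_mult[OF sm] d by (simp add: fderiv_real K)
qed

section \<open>The weak transport equation in space-time\<close>

context l2_field
begin

text \<open>The derivative of \<phi> along the space-time vector (1, b) combines its time derivative
  with b . grad \<phi>, so one directional derivative expresses the whole operator.\<close>

definition transport_pair :: "(real ^ 2 \<Rightarrow> real) \<Rightarrow> (real \<times> (real ^ 2) \<Rightarrow> real) \<Rightarrow> bool" where
  "transport_pair u0 u \<longleftrightarrow> (\<forall>\<phi>\<in>tests (UNIV \<times> \<Omega>).
     (LINT z|lborel. indicator {0..} (fst z) * (u z * fderiv \<phi> z (1, b (snd z)))) = - (LINT x|lborel. u0 x * \<phi> (0, x)))"

lemma fderiv_1_b:
  fixes \<phi> :: "real \<times> (real ^ 2) \<Rightarrow> real"
  assumes "smooth \<phi>"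
  shows "(\<lambda>z. fderiv \<phi> z (1, b (snd z))) \<in> borel_measurable borel"
    and "fderiv \<phi> z (1, v) = fderiv \<phi> z (1, 0) + fderiv \<phi> z (0, v)"
proof -
  note lin = linear_fderiv[OF assms]
  have "fderiv \<phi> z (1, b (snd z)) = fderiv \<phi> z (1, 0) + (\<Sum>e\<in>Basis. (b (snd z) \<bullet> e) * fderiv \<phi> z (0, e))" for z
  proof -
    have "(1, b (snd z)) = (1, 0) + (\<Sum>e\<in>Basis. (b (snd z) \<bullet> e) *\<^sub>R (0, e))"
      by (simp add: prod_eq_iff fst_sum snd_sum euclidean_representation)
    from arg_cong[where f="fderiv \<phi> z", OF this] show ?thesis unfolding linear_add[OF lin] linear_sum[OF lin] linear.scaleR[OF lin] by simp
  qed
  moreover have [measurable]: "(\<lambda>z. fderiv \<phi> z e) \<in> borel_measurable borel" for e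
    by (intro smooth_borel_measurable smooth_fderiv assms)
  ultimately show "(\<lambda>z. fderiv \<phi> z (1, b (snd z))) \<in> borel_measurable borel" by simp
  show "fderiv \<phi> z (1, v) = fderiv \<phi> z (1, 0) + fderiv \<phi> z (0, v)"
    using linear_add[OF lin, of z "(1, 0)" "(0, v)"] by simp
qed

lemma integrable_fderiv_1_b:
  fixes \<phi> :: "real \<times> (real ^ 2) \<Rightarrow> real"
  assumes \<phi>: "\<phi> \<in> tests (UNIV \<times> \<Omega>)"
  shows "integrable lborel (\<lambda>z. fderiv \<phi> z (1, b (snd z)))"
proof -
  obtain T K where K: "T > 0" "compact K" "K \<subseteq> \<Omega>" "\<And>t x. \<bar>t\<bar> > T \<Longrightarrow> \<phi> (t, x) = 0" "\<And>t x. x \<notin> K \<Longrightarrow> \<phi> (t, x) = 0"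
    using tests_spacetime[OF \<phi>] by metis
  obtain C where C: "C > 0" "\<And>z v. \<bar>fderiv \<phi> z v\<bar> \<le> C * norm v" using tests_fderiv_bounded[OF \<phi>] by metis
  have iK: "integrable lborel (indicator K :: _ \<Rightarrow> real)"
    using emeasure_compact_finite[OF K(2)] K(2) by (auto simp: borel_compact)
  have zero: "\<phi> z = 0" if "z \<notin> {- T..T} \<times> K" for z
    using that K(4)[of "fst z" "snd z"] K(5)[of "snd z" "fst z"] by (cases z) auto
  have cl: "closed ({- T..T} \<times> K)" using K(2) by (intro closed_Times compact_imp_closed) auto
  have le: "\<bar>fderiv \<phi> z (1, b (snd z))\<bar> \<le> C * (indicator {- T..T} (fst z) * (indicator K (snd z) + indicator K (snd z) * norm (b (snd z))))" for z
  proof (cases "z \<in> {- T..T} \<times> K")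
    case True
    have "\<bar>fderiv \<phi> z (1, b (snd z))\<bar> \<le> C * norm (1::real, b (snd z))" by (rule C)
    also have "\<dots> \<le> C * (1 + norm (b (snd z)))"
      using norm_Pair_le[of "1::real" "b (snd z)"] C(1) by (intro mult_left_mono) auto
    finally show ?thesis using True by (simp add: mem_Times_iff)
  next
    case False
    then show ?thesis using fderiv_eq_0_outside[OF zero cl False] C(1) by simp
  qed
  show ?thesis
  proof (rule Bochner_Integration.integrable_bound)
    show "integrable lborel (\<lambda>z. C * (indicator {- T..T} (fst z) * (indicator K (snd z) + indicator K (snd z) * norm (b (snd z)))))"
      by (intro integrable_mult_right integrable_tensor integrable_indicator_Icc Bochner_Integration.integrable_add iK b_L1 K)
    show "AE z in lborel. norm (fderiv \<phi> z (1, b (snd z))) \<le> norm (C * (indicator {- T..T} (fst z) * (indicator K (snd z) + indicator K (snd z) * norm (b (snd z)))))"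
      unfolding real_norm_def by (rule AE_I2) (rule order_trans[OF le abs_ge_self])
  qed (use fderiv_1_b(1)[OF testsD(1)[OF \<phi>]] in simp)
qed


text \<open>Mollification at time t uses only times in [t, t + 1]. For 0 \<le> t \<le> T + 1 these
  lie in [0, T + 2], so the truncation leaves the mollified function unchanged there and makes every
  time line integrable.\<close>

definition cut :: "real \<Rightarrow> (real \<times> (real ^ 2) \<Rightarrow> real) \<Rightarrow> real \<times> (real ^ 2) \<Rightarrow> real" where
  "cut T u z = indicator {0..T + 2} (fst z) * u z"

definition tmoll :: "real \<Rightarrow> nat \<Rightarrow> (real \<times> (real ^ 2) \<Rightarrow> real) \<Rightarrow> real \<times> (real ^ 2) \<Rightarrow> real" where
  "tmoll T n u z = conv (time_kernel n) (\<lambda>s. cut T u (s, snd z)) (fst z)"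

text \<open>Minus the time derivative of \<open>tmoll\<close>: with this sign it is directly the
  right-hand side of the divergence equation at a fixed time.\<close>

definition tmoll' :: "real \<Rightarrow> nat \<Rightarrow> (real \<times> (real ^ 2) \<Rightarrow> real) \<Rightarrow> real \<times> (real ^ 2) \<Rightarrow> real" where
  "tmoll' T n u z = - conv (deriv (time_kernel n)) (\<lambda>s. cut T u (s, snd z)) (fst z)"

lemma bounded_borel_cut: "bounded_borel u \<Longrightarrow> bounded_borel (cut T u)"
  unfolding cut_def[abs_def] by (rule bounded_borel_mult) (auto simp: bounded_borel_def indicator_def intro!: exI[of _ 1])

lemma cut_abs_le: "(\<And>z. \<bar>u z\<bar> \<le> C) \<Longrightarrow> \<bar>cut T u z\<bar> \<le> C"
proof -
  assume a: "\<And>z. \<bar>u z\<bar> \<le> C"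
  then have "C \<ge> 0" by (meson abs_ge_zero order_trans)
  then show ?thesis using a[of z] by (simp add: cut_def indicator_def)
qed

lemma integrable_cut:
  assumes "bounded_borel u"
  shows "integrable lborel (\<lambda>s. cut T u (s, x))"
proof -
  have [measurable]: "u \<in> borel_measurable borel" by (rule bounded_borelD(1)[OF assms])
  obtain C where C: "\<And>z. \<bar>u z\<bar> \<le> C" using bounded_borelD(2)[OF assms] by blast
  have "integrable lborel (\<lambda>s. u (s, x) * indicator {0..T + 2} s)"
    by (rule integrable_bounded_mult[OF integrable_indicator_Icc _ C]) measurable
  then show ?thesis by (simp add: cut_def mult.commute)
qed

lemma tmoll_bounded_borel:
  assumes "bounded_borel u"
  shows "bounded_borel (tmoll T n u)" "bounded_borel (tmoll' T n u)"
    and "(\<And>z. \<bar>u z\<bar> \<le> C) \<Longrightarrow> \<bar>tmoll T n u z\<bar> \<le> C"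
proof -
  have [measurable]: "cut T u \<in> borel_measurable borel" by (rule bounded_borelD(1)[OF bounded_borel_cut[OF assms]])
  have sm: "smooth (time_kernel n)" by (rule testsD(1)[OF time_kernel_tests])
  have [measurable]: "time_kernel n \<in> borel_measurable borel" "deriv (time_kernel n) \<in> borel_measurable borel"
    by (intro smooth_borel_measurable sm smooth_deriv)+
  show *: "\<bar>tmoll T n u z\<bar> \<le> C" if "\<And>z. \<bar>u z\<bar> \<le> C" for z C
    unfolding tmoll_def by (rule conv_abs_le[OF approx_identity_time_kernel integrable_cut[OF assms] cut_abs_le[OF that]])
  obtain C where C: "\<And>z. \<bar>u z\<bar> \<le> C" using bounded_borelD(2)[OF assms] by blast
  have "tmoll T n u \<in> borel_measurable borel"
    unfolding tmoll_def[abs_def] conv_def by measurable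
  then show "bounded_borel (tmoll T n u)" unfolding bounded_borel_def using *[OF C] by blast
  have dt: "deriv (time_kernel n) \<in> tests UNIV" by (rule deriv_tests[OF time_kernel_tests])
  have "\<bar>tmoll' T n u z\<bar> \<le> C * (LINT s|lborel. \<bar>deriv (time_kernel n) s\<bar>)" for z
  proof -
    have i: "integrable lborel (\<lambda>s. \<bar>deriv (time_kernel n) (fst z - s)\<bar>)"
      using integrable_reflect_lborel[OF tests_integrable[OF dt], of "fst z"] by simp
    have "\<bar>tmoll' T n u z\<bar> = \<bar>LINT s|lborel. deriv (time_kernel n) (fst z - s) * cut T u (s, snd z)\<bar>"
      by (simp add: tmoll'_def conv_def)
    also have "\<dots> \<le> (LINT s|lborel. \<bar>deriv (time_kernel n) (fst z - s) * cut T u (s, snd z)\<bar>)" by (rule integral_abs_bound)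
    also have "\<dots> \<le> (LINT s|lborel. C * \<bar>deriv (time_kernel n) (fst z - s)\<bar>)"
    proof (rule integral_mono)
      show "integrable lborel (\<lambda>s. \<bar>deriv (time_kernel n) (fst z - s) * cut T u (s, snd z)\<bar>)"
        by (rule integrable_abs[OF integrable_conv_integrand[OF dt integrable_cut[OF assms]]])
      show "\<bar>deriv (time_kernel n) (fst z - s) * cut T u (s, snd z)\<bar> \<le> C * \<bar>deriv (time_kernel n) (fst z - s)\<bar>" for s
        unfolding abs_mult using cut_abs_le[OF C] by (subst mult.commute) (intro mult_right_mono, auto)
    qed (use i in simp)
    also have "\<dots> = C * (LINT s|lborel. \<bar>deriv (time_kernel n) s\<bar>)"
      using integral_reflect_lborel[of "\<lambda>s. \<bar>deriv (time_kernel n) s\<bar>" "fst z"] by simp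
    finally show ?thesis .
  qed
  moreover have "tmoll' T n u \<in> borel_measurable borel"
    unfolding tmoll'_def[abs_def] conv_def by measurable
  ultimately show "bounded_borel (tmoll' T n u)" unfolding bounded_borel_def by blast
qed

lemma bounded_borel_slice:
  assumes "bounded_borel w"
  shows "bounded_borel (\<lambda>x. w (t, x))"
proof -
  have [measurable]: "w \<in> borel_measurable borel" by (rule bounded_borelD(1)[OF assms])
  show ?thesis using bounded_borelD(2)[OF assms] unfolding bounded_borel_def by auto
qed

text \<open>Test the transport equation with \<open>time_kernel n (t - s) * \<psi> x\<close>. At s =
  0 this contains \<open>time_kernel n t\<close>, which is 0 for t \<ge> 0, so the initial datum
  drops out and the equation holds up to and including t = 0.\<close>

lemma tmoll_weak_div:
  assumes u: "bounded_borel u" and tp: "transport_pair u0 u" and t: "0 \<le> t" "t \<le> T + 1"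
  shows "weak_div \<Omega> b (\<lambda>x. tmoll T n u (t, x)) (\<lambda>x. tmoll' T n u (t, x))"
  unfolding weak_div_def
proof
  fix \<psi> assume \<psi>: "\<psi> \<in> tests \<Omega>"
  let ?k = "time_kernel n" and ?w = "cut T u"
  have sm: "smooth ?k" by (rule testsD(1)[OF time_kernel_tests])
  have lin: "linear (uminus :: real \<Rightarrow> real)" by (rule linear_uminus)
  define \<theta> where "\<theta> s = ?k (- s + t)" for s
  have s\<theta>: "smooth \<theta>" unfolding \<theta>_def by (rule smooth_comp_affine(1)[OF sm lin])
  have k0: "?k r = 0" if "r \<ge> 0 \<or> r \<le> - 1" for r
  proof (rule time_kernel_support)
    have "1 / real (Suc n) \<le> 1" by simp
    then show "r \<ge> 0 \<or> r \<le> - (1 / Suc n)" using that by linarith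
  qed
  have dk0: "deriv ?k r = 0" if "r < - 1" for r
  proof -
    have "fderiv ?k r 1 = 0" by (rule fderiv_eq_0_locally_const[of "{..< -1}" _ 0]) (use that k0 in auto)
    then show ?thesis by (simp add: fderiv_real[OF sm])
  qed
  have \<theta>: "\<theta> \<in> tests UNIV" by (rule testsI[OF s\<theta>, of "{t..t + 1}"]) (auto simp: \<theta>_def intro!: k0)
  have d\<theta>: "deriv \<theta> s = - deriv ?k (t - s)" for s
    using smooth_comp_affine(2)[OF sm lin, of t s 1] fderiv_real[OF s\<theta>, of s 1] fderiv_real[OF sm, of "t - s" "- 1"]
    by (simp add: \<theta>_def[abs_def])
  note \<phi> = tests_time_times_space[OF \<theta> \<psi>]
  have bw: "bounded_borel ?w" by (rule bounded_borel_cut[OF u])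
  have i1: "integrable lborel (\<lambda>z. ?w z * (deriv \<theta> (fst z) * \<psi> (snd z)))"
    by (rule integrable_bounded_borel_mult[OF bw integrable_tensor[OF tests_integrable[OF deriv_tests[OF \<theta>]] tests_integrable[OF \<psi>]]])
  have i2: "integrable lborel (\<lambda>z. ?w z * (\<theta> (fst z) * fderiv \<psi> (snd z) (b (snd z))))"
    by (rule integrable_bounded_borel_mult[OF bw integrable_tensor[OF tests_integrable[OF \<theta>] integrable_fderiv_b[OF \<psi>]]])
  have "(LINT z|lborel. indicator {0..} (fst z) * (u z * (deriv \<theta> (fst z) * \<psi> (snd z) + \<theta> (fst z) * fderiv \<psi> (snd z) (b (snd z)))))
      = - (LINT x|lborel. u0 x * (\<theta> 0 * \<psi> x))"
    using tp \<phi>(1) unfolding transport_pair_def \<phi>(2)[symmetric] by fastforce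
  also have "\<dots> = 0" using k0[of t] t by (simp add: \<theta>_def)
  also have "(LINT z|lborel. indicator {0..} (fst z) * (u z * (deriv \<theta> (fst z) * \<psi> (snd z) + \<theta> (fst z) * fderiv \<psi> (snd z) (b (snd z)))))
      = (LINT z|lborel. ?w z * (deriv \<theta> (fst z) * \<psi> (snd z)) + ?w z * (\<theta> (fst z) * fderiv \<psi> (snd z) (b (snd z))))"
  proof (rule Bochner_Integration.integral_cong[OF refl])
    fix z :: "real \<times> (real ^ 2)"
    show "indicator {0..} (fst z) * (u z * (deriv \<theta> (fst z) * \<psi> (snd z) + \<theta> (fst z) * fderiv \<psi> (snd z) (b (snd z))))
        = ?w z * (deriv \<theta> (fst z) * \<psi> (snd z)) + ?w z * (\<theta> (fst z) * fderiv \<psi> (snd z) (b (snd z)))"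
    proof (cases "fst z > T + 2")
      case True
      then have "\<theta> (fst z) = 0" "deriv \<theta> (fst z) = 0"
        using t k0[of "t - fst z"] dk0[of "t - fst z"] by (auto simp: \<theta>_def d\<theta>)
      then show ?thesis by simp
    next
      case False
      then have "?w z = indicator {0..} (fst z) * u z" by (auto simp: cut_def indicator_def)
      then show ?thesis by (simp add: algebra_simps)
    qed
  qed
  also have "\<dots> = (LINT z|lborel. ?w z * (deriv \<theta> (fst z) * \<psi> (snd z))) + (LINT z|lborel. ?w z * (\<theta> (fst z) * fderiv \<psi> (snd z) (b (snd z))))"
    by (rule Bochner_Integration.integral_add[OF i1 i2])
  also have "(LINT z|lborel. ?w z * (deriv \<theta> (fst z) * \<psi> (snd z))) = (LINT x|lborel. tmoll' T n u (t, x) * \<psi> x)"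
    unfolding lborel_Fubini(2)[OF i1]
  proof (rule Bochner_Integration.integral_cong[OF refl])
    fix x
    have "(LINT s|lborel. ?w (s, x) * (deriv \<theta> (fst (s, x)) * \<psi> (snd (s, x)))) = (LINT s|lborel. - (deriv ?k (t - s) * ?w (s, x)) * \<psi> x)"
      by (rule Bochner_Integration.integral_cong) (auto simp: d\<theta>)
    then show "(LINT s|lborel. ?w (s, x) * (deriv \<theta> (fst (s, x)) * \<psi> (snd (s, x)))) = tmoll' T n u (t, x) * \<psi> x"
      by (simp add: tmoll'_def conv_def)
  qed
  also have "(LINT z|lborel. ?w z * (\<theta> (fst z) * fderiv \<psi> (snd z) (b (snd z)))) = (LINT x|lborel. tmoll T n u (t, x) * fderiv \<psi> x (b x))"
    unfolding lborel_Fubini(2)[OF i2]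
  proof (rule Bochner_Integration.integral_cong[OF refl])
    fix x
    have "(LINT s|lborel. ?w (s, x) * (\<theta> (fst (s, x)) * fderiv \<psi> (snd (s, x)) (b (snd (s, x))))) = (LINT s|lborel. (?k (t - s) * ?w (s, x)) * fderiv \<psi> x (b x))"
      by (rule Bochner_Integration.integral_cong) (auto simp: \<theta>_def)
    then show "(LINT s|lborel. ?w (s, x) * (\<theta> (fst (s, x)) * fderiv \<psi> (snd (s, x)) (b (snd (s, x))))) = tmoll T n u (t, x) * fderiv \<psi> x (b x)"
      by (simp add: tmoll_def conv_def)
  qed
  finally show "(LINT x|lborel. tmoll T n u (t, x) * fderiv \<psi> x (b x)) = - (LINT x|lborel. tmoll' T n u (t, x) * \<psi> x)"
    by simp
qed

lemma tmoll_smooth_in_time: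
  assumes "bounded_borel u"
  shows "smooth (\<lambda>t. tmoll T n u (t, x))" "deriv (\<lambda>t. tmoll T n u (t, x)) t = - tmoll' T n u (t, x)"
proof -
  note c = time_kernel_tests[of n] and i = integrable_cut[OF assms, of T x]
  have eq: "(\<lambda>t. tmoll T n u (t, x)) = conv (time_kernel n) (\<lambda>s. cut T u (s, x))" by (auto simp: tmoll_def)
  show s: "smooth (\<lambda>t. tmoll T n u (t, x))" unfolding eq by (rule smooth_conv[OF c i])
  have "deriv (conv (time_kernel n) (\<lambda>s. cut T u (s, x))) t = fderiv (conv (time_kernel n) (\<lambda>s. cut T u (s, x))) t 1"
    using fderiv_real[OF s, of t 1] unfolding eq by simp
  also have "\<dots> = conv (\<lambda>z. fderiv (time_kernel n) z 1) (\<lambda>s. cut T u (s, x)) t" by (rule fderiv_conv[OF c i])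
  also have "(\<lambda>z. fderiv (time_kernel n) z 1) = deriv (time_kernel n)"
    using fderiv_real[OF testsD(1)[OF c]] by auto
  finally show "deriv (\<lambda>t. tmoll T n u (t, x)) t = - tmoll' T n u (t, x)" unfolding eq by (simp add: tmoll'_def)
qed

text \<open>At each fixed time \<open>weak_div_product\<close> turns the integral \<open>B\<close>
  of the spatial derivative into minus the integral \<open>D\<close> of the right-hand sides. In
  time all functions are smooth, and A - D is the derivative of the product of both mollified
  solutions and \<phi>; its integral leaves only the boundary term at t = 0. The parameters n and m
  stay independent for the later limits.\<close>

lemma tmoll_product_identity:
  assumes iso: "discrete {x \<in> \<Omega>. \<not> good x}"
    and u: "bounded_borel u" "transport_pair u0 u" and v: "bounded_borel v" "transport_pair v0 v"
    and \<phi>: "\<phi> \<in> tests (UNIV \<times> \<Omega>)" and T: "T > 0" "\<And>t x. \<bar>t\<bar> > T \<Longrightarrow> \<phi> (t, x) = 0"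
  shows "(LINT z|lborel. indicator {0..} (fst z) * fderiv \<phi> z (1, b (snd z)) * tmoll T m v z * tmoll T n u z)
    = - (LINT x|lborel. tmoll T n u (0, x) * (tmoll T m v (0, x) * \<phi> (0, x)))"
proof -
  let ?U = "tmoll T n u" and ?F = "tmoll' T n u" and ?V = "tmoll T m v" and ?G = "tmoll' T m v"
  let ?I = "\<lambda>z::real \<times> (real ^ 2). indicator {0..T + 1} (fst z) :: real"
  have sm: "smooth \<phi>" using \<phi> by (rule testsD)
  note bU = tmoll_bounded_borel(1)[OF u(1), of T n] and bF = tmoll_bounded_borel(2)[OF u(1), of T n]
    and bV = tmoll_bounded_borel(1)[OF v(1), of T m] and bG = tmoll_bounded_borel(2)[OF v(1), of T m]
  have bI: "bounded_borel ?I" unfolding bounded_borel_def by (auto simp: indicator_def intro!: exI[of _ 1])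
  have bUV: "bounded_borel (\<lambda>z. ?I z * (?U z * ?V z))" and bFG: "bounded_borel (\<lambda>z. ?I z * (?F z * ?V z + ?G z * ?U z))"
    by (intro bounded_borel_mult bounded_borel_add bI bU bF bV bG)+
  have it: "integrable lborel (\<lambda>z. fderiv \<phi> z (1, 0))" by (rule tests_integrable[OF fderiv_tests[OF \<phi>]])
  have ib: "integrable lborel (\<lambda>z. fderiv \<phi> z (0, b (snd z)))"
  proof -
    have "fderiv \<phi> z (0, b (snd z)) = fderiv \<phi> z (1, b (snd z)) - fderiv \<phi> z (1, 0)" for z
      using fderiv_1_b(2)[OF sm, of z "b (snd z)"] by simp
    then show ?thesis
      using Bochner_Integration.integrable_diff[OF integrable_fderiv_1_b[OF \<phi>] it] by simp
  qed
  define A where "A z = (?I z * (?U z * ?V z)) * fderiv \<phi> z (1, 0)" for z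
  define B where "B z = (?I z * (?U z * ?V z)) * fderiv \<phi> z (0, b (snd z))" for z
  define D where "D z = (?I z * (?F z * ?V z + ?G z * ?U z)) * \<phi> z" for z
  have iA: "integrable lborel A" and iB: "integrable lborel B" and iD: "integrable lborel D"
    unfolding A_def B_def D_def
    by (rule integrable_bounded_borel_mult[OF bUV it] integrable_bounded_borel_mult[OF bUV ib]
        integrable_bounded_borel_mult[OF bFG tests_integrable[OF \<phi>]])+
  have BD: "(LINT z|lborel. B z) = - (LINT z|lborel. D z)"
  proof -
    have "(LINT x|lborel. B (t, x)) = - (LINT x|lborel. D (t, x))" for t
    proof (cases "t \<in> {0..T + 1}")
      case True
      then have t: "0 \<le> t" "t \<le> T + 1" by auto
      note W = weak_div_product[OF iso bounded_borel_slice[OF bU, of t] bounded_borel_slice[OF bF, of t]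
          bounded_borel_slice[OF bV, of t] bounded_borel_slice[OF bG, of t] tmoll_weak_div[OF u t] tmoll_weak_div[OF v t]]
      then have "(LINT x|lborel. (?U (t, x) * ?V (t, x)) * fderiv (\<lambda>x. \<phi> (t, x)) x (b x))
          = - (LINT x|lborel. (?F (t, x) * ?V (t, x) + ?G (t, x) * ?U (t, x)) * \<phi> (t, x))"
        using tests_slice(1)[OF \<phi>, of t] unfolding weak_div_def by blast
      then show ?thesis using t by (simp add: B_def D_def tests_slice(2)[OF \<phi>])
    qed (simp add: B_def D_def)
    then show ?thesis unfolding lborel_Fubini(1)[OF iB] lborel_Fubini(1)[OF iD] by simp
  qed
  have AD: "(LINT z|lborel. A z - D z) = - (LINT x|lborel. ?U (0, x) * (?V (0, x) * \<phi> (0, x)))"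
  proof -
    have "(LINT t|lborel. A (t, x) - D (t, x)) = - (?U (0, x) * (?V (0, x) * \<phi> (0, x)))" for x
    proof -
      note s1 = tmoll_smooth_in_time[OF u(1), of T n x] and s2 = tmoll_smooth_in_time[OF v(1), of T m x]
        and s3 = tests_slice(3,4)[OF \<phi>, of x]
      define p where "p t = ?U (t, x) * (?V (t, x) * \<phi> (t, x))" for t
      have s23: "smooth (\<lambda>t. ?V (t, x) * \<phi> (t, x))" by (rule smooth_mult[OF s2(1) s3(1)])
      have sp: "smooth p" unfolding p_def by (rule smooth_mult[OF s1(1) s23])
      have dp: "deriv p t = ?U (t, x) * ?V (t, x) * fderiv \<phi> (t, x) (1, 0) - (?F (t, x) * ?V (t, x) + ?G (t, x) * ?U (t, x)) * \<phi> (t, x)" for t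
      proof -
        have "(p has_real_derivative (- ?F (t, x)) * (?V (t, x) * \<phi> (t, x)) + ((- ?G (t, x)) * \<phi> (t, x) + fderiv \<phi> (t, x) (1, 0) * ?V (t, x)) * ?U (t, x)) (at t)"
          unfolding p_def s1(2)[symmetric] s2(2)[symmetric] s3(2)[symmetric]
          by (intro DERIV_mult smooth_has_real_derivative s1(1) s2(1) s3(1))
        from DERIV_imp_deriv[OF this] show ?thesis by (simp add: algebra_simps)
      qed
      have "(LINT t|lborel. deriv p t * indicator {0..T + 1} t) = p (T + 1) - p 0"
        using T(1) smooth_continuous[OF smooth_deriv[OF sp], of UNIV]
        by (intro integral_FTC_Icc_real smooth_has_real_derivative[OF sp]) (auto simp: continuous_on_eq_continuous_at)
      moreover have "p (T + 1) = 0" using T by (simp add: p_def)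
      moreover have "A (t, x) - D (t, x) = deriv p t * indicator {0..T + 1} t" for t
        by (simp add: A_def D_def dp algebra_simps)
      ultimately show ?thesis by (simp add: p_def)
    qed
    then show ?thesis
      unfolding lborel_Fubini(2)[OF Bochner_Integration.integrable_diff[OF iA iD]] by simp
  qed
  have "indicator {0..} (fst z) * fderiv \<phi> z (1, b (snd z)) * ?V z * ?U z = A z + B z" for z
  proof (cases "fst z > T")
    case True
    have op: "open {z :: real \<times> (real ^ 2). T < fst z}" by (intro open_Collect_less continuous_intros)
    have "\<phi> y = 0" if "y \<in> {z. T < fst z}" for y using T(2)[of "fst y" "snd y"] that by simp
    then have "fderiv \<phi> z v = 0" for v
      using True by (intro fderiv_eq_0_locally_const[of _ \<phi> 0, OF op]) auto
    then show ?thesis by (simp add: A_def B_def)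
  next
    case False
    then have I: "indicator {0..} (fst z) = ?I z" using T(1) by (auto simp: indicator_def)
    have "a * (p + q) * y * x = a * (x * y) * p + a * (x * y) * q" for a p q x y :: real
      by (simp add: algebra_simps)
    then show ?thesis unfolding fderiv_1_b(2)[OF sm, of z "b (snd z)"] A_def B_def I by blast
  qed
  then have "(LINT z|lborel. indicator {0..} (fst z) * fderiv \<phi> z (1, b (snd z)) * ?V z * ?U z) = (LINT z|lborel. A z) + (LINT z|lborel. B z)"
    using iA iB by simp
  also have "\<dots> = (LINT z|lborel. A z - D z)" using iA iD BD by simp
  finally show ?thesis using AD by simp
qed

text \<open>For each x the time line converges in L1, and the uniform bound allows dominated
  convergence in x. The weight \<open>g\<close> involves the field and is merely integrable, whence
  \<open>L1_weighted_tendsto\<close>.\<close>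

lemma tmoll_tendsto:
  assumes u: "bounded_borel u" and g: "integrable lborel g" and K: "compact K" and gK: "\<And>z. snd z \<notin> K \<Longrightarrow> g z = 0"
    and T: "T > 0"
  shows "(\<lambda>n. LINT z|lborel. g z * tmoll T n u z) \<longlonglongrightarrow> (LINT z|lborel. g z * cut T u z)"
proof -
  obtain C where C: "\<And>z. \<bar>u z\<bar> \<le> C" using bounded_borelD(2)[OF u] by blast
  have C0: "C \<ge> 0" using C[of undefined] by simp
  have [measurable]: "K \<in> sets borel" using K by (simp add: borel_compact)
  have iK: "integrable lborel (indicator K :: _ \<Rightarrow> real)"
    using emeasure_compact_finite[OF K] by auto
  have bU: "bounded_borel (tmoll T n u)" for n by (rule tmoll_bounded_borel(1)[OF u])
  have bc: "bounded_borel (cut T u)" by (rule bounded_borel_cut[OF u])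
  have [measurable]: "tmoll T n u \<in> borel_measurable borel" "cut T u \<in> borel_measurable borel" for n
    by (rule bounded_borelD(1)[OF bU] bounded_borelD(1)[OF bc])+
  define E where "E n z = indicator K (snd z) * (tmoll T n u z - cut T u z)" for n z
  have Eb: "\<bar>tmoll T n u z - cut T u z\<bar> \<le> 2 * C" for n z
  proof -
    have "\<bar>tmoll T n u z\<bar> \<le> C" "\<bar>cut T u z\<bar> \<le> C"
      by (rule tmoll_bounded_borel(3)[OF u C] cut_abs_le[OF C])+
    then show ?thesis by linarith
  qed
  then have Eb': "\<bar>E n z\<bar> \<le> 2 * C" for n z using C0 by (simp add: E_def indicator_def)
  have far: "tmoll T n u z - cut T u z = 0" if "fst z \<notin> {- 1..T + 3}" for n z
  proof -
    have "tmoll T n u z = 0" unfolding tmoll_def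
    proof (rule conv_vanish[OF approx_identity_support[OF approx_identity_time_kernel]])
      fix y assume "dist (fst z) y < 1 / real (Suc n)"
      moreover have "1 / real (Suc n) \<le> 1" by simp
      ultimately have "\<bar>fst z - y\<bar> < 1" unfolding dist_real_def by linarith
      then have "y \<notin> {0..T + 2}" using that by auto
      then show "cut T u (y, snd z) = 0" by (simp add: cut_def)
    qed
    moreover have "cut T u z = 0" using that T by (auto simp: cut_def indicator_def)
    ultimately show ?thesis by simp
  qed
  have Ele: "\<bar>E n z\<bar> \<le> 2 * C * (indicator {- 1..T + 3} (fst z) * indicator K (snd z))" for n z
    using Eb[of n z] far[of z n] C0 by (cases "fst z \<in> {- 1..T + 3}") (auto simp: E_def indicator_def)
  have iE: "integrable lborel (E n)" for n
  proof (rule Bochner_Integration.integrable_bound)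
    show "integrable lborel (\<lambda>z. 2 * C * (indicator {- 1..T + 3} (fst z) * indicator K (snd z)))"
      by (intro integrable_mult_right integrable_tensor integrable_indicator_Icc iK)
    show "E n \<in> borel_measurable lborel" unfolding E_def by measurable
    show "AE z in lborel. norm (E n z) \<le> norm (2 * C * (indicator {- 1..T + 3} (fst z) * indicator K (snd z)))"
      unfolding real_norm_def by (rule AE_I2) (rule order_trans[OF Ele abs_ge_self])
  qed
  have "(\<lambda>n. LINT x|lborel. LINT t|lborel. \<bar>E n (t, x)\<bar>) \<longlonglongrightarrow> (LINT x|(lborel :: (real ^ 2) measure). 0)"
  proof (rule integral_dominated_convergence)
    show "integrable lborel (\<lambda>x. (2 * C * (T + 4)) * indicator K x :: real)" using iK by simp
    show "(\<lambda>x. LINT t|lborel. \<bar>E n (t, x)\<bar>) \<in> borel_measurable lborel" for n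
      using lborel_Fubini(4)[OF integrable_abs[OF iE[of n]]] by simp
    show "AE x in lborel. (\<lambda>n. LINT t|lborel. \<bar>E n (t, x)\<bar>) \<longlonglongrightarrow> 0"
    proof (rule AE_I2)
      fix x
      have "(\<lambda>n. indicator K x * (LINT t|lborel. \<bar>conv (time_kernel n) (\<lambda>s. cut T u (s, x)) t - cut T u (t, x)\<bar>)) \<longlonglongrightarrow> indicator K x * 0"
        by (intro tendsto_mult tendsto_const conv_tendsto_L1 approx_identity_time_kernel integrable_cut u)
      moreover have "(LINT t|lborel. \<bar>E n (t, x)\<bar>) = indicator K x * (LINT t|lborel. \<bar>conv (time_kernel n) (\<lambda>s. cut T u (s, x)) t - cut T u (t, x)\<bar>)" for n
        by (simp add: E_def tmoll_def abs_mult indicator_def)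
      ultimately show "(\<lambda>n. LINT t|lborel. \<bar>E n (t, x)\<bar>) \<longlonglongrightarrow> 0" by simp
    qed
    show "AE x in lborel. norm (LINT t|lborel. \<bar>E n (t, x)\<bar>) \<le> (2 * C * (T + 4)) * indicator K x" for n
    proof (rule AE_I2)
      fix x
      have "(LINT t|lborel. \<bar>E n (t, x)\<bar>) \<le> (LINT t|lborel. 2 * C * indicator K x * indicator {- 1..T + 3} t)"
      proof (rule integral_mono')
        show "\<bar>E n (t, x)\<bar> \<le> 2 * C * indicator K x * indicator {- 1..T + 3} t" for t using Ele[of n "(t, x)"] by (simp add: mult_ac)
        show "integrable lborel (\<lambda>t. 2 * C * indicator K x * indicator {- 1..T + 3} t :: real)"
          by (intro integrable_mult_right integrable_indicator_Icc)
        show "0 \<le> 2 * C * indicator K x * indicator {- 1..T + 3} t" for t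
          using C0 by (intro mult_nonneg_nonneg) auto
      qed
      also have "\<dots> = (2 * C * (T + 4)) * indicator K x" using T by simp
      finally show "norm (LINT t|lborel. \<bar>E n (t, x)\<bar>) \<le> (2 * C * (T + 4)) * indicator K x" by (simp add: abs_of_nonneg)
    qed
  qed simp
  then have lim: "(\<lambda>n. LINT z|lborel. \<bar>E n z\<bar>) \<longlonglongrightarrow> 0"
    unfolding lborel_Fubini(2)[OF integrable_abs[OF iE]] by simp
  have w: "(\<lambda>n. LINT z|lborel. \<bar>g z\<bar> * \<bar>E n z\<bar>) \<longlonglongrightarrow> 0"
    by (rule L1_weighted_tendsto[OF iE lim Eb' g])
  have ig: "integrable lborel (\<lambda>z. g z * tmoll T n u z)" "integrable lborel (\<lambda>z. g z * cut T u z)" for n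
    using integrable_bounded_borel_mult[OF bU g] integrable_bounded_borel_mult[OF bc g] by (simp_all add: mult.commute)
  show ?thesis
  proof (rule LIM_zero_cancel, rule Lim_null_comparison[OF _ w], rule always_eventually, rule allI)
    fix n
    have "(LINT z|lborel. g z * tmoll T n u z) - (LINT z|lborel. g z * cut T u z) = (LINT z|lborel. g z * E n z)"
      unfolding Bochner_Integration.integral_diff[OF ig, symmetric]
    proof (rule Bochner_Integration.integral_cong[OF refl])
      fix z show "g z * tmoll T n u z - g z * cut T u z = g z * E n z"
        using gK[of z] by (cases "snd z \<in> K") (auto simp: E_def algebra_simps)
    qed
    moreover have "norm (LINT z|lborel. g z * E n z) \<le> (LINT z|lborel. norm (g z * E n z))" by (rule integral_norm_bound)
    ultimately show "norm ((LINT z|lborel. g z * tmoll T n u z) - (LINT z|lborel. g z * cut T u z)) \<le> (LINT z|lborel. \<bar>g z\<bar> * \<bar>E n z\<bar>)"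
      by (simp add: abs_mult)
  qed
qed


text \<open>Test with \<Theta>_n(t) \<psi>(x), where on t \<ge> 0 the derivative of \<Theta>_n is
  minus the reflected time kernel. The time term is then exactly minus the pairing of
  \<open>tmoll\<close> at time 0 with \<psi>, while the transport term lives on times in
  [0, 1 / (n + 1)] and is of order 1 / (n + 1).\<close>

lemma initial_trace:
  assumes u: "bounded_borel u" and tp: "transport_pair u0 u" and T: "T > 0" and \<psi>: "\<psi> \<in> tests \<Omega>"
  shows "(\<lambda>n. LINT x|lborel. tmoll T n u (0, x) * \<psi> x) \<longlonglongrightarrow> (LINT x|lborel. u0 x * \<psi> x)"
proof -
  obtain C where C: "\<And>z. \<bar>u z\<bar> \<le> C" using bounded_borelD(2)[OF u] by blast
  have C0: "C \<ge> 0" using C[of undefined] by simp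
  have [measurable]: "u \<in> borel_measurable borel" by (rule bounded_borelD(1)[OF u])
  \<comment> \<open>The factor 1 - J_n equals 1 at all negative times, so this cutoff is needed for
    compact support. It is 1 for |s| \<le> 2, which contains all nonnegative times at which 1 - J_n
    is nonzero.\<close>
  let ?X = "ball_cutoff (0::real) 4"
  have X: "smooth ?X" by (rule smooth_ball_cutoff) simp
  have X1: "?X s = 1" if "\<bar>s\<bar> \<le> 2" for s using that by (intro ball_cutoff_eq_1) auto
  have X0: "?X s = 0" if "\<bar>s\<bar> \<ge> 4" for s using that by (intro ball_cutoff_eq_0) auto
  have Xb: "0 \<le> ?X s" "?X s \<le> 1" for s by (rule ball_cutoff_bounds, simp)+
  define J where "J n s = smooth_step (real (Suc n) * s + 0)" for n s
  have lin: "linear (\<lambda>s::real. real (Suc n) * s)" for n by (rule linearI) (simp_all add: algebra_simps)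
  have J: "smooth (J n)" for n unfolding J_def by (rule smooth_comp_affine(1)[OF smooth_smooth_step lin])
  have dJ: "deriv (J n) s = time_kernel n (- s)" for n s
    using smooth_comp_affine(2)[OF smooth_smooth_step lin[of n], of 0 s 1] fderiv_real[OF J, of n s 1]
      fderiv_real[OF smooth_smooth_step, of "real (Suc n) * s" "real (Suc n)"]
    unfolding J_def time_kernel_def minus_mult_minus by simp
  define \<Theta> where "\<Theta> n s = (1 - J n s) * ?X s" for n s
  have s1: "smooth (\<lambda>s. 1 - J n s)" for n by (rule smooth_diff[OF smooth_const J])
  have \<Theta>: "\<Theta> n \<in> tests UNIV" for n
  proof (rule testsI[where K="{- 4..4}"])
    show "smooth (\<Theta> n)" unfolding \<Theta>_def by (rule smooth_mult[OF s1 X])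
    show "\<Theta> n s = 0" if "s \<notin> {- 4..4}" for s
      unfolding \<Theta>_def using that by (subst X0) auto
  qed auto
  have J1: "J n s = 1" if "s \<ge> 1 / Suc n" for n s
    unfolding J_def using that by (intro smooth_step_eq_1) (simp add: field_simps)
  have Jb: "0 \<le> J n s" "J n s \<le> 1" for n s unfolding J_def by (rule smooth_step_bounds)+
  have N1: "1 / real (Suc n) \<le> 1" for n by simp
  have d\<Theta>: "deriv (\<Theta> n) s = - time_kernel n (- s)" if s: "s \<ge> 0" for n s
  proof -
    have "(\<Theta> n has_real_derivative (0 - deriv (J n) s) * ?X s + deriv ?X s * (1 - J n s)) (at s)"
      unfolding \<Theta>_def by (intro DERIV_mult DERIV_diff DERIV_const smooth_has_real_derivative J X)
    then have eq: "deriv (\<Theta> n) s = (0 - deriv (J n) s) * ?X s + deriv ?X s * (1 - J n s)" by (rule DERIV_imp_deriv)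
    show ?thesis
    proof (cases "s < 2")
      case True
      have "fderiv ?X s 1 = 0" by (rule fderiv_eq_0_locally_const[of "{- 2<..<2}" _ 1]) (use s True X1 in auto)
      then have "deriv ?X s = 0" by (simp add: fderiv_real[OF X])
      then show ?thesis using X1[of s] s True by (simp add: eq dJ)
    next
      case False
      then have "time_kernel n (- s) = 0" using N1[of n] by (intro time_kernel_support) linarith
      moreover have "J n s = 1" using False N1[of n] by (intro J1) linarith
      ultimately show ?thesis by (simp add: eq dJ)
    qed
  qed
  have \<Theta>b: "\<bar>indicator {0..} s * \<Theta> n s\<bar> \<le> indicator {0..1 / Suc n} s" for n s
  proof (cases "s \<in> {0..1 / Suc n}")
    case True
    have "\<bar>\<Theta> n s\<bar> \<le> 1 * 1" unfolding \<Theta>_def abs_mult using Jb[of n s] Xb[of s] by (intro mult_mono) auto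
    then show ?thesis using True by simp
  next
    case False
    then have "s \<in> {0..} \<Longrightarrow> J n s = 1" by (intro J1) auto
    then show ?thesis by (cases "s \<in> {0..}") (auto simp: \<Theta>_def)
  qed
  define I where "I = (LINT x|lborel. \<bar>fderiv \<psi> x (b x)\<bar>)"
  have main: "norm ((LINT x|lborel. tmoll T n u (0, x) * \<psi> x) - (LINT x|lborel. u0 x * \<psi> x)) \<le> C * I * (1 / Suc n)" for n
  proof -
    note \<phi> = tests_time_times_space[OF \<Theta>[of n] \<psi>]
    have bIu: "bounded_borel (\<lambda>z. indicator {0..} (fst z) * u z)"
      unfolding bounded_borel_def using C C0 by (auto simp: indicator_def intro!: exI[of _ C])
    have i1: "integrable lborel (\<lambda>z. (indicator {0..} (fst z) * u z) * (deriv (\<Theta> n) (fst z) * \<psi> (snd z)))"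
      by (rule integrable_bounded_borel_mult[OF bIu integrable_tensor[OF tests_integrable[OF deriv_tests[OF \<Theta>]] tests_integrable[OF \<psi>]]])
    have i2: "integrable lborel (\<lambda>z. (indicator {0..} (fst z) * u z) * (\<Theta> n (fst z) * fderiv \<psi> (snd z) (b (snd z))))"
      by (rule integrable_bounded_borel_mult[OF bIu integrable_tensor[OF tests_integrable[OF \<Theta>] integrable_fderiv_b[OF \<psi>]]])
    have "\<Theta> n 0 = 1" using X1[of 0] by (simp add: \<Theta>_def J_def smooth_step_eq_0)
    then have "- (LINT x|lborel. u0 x * \<psi> x) =
        (LINT z|lborel. indicator {0..} (fst z) * (u z * (deriv (\<Theta> n) (fst z) * \<psi> (snd z) + \<Theta> n (fst z) * fderiv \<psi> (snd z) (b (snd z)))))"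
      using tp \<phi>(1) unfolding transport_pair_def \<phi>(2)[symmetric] by fastforce
    also have "\<dots> = (LINT z|lborel. (indicator {0..} (fst z) * u z) * (deriv (\<Theta> n) (fst z) * \<psi> (snd z))
        + (indicator {0..} (fst z) * u z) * (\<Theta> n (fst z) * fderiv \<psi> (snd z) (b (snd z))))"
      by (rule Bochner_Integration.integral_cong) (auto simp: algebra_simps)
    also have "\<dots> = (LINT z|lborel. (indicator {0..} (fst z) * u z) * (deriv (\<Theta> n) (fst z) * \<psi> (snd z)))
        + (LINT z|lborel. (indicator {0..} (fst z) * u z) * (\<Theta> n (fst z) * fderiv \<psi> (snd z) (b (snd z))))"
      by (rule Bochner_Integration.integral_add[OF i1 i2])
    also have "(LINT z|lborel. (indicator {0..} (fst z) * u z) * (deriv (\<Theta> n) (fst z) * \<psi> (snd z))) = - (LINT x|lborel. tmoll T n u (0, x) * \<psi> x)"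
      unfolding lborel_Fubini(2)[OF i1] Bochner_Integration.integral_minus[symmetric]
    proof (rule Bochner_Integration.integral_cong[OF refl])
      fix x
      have "(LINT s|lborel. (indicator {0..} (fst (s, x)) * u (s, x)) * (deriv (\<Theta> n) (fst (s, x)) * \<psi> (snd (s, x))))
          = (LINT s|lborel. (time_kernel n (0 - s) * cut T u (s, x)) * - \<psi> x)"
      proof (rule Bochner_Integration.integral_cong[OF refl])
        fix s :: real
        show "(indicator {0..} (fst (s, x)) * u (s, x)) * (deriv (\<Theta> n) (fst (s, x)) * \<psi> (snd (s, x))) = (time_kernel n (0 - s) * cut T u (s, x)) * - \<psi> x"
        proof (cases "s \<in> {0..T + 2}")
          case True
          then show ?thesis by (simp add: d\<Theta> cut_def)
        next
          case False
          then have "s < 0 \<or> 1 / real (Suc n) \<le> s" using N1[of n] T by (simp only: atLeastAtMost_iff) linarith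
          then have "s < 0 \<or> time_kernel n (- s) = 0" using time_kernel_support[of "- s" n] by (simp only: neg_le_iff_le) blast
          then show ?thesis using False d\<Theta>[of s n] by (cases "s < 0") (auto simp: cut_def)
        qed
      qed
      also have "\<dots> = tmoll T n u (0, x) * - \<psi> x" by (simp add: tmoll_def conv_def)
      finally show "(LINT s|lborel. (indicator {0..} (fst (s, x)) * u (s, x)) * (deriv (\<Theta> n) (fst (s, x)) * \<psi> (snd (s, x)))) = - (tmoll T n u (0, x) * \<psi> x)"
        by simp
    qed
    finally have eq: "(LINT x|lborel. tmoll T n u (0, x) * \<psi> x) - (LINT x|lborel. u0 x * \<psi> x)
        = (LINT z|lborel. (indicator {0..} (fst z) * u z) * (\<Theta> n (fst z) * fderiv \<psi> (snd z) (b (snd z))))" by simp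
    have ir: "integrable lborel (\<lambda>z::real \<times> (real ^ 2). C * (indicator {0..1 / Suc n} (fst z) * \<bar>fderiv \<psi> (snd z) (b (snd z))\<bar>))"
      by (intro integrable_mult_right integrable_tensor integrable_indicator_Icc integrable_abs integrable_fderiv_b \<psi>)
    have "norm (LINT z|lborel. (indicator {0..} (fst z) * u z) * (\<Theta> n (fst z) * fderiv \<psi> (snd z) (b (snd z))))
        \<le> (LINT z|lborel. norm ((indicator {0..} (fst z) * u z) * (\<Theta> n (fst z) * fderiv \<psi> (snd z) (b (snd z)))))"
      by (rule integral_norm_bound)
    also have "\<dots> \<le> (LINT z|lborel. C * (indicator {0..1 / Suc n} (fst z) * \<bar>fderiv \<psi> (snd z) (b (snd z))\<bar>))"
    proof (rule integral_mono[OF integrable_norm[OF i2] ir])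
      fix z :: "real \<times> (real ^ 2)"
      have "\<bar>u z\<bar> * (\<bar>indicator {0..} (fst z) * \<Theta> n (fst z)\<bar> * \<bar>fderiv \<psi> (snd z) (b (snd z))\<bar>)
          \<le> C * (indicator {0..1 / Suc n} (fst z) * \<bar>fderiv \<psi> (snd z) (b (snd z))\<bar>)"
        by (intro mult_mono C mult_right_mono \<Theta>b C0) auto
      then show "norm ((indicator {0..} (fst z) * u z) * (\<Theta> n (fst z) * fderiv \<psi> (snd z) (b (snd z))))
          \<le> C * (indicator {0..1 / Suc n} (fst z) * \<bar>fderiv \<psi> (snd z) (b (snd z))\<bar>)"
        by (simp add: abs_mult mult_ac)
    qed
    also have "\<dots> = C * I * (1 / Suc n)"
      unfolding lborel_Fubini(2)[OF ir] by (simp add: I_def mult_ac)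
    finally show ?thesis unfolding eq .
  qed
  have "(\<lambda>n. C * I * (1 / Suc n)) \<longlonglongrightarrow> C * I * 0"
    by (intro tendsto_mult tendsto_const LIMSEQ_Suc[OF lim_const_over_n])
  then have lim0: "(\<lambda>n. C * I * (1 / Suc n)) \<longlonglongrightarrow> 0" by simp
  show ?thesis
    by (rule LIM_zero_cancel, rule Lim_null_comparison[OF always_eventually[OF allI[OF main]] lim0])
qed

text \<open>In a product of solutions, the factor paired with one trace contains the other solution
  at time 0 and is not smooth in x. Uniform boundedness of the traces lets such a bounded, compactly
  supported factor be replaced by its mollification at small L1 cost.\<close>

lemma initial_trace_bounded:
  assumes u: "bounded_borel u" and u0: "bounded_borel u0" and tp: "transport_pair u0 u" and T: "T > 0"
    and w: "bounded_borel w" and K: "compact K" "K \<subseteq> \<Omega>" "\<And>x. x \<notin> K \<Longrightarrow> w x = 0"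
  shows "(\<lambda>n. LINT x|lborel. tmoll T n u (0, x) * w x) \<longlonglongrightarrow> (LINT x|lborel. u0 x * w x)"
proof (rule LIMSEQ_I)
  fix e :: real assume e: "e > 0"
  obtain A where A: "\<And>z. \<bar>u z\<bar> \<le> A" using bounded_borelD(2)[OF u] by blast
  obtain B where B: "\<And>z. \<bar>u0 z\<bar> \<le> B" using bounded_borelD(2)[OF u0] by blast
  define C where "C = A + B + 1"
  have A0: "A \<ge> 0" using A[of undefined] by simp
  have B0: "B \<ge> 0" using B[of undefined] by simp
  have C: "C > 0" using A0 B0 by (simp add: C_def)
  have iK: "integrable lborel (indicator K :: _ \<Rightarrow> real)"
    using emeasure_compact_finite[OF K(1)] K(1) by (auto simp: borel_compact)
  have "integrable lborel (\<lambda>x. w x * indicator K x)" by (rule integrable_bounded_borel_mult[OF w iK])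
  moreover have "w x * indicator K x = w x" for x by (cases "x \<in> K") (auto simp: K(3))
  ultimately have iw: "integrable lborel w" by simp
  define \<kappa> where "\<kappa> j = mollifier (0::real ^ 2) (1 / Suc j)" for j
  have \<kappa>: "approx_identity \<kappa>" unfolding \<kappa>_def by (rule approx_identity_mollifier) auto
  define W where "W j = conv (\<kappa> j) w" for j
  obtain d where d: "d > 0" "(\<Union>x\<in>K. cball x d) \<subseteq> \<Omega>"
    using compact_subset_open_imp_cball_epsilon_subset[OF K(1) open_domain K(2)] by metis
  obtain j0 where j0: "1 / real (Suc j0) < d" using d(1) by (metis inverse_eq_divide reals_Archimedean)
  have Wt: "W j \<in> tests \<Omega>" if "j \<ge> j0" for j
    unfolding W_def
  proof (rule conv_tests[OF approx_identity_tests[OF \<kappa>] iw approx_identity_support[OF \<kappa>] K(1,3)])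
    have "1 / real (Suc j) \<le> 1 / real (Suc j0)" using that by (simp add: frac_le)
    then show "y \<in> \<Omega>" if "x \<in> K" "dist x y \<le> 1 / real (Suc j)" for x y
      using d(2) that j0 by (force simp: subset_iff)
  qed
  have "\<forall>\<^sub>F j in sequentially. (LINT x|lborel. \<bar>W j x - w x\<bar>) < e / (2 * C)"
    unfolding W_def using e C by (intro order_tendstoD(2)[OF conv_tendsto_L1[OF \<kappa> iw]]) auto
  then obtain j1 where j1: "\<And>j. j \<ge> j1 \<Longrightarrow> (LINT x|lborel. \<bar>W j x - w x\<bar>) < e / (2 * C)"
    by (auto simp: eventually_sequentially)
  define j where "j = max j0 j1"
  have t: "W j \<in> tests \<Omega>" and l: "(LINT x|lborel. \<bar>W j x - w x\<bar>) < e / (2 * C)" using Wt j1 by (auto simp: j_def)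
  have iW: "integrable lborel (W j)" by (rule tests_integrable[OF t])
  obtain N where N: "\<And>n. n \<ge> N \<Longrightarrow> norm ((LINT x|lborel. tmoll T n u (0, x) * W j x) - (LINT x|lborel. u0 x * W j x)) < e / 2"
    using LIMSEQ_D[OF initial_trace[OF u tp T t], of "e / 2"] e by auto
  have "norm ((LINT x|lborel. tmoll T n u (0, x) * w x) - (LINT x|lborel. u0 x * w x)) < e" if "n \<ge> N" for n
  proof -
    have bm: "bounded_borel (\<lambda>x. tmoll T n u (0, x))"
      by (rule bounded_borel_slice[OF tmoll_bounded_borel(1)[OF u]])
    note i = integrable_bounded_borel_mult[OF bm iw] integrable_bounded_borel_mult[OF bm iW]
      integrable_bounded_borel_mult[OF u0 iw] integrable_bounded_borel_mult[OF u0 iW]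
    have eq: "(LINT x|lborel. tmoll T n u (0, x) * w x) - (LINT x|lborel. u0 x * w x)
        = ((LINT x|lborel. tmoll T n u (0, x) * W j x) - (LINT x|lborel. u0 x * W j x))
          + (LINT x|lborel. (u0 x - tmoll T n u (0, x)) * (W j x - w x))"
    proof -
      have "(LINT x|lborel. (u0 x - tmoll T n u (0, x)) * (W j x - w x))
        = (LINT x|lborel. (u0 x * W j x - u0 x * w x) - (tmoll T n u (0, x) * W j x - tmoll T n u (0, x) * w x))"
        by (rule Bochner_Integration.integral_cong) (auto simp: algebra_simps)
      then show ?thesis using i by simp
    qed
    have ia: "integrable lborel (\<lambda>x. C * \<bar>W j x - w x\<bar>)" using iW iw by simp
    have "norm (LINT x|lborel. (u0 x - tmoll T n u (0, x)) * (W j x - w x)) \<le> (LINT x|lborel. norm ((u0 x - tmoll T n u (0, x)) * (W j x - w x)))"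
      by (rule integral_norm_bound)
    also have "\<dots> \<le> (LINT x|lborel. C * \<bar>W j x - w x\<bar>)"
    proof (rule integral_mono'[OF ia])
      fix x
      have "\<bar>tmoll T n u (0, x)\<bar> \<le> A" by (rule tmoll_bounded_borel(3)[OF u A])
      then have "\<bar>u0 x - tmoll T n u (0, x)\<bar> \<le> C" using B[of x] by (simp add: C_def)
      then show "norm ((u0 x - tmoll T n u (0, x)) * (W j x - w x)) \<le> C * \<bar>W j x - w x\<bar>"
        unfolding real_norm_def abs_mult by (rule mult_right_mono) simp
      show "0 \<le> C * \<bar>W j x - w x\<bar>" using C by simp
    qed
    also have "\<dots> = C * (LINT x|lborel. \<bar>W j x - w x\<bar>)" by simp
    also have "\<dots> < C * (e / (2 * C))" using l C by (intro mult_strict_left_mono)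
    also have "\<dots> = e / 2" using C by simp
    finally show ?thesis unfolding eq using N[OF that] by (intro order_le_less_trans[OF norm_triangle_ineq]) linarith
  qed
  then show "\<exists>N. \<forall>n\<ge>N. norm ((LINT x|lborel. tmoll T n u (0, x) * w x) - (LINT x|lborel. u0 x * w x)) < e" by blast
qed

text \<open>Products of solutions are solutions: the mollified solutions satisfy the product rule, and the two mollification
  parameters are removed one after the other, so that at time \<open>0\<close> weak convergence of one factor at a time suffices.\<close>

theorem transport_pair_mult:
  assumes iso: "discrete {x \<in> \<Omega>. \<not> good x}"
    and u: "bounded_borel u" "bounded_borel u0" "transport_pair u0 u"
    and v: "bounded_borel v" "bounded_borel v0" "transport_pair v0 v"
  shows "transport_pair (\<lambda>x. u0 x * v0 x) (\<lambda>z. u z * v z)"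
  unfolding transport_pair_def
proof
  fix \<phi> :: "real \<times> (real ^ 2) \<Rightarrow> real" assume \<phi>: "\<phi> \<in> tests (UNIV \<times> \<Omega>)"
  obtain T K where T: "T > 0" "\<And>t x. \<bar>t\<bar> > T \<Longrightarrow> \<phi> (t, x) = 0"
    and K: "compact K" "K \<subseteq> \<Omega>" "\<And>t x. x \<notin> K \<Longrightarrow> \<phi> (t, x) = 0"
    using tests_spacetime[OF \<phi>] by metis
  define g where "g z = indicator {0..} (fst z) * fderiv \<phi> z (1, b (snd z))" for z
  have bI: "bounded_borel (\<lambda>z::real \<times> (real ^ 2). indicator {0..} (fst z))"
    unfolding bounded_borel_def by (auto simp: indicator_def intro!: exI[of _ 1])
  have ig: "integrable lborel g"
    unfolding g_def by (rule integrable_bounded_borel_mult[OF bI integrable_fderiv_1_b[OF \<phi>]])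
  have zero: "fderiv \<phi> z w = 0" if "fst z > T \<or> snd z \<notin> K" for z w
  proof -
    have "open ({z :: real \<times> (real ^ 2). T < fst z} \<union> {z. snd z \<in> - K})"
      using compact_imp_closed[OF K(1)]
      by (intro open_Un open_Collect_less continuous_intros open_vimage[of "- K" snd, unfolded vimage_def]) auto
    then show ?thesis
    proof (rule fderiv_eq_0_locally_const[where c=0])
      show "\<phi> y = 0" if "y \<in> {z. T < fst z} \<union> {z. snd z \<in> - K}" for y
        using that T(2)[of "fst y" "snd y"] K(3)[of "snd y" "fst y"] by auto
    qed (use that in auto)
  qed
  have gK: "g z = 0" if "snd z \<notin> K" for z using zero[of z] that by (simp add: g_def)
  \<comment> \<open>\<open>g\<close> vanishes at negative times and after \<open>T\<close>, and
    between them the truncation does nothing.\<close>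
  have gcut: "g z * cut T w z = g z * w z" for w z
  proof (cases "fst z > T")
    case True
    then show ?thesis using zero[of z] by (simp add: g_def)
  next
    case False
    then show ?thesis by (auto simp: g_def cut_def indicator_def)
  qed
  have bw: "bounded_borel (\<lambda>x. tmoll T m v (0, x))" for m by (rule bounded_borel_slice[OF tmoll_bounded_borel(1)[OF v(1)]])
  have b\<phi>: "bounded_borel (\<lambda>x. \<phi> (0, x))" by (rule bounded_borel_tests[OF tests_slice(1)[OF \<phi>]])
  have one: "(LINT z|lborel. g z * tmoll T m v z * u z) = - (LINT x|lborel. u0 x * (tmoll T m v (0, x) * \<phi> (0, x)))" for m
  proof -
    have igv: "integrable lborel (\<lambda>z. g z * tmoll T m v z)"
      using integrable_bounded_borel_mult[OF tmoll_bounded_borel(1)[OF v(1)] ig] by (simp add: mult.commute)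
    have "(\<lambda>n. LINT z|lborel. g z * tmoll T m v z * tmoll T n u z) \<longlonglongrightarrow> (LINT z|lborel. g z * tmoll T m v z * cut T u z)"
      by (rule tmoll_tendsto[OF u(1) igv K(1) _ T(1)]) (simp add: gK)
    moreover have "(\<lambda>n. - (LINT x|lborel. tmoll T n u (0, x) * (tmoll T m v (0, x) * \<phi> (0, x)))) \<longlonglongrightarrow> - (LINT x|lborel. u0 x * (tmoll T m v (0, x) * \<phi> (0, x)))"
      by (intro tendsto_minus initial_trace_bounded[OF u T(1) bounded_borel_mult[OF bw b\<phi>] K(1,2)]) (simp add: K(3))
    moreover have "(LINT z|lborel. g z * tmoll T m v z * tmoll T n u z) = - (LINT x|lborel. tmoll T n u (0, x) * (tmoll T m v (0, x) * \<phi> (0, x)))" for n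
      unfolding g_def by (rule tmoll_product_identity[OF iso u(1,3) v(1,3) \<phi> T])
    ultimately have "(LINT z|lborel. g z * tmoll T m v z * cut T u z) = - (LINT x|lborel. u0 x * (tmoll T m v (0, x) * \<phi> (0, x)))"
      using LIMSEQ_unique by fastforce
    moreover have "g z * tmoll T m v z * cut T u z = g z * tmoll T m v z * u z" for z
      using arg_cong[OF gcut[of z u], of "\<lambda>r. r * tmoll T m v z"] by (simp only: mult_ac)
    ultimately show ?thesis by simp
  qed
  have igu: "integrable lborel (\<lambda>z. g z * u z)"
    using integrable_bounded_borel_mult[OF u(1) ig] by (simp add: mult.commute)
  have "(\<lambda>m. LINT z|lborel. g z * u z * tmoll T m v z) \<longlonglongrightarrow> (LINT z|lborel. g z * u z * cut T v z)"
    by (rule tmoll_tendsto[OF v(1) igu K(1) _ T(1)]) (simp add: gK)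
  moreover have "(\<lambda>m. - (LINT x|lborel. tmoll T m v (0, x) * (u0 x * \<phi> (0, x)))) \<longlonglongrightarrow> - (LINT x|lborel. v0 x * (u0 x * \<phi> (0, x)))"
    by (intro tendsto_minus initial_trace_bounded[OF v T(1) bounded_borel_mult[OF u(2) b\<phi>] K(1,2)]) (simp add: K(3))
  moreover have "(LINT z|lborel. g z * u z * tmoll T m v z) = - (LINT x|lborel. tmoll T m v (0, x) * (u0 x * \<phi> (0, x)))" for m
    using one[of m] by (simp add: mult_ac)
  ultimately have "(LINT z|lborel. g z * u z * cut T v z) = - (LINT x|lborel. v0 x * (u0 x * \<phi> (0, x)))"
    using LIMSEQ_unique by fastforce
  moreover have "(LINT z|lborel. g z * u z * cut T v z) = (LINT z|lborel. indicator {0..} (fst z) * (u z * v z * fderiv \<phi> z (1, b (snd z))))"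
  proof (rule Bochner_Integration.integral_cong[OF refl])
    fix z
    show "g z * u z * cut T v z = indicator {0..} (fst z) * (u z * v z * fderiv \<phi> z (1, b (snd z)))"
      using arg_cong[OF gcut[of z v], of "\<lambda>r. r * u z"] unfolding g_def by (simp only: mult_ac)
  qed
  moreover have "(LINT x|lborel. v0 x * (u0 x * \<phi> (0, x))) = (LINT x|lborel. u0 x * v0 x * \<phi> (0, x))" by (simp add: mult_ac)
  ultimately show "(LINT z|lborel. indicator {0..} (fst z) * (u z * v z * fderiv \<phi> z (1, b (snd z)))) = - (LINT x|lborel. u0 x * v0 x * \<phi> (0, x))"
    by (simp only:)
qed

end

subsection \<open>Renormalization\<close>

lemma bounded_borel_comp:
  assumes "bounded_borel u" "continuous_on UNIV (\<beta> :: real \<Rightarrow> real)"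
  shows "bounded_borel (\<lambda>z. \<beta> (u z))"
proof -
  obtain C where C: "\<And>z. \<bar>u z\<bar> \<le> C" using bounded_borelD(2)[OF assms(1)] by blast
  have "bounded (\<beta> ` {- C..C})"
    by (intro compact_imp_bounded compact_continuous_image continuous_on_subset[OF assms(2)]) auto
  then have "\<exists>B. \<forall>s\<in>{- C..C}. \<bar>\<beta> s\<bar> \<le> B" by (simp add: bounded_iff)
  then obtain B where B: "\<And>s. s \<in> {- C..C} \<Longrightarrow> \<bar>\<beta> s\<bar> \<le> B" by blast
  have "\<bar>\<beta> (u z)\<bar> \<le> B" for z using B[of "u z"] C[of z] by (auto simp: abs_le_iff)
  moreover have "(\<lambda>z. \<beta> (u z)) \<in> borel_measurable borel"
    using measurable_compose[OF bounded_borelD(1)[OF assms(1)] borel_measurable_continuous_onI[OF assms(2)]] .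
  ultimately show ?thesis by (auto simp: bounded_borel_def)
qed

context l2_field
begin

text \<open>The unit of the algebra of solutions: the spatial term is zero on every time slice
  because div b = 0, and the time term integrates to the initial value.\<close>

lemma transport_pair_1: "transport_pair (\<lambda>x. 1) (\<lambda>z. 1)"
  unfolding transport_pair_def
proof
  fix \<phi> :: "real \<times> (real ^ 2) \<Rightarrow> real" assume \<phi>: "\<phi> \<in> tests (UNIV \<times> \<Omega>)"
  have sm: "smooth \<phi>" using \<phi> by (rule testsD)
  obtain T where T: "T > 0" "\<And>t x. \<bar>t\<bar> > T \<Longrightarrow> \<phi> (t, x) = 0" using tests_spacetime[OF \<phi>] by metis
  have bI: "bounded_borel (\<lambda>z::real \<times> (real ^ 2). indicator {0..} (fst z))"
    unfolding bounded_borel_def by (auto simp: indicator_def intro!: exI[of _ 1])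
  have it: "integrable lborel (\<lambda>z. indicator {0..} (fst z) * fderiv \<phi> z (1, 0))"
    by (rule integrable_bounded_borel_mult[OF bI tests_integrable[OF fderiv_tests[OF \<phi>]]])
  have i: "integrable lborel (\<lambda>z. indicator {0..} (fst z) * fderiv \<phi> z (1, b (snd z)))"
    by (rule integrable_bounded_borel_mult[OF bI integrable_fderiv_1_b[OF \<phi>]])
  have split: "indicator {0..} (fst z) * fderiv \<phi> z (1, b (snd z))
      = indicator {0..} (fst z) * fderiv \<phi> z (1, 0) + indicator {0..} (fst z) * fderiv \<phi> z (0, b (snd z))" for z
    unfolding fderiv_1_b(2)[OF sm, of z "b (snd z)"] by (rule distrib_left)
  have ib: "integrable lborel (\<lambda>z. indicator {0..} (fst z) * fderiv \<phi> z (0, b (snd z)))"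
    using Bochner_Integration.integrable_diff[OF i it] unfolding split by simp
  have s0: "(LINT x|lborel. indicator {0..} (fst (t, x)) * fderiv \<phi> (t, x) (0, b (snd (t, x)))) = 0" for t
    using b_div tests_slice(1)[OF \<phi>, of t] unfolding weak_div_def
    by (simp flip: tests_slice(2)[OF \<phi>])
  have 0: "(LINT z|lborel. indicator {0..} (fst z) * fderiv \<phi> z (0, b (snd z))) = 0"
    unfolding lborel_Fubini(1)[OF ib] s0 by simp
  have "(LINT t|lborel. indicator {0..} (fst (t, x)) * fderiv \<phi> (t, x) (1, 0)) = - \<phi> (0, x)" for x
  proof -
    note s = tests_slice(3,4)[OF \<phi>, of x]
    have out: "fderiv \<phi> (t, x) (1, 0) = 0" if "t > T" for t
    proof -
      have "fderiv (\<lambda>t. \<phi> (t, x)) t 1 = 0"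
        by (rule fderiv_eq_0_locally_const[of "{T<..}" _ 0]) (use that T in auto)
      then show ?thesis using fderiv_real[OF s(1), of t 1] by (simp add: s(2))
    qed
    have "(LINT t|lborel. deriv (\<lambda>t. \<phi> (t, x)) t * indicator {0..T + 1} t) = \<phi> (T + 1, x) - \<phi> (0, x)"
      using T(1) smooth_continuous[OF smooth_deriv[OF s(1)], of UNIV]
      by (intro integral_FTC_Icc_real smooth_has_real_derivative[OF s(1)]) (auto simp: continuous_on_eq_continuous_at)
    moreover have "deriv (\<lambda>t. \<phi> (t, x)) t * indicator {0..T + 1} t = indicator {0..} (fst (t, x)) * fderiv \<phi> (t, x) (1, 0)" for t
      using out[of t] by (cases "t > T") (auto simp: s(2) indicator_def)
    ultimately show ?thesis using T by simp
  qed
  then have "(LINT z|lborel. indicator {0..} (fst z) * fderiv \<phi> z (1, 0)) = - (LINT x|lborel. \<phi> (0, x))"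
    unfolding lborel_Fubini(2)[OF it] by simp
  then show "(LINT z|lborel. indicator {0..} (fst z) * (1 * fderiv \<phi> z (1, b (snd z)))) = - (LINT x|lborel. 1 * \<phi> (0, x))"
    using 0 it ib by (simp add: split)
qed

lemma transport_pair_integrable:
  fixes u :: "real \<times> (real ^ 2) \<Rightarrow> real"
  assumes "bounded_borel u" "bounded_borel u0" "\<phi> \<in> tests (UNIV \<times> \<Omega>)"
  shows "integrable lborel (\<lambda>z. indicator {0..} (fst z) * (u z * fderiv \<phi> z (1, b (snd z))))"
    and "integrable lborel (\<lambda>x. u0 x * \<phi> (0, x))"
proof -
  have bI: "bounded_borel (\<lambda>z::real \<times> (real ^ 2). indicator {0..} (fst z))"
    unfolding bounded_borel_def by (auto simp: indicator_def intro!: exI[of _ 1])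
  show "integrable lborel (\<lambda>z. indicator {0..} (fst z) * (u z * fderiv \<phi> z (1, b (snd z))))"
    by (rule integrable_bounded_borel_mult[OF bI integrable_bounded_borel_mult[OF assms(1) integrable_fderiv_1_b[OF assms(3)]]])
  show "integrable lborel (\<lambda>x. u0 x * \<phi> (0, x))"
    by (rule integrable_bounded_borel_mult[OF assms(2) tests_integrable[OF tests_slice(1)[OF assms(3)]]])
qed

lemma transport_pair_add:
  assumes "bounded_borel u" "bounded_borel u0" "transport_pair u0 u"
    and "bounded_borel v" "bounded_borel v0" "transport_pair v0 v"
  shows "transport_pair (\<lambda>x. u0 x + v0 x) (\<lambda>z. u z + v z)"
  unfolding transport_pair_def
proof
  fix \<phi> :: "real \<times> (real ^ 2) \<Rightarrow> real" assume \<phi>: "\<phi> \<in> tests (UNIV \<times> \<Omega>)"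
  show "(LINT z|lborel. indicator {0..} (fst z) * ((u z + v z) * fderiv \<phi> z (1, b (snd z)))) = - (LINT x|lborel. (u0 x + v0 x) * \<phi> (0, x))"
    using transport_pair_integrable[OF assms(1,2) \<phi>] transport_pair_integrable[OF assms(4,5) \<phi>] assms(3,6) \<phi>
    unfolding transport_pair_def by (simp add: distrib_left distrib_right)
qed

lemma transport_pair_cmult:
  assumes "transport_pair u0 u"
  shows "transport_pair (\<lambda>x. c * u0 x) (\<lambda>z. c * u z)"
  unfolding transport_pair_def
proof
  fix \<phi> :: "real \<times> (real ^ 2) \<Rightarrow> real" assume \<phi>: "\<phi> \<in> tests (UNIV \<times> \<Omega>)"
  have "(LINT z|lborel. indicator {0..} (fst z) * (c * u z * fderiv \<phi> z (1, b (snd z)))) = c * (LINT z|lborel. indicator {0..} (fst z) * (u z * fderiv \<phi> z (1, b (snd z))))"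
    unfolding integral_mult_right_zero[symmetric] by (simp add: mult_ac)
  then show "(LINT z|lborel. indicator {0..} (fst z) * (c * u z * fderiv \<phi> z (1, b (snd z)))) = - (LINT x|lborel. c * u0 x * \<phi> (0, x))"
    using assms \<phi> unfolding transport_pair_def by (simp add: mult.assoc)
qed

text \<open>Boundedness is carried through the induction together with the equation, because the sum
  and product rules for solutions ask for it.\<close>

lemma transport_pair_polynomial:
  assumes iso: "discrete {x \<in> \<Omega>. \<not> good x}"
    and u: "bounded_borel u" "bounded_borel u0" "transport_pair u0 u" and p: "real_polynomial_function p"
  shows "bounded_borel (\<lambda>z. p (u z)) \<and> bounded_borel (\<lambda>x. p (u0 x)) \<and> transport_pair (\<lambda>x. p (u0 x)) (\<lambda>z. p (u z))"
  using p
proof (induction rule: real_polynomial_function.induct)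
  case (linear f)
  interpret f: bounded_linear f by (rule linear)
  define c where "c = f 1"
  have f: "f = (\<lambda>r. c * r)"
  proof
    fix r show "f r = c * r" using f.scaleR[of r 1] by (simp add: c_def)
  qed
  show ?case unfolding f
    by (intro conjI bounded_borel_mult[OF bounded_borel_const] u transport_pair_cmult)
next
  case (const c)
  then show ?case using transport_pair_cmult[OF transport_pair_1, of c] by (simp add: bounded_borel_const)
next
  case (add f g)
  then show ?case by (auto intro: bounded_borel_add transport_pair_add)
next
  case (mult f g)
  then show ?case by (auto intro: bounded_borel_mult transport_pair_mult[OF iso])
qed

text \<open>The defect \<open>L\<close> of the equation is linear in the renormalizing function and
  controlled by its supremum on an interval containing the values of u and u0. It vanishes on
  polynomials, hence by Weierstrass on \<beta>.\<close>

theorem transport_pair_renormalized: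
  assumes iso: "discrete {x \<in> \<Omega>. \<not> good x}"
    and u: "bounded_borel u" "bounded_borel u0" "transport_pair u0 u" and \<beta>: "continuous_on UNIV \<beta>"
  shows "transport_pair (\<lambda>x. \<beta> (u0 x)) (\<lambda>z. \<beta> (u z))"
  unfolding transport_pair_def
proof
  fix \<phi> :: "real \<times> (real ^ 2) \<Rightarrow> real" assume \<phi>: "\<phi> \<in> tests (UNIV \<times> \<Omega>)"
  obtain A where A: "\<And>z. \<bar>u z\<bar> \<le> A" using bounded_borelD(2)[OF u(1)] by blast
  obtain B where B: "\<And>z. \<bar>u0 z\<bar> \<le> B" using bounded_borelD(2)[OF u(2)] by blast
  define C where "C = max A B"
  have C: "u z \<in> {- C..C}" "u0 x \<in> {- C..C}" for z x using A[of z] B[of x] by (auto simp: C_def abs_le_iff)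
  \<comment> \<open>The summand 1 makes \<open>I\<close> positive and turns the final bound e / I *
    (I - 1) into a strict one.\<close>
  define I where "I = (LINT z|lborel. \<bar>fderiv \<phi> z (1, b (snd z))\<bar>) + (LINT x|lborel. \<bar>\<phi> (0, x)\<bar>) + 1"
  have iD: "integrable lborel (\<lambda>z. fderiv \<phi> z (1, b (snd z)))" by (rule integrable_fderiv_1_b[OF \<phi>])
  have i0: "integrable lborel (\<lambda>x. \<phi> (0, x))" by (rule tests_integrable[OF tests_slice(1)[OF \<phi>]])
  have I: "I > 0" unfolding I_def by (simp add: add_nonneg_pos)
  define L where "L \<gamma> = (LINT z|lborel. indicator {0..} (fst z) * (\<gamma> (u z) * fderiv \<phi> z (1, b (snd z)))) + (LINT x|lborel. \<gamma> (u0 x) * \<phi> (0, x))" for \<gamma> :: "real \<Rightarrow> real"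
  have "\<bar>L \<beta>\<bar> < e" if e: "e > 0" for e
  proof -
    have eI: "0 < e / I" using e I by simp
    obtain p where p: "real_polynomial_function p" and near: "\<And>s. s \<in> {- C..C} \<Longrightarrow> \<bar>\<beta> s - p s\<bar> \<le> e / I"
      using Stone_Weierstrass_real_polynomial_function[OF compact_Icc continuous_on_subset[OF \<beta> subset_UNIV] eI]
      by (metis less_imp_le)
    note q = transport_pair_polynomial[OF iso u p]
    note ip = transport_pair_integrable[OF conjunct1[OF q] conjunct1[OF conjunct2[OF q]] \<phi>]
    note ib = transport_pair_integrable[OF bounded_borel_comp[OF u(1) \<beta>] bounded_borel_comp[OF u(2) \<beta>] \<phi>]
    have "L p = 0" using q \<phi> unfolding transport_pair_def L_def by simp
    then have eq: "L \<beta> = (LINT z|lborel. indicator {0..} (fst z) * (\<beta> (u z) * fderiv \<phi> z (1, b (snd z))) - indicator {0..} (fst z) * (p (u z) * fderiv \<phi> z (1, b (snd z))))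
        + (LINT x|lborel. \<beta> (u0 x) * \<phi> (0, x) - p (u0 x) * \<phi> (0, x))"
      unfolding L_def using ip ib by simp
    have "\<bar>LINT z|lborel. indicator {0..} (fst z) * (\<beta> (u z) * fderiv \<phi> z (1, b (snd z))) - indicator {0..} (fst z) * (p (u z) * fderiv \<phi> z (1, b (snd z)))\<bar>
        \<le> (LINT z|lborel. e / I * \<bar>fderiv \<phi> z (1, b (snd z))\<bar>)"
    proof (rule order_trans[OF integral_abs_bound integral_mono])
      show "integrable lborel (\<lambda>z. \<bar>indicator {0..} (fst z) * (\<beta> (u z) * fderiv \<phi> z (1, b (snd z))) - indicator {0..} (fst z) * (p (u z) * fderiv \<phi> z (1, b (snd z)))\<bar>)"
        using ip(1) ib(1) by simp
      fix z
      have "\<bar>indicator {0..} (fst z) :: real\<bar> * \<bar>\<beta> (u z) - p (u z)\<bar> \<le> 1 * (e / I)"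
        by (rule mult_mono[OF _ near[OF C(1)]]) (auto simp: indicator_def)
      then have "\<bar>indicator {0..} (fst z) :: real\<bar> * \<bar>\<beta> (u z) - p (u z)\<bar> * \<bar>fderiv \<phi> z (1, b (snd z))\<bar> \<le> 1 * (e / I) * \<bar>fderiv \<phi> z (1, b (snd z))\<bar>"
        by (rule mult_right_mono) simp
      then show "\<bar>indicator {0..} (fst z) * (\<beta> (u z) * fderiv \<phi> z (1, b (snd z))) - indicator {0..} (fst z) * (p (u z) * fderiv \<phi> z (1, b (snd z)))\<bar>
          \<le> e / I * \<bar>fderiv \<phi> z (1, b (snd z))\<bar>"
        by (simp only: abs_mult mult.assoc mult_1_left flip: right_diff_distrib left_diff_distrib)
    qed (use iD in simp)
    moreover have "\<bar>LINT x|lborel. \<beta> (u0 x) * \<phi> (0, x) - p (u0 x) * \<phi> (0, x)\<bar> \<le> (LINT x|lborel. e / I * \<bar>\<phi> (0, x)\<bar>)"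
    proof (rule order_trans[OF integral_abs_bound integral_mono])
      show "integrable lborel (\<lambda>x. \<bar>\<beta> (u0 x) * \<phi> (0, x) - p (u0 x) * \<phi> (0, x)\<bar>)"
        using ip(2) ib(2) by simp
      fix x
      show "\<bar>\<beta> (u0 x) * \<phi> (0, x) - p (u0 x) * \<phi> (0, x)\<bar> \<le> e / I * \<bar>\<phi> (0, x)\<bar>"
        unfolding left_diff_distrib[symmetric] abs_mult by (rule mult_right_mono[OF near[OF C(2)]]) simp
    qed (use i0 in simp)
    ultimately have "\<bar>L \<beta>\<bar> \<le> (LINT z|lborel. e / I * \<bar>fderiv \<phi> z (1, b (snd z))\<bar>) + (LINT x|lborel. e / I * \<bar>\<phi> (0, x)\<bar>)"
      unfolding eq by linarith
    also have "\<dots> = e / I * (I - 1)" by (simp add: I_def distrib_left)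
    also have "\<dots> < e / I * I" using e I by (intro mult_strict_left_mono) auto
    also have "\<dots> = e" using I by simp
    finally show ?thesis .
  qed
  from this[of "\<bar>L \<beta>\<bar>"] have "L \<beta> = 0" by auto
  then show "(LINT z|lborel. indicator {0..} (fst z) * (\<beta> (u z) * fderiv \<phi> z (1, b (snd z)))) = - (LINT x|lborel. \<beta> (u0 x) * \<phi> (0, x))"
    unfolding L_def by simp
qed

end

subsection \<open>Borel versions and periodization\<close>

lemma borel_measurable_lebesgue_AE:
  fixes f g :: "'a::euclidean_space \<Rightarrow> 'b::euclidean_space"
  assumes "g \<in> borel_measurable lebesgue" "AE x in lborel. f x = g x"
  shows "f \<in> borel_measurable lebesgue"
proof -
  have "AE x in lebesgue. f x = g x" using assms(2) by (rule AE_completion)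
  then obtain N where N: "N \<in> null_sets lebesgue" "{x. f x \<noteq> g x} \<subseteq> N"
    unfolding eventually_ae_filter by auto
  have "g \<in> borel_measurable (lebesgue_on (- N))"
    using lebesgue_measurable_diff_null[OF N(1), of g] assms(1) by blast
  then have "f \<in> borel_measurable (lebesgue_on (- N))"
    by (rule measurable_cong[THEN iffD2, rotated]) (use N(2) in auto)
  then show ?thesis using lebesgue_measurable_diff_null[OF N(1), of f] by blast
qed

lemma borel_version:
  fixes f :: "'a::euclidean_space \<Rightarrow> 'b::euclidean_space"
  assumes "S \<in> sets borel" "f \<in> borel_measurable (lebesgue_on S)"
  obtains g where "g \<in> borel_measurable borel" "AE x in lborel. x \<in> S \<longrightarrow> f x = g x"
proof -
  let ?F = "\<lambda>x. if x \<in> S then f x else 0"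
  have F: "?F \<in> borel_measurable lebesgue"
    using borel_measurable_if[of S f] assms by simp
  have "\<exists>g. g \<in> borel_measurable borel \<and> (AE x in lborel. ?F x \<bullet> e = g x)" for e
  proof -
    have "(\<lambda>x. ?F x \<bullet> e) \<in> borel_measurable lebesgue" using F by measurable
    from completion_ex_borel_measurable_real[OF this] show ?thesis by auto
  qed
  then obtain G where G: "\<And>e. G e \<in> borel_measurable borel" "\<And>e. AE x in lborel. ?F x \<bullet> e = G e x" by metis
  have "AE x in lborel. \<forall>e\<in>Basis. ?F x \<bullet> e = G e x" by (rule AE_finite_allI) (use G(2) in auto)
  then have "AE x in lborel. x \<in> S \<longrightarrow> f x = (\<Sum>e\<in>Basis. G e x *\<^sub>R e)"
  proof eventually_elim
    case (elim x)
    show ?case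
    proof
      assume "x \<in> S"
      then have "(\<Sum>e\<in>Basis. G e x *\<^sub>R e) = (\<Sum>e\<in>Basis. (f x \<bullet> e) *\<^sub>R e)" using elim by simp
      then show "f x = (\<Sum>e\<in>Basis. G e x *\<^sub>R e)" by (simp add: euclidean_representation)
    qed
  qed
  moreover have "(\<lambda>x. \<Sum>e\<in>Basis. G e x *\<^sub>R e) \<in> borel_measurable borel" using G(1) by measurable
  ultimately show ?thesis using that by blast
qed

text \<open>The link between the integrals over restricted Lebesgue measure in the definitions and
  Borel integrals over the whole space. Completeness makes a function that agrees almost everywhere
  with a Borel function measurable.\<close>

lemma lebesgue_on_borel_version:
  fixes f g :: "'a::euclidean_space \<Rightarrow> real"
  assumes S: "S \<in> sets borel" and g: "g \<in> borel_measurable borel" "AE x in lborel. x \<in> S \<longrightarrow> f x = g x"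
  shows "(LINT x|lebesgue_on S. f x) = (LINT x|lborel. indicator S x * g x)"
    and "integrable (lebesgue_on S) f \<longleftrightarrow> integrable lborel (\<lambda>x. indicator S x * g x)"
    and "f \<in> borel_measurable (lebesgue_on S)"
proof -
  have G: "(\<lambda>x. indicator S x * g x) \<in> borel_measurable borel" using S g(1) by measurable
  then have G': "(\<lambda>x. indicator S x * g x) \<in> borel_measurable lebesgue" by (simp add: measurable_completion)
  have ae: "AE x in lborel. indicator S x *\<^sub>R f x = indicator S x * g x"
    using g(2) by eventually_elim (auto simp: indicator_def)
  have F: "(\<lambda>x. indicator S x *\<^sub>R f x) \<in> borel_measurable lebesgue"
    by (rule borel_measurable_lebesgue_AE[OF G' ae])
  have S': "S \<inter> space lebesgue \<in> sets lebesgue" using S by simp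
  show "(LINT x|lebesgue_on S. f x) = (LINT x|lborel. indicator S x * g x)"
    unfolding integral_restrict_space[OF S'] integral_cong_AE[OF F G' AE_completion[OF ae]]
    by (rule integral_completion) (use G in simp)
  show "integrable (lebesgue_on S) f \<longleftrightarrow> integrable lborel (\<lambda>x. indicator S x * g x)"
    unfolding integrable_restrict_space[OF S'] integrable_cong_AE[OF F G' AE_completion[OF ae]]
    by (rule integrable_completion) (use G in simp)
  have "(\<lambda>x. if x \<in> S then f x else 0) = (\<lambda>x. indicator S x *\<^sub>R f x)" by (auto simp: fun_eq_iff)
  then show "f \<in> borel_measurable (lebesgue_on S)"
    using borel_measurable_if[of S f] S F by simp
qed

section \<open>Tilings and periodization\<close>

lemma AE_translate_lborel:
  fixes a :: "'a::euclidean_space"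
  assumes "AE z in lborel. P z"
  shows "AE z in lborel. P (z + a)"
proof -
  obtain N where N: "{z \<in> space lborel. \<not> P z} \<subseteq> N" "emeasure lborel N = 0" "N \<in> sets lborel"
    using assms by (rule AE_E)
  have "emeasure lborel ((\<lambda>z. z + a) -` N) = emeasure (distr lborel borel (\<lambda>z. z + a)) N"
    using N(3) by (subst emeasure_distr) auto
  then have 0: "emeasure lborel ((\<lambda>z. z + a) -` N) = 0" using N(2) by (simp add: lborel_distr_translate)
  show ?thesis
    by (rule AE_I[of _ _ "(\<lambda>z. z + a) -` N"])
       (use N 0 measurable_sets_borel[of "\<lambda>z. z + a" borel N] in auto)
qed

text \<open>A group \<open>K\<close> of translations with fundamental cell \<open>C\<close>. The
  instances are the integer lattice in the plane and the same lattice acting on space-time, whose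
  cell is unbounded in time. Hence \<open>shift_bound\<close> instead of boundedness of the cell: it
  ensures that only finitely many translates of the cell meet a given ball.\<close>

locale tiling =
  fixes K C :: "'a::euclidean_space set" and M :: real
  assumes finite_shifts: "\<And>r. finite {k \<in> K. norm k \<le> r}"
    and shift_add: "\<And>k l. k \<in> K \<Longrightarrow> l \<in> K \<Longrightarrow> k + l \<in> K"
    and shift_minus: "\<And>k. k \<in> K \<Longrightarrow> - k \<in> K"
    and cell_borel: "C \<in> sets borel"
    and unique_shift: "\<And>z. \<exists>!k. k \<in> K \<and> z - k \<in> C"
    and shift_bound: "\<And>z k. z \<in> C \<Longrightarrow> k \<in> K \<Longrightarrow> norm k \<le> norm (z + k) + M"
begin

lemma countable_shifts: "countable K"
proof -
  have "K = (\<Union>n. {k \<in> K. norm k \<le> real n})" using real_arch_simple by auto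
  moreover have "countable (\<Union>n. {k \<in> K. norm k \<le> real n})"
    by (intro countable_UN countable_finite[OF finite_shifts]) auto
  ultimately show ?thesis by simp
qed

lemma finite_near: "finite {k \<in> K. norm (z + k) \<le> R}"
proof (rule finite_subset[OF _ finite_shifts[of "R + norm z"]])
  show "{k \<in> K. norm (z + k) \<le> R} \<subseteq> {k \<in> K. norm k \<le> R + norm z}"
  proof safe
    fix k assume "norm (z + k) \<le> R"
    then show "norm k \<le> R + norm z" using norm_triangle_ineq4[of "z + k" z] by simp
  qed
qed

text \<open>There are countably many translations, so outside one null set the two functions agree
  at all translates simultaneously. Evaluating \<open>g\<close> at a chosen representative
  \<open>r z\<close> then gives a version with the periodicity of \<open>r\<close>.\<close>

lemma periodic_version:
  assumes ae: "AE z in lborel. z \<in> S \<longrightarrow> f z = g z"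
    and per: "\<And>z k. k \<in> K \<Longrightarrow> z \<in> S \<Longrightarrow> z + k \<in> S \<and> f (z + k) = f z"
    and r: "\<And>z. \<exists>k\<in>K. r z = z + k"
  shows "AE z in lborel. z \<in> S \<longrightarrow> f z = g (r z)"
proof -
  have "AE z in lborel. \<forall>k\<in>K. z + k \<in> S \<longrightarrow> f (z + k) = g (z + k)"
    unfolding AE_ball_countable[OF countable_shifts] by (intro ballI AE_translate_lborel[OF ae])
  then show ?thesis
  proof eventually_elim
    case (elim z)
    obtain k where k: "k \<in> K" "r z = z + k" using r by blast
    show ?case using elim k per[OF k(1), of z] by auto
  qed
qed

text \<open>Cut the integral along the translates of the cell and shift each piece back to
  \<open>C\<close>. Only the shifts in \<open>A\<close> matter, because \<open>G\<close> vanishes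
  outside a ball.\<close>

lemma integral_unfold:
  fixes G :: "'a \<Rightarrow> real"
  assumes G: "integrable lborel G" and vanish: "\<And>z. norm z > R \<Longrightarrow> G z = 0"
  shows "(LINT z|lborel. G z) = (LINT z|lborel. indicator C z * (\<Sum>k | k \<in> K \<and> norm (z + k) \<le> R. G (z + k)))"
proof -
  define A where "A = {k \<in> K. norm k \<le> R + M}"
  have fin: "finite A" unfolding A_def by (rule finite_shifts)
  have [measurable]: "G \<in> borel_measurable borel" "C \<in> sets borel" using G cell_borel by auto
  have part: "G z = (\<Sum>k\<in>A. indicator C (z - k) * G z)" for z
  proof (cases "norm z > R")
    case False
    obtain k where k: "k \<in> K" "z - k \<in> C" "\<And>l. l \<in> K \<Longrightarrow> z - l \<in> C \<Longrightarrow> l = k" using unique_shift[of z] by blast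
    have kA: "k \<in> A" using shift_bound[OF k(2,1)] k(1) False by (simp add: A_def)
    have ind: "indicator C (z - l) * G z = (if l = k then G z else 0)" if "l \<in> A" for l
    proof (cases "l = k")
      case False
      have "l \<in> K" using that by (simp add: A_def)
      then have "z - l \<notin> C" using k(3) False by blast
      then show ?thesis using False by simp
    qed (use k(2) in simp)
    have "(\<Sum>l\<in>A. indicator C (z - l) * G z) = (\<Sum>l\<in>A. if l = k then G z else 0)"
      by (rule sum.cong[OF refl ind])
    then show ?thesis using kA fin by simp
  qed (simp add: vanish)
  have int: "integrable lborel (\<lambda>z. indicator C (z - k) * G z)" for k
    by (rule Bochner_Integration.integrable_bound[OF G]) (auto simp: indicator_def)
  have shift: "(LINT z|lborel. indicator C (z - k) * G z) = (LINT z|lborel. indicator C z * G (z + k))" for k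
    using integral_translate_lborel[of "\<lambda>z. indicator C (z - k) * G z" k] by simp
  have int': "integrable lborel (\<lambda>z. indicator C z * G (z + k))" for k
    using integrable_translate_lborel[OF int[of k], of k] by simp
  have near: "indicator C z * (\<Sum>k\<in>A. G (z + k)) = indicator C z * (\<Sum>k | k \<in> K \<and> norm (z + k) \<le> R. G (z + k))" for z
  proof (cases "z \<in> C")
    case True
    have "(\<Sum>k | k \<in> K \<and> norm (z + k) \<le> R. G (z + k)) = (\<Sum>k\<in>A. G (z + k))"
    proof (rule sum.mono_neutral_left[OF fin])
      show "{k \<in> K. norm (z + k) \<le> R} \<subseteq> A" using shift_bound[OF True] by (force simp: A_def)
      show "\<forall>k\<in>A - {k \<in> K. norm (z + k) \<le> R}. G (z + k) = 0" using vanish by (auto simp: A_def not_le)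
    qed
    then show ?thesis by simp
  qed simp
  have "(LINT z|lborel. G z) = (LINT z|lborel. (\<Sum>k\<in>A. indicator C (z - k) * G z))"
    by (rule Bochner_Integration.integral_cong[OF refl part])
  also have "\<dots> = (\<Sum>k\<in>A. LINT z|lborel. indicator C z * G (z + k))"
    using int by (simp add: shift)
  also have "\<dots> = (LINT z|lborel. (\<Sum>k\<in>A. indicator C z * G (z + k)))"
    using int' by simp
  also have "\<dots> = (LINT z|lborel. indicator C z * (\<Sum>k | k \<in> K \<and> norm (z + k) \<le> R. G (z + k)))"
    by (simp add: near flip: sum_distrib_left)
  finally show ?thesis .
qed

text \<open>Restricting the sum to nonzero terms makes the index set finite for compactly supported
  functions without naming a radius; a sum over an infinite index set would be 0 by
  convention.\<close>

definition periodize :: "('a \<Rightarrow> real) \<Rightarrow> 'a \<Rightarrow> real" where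
  "periodize \<phi> z = (\<Sum>k | k \<in> K \<and> \<phi> (z + k) \<noteq> 0. \<phi> (z + k))"

lemma periodize_eq:
  assumes "finite A" "A \<subseteq> K" "\<And>k. k \<in> K \<Longrightarrow> k \<notin> A \<Longrightarrow> \<phi> (z + k) = 0"
  shows "periodize \<phi> z = (\<Sum>k\<in>A. \<phi> (z + k))"
  unfolding periodize_def by (rule sum.mono_neutral_left) (use assms in auto)

lemma periodize_mult:
  assumes "finite {k \<in> K. \<eta> (z + k) \<noteq> 0}" and per: "\<And>k. k \<in> K \<Longrightarrow> \<phi> (z + k) = \<phi> z"
  shows "periodize (\<lambda>z. \<phi> z * \<eta> z) z = \<phi> z * periodize \<eta> z"
proof -
  have "periodize (\<lambda>z. \<phi> z * \<eta> z) z = (\<Sum>k | k \<in> K \<and> \<eta> (z + k) \<noteq> 0. \<phi> (z + k) * \<eta> (z + k))"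
    by (rule periodize_eq[OF assms(1)]) auto
  also have "\<dots> = (\<Sum>k | k \<in> K \<and> \<eta> (z + k) \<noteq> 0. \<phi> z * \<eta> (z + k))" by (rule sum.cong) (simp_all add: per)
  finally show ?thesis by (simp add: periodize_def sum_distrib_left)
qed

text \<open>Near each point one fixed finite set of shifts suffices, so the periodization is locally
  a finite sum of smooth functions. Periodicity is a reindexing of the sum by the group.\<close>

lemma
  assumes sm: "smooth \<phi>" and vanish: "\<And>z. norm z > R \<Longrightarrow> \<phi> z = 0"
  shows periodize_near: "periodize \<phi> z = (\<Sum>k | k \<in> K \<and> norm (z + k) \<le> R. \<phi> (z + k))"
    and smooth_periodize: "smooth (periodize \<phi>)"
    and fderiv_periodize: "fderiv (periodize \<phi>) z v = (\<Sum>k | k \<in> K \<and> norm (z + k) \<le> R. fderiv \<phi> (z + k) v)"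
    and periodize_periodic: "k \<in> K \<Longrightarrow> periodize \<phi> (z + k) = periodize \<phi> z"
proof -
  show near: "periodize \<phi> z = (\<Sum>k | k \<in> K \<and> norm (z + k) \<le> R. \<phi> (z + k))" for z
    by (rule periodize_eq[OF finite_near]) (use vanish in \<open>auto simp: not_le\<close>)
  \<comment> \<open>Large enough for every point within distance 1 of \<open>z\<close>, so that the
    same sum represents the periodization on a whole neighbourhood.\<close>
  define A where "A z = {k \<in> K. norm k \<le> R + norm z + 1}" for z :: 'a
  have finA: "finite (A z)" for z unfolding A_def by (rule finite_shifts)
  have loc: "periodize \<phi> y = (\<Sum>k\<in>A z. \<phi> (y + k))" if "y \<in> ball z 1" for y z
  proof (rule periodize_eq[OF finA])
    fix k assume k: "k \<in> K" "k \<notin> A z"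
    have "norm y < norm z + 1" using that norm_triangle_ineq2[of y z] by (simp add: dist_norm norm_minus_commute)
    moreover have "norm k \<le> norm (y + k) + norm y" using norm_triangle_ineq4[of "y + k" y] by simp
    ultimately show "\<phi> (y + k) = 0" using k by (intro vanish) (auto simp: A_def)
  qed (auto simp: A_def)
  have sh: "smooth (\<lambda>y. \<phi> (y + k))" "fderiv (\<lambda>y. \<phi> (y + k)) z v = fderiv \<phi> (z + k) v" for k z v
    using smooth_comp_affine[OF sm linear_id, of k] by simp_all
  show "smooth (periodize \<phi>)"
  proof (rule smooth_local)
    fix z
    show "\<exists>U g. open U \<and> z \<in> U \<and> smooth g \<and> (\<forall>y\<in>U. periodize \<phi> y = g y)"
      using smooth_sum[of "A z" "\<lambda>k y. \<phi> (y + k)", OF sh(1)] loc[of _ z]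
      by (intro exI[of _ "ball z 1"] exI[of _ "\<lambda>y. \<Sum>k\<in>A z. \<phi> (y + k)"]) auto
  qed
  show "fderiv (periodize \<phi>) z v = (\<Sum>k | k \<in> K \<and> norm (z + k) \<le> R. fderiv \<phi> (z + k) v)"
  proof -
    have "((\<lambda>y. \<Sum>k\<in>A z. \<phi> (y + k)) has_derivative (\<lambda>v. \<Sum>k\<in>A z. fderiv (\<lambda>y. \<phi> (y + k)) z v)) (at z)"
      by (intro has_derivative_sum smooth_has_derivative sh)
    then have "(periodize \<phi> has_derivative (\<lambda>v. \<Sum>k\<in>A z. fderiv (\<lambda>y. \<phi> (y + k)) z v)) (at z)"
      by (rule has_derivative_transform_within_open[of _ _ _ _ "ball z 1"]) (use loc in auto)
    then have "fderiv (periodize \<phi>) z v = (\<Sum>k\<in>A z. fderiv \<phi> (z + k) v)" by (simp add: fderivI sh)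
    also have "\<dots> = (\<Sum>k | k \<in> K \<and> norm (z + k) \<le> R. fderiv \<phi> (z + k) v)"
    proof (rule sum.mono_neutral_right[OF finA])
      show "{k \<in> K. norm (z + k) \<le> R} \<subseteq> A z"
      proof safe
        fix k assume "k \<in> K" "norm (z + k) \<le> R"
        then show "k \<in> A z" using norm_triangle_ineq4[of "z + k" z] by (simp add: A_def)
      qed
      show "\<forall>k\<in>A z - {k \<in> K. norm (z + k) \<le> R}. fderiv \<phi> (z + k) v = 0"
      proof
        fix k assume "k \<in> A z - {k \<in> K. norm (z + k) \<le> R}"
        then have "z + k \<notin> cball 0 R" by (auto simp: A_def)
        then show "fderiv \<phi> (z + k) v = 0"
          by (rule fderiv_eq_0_outside[rotated 2]) (use vanish in auto)
      qed
    qed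
    finally show ?thesis .
  qed
  show "periodize \<phi> (z + k) = periodize \<phi> z" if k: "k \<in> K"
  proof -
    have "bij_betw (\<lambda>l. k + l) {l \<in> K. norm (z + k + l) \<le> R} {l \<in> K. norm (z + l) \<le> R}"
    proof (rule bij_betw_byWitness[where f'="\<lambda>l. - k + l"])
      show "(+) k ` {l \<in> K. norm (z + k + l) \<le> R} \<subseteq> {l \<in> K. norm (z + l) \<le> R}"
        using shift_add[OF k] by (auto simp: add.assoc)
      show "(+) (- k) ` {l \<in> K. norm (z + l) \<le> R} \<subseteq> {l \<in> K. norm (z + k + l) \<le> R}"
        using shift_add[OF shift_minus[OF k]] by (auto simp: add.assoc)
    qed auto
    from sum.reindex_bij_betw[OF this, of "\<lambda>l. \<phi> (z + l)"] show ?thesis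
      unfolding near by (simp add: add.assoc)
  qed
qed

lemma tests_UNIV_vanish:
  assumes "\<phi> \<in> tests (UNIV :: 'a set)"
  obtains R where "\<And>z. norm z > R \<Longrightarrow> \<phi> z = 0"
proof -
  obtain L where L: "compact L" "\<And>z. z \<notin> L \<Longrightarrow> \<phi> z = 0" using tests_cases[OF assms] by blast
  obtain R where "\<forall>z\<in>L. norm z \<le> R" using compact_imp_bounded[OF L(1)] unfolding bounded_iff by blast
  then show ?thesis using that L(2) by (meson not_le)
qed

lemma integral_periodize_fderiv:
  assumes \<phi>: "\<phi> \<in> tests UNIV" and m: "\<And>z k. k \<in> K \<Longrightarrow> m (z + k) = m z"
    and V: "\<And>z k. k \<in> K \<Longrightarrow> V (z + k) = V z"
    and int: "integrable lborel (\<lambda>z. m z * fderiv \<phi> z (V z))"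
  shows "(LINT z|lborel. m z * fderiv \<phi> z (V z)) = (LINT z|lborel. indicator C z * (m z * fderiv (periodize \<phi>) z (V z)))"
proof -
  have sm: "smooth \<phi>" using \<phi> by (rule testsD)
  obtain R where R: "\<And>z. norm z > R \<Longrightarrow> \<phi> z = 0" using tests_UNIV_vanish[OF \<phi>] by blast
  have out: "m z * fderiv \<phi> z (V z) = 0" if "norm z > R" for z
    using fderiv_eq_0_outside[of "cball 0 R" \<phi> z "V z"] R that by auto
  show ?thesis
    by (rule integral_unfold[OF int out, THEN trans], assumption)
       (simp add: fderiv_periodize[OF sm R] m V sum_distrib_left)
qed

lemma integral_periodize:
  assumes \<phi>: "\<phi> \<in> tests UNIV" and m: "\<And>z k. k \<in> K \<Longrightarrow> m (z + k) = m z"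
    and int: "integrable lborel (\<lambda>z. m z * \<phi> z)"
  shows "(LINT z|lborel. m z * \<phi> z) = (LINT z|lborel. indicator C z * (m z * periodize \<phi> z))"
proof -
  have sm: "smooth \<phi>" using \<phi> by (rule testsD)
  obtain R where R: "\<And>z. norm z > R \<Longrightarrow> \<phi> z = 0" using tests_UNIV_vanish[OF \<phi>] by blast
  have out: "m z * \<phi> z = 0" if "norm z > R" for z using R that by simp
  show ?thesis
    by (rule integral_unfold[OF int out, THEN trans], assumption)
       (simp add: periodize_near[OF sm R] m sum_distrib_left)
qed

end

section \<open>The integer lattice of the torus\<close>

definition int_lattice :: "(real ^ 2) set" where
  "int_lattice = {k. \<forall>i. k $ i \<in> \<int>}"

lemma int_latticeE:
  assumes "k \<in> int_lattice"
  obtains m where "k = (\<chi> i. of_int (m i))"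
proof -
  have "\<forall>i. \<exists>n. k $ i = of_int n" using assms by (auto simp: int_lattice_def elim!: Ints_cases)
  then obtain m where "\<And>i. k $ i = of_int (m i)" by metis
  then show ?thesis using that[of m] by (simp add: vec_eq_iff)
qed

lemma finite_lattice_box: "finite {k \<in> int_lattice. \<forall>i. \<bar>k $ i\<bar> \<le> r}"
proof (rule finite_subset)
  let ?I = "{- \<lceil>r\<rceil>..\<lceil>r\<rceil>}"
  show "finite ((\<lambda>(a, b). (\<chi> i. if i = 1 then of_int a else of_int b) :: real ^ 2) ` (?I \<times> ?I))" by simp
  show "{k \<in> int_lattice. \<forall>i. \<bar>k $ i\<bar> \<le> r} \<subseteq> (\<lambda>(a, b). \<chi> i. if i = 1 then of_int a else of_int b) ` (?I \<times> ?I)"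
  proof safe
    fix k assume k: "k \<in> int_lattice" and le: "\<forall>i. \<bar>k $ i\<bar> \<le> r"
    obtain m where m: "k = (\<chi> i. of_int (m i))" using int_latticeE[OF k] .
    have "m i \<in> ?I" for i using spec[OF le, of i] by (simp add: m abs_le_iff) linarith
    moreover have "k = (\<chi> i. if i = 1 then of_int (m 1) else of_int (m 2))" by (simp add: m vec_eq_iff forall_2)
    ultimately show "k \<in> (\<lambda>(a, b). \<chi> i. if i = 1 then of_int a else of_int b) ` (?I \<times> ?I)"
      by (intro image_eqI[of _ _ "(m 1, m 2)"]) auto
  qed
qed

lemma finite_lattice_norm: "finite {k \<in> int_lattice. norm k \<le> r}"
  by (rule finite_subset[OF _ finite_lattice_box[of r]]) (use component_le_norm_cart order_trans in blast)

lemma torus_cell_borel: "cell Torus \<in> sets borel"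
proof -
  have "cell Torus = (\<Inter>i\<in>UNIV. (\<lambda>x. x $ i) -` {0..<1})" by auto
  moreover have "(\<lambda>x::real ^ 2. x $ i) -` {0..<1} \<in> sets borel" for i
    using measurable_sets_borel[of "\<lambda>x::real ^ 2. x $ i" borel "{0..<1}"] by simp
  ultimately show ?thesis by (simp add: sets.finite_INT)
qed

lemma torus_cell_norm: "x \<in> cell Torus \<Longrightarrow> norm x \<le> 2"
proof -
  assume x: "x \<in> cell Torus"
  have "norm x \<le> (\<Sum>i\<in>UNIV. \<bar>x $ i\<bar>)" by (rule norm_le_l1_cart)
  also have "\<dots> \<le> (\<Sum>i\<in>(UNIV :: 2 set). 1)" using x by (intro sum_mono) (auto simp: less_imp_le)
  finally show ?thesis by simp
qed

lemma unique_lattice_shift: "\<exists>!k. k \<in> int_lattice \<and> z - k \<in> cell Torus"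
proof
  show "(\<chi> i. of_int \<lfloor>z $ i\<rfloor>) \<in> int_lattice \<and> z - (\<chi> i. of_int \<lfloor>z $ i\<rfloor>) \<in> cell Torus"
    by (auto simp: int_lattice_def; linarith)
  fix k assume k: "k \<in> int_lattice \<and> z - k \<in> cell Torus"
  obtain m where m: "k = (\<chi> i. of_int (m i))" using int_latticeE k by blast
  have "\<lfloor>z $ i\<rfloor> = m i" for i using k unfolding m by (intro floor_unique) (auto simp: algebra_simps)
  then show "k = (\<chi> i. of_int \<lfloor>z $ i\<rfloor>)" by (simp add: m)
qed

interpretation space: tiling int_lattice "cell Torus" 2
proof
  show "finite {k \<in> int_lattice. norm k \<le> r}" for r by (rule finite_lattice_norm)
  show "\<exists>!k. k \<in> int_lattice \<and> z - k \<in> cell Torus" for z by (rule unique_lattice_shift)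
  show "norm k \<le> norm (z + k) + 2" if "z \<in> cell Torus" for z k
    using norm_triangle_ineq4[of "z + k" z] torus_cell_norm[OF that] by simp
qed (auto simp: int_lattice_def torus_cell_borel simp del: cell.simps)

interpretation spacetime: tiling "{0::real} \<times> int_lattice" "UNIV \<times> cell Torus" 2
proof
  show "finite {k \<in> {0::real} \<times> int_lattice. norm k \<le> r}" for r
  proof (rule finite_subset)
    show "finite (Pair (0::real) ` {k \<in> int_lattice. norm k \<le> r})" by (intro finite_imageI finite_lattice_norm)
    show "{k \<in> {0::real} \<times> int_lattice. norm k \<le> r} \<subseteq> Pair 0 ` {k \<in> int_lattice. norm k \<le> r}"
      by (auto simp: norm_Pair)
  qed
  show "UNIV \<times> cell Torus \<in> sets (borel :: (real \<times> (real ^ 2)) measure)"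
    unfolding borel_prod[symmetric] using torus_cell_borel by (intro pair_measureI) auto
  show "\<exists>!k. k \<in> {0::real} \<times> int_lattice \<and> z - k \<in> UNIV \<times> cell Torus" for z
  proof -
    obtain k where k: "k \<in> int_lattice" "snd z - k \<in> cell Torus" "\<And>l. l \<in> int_lattice \<Longrightarrow> snd z - l \<in> cell Torus \<Longrightarrow> l = k"
      using unique_lattice_shift[of "snd z"] by blast
    show ?thesis
    proof (rule ex1I[of _ "(0, k)"])
      show "(0, k) \<in> {0} \<times> int_lattice \<and> z - (0, k) \<in> UNIV \<times> cell Torus"
        using k(1,2) by (simp add: mem_Times_iff del: cell.simps)
      fix l assume "l \<in> {0::real} \<times> int_lattice \<and> z - l \<in> UNIV \<times> cell Torus"
      then show "l = (0, k)" using k(3)[of "snd l"] by (simp add: mem_Times_iff prod_eq_iff del: cell.simps)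
    qed
  qed
  show "norm k \<le> norm (z + k) + 2" if "z \<in> UNIV \<times> cell Torus" "k \<in> {0::real} \<times> int_lattice" for z k
  proof -
    have "norm (snd k) \<le> norm (snd z + snd k) + norm (snd z)"
      using norm_triangle_ineq4[of "snd z + snd k" "snd z"] by simp
    moreover have "norm k = norm (snd k)" using that(2) by (auto simp: norm_Pair)
    moreover have "norm (snd z + snd k) \<le> norm (z + k)" using norm_snd_le[of "snd z + snd k" "fst z + fst k"] by (simp add: plus_prod_def)
    moreover have "norm (snd z) \<le> 2" using that(1) by (intro torus_cell_norm) (simp add: mem_Times_iff del: cell.simps)
    ultimately show ?thesis by linarith
  qed
qed (auto simp: int_lattice_def)

lemma spacetime_periodize_slice: "spacetime.periodize \<phi> (t, x) = space.periodize (\<lambda>x. \<phi> (t, x)) x"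
proof -
  have "{k \<in> {0} \<times> int_lattice. \<phi> ((t, x) + k) \<noteq> 0} = Pair 0 ` {k \<in> int_lattice. \<phi> (t, x + k) \<noteq> 0}" by auto
  then show ?thesis
    unfolding spacetime.periodize_def space.periodize_def by (simp add: sum.reindex inj_on_def)
qed

lemma function_on_torus_periodic:
  assumes "function_on Torus f" "k \<in> int_lattice"
  shows "f (x + k) = f x"
proof -
  have f: "f (x + axis i 1) = f x" for x i using assms(1) by simp
  have int: "f (x + of_int n *\<^sub>R axis i 1) = f x" for x i n
  proof (induction n rule: int_induct[where k=0])
    case (step1 n)
    have "x + of_int (n + 1) *\<^sub>R axis i 1 = (x + of_int n *\<^sub>R axis i 1) + axis i 1" by (simp add: algebra_simps)
    then show ?case using step1 f by metis
  next
    case (step2 n)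
    have "(x + of_int (n - 1) *\<^sub>R axis i 1) + axis i 1 = x + of_int n *\<^sub>R axis i 1" by (simp add: algebra_simps)
    then show ?case using step2 f by metis
  qed simp
  obtain m where m: "k = (\<chi> i. of_int (m i))" using int_latticeE[OF assms(2)] .
  have "k = of_int (m 1) *\<^sub>R axis 1 1 + of_int (m 2) *\<^sub>R axis 2 1"
    by (simp add: m vec_eq_iff forall_2 axis_def)
  then show ?thesis using int[of "x + of_int (m 1) *\<^sub>R axis 1 1" "m 2" 2] int[of x "m 1" 1] by (simp add: add.assoc)
qed

lemma function_on_torusI: "(\<And>x k. k \<in> int_lattice \<Longrightarrow> f (x + k) = f x) \<Longrightarrow> function_on Torus f"
  by (simp add: int_lattice_def axis_def)

section \<open>A smooth partition of unity by integer translates\<close>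

definition bump :: "real \<Rightarrow> real" where
  "bump s = smooth_step (s + 1) - smooth_step s"

lemma bump_eq_0: "1 \<le> \<bar>s\<bar> \<Longrightarrow> bump s = 0"
  by (cases "s \<ge> 0") (auto simp: bump_def smooth_step_eq_0 smooth_step_eq_1)

text \<open>The sum telescopes to a difference of two steps, which sits at its limiting value 1 - 0
  once n reaches |s|.\<close>

lemma sum_bump: "\<bar>s\<bar> \<le> real n \<Longrightarrow> (\<Sum>a\<in>{- int n..int n}. bump (s + of_int a)) = 1"
proof -
  assume s: "\<bar>s\<bar> \<le> real n"
  have "(\<Sum>a\<in>{- int n..int n}. bump (s + of_int a)) = smooth_step (s + real n + 1) - smooth_step (s - real n)"
  proof (induction n)
    case (Suc n)
    have "{- int (Suc n)..int (Suc n)} = insert (int n + 1) (insert (- int n - 1) {- int n..int n})" by auto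
    then show ?case using Suc by (simp add: bump_def algebra_simps)
  qed (simp add: bump_def)
  then show ?thesis using s by (simp add: smooth_step_eq_0 smooth_step_eq_1)
qed

definition bump2 :: "real ^ 2 \<Rightarrow> real" where
  "bump2 x = bump (x $ 1) * bump (x $ 2)"

lemma bump2_eq_0: "1 \<le> \<bar>x $ i\<bar> \<Longrightarrow> bump2 x = 0"
  using exhaust_2[of i] by (auto simp: bump2_def bump_eq_0)

lemma smooth_bump2: "smooth bump2"
proof -
  have g: "smooth bump" unfolding bump_def[abs_def]
    using smooth_comp_affine(1)[OF smooth_smooth_step linear_id, of 1] by (simp add: smooth_diff smooth_smooth_step)
  have "linear (\<lambda>x::real ^ 2. x $ i)" for i by (simp add: linear_iff)
  then have "smooth (\<lambda>x::real ^ 2. bump (x $ i))" for i using smooth_comp_affine(1)[OF g, of "\<lambda>x::real ^ 2. x $ i" 0] by simp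
  then show ?thesis unfolding bump2_def[abs_def] by (intro smooth_mult)
qed

lemma finite_bump2: "finite {k \<in> int_lattice. bump2 (x + k) \<noteq> 0}"
proof (rule finite_subset[OF _ finite_lattice_box[of "1 + norm x"]])
  show "{k \<in> int_lattice. bump2 (x + k) \<noteq> 0} \<subseteq> {k \<in> int_lattice. \<forall>i. \<bar>k $ i\<bar> \<le> 1 + norm x}"
  proof safe
    fix k i assume "bump2 (x + k) \<noteq> 0"
    then have "\<bar>x $ i + k $ i\<bar> < 1" using bump2_eq_0[of "x + k" i] by (auto simp: not_le[symmetric])
    then show "\<bar>k $ i\<bar> \<le> 1 + norm x" using component_le_norm_cart[of x i] by linarith
  qed
qed

lemma periodize_bump2: "space.periodize bump2 x = 1"
proof -
  obtain n where n: "norm x + 2 \<le> real n" using real_arch_simple by blast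
  define I where "I = {- int n..int n}"
  define v where "v = (\<lambda>(a, b). (\<chi> i. if i = 1 then of_int a else of_int b) :: real ^ 2)"
  have v: "v p $ 1 = of_int (fst p)" "v p $ 2 = of_int (snd p)" for p by (auto simp: v_def split: prod.splits)
  have inj: "inj_on v (I \<times> I)"
  proof (rule inj_onI)
    fix p q assume "v p = v q"
    then have "v p $ 1 = v q $ 1" "v p $ 2 = v q $ 2" by auto
    then show "p = q" by (simp add: v prod_eq_iff)
  qed
  have "space.periodize bump2 x = (\<Sum>k\<in>v ` (I \<times> I). bump2 (x + k))"
  proof (rule space.periodize_eq)
    show "v ` (I \<times> I) \<subseteq> int_lattice" by (auto simp: v_def int_lattice_def)
    fix k assume k: "k \<in> int_lattice" "k \<notin> v ` (I \<times> I)"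
    obtain m where m: "k = (\<chi> i. of_int (m i))" using int_latticeE[OF k(1)] .
    have "k = v (m 1, m 2)" by (simp add: m v_def vec_eq_iff forall_2)
    then have "\<not> (m 1 \<in> I \<and> m 2 \<in> I)" using k(2) by blast
    then obtain i where i: "m i \<notin> I" by blast
    then have "1 + int n \<le> \<bar>m i\<bar>" by (auto simp: I_def abs_if)
    then have "1 + real n \<le> \<bar>k $ i\<bar>" by (simp add: m)
    then show "bump2 (x + k) = 0"
      using component_le_norm_cart[of x i] n by (intro bump2_eq_0[of _ i]) simp
  qed (simp add: I_def)
  also have "\<dots> = (\<Sum>p\<in>I \<times> I. bump2 (x + v p))" by (simp add: sum.reindex[OF inj])
  also have "\<dots> = (\<Sum>a\<in>I. \<Sum>b\<in>I. bump (x $ 1 + of_int a) * bump (x $ 2 + of_int b))"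
    by (simp add: sum.cartesian_product bump2_def v split_beta)
  also have "\<dots> = (\<Sum>a\<in>I. bump (x $ 1 + of_int a)) * (\<Sum>b\<in>I. bump (x $ 2 + of_int b))"
    by (rule sum_product[symmetric])
  also have "\<dots> = 1"
    using component_le_norm_cart[of x 1] component_le_norm_cart[of x 2] n unfolding I_def
    by (subst (1 2) sum_bump) auto
  finally show ?thesis .
qed

text \<open>Multiplying a periodic function by \<open>bump2\<close> makes it compactly supported in
  space. Periodizing the product pulls the periodic factor out and leaves the sum of the translates
  of \<open>bump2\<close>, which is 1.\<close>

lemma torus_test_eq_periodize:
  assumes \<phi>: "spacetime_test Torus \<phi>"
  defines "\<eta> \<equiv> \<lambda>z. \<phi> z * bump2 (snd z)"
  shows "\<eta> \<in> tests (UNIV \<times> UNIV)" and "spacetime.periodize \<eta> = \<phi>"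
proof -
  have sm: "smooth \<phi>" and per: "function_on Torus (\<lambda>x. \<phi> (t, x))" for t
    using \<phi> unfolding spacetime_test_def by blast+
  obtain T where T: "\<And>t x. T < \<bar>t\<bar> \<Longrightarrow> \<phi> (t, x) = 0"
    using \<phi> unfolding spacetime_test_def compact_support_in_spacetime.simps by blast
  have lin: "linear (snd :: real \<times> (real ^ 2) \<Rightarrow> real ^ 2)" by (auto simp: linear_iff)
  have smg: "smooth (\<lambda>z::real \<times> (real ^ 2). bump2 (snd z))"
    using smooth_comp_affine(1)[OF smooth_bump2 lin, of 0] by simp
  show "\<eta> \<in> tests (UNIV \<times> UNIV)" unfolding \<eta>_def
  proof (rule testsI[OF smooth_mult[OF sm smg], of "{- T..T} \<times> cball 0 2"])
    show "compact ({- T..T} \<times> cball (0::real ^ 2) 2)" by (intro compact_Times) auto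
    fix z :: "real \<times> (real ^ 2)" assume z: "z \<notin> {- T..T} \<times> cball 0 2"
    show "\<phi> z * bump2 (snd z) = 0"
    proof (cases "T < \<bar>fst z\<bar>")
      case True
      then show ?thesis using T[of "fst z" "snd z"] by simp
    next
      case False
      then have "2 < norm (snd z)" using z by (auto simp: mem_Times_iff abs_le_iff not_less)
      moreover have "norm (snd z) \<le> (\<Sum>i\<in>UNIV. \<bar>snd z $ i\<bar>)" by (rule norm_le_l1_cart)
      ultimately have "2 < \<bar>snd z $ 1\<bar> + \<bar>snd z $ 2\<bar>" by (simp add: sum_2)
      then have "1 \<le> \<bar>snd z $ 1\<bar> \<or> 1 \<le> \<bar>snd z $ 2\<bar>" by linarith
      then show ?thesis using bump2_eq_0 by auto
    qed
  qed simp
  show "spacetime.periodize \<eta> = \<phi>"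
  proof
    fix z
    have "space.periodize (\<lambda>x. \<phi> (fst z, x) * bump2 x) (snd z) = \<phi> (fst z, snd z) * space.periodize bump2 (snd z)"
      by (intro space.periodize_mult finite_bump2 function_on_torus_periodic[OF per])
    then show "spacetime.periodize \<eta> z = \<phi> z"
      using spacetime_periodize_slice[of \<eta> "fst z" "snd z"] by (simp add: \<eta>_def periodize_bump2)
  qed
qed

lemma spacetime_test_periodize:
  assumes "\<phi> \<in> tests (UNIV \<times> UNIV)"
  shows "spacetime_test Torus (spacetime.periodize \<phi>)"
proof -
  have \<phi>: "\<phi> \<in> tests UNIV" using assms by simp
  have sm: "smooth \<phi>" using \<phi> by (rule testsD)
  obtain R where R: "\<And>z. norm z > R \<Longrightarrow> \<phi> z = 0" using spacetime.tests_UNIV_vanish[OF \<phi>] by blast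
  have "function_on Torus (\<lambda>x. spacetime.periodize \<phi> (t, x))" for t
  proof (rule function_on_torusI)
    fix x k assume "k \<in> int_lattice"
    then show "spacetime.periodize \<phi> (t, x + k) = spacetime.periodize \<phi> (t, x)"
      using spacetime.periodize_periodic[where z="(t, x)" and k="(0, k)", OF sm R] by simp
  qed
  moreover have "spacetime.periodize \<phi> (t, x) = 0" if t: "\<bar>R\<bar> < \<bar>t\<bar>" for t x
  proof -
    have z: "\<phi> ((t, x) + k) = 0" if "k \<in> {0} \<times> int_lattice" for k
      using that t norm_fst_le[of t "x + snd k"] by (intro R) auto
    show ?thesis unfolding spacetime.periodize_def by (rule sum.neutral) (use z in blast)
  qed
  ultimately show ?thesis
    unfolding spacetime_test_def compact_support_in_spacetime.simps using spacetime.smooth_periodize[OF sm R] by blast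
qed

lemma space_test_periodize:
  assumes \<psi>: "\<psi> \<in> tests UNIV"
  shows "space_test Torus (space.periodize \<psi>)"
proof -
  have sm: "smooth \<psi>" using \<psi> by (rule testsD)
  obtain R where R: "\<And>z. norm z > R \<Longrightarrow> \<psi> z = 0" using space.tests_UNIV_vanish[OF \<psi>] by blast
  have "function_on Torus (space.periodize \<psi>)"
    by (rule function_on_torusI) (rule space.periodize_periodic[OF sm R])
  then show ?thesis unfolding space_test_def using space.smooth_periodize[OF sm R] by simp
qed

subsection \<open>The three domains\<close>

lemma AE_lborel_snd:
  assumes "AE x in lborel. P x"
  shows "AE z in (lborel :: ('a::euclidean_space \<times> 'b::euclidean_space) measure). P (snd z)"
proof -
  obtain N where N: "{x \<in> space lborel. \<not> P x} \<subseteq> N" "emeasure lborel N = 0" "N \<in> sets lborel"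
    using assms by (rule AE_E)
  have "emeasure (lborel \<Otimes>\<^sub>M lborel) ((UNIV :: 'a set) \<times> N) = emeasure lborel (UNIV :: 'a set) * emeasure lborel N"
    by (rule lborel.emeasure_pair_measure_Times) (use N in auto)
  then have 0: "emeasure lborel ((UNIV :: 'a set) \<times> N) = 0" using N(2) by (simp add: lborel_prod)
  have "(UNIV :: 'a set) \<times> N \<in> sets (lborel \<Otimes>\<^sub>M lborel)" using N(3) by (intro pair_measureI) auto
  then have "(UNIV :: 'a set) \<times> N \<in> sets lborel" by (simp only: lborel_prod)
  then show ?thesis
    by (intro AE_I[of _ _ "UNIV \<times> N"]) (use N 0 in auto)
qed

lemma inner_grad: "smooth \<psi> \<Longrightarrow> v \<bullet> grad \<psi> x = fderiv \<psi> x v"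
proof -
  assume \<psi>: "smooth \<psi>"
  note lin = linear_fderiv[OF \<psi>, of x]
  have v: "v = (\<Sum>i\<in>UNIV. v $ i *\<^sub>R axis i 1)" by (simp add: vec_eq_iff axis_def if_distrib cong: if_cong)
  have "fderiv \<psi> x v = (\<Sum>i\<in>UNIV. v $ i * fderiv \<psi> x (axis i 1))"
    by (subst v) (simp add: linear_sum[OF lin] linear.scaleR[OF lin])
  then show ?thesis by (simp add: inner_vec_def grad_def)
qed

lemma transport_derivative:
  fixes \<phi> :: "real \<times> (real ^ 2) \<Rightarrow> real"
  assumes sm: "smooth \<phi>"
  shows "deriv (\<lambda>s. \<phi> (s, x)) t + v \<bullet> grad (\<lambda>y. \<phi> (t, y)) x = fderiv \<phi> (t, x) (1, v)"
proof -
  have l1: "linear (\<lambda>x::real ^ 2. (0::real, x))" and l2: "linear (\<lambda>t::real. (t, 0::real ^ 2))" by (auto simp: linear_iff)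
  have s: "smooth (\<lambda>y. \<phi> (t, y))" "fderiv (\<lambda>y. \<phi> (t, y)) x v = fderiv \<phi> (t, x) (0, v)"
    using smooth_comp_affine[OF sm l1, of "(t, 0)"] by simp_all
  have s2: "smooth (\<lambda>s. \<phi> (s, x))" "fderiv (\<lambda>s. \<phi> (s, x)) t 1 = fderiv \<phi> (t, x) (1, 0)"
    using smooth_comp_affine[OF sm l2, of "(0, x)"] by simp_all
  have "deriv (\<lambda>s. \<phi> (s, x)) t = fderiv \<phi> (t, x) (1, 0)" using fderiv_real[OF s2(1), of t 1] s2(2) by simp
  moreover have "fderiv \<phi> (t, x) (1, v) = fderiv \<phi> (t, x) (1, 0) + fderiv \<phi> (t, x) (0, v)"
    using linear_add[OF linear_fderiv[OF sm], of "(t, x)" "(1, 0)" "(0, v)"] by simp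
  ultimately show ?thesis using inner_grad[OF s(1)] s(2) by simp
qed

lemma open_region: "valid_domain D \<Longrightarrow> open (region D)"
  by (cases D) (auto simp: regular_open_def)

lemma cell_subset_region: "cell D \<subseteq> region D"
  by (cases D) auto

lemma region_borel: "valid_domain D \<Longrightarrow> region D \<in> sets borel"
  by (intro borel_open open_region)

lemma cell_borel: "valid_domain D \<Longrightarrow> cell D \<in> sets borel"
  using region_borel[of D] torus_cell_borel by (cases D) (auto simp del: cell.simps(1))

section \<open>Periodic Borel representatives\<close>

definition wrap :: "real ^ 2 \<Rightarrow> real ^ 2" where
  "wrap x = (\<chi> i. frac (x $ i))"

lemma wrap_shift: "\<exists>k\<in>int_lattice. wrap x = x + k"
  by (rule bexI[of _ "\<chi> i. - of_int \<lfloor>x $ i\<rfloor>"]) (auto simp: wrap_def int_lattice_def vec_eq_iff frac_def)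

lemma wrap_add_axis: "wrap (x + axis i 1) = wrap x"
  by (simp add: wrap_def vec_eq_iff axis_def frac_1_eq)

lemma wrap_borel [measurable]: "wrap \<in> borel \<rightarrow>\<^sub>M borel"
proof -
  have "(\<lambda>x. frac (x $ i) *\<^sub>R axis i (1::real)) \<in> borel_measurable (borel :: (real ^ 2) measure)" for i
    unfolding frac_def by measurable
  then have "(\<lambda>x. \<Sum>i\<in>UNIV. frac (x $ i) *\<^sub>R axis i (1::real)) \<in> borel_measurable (borel :: (real ^ 2) measure)"
    by measurable
  moreover have "(\<Sum>i\<in>UNIV. frac (x $ i) *\<^sub>R axis i (1::real)) = wrap x" for x
    by (simp add: wrap_def vec_eq_iff axis_def if_distrib cong: if_cong)
  ultimately show ?thesis by simp
qed

text \<open>A Borel version of a periodic function is in general periodic only almost everywhere. On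
  the torus, composing it with \<open>wrap\<close> makes the periodicity exact, as the periodization
  identities require.\<close>

lemma space_borel_version:
  fixes f :: "real ^ 2 \<Rightarrow> 'b::euclidean_space"
  assumes D: "valid_domain D" and f: "f \<in> borel_measurable (lebesgue_on (region D))" "function_on D f"
  obtains g where "g \<in> borel_measurable borel" "AE x in lborel. x \<in> region D \<longrightarrow> f x = g x" "function_on D g"
proof -
  obtain g where g: "g \<in> borel_measurable borel" "AE x in lborel. x \<in> region D \<longrightarrow> f x = g x"
    using borel_version[OF region_borel[OF D] f(1)] by blast
  show ?thesis
  proof (cases "D = Torus")
    case True
    have "AE x in lborel. x \<in> region D \<longrightarrow> f x = g (wrap x)"
      by (rule space.periodic_version[OF g(2) _ wrap_shift])
         (use f(2) in \<open>auto simp: True intro!: function_on_torus_periodic\<close>)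
    moreover have "(\<lambda>x. g (wrap x)) \<in> borel_measurable borel" using g(1) by measurable
    ultimately show ?thesis using that by (auto simp: True wrap_add_axis)
  next
    case False
    then have "function_on D g" by (cases D) auto
    then show ?thesis using that g by blast
  qed
qed

lemma spacetime_borel_version:
  fixes f :: "real \<times> (real ^ 2) \<Rightarrow> real"
  assumes D: "valid_domain D" and f: "f \<in> borel_measurable (lebesgue_on ({0..} \<times> region D))" "\<forall>t\<ge>0. function_on D (\<lambda>x. f (t, x))"
  obtains g where "g \<in> borel_measurable borel" "AE z in lborel. z \<in> {0..} \<times> region D \<longrightarrow> f z = g z" "\<And>t. function_on D (\<lambda>x. g (t, x))"
proof -
  have S: "{0..} \<times> region D \<in> sets (borel :: (real \<times> (real ^ 2)) measure)"
    unfolding borel_prod[symmetric] using region_borel[OF D] by (intro pair_measureI) auto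
  obtain g where g: "g \<in> borel_measurable borel" "AE z in lborel. z \<in> {0..} \<times> region D \<longrightarrow> f z = g z"
    using borel_version[OF S f(1)] by blast
  show ?thesis
  proof (cases "D = Torus")
    case True
    have "AE z in lborel. z \<in> {0..} \<times> region D \<longrightarrow> f z = g (fst z, wrap (snd z))"
    proof (rule spacetime.periodic_version[OF g(2)])
      fix z :: "real \<times> (real ^ 2)"
      show "\<exists>k\<in>{0} \<times> int_lattice. (fst z, wrap (snd z)) = z + k"
      proof -
        obtain k where "k \<in> int_lattice" "wrap (snd z) = snd z + k" using wrap_shift[of "snd z"] by blast
        then show ?thesis by (intro bexI[of _ "(0, k)"]) (auto simp: prod_eq_iff)
      qed
    next
      fix z k :: "real \<times> (real ^ 2)"
      assume k: "k \<in> {0} \<times> int_lattice" and z: "z \<in> {0..} \<times> region D"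
      have "f (fst z, snd z + snd k) = f (fst z, snd z)"
        using k z f(2) function_on_torus_periodic[of "\<lambda>x. f (fst z, x)" "snd k" "snd z"] by (auto simp: True)
      then show "z + k \<in> {0..} \<times> region D \<and> f (z + k) = f z"
        using k z by (cases z) (auto simp: True)
    qed
    moreover have "(\<lambda>z. g (fst z, wrap (snd z))) \<in> borel_measurable borel"
      using g(1) unfolding borel_prod[symmetric] by measurable
    ultimately show ?thesis using that by (auto simp: True wrap_add_axis)
  next
    case False
    then have "function_on D (\<lambda>x. g (t, x))" for t by (cases D) auto
    then show ?thesis using that g by blast
  qed
qed

lemma clip_bounded_borel:
  assumes "g \<in> borel_measurable borel"
  shows "bounded_borel (\<lambda>z. max (- C) (min C (g z)))"
  unfolding bounded_borel_def
proof
  show "(\<lambda>z. max (- C) (min C (g z))) \<in> borel_measurable borel" using assms by measurable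
  show "\<exists>B. \<forall>z. \<bar>max (- C) (min C (g z))\<bar> \<le> B" by (rule exI[of _ "\<bar>C\<bar>"]) auto
qed

text \<open>Clipping the Borel version at the essential bound alters it only on a null set of the
  region, makes the bound valid everywhere and keeps periodicity.\<close>

lemma Linf_space_version:
  assumes D: "valid_domain D" and u0: "Linf_space D u0"
  obtains v0 where "bounded_borel v0" "AE x in lborel. x \<in> region D \<longrightarrow> u0 x = v0 x" "function_on D v0"
proof -
  have u: "u0 \<in> borel_measurable (lebesgue_on (region D))" "function_on D u0"
    using u0 unfolding Linf_space_def Linf_def by blast+
  obtain C where C: "AE x in lebesgue_on (region D). \<bar>u0 x\<bar> \<le> C"
    using u0 unfolding Linf_space_def Linf_def by blast
  obtain g where g: "g \<in> borel_measurable borel" "AE x in lborel. x \<in> region D \<longrightarrow> u0 x = g x" "function_on D g"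
    using space_borel_version[OF D u] by blast
  have "AE x in lborel. x \<in> region D \<longrightarrow> \<bar>u0 x\<bar> \<le> C"
    using C region_borel[OF D] by (simp add: AE_restrict_space_iff AE_completion_iff)
  with g(2) have "AE x in lborel. x \<in> region D \<longrightarrow> u0 x = max (- C) (min C (g x))"
    by eventually_elim (auto simp: abs_le_iff)
  moreover have "function_on D (\<lambda>x. max (- C) (min C (g x)))" using g(3) by (cases D) auto
  ultimately show ?thesis using that clip_bounded_borel[OF g(1)] by blast
qed

lemma Linf_spacetime_version:
  assumes D: "valid_domain D" and u: "Linf_spacetime D u"
  obtains v where "bounded_borel v" "AE z in lborel. z \<in> {0..} \<times> region D \<longrightarrow> u z = v z" "\<And>t. function_on D (\<lambda>x. v (t, x))"
proof -
  have u': "u \<in> borel_measurable (lebesgue_on ({0..} \<times> region D))" "\<forall>t\<ge>0. function_on D (\<lambda>x. u (t, x))"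
    using u unfolding Linf_spacetime_def Linf_def by blast+
  obtain C where C: "AE z in lebesgue_on ({0..} \<times> region D). \<bar>u z\<bar> \<le> C"
    using u unfolding Linf_spacetime_def Linf_def by blast
  obtain g where g: "g \<in> borel_measurable borel" "AE z in lborel. z \<in> {0..} \<times> region D \<longrightarrow> u z = g z" "\<And>t. function_on D (\<lambda>x. g (t, x))"
    using spacetime_borel_version[OF D u'] by blast
  have S: "{0..} \<times> region D \<in> sets (borel :: (real \<times> (real ^ 2)) measure)"
    unfolding borel_prod[symmetric] using region_borel[OF D] by (intro pair_measureI) auto
  have "AE z in lborel. z \<in> {0..} \<times> region D \<longrightarrow> \<bar>u z\<bar> \<le> C"
    using C S by (simp add: AE_restrict_space_iff AE_completion_iff)
  with g(2) have "AE z in lborel. z \<in> {0..} \<times> region D \<longrightarrow> u z = max (- C) (min C (g z))"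
    by eventually_elim (auto simp: abs_le_iff)
  moreover have "function_on D (\<lambda>x. max (- C) (min C (g (t, x))))" for t using g(3)[of t] by (cases D) auto
  ultimately show ?thesis using that clip_bounded_borel[OF g(1)] by blast
qed

lemma L2_loc_imp_local_L2_field:
  assumes D: "valid_domain D" and b: "L2_loc (region D) b"
    and c: "c \<in> borel_measurable borel" "AE x in lborel. x \<in> region D \<longrightarrow> b x = c x"
  shows "local_L2_field (region D) c"
proof
  show "open (region D)" by (rule open_region[OF D])
  show "c \<in> borel_measurable borel" by (rule c)
  fix K assume K: "compact K" "K \<subseteq> region D"
  have "AE x in lborel. x \<in> K \<longrightarrow> (norm (b x))\<^sup>2 = (norm (c x))\<^sup>2"
    using c(2) by eventually_elim (use K in auto)
  moreover have "(\<lambda>x. (norm (c x))\<^sup>2) \<in> borel_measurable borel" using c(1) by measurable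
  moreover have "integrable (lebesgue_on K) (\<lambda>x. (norm (b x))\<^sup>2)" using b K unfolding L2_loc_def by blast
  ultimately show "integrable lborel (\<lambda>x. indicator K x * (norm (c x))\<^sup>2)"
    using lebesgue_on_borel_version(2)[of K "\<lambda>x. (norm (c x))\<^sup>2" "\<lambda>x. (norm (b x))\<^sup>2"] K(1)
    by (simp add: borel_compact)
qed

lemma space_test_iff_tests: "D \<noteq> Torus \<Longrightarrow> space_test D \<psi> \<longleftrightarrow> \<psi> \<in> tests (region D)"
  by (cases D) (auto simp: space_test_def tests_def)

lemma spacetime_test_iff_tests: "D \<noteq> Torus \<Longrightarrow> spacetime_test D \<phi> \<longleftrightarrow> \<phi> \<in> tests (UNIV \<times> region D)"
  by (cases D) (auto simp: spacetime_test_def tests_def)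

lemma cell_eq_region: "D \<noteq> Torus \<Longrightarrow> cell D = region D"
  by (cases D) auto

text \<open>On the torus a test function of the plane is replaced by its periodization, and
  integrals over the plane fold into integrals over the cell. In the other cases cell and region
  coincide.\<close>

lemma divergence_free_imp_weak_div:
  assumes D: "valid_domain D" and b: "L2_loc (region D) b" "divergence_free D b"
    and c: "c \<in> borel_measurable borel" "AE x in lborel. x \<in> region D \<longrightarrow> b x = c x" "function_on D c"
  shows "l2_field (region D) c"
proof -
  interpret local_L2_field "region D" c by (rule L2_loc_imp_local_L2_field[OF D b(1) c(1,2)])
  have div: "(LINT x|lborel. indicator (cell D) x * fderiv \<psi> x (c x)) = 0" if \<psi>: "space_test D \<psi>" for \<psi>
  proof -
    have sm: "smooth \<psi>" using \<psi> by (simp add: space_test_def)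
    have "AE x in lborel. x \<in> cell D \<longrightarrow> b x \<bullet> grad \<psi> x = fderiv \<psi> x (c x)"
      using c(2) by eventually_elim (use cell_subset_region[of D] inner_grad[OF sm] in auto)
    from lebesgue_on_borel_version(1)[OF cell_borel[OF D] fderiv_b_measurable[OF sm] this]
    show ?thesis using b(2) \<psi> unfolding divergence_free_def by simp
  qed
  have "(LINT x|lborel. 1 * fderiv \<psi> x (c x)) = 0" if \<psi>: "\<psi> \<in> tests (region D)" for \<psi>
  proof (cases "D = Torus")
    case True
    have t: "\<psi> \<in> tests UNIV" using \<psi> by (simp add: True)
    have "(LINT x|lborel. 1 * fderiv \<psi> x (c x)) = (LINT x|lborel. indicator (cell D) x * (1 * fderiv (space.periodize \<psi>) x (c x)))"
      unfolding True
      by (rule space.integral_periodize_fderiv[OF t])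
         (use integrable_fderiv_b[OF \<psi>] c(3) in \<open>auto simp: True intro!: function_on_torus_periodic\<close>)
    then show ?thesis using div[of "space.periodize \<psi>"] space_test_periodize[OF t] by (simp add: True)
  next
    case False
    obtain K where K: "compact K" "K \<subseteq> region D" "\<And>x. x \<notin> K \<Longrightarrow> \<psi> x = 0" using tests_cases[OF \<psi>] by blast
    have eq: "1 * fderiv \<psi> x (c x) = indicator (cell D) x * fderiv \<psi> x (c x)" for x
      using fderiv_eq_0_outside[OF K(3) compact_imp_closed[OF K(1)], where x=x and v="c x"] K(2) cell_eq_region[OF False]
      by (cases "x \<in> K") auto
    show ?thesis unfolding eq using div[of \<psi>] space_test_iff_tests[OF False] \<psi> by blast
  qed
  then have "weak_div (region D) c (\<lambda>x. 1) (\<lambda>x. 0)" by (simp add: weak_div_def)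
  then show ?thesis by unfold_locales
qed

lemma Linf_comp:
  assumes S: "S \<in> sets borel" and v: "bounded_borel v" "AE z in lborel. z \<in> S \<longrightarrow> u z = v z"
    and \<beta>: "continuous_on UNIV \<beta>"
  shows "Linf S (\<lambda>z. \<beta> (u z))"
  unfolding Linf_def
proof
  note bv = bounded_borelD[OF bounded_borel_comp[OF v(1) \<beta>]]
  have ae: "AE z in lborel. z \<in> S \<longrightarrow> \<beta> (u z) = \<beta> (v z)" using v(2) by eventually_elim auto
  show "(\<lambda>z. \<beta> (u z)) \<in> borel_measurable (lebesgue_on S)" by (rule lebesgue_on_borel_version(3)[OF S bv(1) ae])
  obtain C where C: "\<And>z. \<bar>\<beta> (v z)\<bar> \<le> C" using bv(2) by blast
  have "AE z in lborel. z \<in> S \<longrightarrow> \<bar>\<beta> (u z)\<bar> \<le> C" using ae by eventually_elim (use C in auto)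
  then have "AE z in lebesgue_on S. \<bar>\<beta> (u z)\<bar> \<le> C" using S by (simp add: AE_restrict_space_iff AE_completion_iff)
  then show "\<exists>C. AE z in lebesgue_on S. \<bar>\<beta> (u z)\<bar> \<le> C" by blast
qed

section \<open>Equivalence with the Borel formulation\<close>

context
  fixes D :: domain2 and b c :: "real ^ 2 \<Rightarrow> real ^ 2"
  assumes D: "valid_domain D" and c: "AE x in lborel. x \<in> region D \<longrightarrow> b x = c x" "function_on D c"
    and field: "l2_field (region D) c"
begin

interpretation l2_field "region D" c by (rule field)

lemma spacetime_region_borel:
  shows "{0..} \<times> region D \<in> sets (borel :: (real \<times> (real ^ 2)) measure)"
    and "{0..} \<times> cell D \<in> sets (borel :: (real \<times> (real ^ 2)) measure)"
  unfolding borel_prod[symmetric] using region_borel[OF D] cell_borel[OF D] by (auto intro!: pair_measureI)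

text \<open>\<open>E\<close> is the equation over the cell and \<open>F\<close> the one over the
  region, both for the Borel versions. On the torus, \<open>F\<close> for \<phi> is \<open>E\<close>
  for its periodization; this gives one direction because periodizations are torus tests, and the
  other because every torus test is a periodization.\<close>

lemma transport_equation_iff_transport_pair:
  assumes v: "bounded_borel v" "AE z in lborel. z \<in> {0..} \<times> region D \<longrightarrow> u z = v z" "\<And>t. function_on D (\<lambda>x. v (t, x))"
    and v0: "bounded_borel v0" "AE x in lborel. x \<in> region D \<longrightarrow> u0 x = v0 x" "function_on D v0"
  shows "(\<forall>\<phi>. spacetime_test D \<phi> \<longrightarrow>
        (LINT (t, x)|lebesgue_on ({0..} \<times> cell D). u (t, x) * (deriv (\<lambda>s. \<phi> (s, x)) t + b x \<bullet> grad (\<lambda>y. \<phi> (t, y)) x))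
        = - (LINT x|lebesgue_on (cell D). u0 x * \<phi> (0, x)))
    \<longleftrightarrow> transport_pair v0 v"
proof -
  define E where "E \<phi> \<longleftrightarrow> (LINT z|lborel. indicator ({0..} \<times> cell D) z * (v z * fderiv \<phi> z (1, c (snd z))))
      = - (LINT x|lborel. indicator (cell D) x * (v0 x * \<phi> (0, x)))" for \<phi>
  define F where "F \<phi> \<longleftrightarrow> (LINT z|lborel. indicator {0..} (fst z) * (v z * fderiv \<phi> z (1, c (snd z))))
      = - (LINT x|lborel. v0 x * \<phi> (0, x))" for \<phi>
  have E: "(LINT (t, x)|lebesgue_on ({0..} \<times> cell D). u (t, x) * (deriv (\<lambda>s. \<phi> (s, x)) t + b x \<bullet> grad (\<lambda>y. \<phi> (t, y)) x))
        = - (LINT x|lebesgue_on (cell D). u0 x * \<phi> (0, x)) \<longleftrightarrow> E \<phi>" if \<phi>: "spacetime_test D \<phi>" for \<phi>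
  proof -
    have sm: "smooth \<phi>" using \<phi> by (simp add: spacetime_test_def)
    have m: "(\<lambda>z. v z * fderiv \<phi> z (1, c (snd z))) \<in> borel_measurable borel"
      using bounded_borelD(1)[OF v(1)] fderiv_1_b(1)[OF sm] by measurable
    have "AE z in lborel. z \<in> {0..} \<times> cell D \<longrightarrow>
        (case z of (t, x) \<Rightarrow> u (t, x) * (deriv (\<lambda>s. \<phi> (s, x)) t + b x \<bullet> grad (\<lambda>y. \<phi> (t, y)) x)) = v z * fderiv \<phi> z (1, c (snd z))"
      using v(2) AE_lborel_snd[OF c(1)]
    proof eventually_elim
      case (elim z)
      show ?case
        using elim cell_subset_region[of D] by (cases z) (auto simp: transport_derivative[OF sm])
    qed
    note 1 = lebesgue_on_borel_version(1)[OF spacetime_region_borel(2) m this]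
    have "linear (\<lambda>x::real ^ 2. (0::real, x))" by (auto simp: linear_iff)
    from smooth_comp_affine(1)[OF sm this, of 0] have "smooth (\<lambda>x. \<phi> (0, x))" by (simp add: zero_prod_def)
    then have m0: "(\<lambda>x. v0 x * \<phi> (0, x)) \<in> borel_measurable borel"
      using bounded_borelD(1)[OF v0(1)] smooth_borel_measurable[of "\<lambda>x. \<phi> (0, x)"] by measurable
    have "AE x in lborel. x \<in> cell D \<longrightarrow> u0 x * \<phi> (0, x) = v0 x * \<phi> (0, x)"
      using v0(2) by eventually_elim (use cell_subset_region[of D] in auto)
    note 2 = lebesgue_on_borel_version(1)[OF cell_borel[OF D] m0 this]
    show ?thesis unfolding E_def 1 2 by (rule refl)
  qed
  have "(\<forall>\<phi>. spacetime_test D \<phi> \<longrightarrow> E \<phi>) \<longleftrightarrow> (\<forall>\<phi>\<in>tests (UNIV \<times> region D). F \<phi>)"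
  proof (cases "D = Torus")
    case True
    have EF: "E (spacetime.periodize \<phi>) \<longleftrightarrow> F \<phi>" if \<phi>: "\<phi> \<in> tests (UNIV \<times> UNIV)" for \<phi> :: "real \<times> (real ^ 2) \<Rightarrow> real"
    proof -
      have \<phi>': "\<phi> \<in> tests (UNIV \<times> region D)" "\<phi> \<in> tests UNIV" using \<phi> by (simp_all add: True)
      note int = transport_pair_integrable[OF v(1) v0(1) \<phi>'(1)]
      have vper: "v (z + k) = v z" if "k \<in> {0::real} \<times> int_lattice" for z k
        using that function_on_torus_periodic[OF v(3)[unfolded True], of "snd k" "fst z" "snd z"] by (cases z) auto
      have a: "(LINT z|lborel. (indicator {0..} (fst z) * v z) * fderiv \<phi> z (1, c (snd z)))
          = (LINT z|lborel. indicator (UNIV \<times> cell Torus) z * ((indicator {0..} (fst z) * v z) * fderiv (spacetime.periodize \<phi>) z (1, c (snd z))))"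
      proof (rule spacetime.integral_periodize_fderiv[OF \<phi>'(2)])
        show "integrable lborel (\<lambda>z. (indicator {0..} (fst z) * v z) * fderiv \<phi> z (1, c (snd z)))" using int(1) by (simp add: mult.assoc)
        show "(1, c (snd (z + k))) = (1, c (snd z))" if "k \<in> {0::real} \<times> int_lattice" for z k
          using that function_on_torus_periodic[OF c(2)[unfolded True]] by auto
        show "indicator {0..} (fst (z + k)) * v (z + k) = indicator {0..} (fst z) * v z" if "k \<in> {0::real} \<times> int_lattice" for z k
          unfolding vper[OF that] using that by auto
      qed
      have ind: "indicator (UNIV \<times> cell Torus) z * ((indicator {0..} (fst z) * v z) * fderiv (spacetime.periodize \<phi>) z (1, c (snd z)))
          = indicator ({0..} \<times> cell D) z * (v z * fderiv (spacetime.periodize \<phi>) z (1, c (snd z)))" for z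
        by (auto simp: True indicator_def mem_Times_iff simp del: cell.simps)
      have 1: "(LINT z|lborel. indicator {0..} (fst z) * (v z * fderiv \<phi> z (1, c (snd z))))
          = (LINT z|lborel. indicator ({0..} \<times> cell D) z * (v z * fderiv (spacetime.periodize \<phi>) z (1, c (snd z))))"
        using a[unfolded ind] by (simp only: mult.assoc)
      have "(LINT x|lborel. v0 x * \<phi> (0, x)) = (LINT x|lborel. indicator (cell Torus) x * (v0 x * space.periodize (\<lambda>x. \<phi> (0, x)) x))"
        using tests_slice(1)[OF \<phi>, of 0] function_on_torus_periodic[OF v0(3)[unfolded True]] int(2)
        by (rule space.integral_periodize)
      then have 2: "(LINT x|lborel. v0 x * \<phi> (0, x)) = (LINT x|lborel. indicator (cell D) x * (v0 x * spacetime.periodize \<phi> (0, x)))"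
        by (simp add: True spacetime_periodize_slice del: cell.simps)
      show ?thesis unfolding E_def F_def 1 2 by (rule refl)
    qed
    show ?thesis
    proof safe
      fix \<phi> :: "real \<times> (real ^ 2) \<Rightarrow> real"
      assume "\<forall>\<phi>. spacetime_test D \<phi> \<longrightarrow> E \<phi>" "\<phi> \<in> tests (UNIV \<times> region D)"
      then show "F \<phi>" using EF[of \<phi>] spacetime_test_periodize[of \<phi>] by (simp add: True)
    next
      fix \<phi> :: "real \<times> (real ^ 2) \<Rightarrow> real"
      assume F: "\<forall>\<phi>\<in>tests (UNIV \<times> region D). F \<phi>" and \<phi>: "spacetime_test D \<phi>"
      note \<eta> = torus_test_eq_periodize[OF \<phi>[unfolded True]]
      show "E \<phi>" using EF[OF \<eta>(1)] F \<eta>(1) unfolding \<eta>(2) by (simp add: True)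
    qed
  next
    case False
    have "E \<phi> \<longleftrightarrow> F \<phi>" if \<phi>: "\<phi> \<in> tests (UNIV \<times> region D)" for \<phi> :: "real \<times> (real ^ 2) \<Rightarrow> real"
    proof -
      obtain L where L: "compact L" "L \<subseteq> UNIV \<times> region D" "\<And>z. z \<notin> L \<Longrightarrow> \<phi> z = 0" using tests_cases[OF \<phi>] by blast
      have 1: "indicator ({0..} \<times> cell D) z * (v z * fderiv \<phi> z (1, c (snd z))) = indicator {0..} (fst z) * (v z * fderiv \<phi> z (1, c (snd z)))" for z
        using fderiv_eq_0_outside[OF L(3) compact_imp_closed[OF L(1)], where x=z and v="(1, c (snd z))"] L(2)
        by (cases "z \<in> L") (auto simp: cell_eq_region[OF False] indicator_def)
      have 2: "indicator (cell D) x * (v0 x * \<phi> (0, x)) = v0 x * \<phi> (0, x)" for x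
        using L(2) L(3)[of "(0, x)"] by (cases "(0, x) \<in> L") (auto simp: cell_eq_region[OF False])
      show ?thesis unfolding E_def F_def 1 2 by (rule refl)
    qed
    then show ?thesis using spacetime_test_iff_tests[OF False] by blast
  qed
  then show ?thesis using E unfolding transport_pair_def F_def by blast
qed

text \<open>The direction condition passes to the Borel version, so the exceptional set can only
  shrink, and subsets of discrete sets are discrete.\<close>

lemma discrete_not_good:
  assumes "discrete {x \<in> region D. \<not> local_direction D b x}"
  shows "discrete {x \<in> region D. \<not> good x}"
proof -
  have "good x" if dir: "local_direction D b x" for x
  proof -
    obtain \<xi> \<alpha> \<epsilon> where d: "\<alpha> > 0" "\<epsilon> > 0" "ball x \<epsilon> \<subseteq> region D" "AE y in lebesgue_on (ball x \<epsilon>). b y \<bullet> \<xi> \<ge> \<alpha>"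
      using dir unfolding local_direction_def by blast
    have "AE y in lborel. y \<in> ball x \<epsilon> \<longrightarrow> b y \<bullet> \<xi> \<ge> \<alpha>"
      using d(4) by (simp add: AE_restrict_space_iff AE_completion_iff)
    with c(1) have "AE y in lborel. y \<in> ball x \<epsilon> \<longrightarrow> c y \<bullet> \<xi> \<ge> \<alpha>"
      by eventually_elim (use d(3) in auto)
    then show ?thesis unfolding good_def using d(1-3) by blast
  qed
  then have sub: "{x \<in> region D. \<not> good x} \<subseteq> {x \<in> region D. \<not> local_direction D b x}" by blast
  show ?thesis unfolding discrete_def
  proof
    fix x assume x: "x \<in> {x \<in> region D. \<not> good x}"
    then have "x isolated_in {x \<in> region D. \<not> local_direction D b x}"
      using assms sub unfolding discrete_def by blast
    then obtain T where T: "open T" "T \<inter> {x \<in> region D. \<not> local_direction D b x} = {x}"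
      unfolding isolated_in_def by blast
    have "T \<inter> {x \<in> region D. \<not> good x} = {x}" using T(2) x sub by blast
    then show "x isolated_in {x \<in> region D. \<not> good x}" unfolding isolated_in_def using T(1) x by blast
  qed
qed

end

theorem corollary1:
  fixes D :: domain2 and b :: "real^2 \<Rightarrow> real^2"
  assumes "valid_domain D"
    and "function_on D b"
    and "L2_loc (region D) b"
    and "divergence_free D b"
    and "tangent_to_boundary D b"
    and "discrete {x \<in> region D. \<not> local_direction D b x}"
  shows "condition_R D b"
  unfolding condition_R_def renormalized_solution_def
proof (intro allI impI, elim conjE)
  fix u0 u \<beta> assume u0: "Linf_space D u0" and u: "transport_solution D b u0 u" and C1: "C1b \<beta>"
  note D = assms(1)
  have bm: "b \<in> borel_measurable (lebesgue_on (region D))" using assms(3) by (simp add: L2_loc_def)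
  obtain c where c: "c \<in> borel_measurable borel" "AE x in lborel. x \<in> region D \<longrightarrow> b x = c x" "function_on D c"
    using space_borel_version[OF D bm assms(2)] by blast
  note field = divergence_free_imp_weak_div[OF D assms(3,4) c]
  interpret l2_field "region D" c by (rule field)
  obtain v where v: "bounded_borel v" "AE z in lborel. z \<in> {0..} \<times> region D \<longrightarrow> u z = v z" "\<And>t. function_on D (\<lambda>x. v (t, x))"
    using Linf_spacetime_version[OF D] u unfolding transport_solution_def by blast
  obtain v0 where v0: "bounded_borel v0" "AE x in lborel. x \<in> region D \<longrightarrow> u0 x = v0 x" "function_on D v0"
    using Linf_space_version[OF D u0] by blast
  \<comment> \<open>Differentiability of \<beta> supplies the continuity used for uniform
    approximation by polynomials.\<close>
  have \<beta>: "continuous_on UNIV \<beta>"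
    using C1 by (auto simp: C1b_def continuous_on_eq_continuous_at intro: differentiable_imp_continuous_within)
  have "transport_pair v0 v"
    using u transport_equation_iff_transport_pair[OF D c(2,3) field v v0] unfolding transport_solution_def by blast
  then have pair: "transport_pair (\<lambda>x. \<beta> (v0 x)) (\<lambda>z. \<beta> (v z))"
    by (rule transport_pair_renormalized[OF discrete_not_good[OF D c(2,3) field assms(6)] v(1) v0(1) _ \<beta>])
  have per: "function_on D (\<lambda>x. \<beta> (w x))" if "function_on D w" for w :: "real ^ 2 \<Rightarrow> real"
    using that by (cases D) auto
  have ae: "AE z in lborel. z \<in> {0..} \<times> region D \<longrightarrow> \<beta> (u z) = \<beta> (v z)"
    using v(2) by eventually_elim auto
  have ae0: "AE x in lborel. x \<in> region D \<longrightarrow> \<beta> (u0 x) = \<beta> (v0 x)"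
    using v0(2) by eventually_elim auto
  have "\<forall>\<phi>. spacetime_test D \<phi> \<longrightarrow>
        (LINT (t, x)|lebesgue_on ({0..} \<times> cell D). \<beta> (u (t, x)) * (deriv (\<lambda>s. \<phi> (s, x)) t + b x \<bullet> grad (\<lambda>y. \<phi> (t, y)) x))
        = - (LINT x|lebesgue_on (cell D). \<beta> (u0 x) * \<phi> (0, x))"
    using transport_equation_iff_transport_pair[OF D c(2,3) field bounded_borel_comp[OF v(1) \<beta>] ae per[OF v(3)]
        bounded_borel_comp[OF v0(1) \<beta>] ae0 per[OF v0(3)]] pair by blast
  moreover have "Linf_spacetime D (\<lambda>z. \<beta> (u z))"
    unfolding Linf_spacetime_def
    using Linf_comp[OF spacetime_region_borel(1)[OF D c(2,3) field] v(1,2) \<beta>] u per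
    unfolding transport_solution_def Linf_spacetime_def by blast
  ultimately show "transport_solution D b (\<lambda>x. \<beta> (u0 x)) (\<lambda>z. \<beta> (u z))"
    unfolding transport_solution_def by blast
qed

end
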